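(* Let $d\ge1$, let $(k,\ell)$ be a pair of normalized diagonal holomorphic kernels on a domain $\Omega\subseteq\mathbb{C}^d$ with $\mathbf{0}\in\Omega$. Let $\vartheta$ denote the master certificate associated with $k$, let $s$ denote the kernel $s(z,w)=\frac{1}{1-\vartheta(z\overline{w})}$ and let $\Omega_\vartheta^1=\{z\in\Omega_\vartheta:\vartheta(z\overline{z})<1\}$. If $(k,\ell)$ is a complete Pick pair, then $$\Omega\subseteq\Omega_\ell\subseteq\Omega_s=\Omega_\vartheta^1\subseteq\Omega_k\subseteq\Omega_\vartheta.$$ Further, the following assertions are equivalent, independent of the domain $\Omega\subseteq\Omega_\ell$ (where always $\mathbf{0}\in\Omega$): (i) $(k,\ell)$ is a complete Pick pair on $\Omega$; (ii) $(k,\ell)$ is a complete Carathéodory pair; (iii) $s$ is a strong Shimorin certificate for $(k,\ell)$ on $\Omega$; (iv) there exists a positive kernel $g$ on $\Omega$ such that $\ell=g\,s$ on $\Omega$; (v) $(k,\ell)$ has a diagonal holomorphic strong Shimorin certificate on $\Omega$; (vi) $(k,\ell)$ has a strong Shimorin certificate on $\Omega$; (vii) $(k,\ell)$ has a Shimorin certificate on $\Omega$.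
   Context: A (positive) kernel on a non-empty set $X$ is a function $k:X\times X\to\mathbb{C}$ such that $[k(z_i,z_j)]_{i,j=1}^n$ is positive semi-definite for all finite choices of points; $k_1\succeq k_2$ (or $k_2\preceq k_1$) means $k_1-k_2$ is a kernel; $\mathcal{H}_k$ is the reproducing kernel Hilbert space. $\mathrm{Mult}(\mathcal{H}_k\otimes\mathbb{C}^N,\mathcal{H}_\ell\otimes\mathbb{C}^N)$ is the set of $\Phi:X\to\mathbb{M}_N$ (complex $N\times N$ matrices) with $\Phi f\in\mathcal{H}_\ell\otimes\mathbb{C}^N$ for all $f\in\mathcal{H}_k\otimes\mathbb{C}^N$, normed by the operator norm of $f\mapsto\Phi f$; contractive means norm at most one. $(k,\ell)$ is a complete Pick pair on $X$ if for all $n,N\ge1$, all $z_1,\dots,z_n\in X$ and all $W_1,\dots,W_n\in\mathbb{M}_N$ with $[\ell(z_i,z_j)I_{N\times N}-k(z_i,z_j)W_iW_j^*]_{i,j=1}^n$ positive semi-definite, there is a contractive $\Phi\in\mathrm{Mult}(\mathcal{H}_k\otimes\mathbb{C}^N,\mathcal{H}_\ell\otimes\mathbb{C}^N)$ with $\Phi(z_i)=W_i$ for all $i$. A kernel $s$ is a complete Pick kernel if $(s,s)$ is a complete Pick pair. For a kernel $k$ with $k(z,z)\ne0$, $k^z(w,v)=k(w,v)-\frac{k(w,z)k(z,v)}{k(z,z)}$. A Shimorin certificate for $(k,\ell)$ on $X$ is a family of kernels $\{p[z]\}_{z\in X}$ on $X$ such that $\ell^z\succeq p[z]\ell$ and $k^z\preceq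 p[z]k$ for every $z\in X$. A strong Shimorin certificate for $(k,\ell)$ on $X$ is a complete Pick kernel $s$ on $X$ for which there are kernels $h,g$ on $X$ with $k=(1-h)s$ and $\ell=sg$. A domain is open, connected and non-empty. $\mathbb{N}$ includes $0$; for $a\in\mathbb{N}^d$, $|a|=\sum a_j$; $z\overline{w}=(z_1\overline{w_1},\dots,z_d\overline{w_d})$. A diagonal holomorphic kernel on a domain $\Omega\ni\mathbf{0}$ is a kernel $f$ on $\Omega$, holomorphic in $z$ and conjugate holomorphic in $w$, whose power series at $\mathbf{0}$ has the form $f(z,w)=\sum_{a\in\mathbb{N}^d}f_az^a\overline{w}^a$ with all $f_a>0$; it is normalized if $f_{\mathbf{0}}=1$. The master certificate associated with $k$ is the formal power series $\vartheta(x)=\sum_{b\in\mathbb{N}^d}\vartheta_bx^b$ with $\vartheta_{\mathbf{0}}=0$, $\vartheta_{e_j}=k_{e_j}$ for $1\le j\le d$, and, recursively for $|b|\ge2$, $\vartheta_b=\max\{0,\,k_b-\sum_{w+u=b,\;w,u\ne\mathbf{0}}\vartheta_wk_u\}$. For $f=\sum_af_az^a\overline{w}^a$ (or $f(x)=\sum_af_ax^a$) with $f_a\ge0$, $\Omega_f=\bigcup_{r>0}\{x\in\mathbb{C}^d:\sum_af_a|y|^{2a}<\infty\text{ for all }y\text{ with }\|x-y\|<r\}$, where $|y|=(|y_1|,\dots,|y_d|)$; $\Omega_s$ is defined using the coefficients of the power series reciprocal of $1-\vartheta$. Statements (iii) and (iv) are understood to include that $s$ is defined on $\Omega\times\Omega$.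 For $a,b\in\mathbb{N}^d$, $a\le b$ means $a_i\le b_i$ for all $i$. A non-empty set $F\subseteq\mathbb{N}^d$ is co-invariant if $b\in F$ and $a\le b$ imply $a\in F$. $(k,\ell)$ is a complete Carathéodory pair if for every positive integer $J$, every finite co-invariant $\varnothing\ne F\subseteq\mathbb{N}^d$ and every $\{c_a:a\in F\}\subseteq\mathbb{M}_J$, the block matrix $C$ indexed by $F\times F$ with blocks $C_{a,b}=c_{b-a}\sqrt{k_a/\ell_b}$ if $b\ge a$ and $C_{a,b}=\mathbf{0}$ otherwise is a contraction if and only if there exist $\{c_a:a\in\mathbb{N}^d\setminus F\}\subseteq\mathbb{M}_J$ such that $\Phi(z)=\sum_{a\in\mathbb{N}^d}z^a\otimes c_a^*$ is a contractive multiplier from $\mathcal{H}_k\otimes\mathbb{C}^J$ to $\mathcal{H}_\ell\otimes\mathbb{C}^J$. *)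

theory Defs
  imports "HOL-Analysis.Analysis"
begin

section \<open>Matrices over a finite index set\<close>

text \<open>Matrix sizes are quantified inside the definitions below, so a matrix is a function of two
  indices, of which only the values on an explicit finite index set matter: \<open>{..<N}\<close> for
  an \<open>N \<times> N\<close> matrix, \<open>I \<times> {..<N}\<close> for a block matrix indexed by \<open>I\<close>.\<close>

definition psd_on :: "'i set \<Rightarrow> ('i \<Rightarrow> 'i \<Rightarrow> complex) \<Rightarrow> bool" where
  "psd_on I M \<longleftrightarrow>
     (\<forall>v :: 'i \<Rightarrow> complex.
        (\<Sum>i\<in>I. \<Sum>j\<in>I. cnj (v i) * M i j * v j) \<in> \<real> \<and>
        0 \<le> Re (\<Sum>i\<in>I. \<Sum>j\<in>I. cnj (v i) * M i j * v j))"

definition contraction_on :: "'i set \<Rightarrow> ('i \<Rightarrow> 'i \<Rightarrow> complex) \<Rightarrow> bool" where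
  "contraction_on I M \<longleftrightarrow>
     (\<forall>v :: 'i \<Rightarrow> complex.
        (\<Sum>i\<in>I. (cmod (\<Sum>j\<in>I. M i j * v j))\<^sup>2) \<le> (\<Sum>j\<in>I. (cmod (v j))\<^sup>2))"


section \<open>Kernels and reproducing kernel Hilbert spaces\<close>

definition kernel :: "'a set \<Rightarrow> ('a \<Rightarrow> 'a \<Rightarrow> complex) \<Rightarrow> bool" where
  "kernel X k \<longleftrightarrow>
     (\<forall>n (z :: nat \<Rightarrow> 'a). (\<forall>i<n. z i \<in> X) \<longrightarrow> psd_on {..<n} (\<lambda>i j. k (z i) (z j)))"

definition kernel_le :: "'a set \<Rightarrow> ('a \<Rightarrow> 'a \<Rightarrow> complex) \<Rightarrow> ('a \<Rightarrow> 'a \<Rightarrow> complex) \<Rightarrow> bool" where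
  "kernel_le X k1 k2 \<longleftrightarrow> kernel X (\<lambda>z w. k2 z w - k1 z w)"

text \<open>A function on \<open>X\<close> is represented by its extension by zero, which makes the space and the
  values of the inner product on it unique. The inner product is linear in its first argument.\<close>

definition is_rkhs ::
  "'a set \<Rightarrow> ('a \<Rightarrow> 'a \<Rightarrow> complex) \<Rightarrow> ('a \<Rightarrow> complex) set \<Rightarrow>
   (('a \<Rightarrow> complex) \<Rightarrow> ('a \<Rightarrow> complex) \<Rightarrow> complex) \<Rightarrow> bool" where
  "is_rkhs X k H ip \<longleftrightarrow>
     (\<forall>f\<in>H. \<forall>x. x \<notin> X \<longrightarrow> f x = 0) \<and>
     (\<lambda>x. 0) \<in> H \<and>
     (\<forall>f\<in>H. \<forall>g\<in>H. (\<lambda>x. f x + g x) \<in> H) \<and>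
     (\<forall>c. \<forall>f\<in>H. (\<lambda>x. c * f x) \<in> H) \<and>
     (\<forall>f\<in>H. \<forall>g\<in>H. \<forall>h\<in>H. ip (\<lambda>x. f x + g x) h = ip f h + ip g h) \<and>
     (\<forall>c. \<forall>f\<in>H. \<forall>g\<in>H. ip (\<lambda>x. c * f x) g = c * ip f g) \<and>
     (\<forall>f\<in>H. \<forall>g\<in>H. ip g f = cnj (ip f g)) \<and>
     (\<forall>f\<in>H. f \<noteq> (\<lambda>x. 0) \<longrightarrow> 0 < Re (ip f f)) \<and>
     (\<forall>F :: nat \<Rightarrow> 'a \<Rightarrow> complex. (\<forall>n. F n \<in> H) \<and>
        (\<forall>e>0. \<exists>M. \<forall>m\<ge>M. \<forall>n\<ge>M. sqrt (Re (ip (\<lambda>x. F m x - F n x) (\<lambda>x. F m x - F n x))) < e)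
        \<longrightarrow> (\<exists>f\<in>H. (\<lambda>n. sqrt (Re (ip (\<lambda>x. F n x - f x) (\<lambda>x. F n x - f x)))) \<longlonglongrightarrow> 0)) \<and>
     (\<forall>w\<in>X. (\<lambda>z. if z \<in> X then k z w else 0) \<in> H \<and>
             (\<forall>f\<in>H. ip f (\<lambda>z. if z \<in> X then k z w else 0) = f w))"

definition rkhs ::
  "'a set \<Rightarrow> ('a \<Rightarrow> 'a \<Rightarrow> complex) \<Rightarrow>
   ('a \<Rightarrow> complex) set \<times> (('a \<Rightarrow> complex) \<Rightarrow> ('a \<Rightarrow> complex) \<Rightarrow> complex)" where
  "rkhs X k = (SOME R. is_rkhs X k (fst R) (snd R))"

text \<open>Elements of \<open>H\<^sub>k \<otimes> C\<^sup>N\<close> are \<open>N\<close>-tuples of elements of \<open>H\<^sub>k\<close>.\<close>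

definition rkhs_tensor ::
  "'a set \<Rightarrow> ('a \<Rightarrow> 'a \<Rightarrow> complex) \<Rightarrow> nat \<Rightarrow> (nat \<Rightarrow> 'a \<Rightarrow> complex) set" where
  "rkhs_tensor X k N = {f. \<forall>q<N. f q \<in> fst (rkhs X k)}"

definition rkhs_tensor_norm ::
  "'a set \<Rightarrow> ('a \<Rightarrow> 'a \<Rightarrow> complex) \<Rightarrow> nat \<Rightarrow> (nat \<Rightarrow> 'a \<Rightarrow> complex) \<Rightarrow> real" where
  "rkhs_tensor_norm X k N f = sqrt (\<Sum>q<N. Re (snd (rkhs X k) (f q) (f q)))"

text \<open>The values of \<open>\<Phi>\<close> outside \<open>X\<close> are irrelevant, since \<open>f\<close> vanishes there.\<close>

definition mult_apply ::
  "nat \<Rightarrow> ('a \<Rightarrow> nat \<Rightarrow> nat \<Rightarrow> complex) \<Rightarrow> (nat \<Rightarrow> 'a \<Rightarrow> complex) \<Rightarrow> nat \<Rightarrow> 'a \<Rightarrow> complex" where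
  "mult_apply N \<Phi> f = (\<lambda>p z. \<Sum>q<N. \<Phi> z p q * f q z)"

definition multipliers ::
  "'a set \<Rightarrow> ('a \<Rightarrow> 'a \<Rightarrow> complex) \<Rightarrow> ('a \<Rightarrow> 'a \<Rightarrow> complex) \<Rightarrow> nat \<Rightarrow>
   ('a \<Rightarrow> nat \<Rightarrow> nat \<Rightarrow> complex) set" where
  "multipliers X k l N =
     {\<Phi>. \<forall>f\<in>rkhs_tensor X k N. mult_apply N \<Phi> f \<in> rkhs_tensor X l N}"

definition contractive_multiplier ::
  "'a set \<Rightarrow> ('a \<Rightarrow> 'a \<Rightarrow> complex) \<Rightarrow> ('a \<Rightarrow> 'a \<Rightarrow> complex) \<Rightarrow> nat \<Rightarrow>
   ('a \<Rightarrow> nat \<Rightarrow> nat \<Rightarrow> complex) \<Rightarrow> bool" where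
  "contractive_multiplier X k l N \<Phi> \<longleftrightarrow>
     \<Phi> \<in> multipliers X k l N \<and>
     (\<forall>f\<in>rkhs_tensor X k N.
        rkhs_tensor_norm X l N (mult_apply N \<Phi> f) \<le> rkhs_tensor_norm X k N f)"


section \<open>Complete Pick pairs and Shimorin certificates\<close>

definition complete_pick_pair ::
  "'a set \<Rightarrow> ('a \<Rightarrow> 'a \<Rightarrow> complex) \<Rightarrow> ('a \<Rightarrow> 'a \<Rightarrow> complex) \<Rightarrow> bool" where
  "complete_pick_pair X k l \<longleftrightarrow>
     (\<forall>n N (z :: nat \<Rightarrow> 'a) (W :: nat \<Rightarrow> nat \<Rightarrow> nat \<Rightarrow> complex).
        1 \<le> n \<and> 1 \<le> N \<and> (\<forall>i<n. z i \<in> X) \<and>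
        psd_on ({..<n} \<times> {..<N})
          (\<lambda>(i, p) (j, q). l (z i) (z j) * (if p = q then 1 else 0)
             - k (z i) (z j) * (\<Sum>m<N. W i p m * cnj (W j q m)))
        \<longrightarrow> (\<exists>\<Phi>. contractive_multiplier X k l N \<Phi> \<and>
                 (\<forall>i<n. \<forall>p<N. \<forall>q<N. \<Phi> (z i) p q = W i p q)))"

definition complete_pick_kernel :: "'a set \<Rightarrow> ('a \<Rightarrow> 'a \<Rightarrow> complex) \<Rightarrow> bool" where
  "complete_pick_kernel X s \<longleftrightarrow> kernel X s \<and> complete_pick_pair X s s"

definition kernel_at :: "('a \<Rightarrow> 'a \<Rightarrow> complex) \<Rightarrow> 'a \<Rightarrow> 'a \<Rightarrow> 'a \<Rightarrow> complex" where
  "kernel_at k z = (\<lambda>w v. k w v - k w z * k z v / k z z)"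

definition shimorin_certificate ::
  "'a set \<Rightarrow> ('a \<Rightarrow> 'a \<Rightarrow> complex) \<Rightarrow> ('a \<Rightarrow> 'a \<Rightarrow> complex) \<Rightarrow>
   ('a \<Rightarrow> 'a \<Rightarrow> 'a \<Rightarrow> complex) \<Rightarrow> bool" where
  "shimorin_certificate X k l p \<longleftrightarrow>
     (\<forall>z\<in>X. kernel X (p z) \<and>
        kernel_le X (\<lambda>w v. p z w v * l w v) (kernel_at l z) \<and>
        kernel_le X (kernel_at k z) (\<lambda>w v. p z w v * k w v))"

definition strong_shimorin_certificate ::
  "'a set \<Rightarrow> ('a \<Rightarrow> 'a \<Rightarrow> complex) \<Rightarrow> ('a \<Rightarrow> 'a \<Rightarrow> complex) \<Rightarrow>
   ('a \<Rightarrow> 'a \<Rightarrow> complex) \<Rightarrow> bool" where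
  "strong_shimorin_certificate X k l s \<longleftrightarrow>
     complete_pick_kernel X s \<and>
     (\<exists>h g. kernel X h \<and> kernel X g \<and>
        (\<forall>z\<in>X. \<forall>w\<in>X. k z w = (1 - h z w) * s z w \<and> l z w = s z w * g z w))"


section \<open>Power series in several variables and diagonal holomorphic kernels\<close>

text \<open>Multi-indices are elements of \<^typ>\<open>nat ^ 'd\<close>, with the componentwise addition, subtraction and
  order of the library; the product of two vectors is componentwise as well.\<close>

definition mdeg :: "nat ^ 'd \<Rightarrow> nat" where
  "mdeg a = (\<Sum>j\<in>UNIV. a $ j)"

definition mpow :: "complex ^ 'd \<Rightarrow> nat ^ 'd \<Rightarrow> complex" where
  "mpow z a = (\<Prod>j\<in>UNIV. (z $ j) ^ (a $ j))"

definition vcnj :: "complex ^ 'd \<Rightarrow> complex ^ 'd" where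
  "vcnj z = (\<chi> j. cnj (z $ j))"

definition is_domain :: "(complex ^ 'd) set \<Rightarrow> bool" where
  "is_domain \<Omega> \<longleftrightarrow> open \<Omega> \<and> connected \<Omega> \<and> \<Omega> \<noteq> {}"

definition holomorphic_several :: "(complex ^ 'd) set \<Rightarrow> (complex ^ 'd \<Rightarrow> complex) \<Rightarrow> bool" where
  "holomorphic_several \<Omega> f \<longleftrightarrow>
     (\<forall>z\<in>\<Omega>. \<exists>D. (f has_derivative D) (at z) \<and> (\<forall>c v. D (c *s v) = c * D v))"

definition diagonal_holomorphic_kernel ::
  "(complex ^ 'd) set \<Rightarrow> (complex ^ 'd \<Rightarrow> complex ^ 'd \<Rightarrow> complex) \<Rightarrow> (nat ^ 'd \<Rightarrow> real) \<Rightarrow> bool" where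
  "diagonal_holomorphic_kernel \<Omega> f c \<longleftrightarrow>
     kernel \<Omega> f \<and>
     (\<forall>w\<in>\<Omega>. holomorphic_several \<Omega> (\<lambda>z. f z w)) \<and>
     (\<forall>z\<in>\<Omega>. holomorphic_several \<Omega> (\<lambda>w. cnj (f z w))) \<and>
     (\<forall>a. 0 < c a) \<and>
     (\<exists>r>0. \<forall>z\<in>\<Omega> \<inter> ball 0 r. \<forall>w\<in>\<Omega> \<inter> ball 0 r.
        ((\<lambda>a. of_real (c a) * mpow z a * mpow (vcnj w) a) has_sum f z w) UNIV)"

definition normalized_diagonal_holomorphic_kernel ::
  "(complex ^ 'd) set \<Rightarrow> (complex ^ 'd \<Rightarrow> complex ^ 'd \<Rightarrow> complex) \<Rightarrow> (nat ^ 'd \<Rightarrow> real) \<Rightarrow> bool" where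
  "normalized_diagonal_holomorphic_kernel \<Omega> f c \<longleftrightarrow>
     diagonal_holomorphic_kernel \<Omega> f c \<and> c 0 = 1"

text \<open>The convergence domain \<open>\<Omega>\<^sub>f\<close> for the coefficient family \<open>c\<close> of \<open>f\<close>; the terms are nonnegative in
  all uses, so summability is finiteness of the sum.\<close>

definition conv_domain :: "(nat ^ 'd \<Rightarrow> real) \<Rightarrow> (complex ^ 'd) set" where
  "conv_domain c =
     (\<Union>r\<in>{0<..}. {x. \<forall>y. norm (x - y) < r \<longrightarrow>
        (\<lambda>a. c a * (\<Prod>j\<in>UNIV. cmod (y $ j) ^ (2 * a $ j))) summable_on UNIV})"

definition ps_eval :: "(nat ^ 'd \<Rightarrow> real) \<Rightarrow> complex ^ 'd \<Rightarrow> complex" where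
  "ps_eval c x = (\<Sum>\<^sub>\<infinity>a. of_real (c a) * mpow x a)"

definition ps_mult :: "(nat ^ 'd \<Rightarrow> real) \<Rightarrow> (nat ^ 'd \<Rightarrow> real) \<Rightarrow> nat ^ 'd \<Rightarrow> real" where
  "ps_mult c c' b = (\<Sum>(w, u)\<in>{(w, u). w + u = b}. c w * c' u)"

definition ps_one :: "nat ^ 'd \<Rightarrow> real" where
  "ps_one a = (if a = 0 then 1 else 0)"

definition ps_reciprocal :: "(nat ^ 'd \<Rightarrow> real) \<Rightarrow> nat ^ 'd \<Rightarrow> real" where
  "ps_reciprocal c = (THE c'. ps_mult c c' = ps_one)"


section \<open>The master certificate\<close>

text \<open>Multi-indices of degree one are exactly the unit vectors.\<close>

function master :: "(nat ^ 'd \<Rightarrow> real) \<Rightarrow> nat ^ 'd \<Rightarrow> real" where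
  "master k b =
     (if b = 0 then 0
      else if mdeg b = 1 then k b
      else max 0 (k b - (\<Sum>(w, u)\<in>{(w, u). w + u = b \<and> w \<noteq> 0 \<and> u \<noteq> 0}. master k w * k u)))"
  by pat_completeness auto

lemma mdeg_add_less:
  assumes "u \<noteq> 0"
  shows "mdeg w < mdeg (w + u)"
proof -
  obtain j where "u $ j \<noteq> 0"
    using assms by (auto simp: vec_eq_iff)
  then have "w $ j < (w + u) $ j"
    by simp
  then show ?thesis
    unfolding mdeg_def by (intro sum_strict_mono_ex1) auto
qed

termination master
  by (relation "Wellfounded.measure (\<lambda>(k, b). mdeg b)") (auto intro: mdeg_add_less)

declare master.simps [simp del]

definition master_kernel ::
  "(nat ^ 'd \<Rightarrow> real) \<Rightarrow> complex ^ 'd \<Rightarrow> complex ^ 'd \<Rightarrow> complex" where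
  "master_kernel k z w = 1 / (1 - ps_eval (master k) (z * vcnj w))"

text \<open>\<open>master_kernel k\<close> is defined on \<open>\<Omega> \<times> \<Omega>\<close>: neither the infinite sum nor the quotient is a junk value.\<close>

definition master_kernel_defined :: "(nat ^ 'd \<Rightarrow> real) \<Rightarrow> (complex ^ 'd) set \<Rightarrow> bool" where
  "master_kernel_defined k \<Omega> \<longleftrightarrow>
     (\<forall>z\<in>\<Omega>. \<forall>w\<in>\<Omega>.
        (\<lambda>a. of_real (master k a) * mpow (z * vcnj w) a :: complex) summable_on UNIV \<and>
        ps_eval (master k) (z * vcnj w) \<noteq> 1)"


section \<open>Complete Caratheodory pairs\<close>

definition coinvariant :: "(nat ^ 'd) set \<Rightarrow> bool" where
  "coinvariant F \<longleftrightarrow> F \<noteq> {} \<and> (\<forall>b\<in>F. \<forall>a. a \<le> b \<longrightarrow> a \<in> F)"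

text \<open>Here \<open>kc\<close> and \<open>lc\<close> are the coefficient families of \<open>k\<close> and \<open>l\<close>, and \<open>cnj (c a q p)\<close> is the entry
  \<open>(p, q)\<close> of the adjoint of \<open>c a\<close>.\<close>

definition complete_caratheodory_pair ::
  "(complex ^ 'd) set \<Rightarrow>
   (complex ^ 'd \<Rightarrow> complex ^ 'd \<Rightarrow> complex) \<Rightarrow> (nat ^ 'd \<Rightarrow> real) \<Rightarrow>
   (complex ^ 'd \<Rightarrow> complex ^ 'd \<Rightarrow> complex) \<Rightarrow> (nat ^ 'd \<Rightarrow> real) \<Rightarrow> bool" where
  "complete_caratheodory_pair \<Omega> k kc l lc \<longleftrightarrow>
     (\<forall>J F (c :: nat ^ 'd \<Rightarrow> nat \<Rightarrow> nat \<Rightarrow> complex).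
        1 \<le> J \<and> finite F \<and> coinvariant F \<longrightarrow>
        (contraction_on (F \<times> {..<J})
           (\<lambda>(a, p) (b, q). if a \<le> b then c (b - a) p q * of_real (sqrt (kc a / lc b)) else 0)
         \<longleftrightarrow>
         (\<exists>c' \<Phi>. (\<forall>a\<in>F. \<forall>p<J. \<forall>q<J. c' a p q = c a p q) \<and>
            (\<forall>z\<in>\<Omega>. \<forall>p<J. \<forall>q<J. ((\<lambda>a. mpow z a * cnj (c' a q p)) has_sum \<Phi> z p q) UNIV) \<and>
            contractive_multiplier \<Omega> k l J \<Phi>)))"

end

theory Submission
  imports Defs "HOL-Library.Complex_Order" "HOL-Complex_Analysis.Conformal_Mappings"
begin

text \<open>The seven assertions are all equivalent to one condition on the coefficients, \<open>master_factor_nonneg\<close>: the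
  power series \<open>(1 - \<theta>) \<ell>\<close> has nonnegative coefficients, where \<open>\<theta>\<close> is the master certificate. The condition
  does not mention the domain, and this is why the equivalences do not depend on it.

  Sufficiency. By its recursion \<open>\<theta>\<close> has nonnegative coefficients, and so has \<open>h = 1 - (1 - \<theta>) k\<close>. With
  \<open>s = 1 / (1 - \<theta>)\<close> and \<open>g = (1 - \<theta>) \<ell>\<close> this gives \<open>k = (1 - h) s\<close> and \<open>\<ell> = s g\<close> with kernels \<open>h\<close>
  and \<open>g\<close>, so \<open>s\<close> is a strong Shimorin certificate (\<open>master_certificate_consequences\<close>). From a factorization
  of this kind one gets the Shimorin certificate \<open>p[z] = s\<^sup>z / s\<close>
  (\<open>factorization_imp_shimorin_certificate\<close>), and a Shimorin certificate allows Pick interpolation to be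
  extended by one node: the part of the Pick matrix that does not contain the unknown value is positive, and
  the value itself is an extension of a contraction to a larger space (\<open>contraction_extension\<close>).
  Compactness then gives a multiplier on the whole domain (\<open>shimorin_interpolation\<close>). The Caratheodory
  property follows the same pattern with multi-indices in place of nodes (\<open>toeplitz_extension\<close>); there the
  positivity of the known part comes from adding up shifted copies of the given contraction with the weights
  \<open>\<theta>\<^sub>w\<close>. The inclusions of the domains hold because the condition implies
  \<open>\<theta> \<le> k \<le> 1 / (1 - \<theta>) \<le> \<ell>\<close> coefficientwise.

  Necessity. Interpolation on a small grid about the origin, and likewise the extension of Toeplitz contractions,
  imply a family of statements about linear inequalities (\<open>lp_condition\<close>): if \<open>y \<ge> 0\<close> satisfies
  \<open>(k y)\<^sub>a \<le> \<ell>\<^sub>a\<close> for all \<open>a < b\<close>, then the part of the inequality at \<open>b\<close> that does not contain \<open>y\<^sub>b\<close>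
  holds as well. Here \<open>y\<^sub>u\<close> is the squared norm of the Taylor coefficient at \<open>u\<close> of a row of monomials, and the
  coefficient at \<open>b\<close> is the one that has to be found. This is a linear program whose dual solution is \<open>\<theta>\<close>:
  a vector \<open>y\<close> that satisfies complementary slackness turns the inequality at \<open>b\<close> into the condition
  (\<open>lp_condition_imp_nonneg\<close>). A strong certificate with an arbitrary complete Pick kernel is reduced to this
  case on a small ball where \<open>\<ell>\<close> has no zeros, and for a factorization \<open>\<ell> = g s\<close> the condition says that the kernel
  \<open>g\<close> has nonnegative coefficients (\<open>kernel_coefficient_nonneg\<close>).

  Two translations support both directions. A matrix function is a contractive multiplier exactly if its Pick
  matrices are positive on all finite sets (\<open>contractive_multiplier_iff\<close>), which rests on the construction of
  the reproducing kernel Hilbert space. A diagonal holomorphic kernel equals its power series on the whole domain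
  (\<open>diagonal_holomorphic_kernel_expansion\<close>), so that the value of its form on finitely many
  weighted points depends only on the moments of the weights; weights on shrinking grids can be given
  prescribed moments up to some order and negligible moments beyond it (\<open>grid_form_approx\<close>).\<close>

section \<open>Positive semi-definite matrices\<close>

definition qf :: "'i set \<Rightarrow> ('i \<Rightarrow> 'i \<Rightarrow> complex) \<Rightarrow> ('i \<Rightarrow> complex) \<Rightarrow> complex" where
  "qf I M v = (\<Sum>i\<in>I. \<Sum>j\<in>I. cnj (v i) * M i j * v j)"

lemma complex_nonneg_iff: "0 \<le> (z::complex) \<longleftrightarrow> z \<in> \<real> \<and> 0 \<le> Re z"
  by (auto simp: less_eq_complex_def complex_is_Real_iff)

lemma complex_of_real_nonneg_iff [simp]: "0 \<le> complex_of_real r \<longleftrightarrow> 0 \<le> r"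
  by (simp add: less_eq_complex_def)

lemma cnj_mult_self_nonneg [simp]: "0 \<le> cnj z * z" "0 \<le> z * cnj z"
  by (auto simp: less_eq_complex_def algebra_simps)

lemma cnj_mult_self: "cnj z * z = of_real ((cmod z)\<^sup>2)" "z * cnj z = of_real ((cmod z)\<^sup>2)"
  by (metis complex_norm_square mult.commute)+

lemma nonneg_complex_cases:
  assumes "0 \<le> (z::complex)"
  obtains r where "z = of_real r" "0 \<le> r"
  using assms by (metis complex_nonneg_iff Reals_cases complex_of_real_nonneg_iff)

text \<open>In the componentwise order of the complex numbers, \<open>0 \<le> z\<close> says that \<open>z\<close> is real and nonnegative; the
  two conjuncts of positivity become one inequality.\<close>

lemma psd_on_iff: "psd_on I M \<longleftrightarrow> (\<forall>v. 0 \<le> qf I M v)"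
  unfolding psd_on_def qf_def complex_nonneg_iff by simp

lemma psd_onD: "psd_on I M \<Longrightarrow> 0 \<le> qf I M v"
  by (simp add: psd_on_iff)

lemma qf_cong:
  assumes "\<And>i j. i \<in> I \<Longrightarrow> j \<in> I \<Longrightarrow> M i j = M' i j" "\<And>i. i \<in> I \<Longrightarrow> v i = v' i"
  shows "qf I M v = qf I M' v'"
  unfolding qf_def using assms by (intro sum.cong refl) auto

lemma psd_on_cong:
  assumes "\<And>i j. i \<in> I \<Longrightarrow> j \<in> I \<Longrightarrow> M i j = M' i j"
  shows "psd_on I M \<longleftrightarrow> psd_on I M'"
proof -
  have "qf I M v = qf I M' v" for v
    by (rule qf_cong) (use assms in auto)
  then show ?thesis by (simp add: psd_on_iff)
qed

lemma qf_add: "qf I (\<lambda>i j. M i j + M' i j) v = qf I M v + qf I M' v"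
  unfolding qf_def by (simp add: algebra_simps sum.distrib)

lemma qf_diff: "qf I (\<lambda>i j. M i j - M' i j) v = qf I M v - qf I M' v"
  unfolding qf_def by (simp add: algebra_simps sum_subtractf)

lemma qf_scale: "qf I (\<lambda>i j. c * M i j) v = c * qf I M v"
  unfolding qf_def by (simp add: algebra_simps sum_distrib_left)

lemma qf_sum: "qf I (\<lambda>i j. \<Sum>r\<in>R. M r i j) v = (\<Sum>r\<in>R. qf I (M r) v)"
  unfolding qf_def
  by (induction R rule: infinite_finite_induct) (auto simp: algebra_simps sum.distrib)

lemma qf_rank_one: "qf I (\<lambda>i j. f i * cnj (g j)) v = (\<Sum>i\<in>I. f i * cnj (v i)) * cnj (\<Sum>i\<in>I. g i * cnj (v i))"
  unfolding qf_def sum_product cnj_sum by (simp add: algebra_simps)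

lemma psd_on_rank_one: "psd_on I (\<lambda>i j. f i * cnj (f j))"
  unfolding psd_on_iff qf_rank_one by (simp del: cnj_sum)

lemma psd_on_add: "psd_on I M \<Longrightarrow> psd_on I M' \<Longrightarrow> psd_on I (\<lambda>i j. M i j + M' i j)"
  unfolding psd_on_iff qf_add by simp

lemma psd_on_scale: "0 \<le> c \<Longrightarrow> psd_on I M \<Longrightarrow> psd_on I (\<lambda>i j. c * M i j)"
  unfolding psd_on_iff qf_scale by (auto intro: mult_nonneg_nonneg)

lemma psd_on_sum: "(\<And>r. r \<in> R \<Longrightarrow> psd_on I (M r)) \<Longrightarrow> psd_on I (\<lambda>i j. \<Sum>r\<in>R. M r i j)"
  unfolding psd_on_iff qf_sum by (auto intro: sum_nonneg)

lemma psd_on_zero: "psd_on I (\<lambda>i j. 0)"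
  unfolding psd_on_iff qf_def by simp

lemma psd_on_gram: "psd_on I (\<lambda>i j. \<Sum>r\<in>R. f r i * cnj (f r j))"
  by (rule psd_on_sum) (rule psd_on_rank_one)

text \<open>The vector on \<open>I\<close> that collects the entries over each fibre of \<open>f\<close> gives both matrices
  the same form.\<close>

lemma psd_on_reindex:
  assumes psd: "psd_on I M" and fin: "finite I" "finite J" and "f ` J \<subseteq> I"
  shows "psd_on J (\<lambda>i j. M (f i) (f j))"
  unfolding psd_on_iff
proof
  fix v
  define w where "w i = (\<Sum>j | j \<in> J \<and> f j = i. v j :: complex)" for i
  have g: "(\<Sum>j\<in>J. v j * F (f j)) = (\<Sum>i\<in>I. w i * F i)" for F :: "_ \<Rightarrow> complex"
    unfolding w_def sum_distrib_right
    by (subst sum.group[OF fin(2,1) assms(4), symmetric]) (auto intro!: sum.cong)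
  have g': "(\<Sum>j\<in>J. cnj (v j) * F (f j)) = (\<Sum>i\<in>I. cnj (w i) * F i)" for F :: "_ \<Rightarrow> complex"
    using arg_cong[OF g[of "\<lambda>i. cnj (F i)"], of cnj] by (simp add: cnj_sum)
  have "qf J (\<lambda>i j. M (f i) (f j)) v = (\<Sum>i\<in>J. cnj (v i) * (\<Sum>j\<in>J. v j * M (f i) (f j)))"
    unfolding qf_def by (simp add: sum_distrib_left mult_ac)
  also have "\<dots> = (\<Sum>i\<in>J. cnj (v i) * (\<Sum>j\<in>I. w j * M (f i) j))"
    using g by (metis (no_types))
  also have "\<dots> = (\<Sum>i\<in>I. cnj (w i) * (\<Sum>j\<in>I. w j * M i j))"
    by (rule g')
  also have "\<dots> = qf I M w"
    unfolding qf_def by (simp add: sum_distrib_left mult_ac)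
  finally show "0 \<le> qf J (\<lambda>i j. M (f i) (f j)) v"
    using psd by (simp add: psd_on_iff)
qed

lemma psd_on_subset: "psd_on I M \<Longrightarrow> finite I \<Longrightarrow> J \<subseteq> I \<Longrightarrow> psd_on J M"
  using psd_on_reindex[of I M J "\<lambda>x. x"] finite_subset by auto

lemma qf_zero_extend:
  assumes "finite K" "I \<subseteq> K" "\<And>i j. i \<in> K \<Longrightarrow> j \<in> K \<Longrightarrow> i \<notin> I \<or> j \<notin> I \<Longrightarrow> cnj (v i) * M i j * v j = 0"
  shows "qf K M v = qf I M v"
proof -
  have "(\<Sum>i\<in>K. \<Sum>j\<in>K. cnj (v i) * M i j * v j) = (\<Sum>i\<in>I. \<Sum>j\<in>K. cnj (v i) * M i j * v j)"
    by (rule sum.mono_neutral_right[OF assms(1,2)]) (auto intro!: sum.neutral dest: assms(3))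
  also have "\<dots> = (\<Sum>i\<in>I. \<Sum>j\<in>I. cnj (v i) * M i j * v j)"
    using assms by (intro sum.cong refl sum.mono_neutral_right) auto
  finally show ?thesis
    by (simp add: qf_def)
qed

lemma psd_on_zero_extend:
  assumes "finite K" "I \<subseteq> K" "psd_on I M" "\<And>i j. i \<in> K \<Longrightarrow> j \<in> K \<Longrightarrow> i \<notin> I \<or> j \<notin> I \<Longrightarrow> M i j = 0"
  shows "psd_on K M"
  unfolding psd_on_iff
proof
  fix v
  have "qf K M v = qf I M v"
    by (rule qf_zero_extend[OF assms(1,2)]) (use assms(4) in auto)
  then show "0 \<le> qf K M v"
    using assms(3) by (simp add: psd_on_iff)
qed

lemma qf_single:
  assumes "finite I" "i \<in> I"
  shows "qf I M (\<lambda>j. if j = i then 1 else 0) = M i i"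
proof -
  have "qf I M (\<lambda>j. if j = i then 1 else 0) = qf {i} M (\<lambda>j. if j = i then 1 else 0)"
    using assms by (intro qf_zero_extend) auto
  then show ?thesis by (simp add: qf_def)
qed

lemma psd_on_diag: "psd_on I M \<Longrightarrow> finite I \<Longrightarrow> i \<in> I \<Longrightarrow> 0 \<le> M i i"
  using psd_onD[of I M] qf_single[of I i M] by metis

lemma psd_on_hermitian:
  assumes "psd_on I M" "finite I" "i \<in> I" "j \<in> I"
  shows "M j i = cnj (M i j)"
proof (cases "i = j")
  case True
  then show ?thesis
    using psd_on_diag[OF assms(1-3)] by (auto simp: less_eq_complex_def complex_eq_iff)
next
  case False
  have psd: "psd_on {i, j} M"
    using assms psd_on_subset by (metis empty_subsetI insert_subset)
  have "0 \<le> M i i" "0 \<le> M j j"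
    using psd_on_diag[OF psd] by auto
  moreover have "0 \<le> qf {i, j} M (\<lambda>x. 1)" "0 \<le> qf {i, j} M (\<lambda>x. if x = i then 1 else \<i>)"
    using psd by (auto simp: psd_on_iff)
  ultimately show ?thesis
    using False by (auto simp: qf_def less_eq_complex_def complex_eq_iff)
qed

lemma qf_update:
  assumes psd: "psd_on I M" and I: "finite I" "z \<in> I"
  shows "qf I M (\<lambda>i. v i - (if i = z then c else 0)) =
         qf I M v - cnj c * (\<Sum>j\<in>I. M z j * v j) - c * cnj (\<Sum>j\<in>I. M z j * v j) + cnj c * c * M z z"
proof -
  let ?d = "\<lambda>i. if i = z then c else 0"
  have h: "M i z = cnj (M z i)" if "i \<in> I" for i
    using psd_on_hermitian[OF psd I(1,2) that] .
  have "qf I M (\<lambda>i. v i - ?d i) = qf I M v - (\<Sum>i\<in>I. \<Sum>j\<in>I. cnj (?d i) * M i j * v j)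
     - (\<Sum>i\<in>I. \<Sum>j\<in>I. cnj (v i) * M i j * ?d j) + (\<Sum>i\<in>I. \<Sum>j\<in>I. cnj (?d i) * M i j * ?d j)"
    unfolding qf_def by (simp add: algebra_simps sum.distrib sum_subtractf)
  also have "(\<Sum>i\<in>I. \<Sum>j\<in>I. cnj (?d i) * M i j * v j) = (\<Sum>i\<in>I. if i = z then cnj c * (\<Sum>j\<in>I. M i j * v j) else 0)"
    by (auto intro!: sum.cong simp: sum_distrib_left mult_ac)
  also have "\<dots> = cnj c * (\<Sum>j\<in>I. M z j * v j)"
    using I by simp
  also have "(\<Sum>i\<in>I. \<Sum>j\<in>I. cnj (v i) * M i j * ?d j) = (\<Sum>i\<in>I. \<Sum>j\<in>I. if j = z then cnj (v i) * M i j * c else 0)"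
    by (intro sum.cong) auto
  also have "\<dots> = (\<Sum>i\<in>I. cnj (v i) * M i z * c)"
    using I by simp
  also have "\<dots> = c * cnj (\<Sum>j\<in>I. M z j * v j)"
    unfolding cnj_sum sum_distrib_left using h by (intro sum.cong) auto
  also have "(\<Sum>i\<in>I. \<Sum>j\<in>I. cnj (?d i) * M i j * ?d j) = (\<Sum>i\<in>I. \<Sum>j\<in>I. if j = z then (if i = z then cnj c * M z z * c else 0) else 0)"
    by (intro sum.cong) auto
  also have "\<dots> = cnj c * c * M z z"
    using I by simp
  finally show ?thesis .
qed

lemma qf_kernel_at:
  assumes psd: "psd_on I M" and I: "finite I" "z \<in> I"
  shows "qf I (kernel_at M z) v = qf I M v - cnj (\<Sum>j\<in>I. M z j * v j) * (\<Sum>j\<in>I. M z j * v j) / M z z"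
proof -
  have "qf I (kernel_at M z) v = qf I M v - (\<Sum>i\<in>I. \<Sum>j\<in>I. cnj (v i) * (M i z * M z j / M z z) * v j)"
    unfolding kernel_at_def qf_diff by (simp add: qf_def)
  also have "(\<Sum>i\<in>I. \<Sum>j\<in>I. cnj (v i) * (M i z * M z j / M z z) * v j) =
      cnj (\<Sum>j\<in>I. M z j * v j) * (\<Sum>j\<in>I. M z j * v j) / M z z"
    unfolding cnj_sum sum_product sum_divide_distrib
    using psd_on_hermitian[OF psd I(1,2)] by (intro sum.cong) (auto simp: mult_ac)
  finally show ?thesis .
qed

text \<open>The form of the Schur complement at \<open>z\<close> is the minimum of the form of \<open>M\<close> over the
  choices of the entry of the vector at \<open>z\<close>.\<close>

lemma kernel_at_minimizer:
  assumes psd: "psd_on I M" and I: "finite I" "z \<in> I" and "M z z \<noteq> 0"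
  shows "qf I (kernel_at M z) v =
         qf I M (\<lambda>i. v i - (if i = z then (\<Sum>j\<in>I. M z j * v j) / M z z else 0))"
proof -
  have "cnj (M z z) = M z z"
    using psd_on_hermitian[OF psd I(1,2,2)] by simp
  then show ?thesis
    using assms(4) by (subst qf_update[OF psd I]) (simp add: qf_kernel_at[OF psd I])
qed

lemma psd_on_kernel_at:
  assumes psd: "psd_on I M" and I: "finite I" "z \<in> I"
  shows "psd_on I (kernel_at M z)"
proof (cases "M z z = 0")
  case True
  then show ?thesis using psd by (simp add: kernel_at_def)
next
  case False
  then show ?thesis
    unfolding psd_on_iff kernel_at_minimizer[OF psd I False] using psd by (simp add: psd_on_iff)
qed

lemma psd_on_minus_kernel_at:
  assumes psd: "psd_on I M" and I: "finite I" "z \<in> I"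
  shows "psd_on I (\<lambda>x y. M x z * M z y / M z z)"
proof -
  have "psd_on I (\<lambda>x y. (1 / M z z) * (M x z * cnj (M y z)))"
    using psd_on_diag[OF psd I] by (intro psd_on_scale psd_on_rank_one) (auto simp: less_eq_complex_def complex_eq_iff Re_divide Im_divide)
  then show ?thesis
    by (rule iffD1[OF psd_on_cong, rotated]) (use psd_on_hermitian[OF psd I(1) _ I(2)] in auto)
qed

text \<open>Otherwise moving the entry of the vector at \<open>z\<close> far enough against the \<open>j\<close>-th unit vector makes the form
  negative.\<close>

lemma psd_on_zero_diag:
  assumes psd: "psd_on I M" and I: "finite I" "z \<in> I" "j \<in> I" and "M z z = 0"
  shows "M z j = 0" "M j z = 0"
proof -
  have *: "M z j = 0"
  proof (rule ccontr)
    assume nz: "M z j \<noteq> 0"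
    obtain r where r: "M j j = of_real r" "0 \<le> r"
      using psd_on_diag[OF psd I(1,3)] by (elim nonneg_complex_cases)
    let ?v = "\<lambda>i. if i = j then 1 else 0 :: complex"
    have s: "(\<Sum>i\<in>I. M z i * ?v i) = M z j"
      using I by (simp add: if_distrib cong: if_cong)
    define c where "c = of_real (r + 1) / cnj (M z j)"
    have "0 \<le> qf I M (\<lambda>i. ?v i - (if i = z then c else 0))"
      using psd by (simp add: psd_on_iff)
    also have "\<dots> = of_real r - 2 * of_real (r + 1)"
      using nz unfolding qf_update[OF psd I(1,2)] qf_single[OF I(1,3)] s c_def \<open>M z z = 0\<close> r
      by (simp add: field_simps)
    finally have "0 \<le> complex_of_real (r - 2 * (r + 1))" by simp
    then show False
      using r(2) unfolding complex_of_real_nonneg_iff by simp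
  qed
  then show "M z j = 0" "M j z = 0"
    using psd_on_hermitian[OF psd I(1,2,3)] by auto
qed

text \<open>Induction on the index set: splitting off a diagonal entry leaves the Schur complement.\<close>

lemma psd_on_gram_decomposition:
  assumes "finite I" "psd_on I M"
  shows "\<exists>f :: nat \<Rightarrow> 'i \<Rightarrow> complex. \<forall>i\<in>I. \<forall>j\<in>I. M i j = (\<Sum>r<card I. f r i * cnj (f r j))"
  using assms
proof (induction I arbitrary: M rule: finite_induct)
  case empty
  then show ?case by simp
next
  case (insert z I)
  let ?K = "insert z I"
  have fin: "finite ?K" "z \<in> ?K" using insert by auto
  have "psd_on I (kernel_at M z)"
    using psd_on_kernel_at[OF insert.prems fin] by (rule psd_on_subset) (use insert in auto)
  from insert.IH[OF this] obtain f where
    f: "\<And>i j. i \<in> I \<Longrightarrow> j \<in> I \<Longrightarrow> kernel_at M z i j = (\<Sum>r<card I. f r i * cnj (f r j))" by blast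
  have h: "M j i = cnj (M i j)" if "i \<in> ?K" "j \<in> ?K" for i j
    by (rule psd_on_hermitian[OF insert.prems fin(1) that])
  obtain d where d: "M z z = of_real d" "0 \<le> d"
    using psd_on_diag[OF insert.prems fin] by (elim nonneg_complex_cases)
  define g where "g r i = (if r = card I then M i z / of_real (sqrt d) else if i = z then 0 else f r i)" for r i
  have sq: "complex_of_real (sqrt d) * of_real (sqrt d) = of_real d"
    using d by (simp flip: of_real_mult)
  have z0: "M i z = 0" "M z i = 0" if "d = 0" "i \<in> ?K" for i
    using psd_on_zero_diag[OF insert.prems fin that(2)] that(1) d(1) by auto
  have "M i j = (\<Sum>r<card ?K. g r i * cnj (g r j))" if ij: "i \<in> ?K" "j \<in> ?K" for i j
  proof -
    have "(\<Sum>r<card ?K. g r i * cnj (g r j)) = (\<Sum>r<card I. g r i * cnj (g r j)) + M i z * cnj (M j z) / M z z"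
      using insert(1,2) sq d by (simp add: g_def)
    also have "cnj (M j z) = M z j"
      using h[of j z] ij by simp
    also have "(\<Sum>r<card I. g r i * cnj (g r j)) = kernel_at M z i j"
    proof (cases "i = z \<or> j = z")
      case True
      then have "kernel_at M z i j = 0"
        unfolding kernel_at_def using z0 ij d by (cases "d = 0") auto
      with True show ?thesis by (auto simp: g_def intro!: sum.neutral)
    next
      case False
      then show ?thesis using f[of i j] ij insert(2) by (auto simp: g_def intro!: sum.cong)
    qed
    finally show ?thesis by (simp add: kernel_at_def)
  qed
  then show ?case by blast
qed

text \<open>Schur's product theorem, by multiplying Gram decompositions.\<close>

lemma psd_on_mult:
  assumes "finite I" "psd_on I M" "psd_on I M'"
  shows "psd_on I (\<lambda>i j. M i j * M' i j)"
proof -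
  obtain f :: "nat \<Rightarrow> 'a \<Rightarrow> complex" where
    f: "\<And>i j. i \<in> I \<Longrightarrow> j \<in> I \<Longrightarrow> M i j = (\<Sum>r<card I. f r i * cnj (f r j))"
    using psd_on_gram_decomposition[OF assms(1,2)] by blast
  obtain g :: "nat \<Rightarrow> 'a \<Rightarrow> complex" where
    g: "\<And>i j. i \<in> I \<Longrightarrow> j \<in> I \<Longrightarrow> M' i j = (\<Sum>r<card I. g r i * cnj (g r j))"
    using psd_on_gram_decomposition[OF assms(1,3)] by blast
  have "psd_on I (\<lambda>i j. \<Sum>s<card I. (f r i * g s i) * cnj (f r j * g s j))" for r
    by (rule psd_on_gram[where f = "\<lambda>s i. f r i * g s i"])
  then have "psd_on I (\<lambda>i j. \<Sum>r<card I. \<Sum>s<card I. (f r i * g s i) * cnj (f r j * g s j))"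
    by (rule psd_on_sum[where M = "\<lambda>r i j. \<Sum>s<card I. (f r i * g s i) * cnj (f r j * g s j)"])
  moreover have "(\<Sum>r<card I. \<Sum>s<card I. (f r i * g s i) * cnj (f r j * g s j)) = M i j * M' i j"
    if "i \<in> I" "j \<in> I" for i j
    unfolding f[OF that] g[OF that] sum_product by (intro sum.cong refl) simp
  ultimately show ?thesis
    by (simp cong: psd_on_cong)
qed

text \<open>Again by splitting off one diagonal entry at a time; where it vanishes, so do its row and column.\<close>

lemma psd_on_column_in_range:
  assumes "finite I" "psd_on (insert z I) M" "z \<notin> I"
  shows "\<exists>x. \<forall>i\<in>I. (\<Sum>j\<in>I. M i j * x j) = M i z"
  using assms
proof (induction I arbitrary: M rule: finite_induct)
  case empty
  then show ?case by simp
next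
  case (insert y I)
  let ?K = "insert z (insert y I)"
  have fin: "finite ?K" "y \<in> ?K" using insert by auto
  have "psd_on (insert z I) (kernel_at M y)"
    using psd_on_kernel_at[OF insert.prems(1) fin] by (rule psd_on_subset) (use insert in auto)
  from insert.IH[OF this] obtain x where
    x: "\<And>i. i \<in> I \<Longrightarrow> (\<Sum>j\<in>I. kernel_at M y i j * x j) = kernel_at M y i z"
    using insert by auto
  have z0: "M i y = 0" "M y i = 0" if "M y y = 0" "i \<in> ?K" for i
    using psd_on_zero_diag[OF insert.prems(1) fin that(2)] that(1) by auto
  define c where "c = (M y z - (\<Sum>j\<in>I. M y j * x j)) / M y y"
  define x' where "x' = x(y := c)"
  have s: "(\<Sum>j\<in>insert y I. M i j * x' j) = M i y * c + (\<Sum>j\<in>I. M i j * x j)" for i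
    using insert(1,2) by (auto simp: x'_def intro!: sum.cong)
  have c: "M y y * c = M y z - (\<Sum>j\<in>I. M y j * x j)"
    using z0 by (cases "M y y = 0") (auto simp: c_def)
  have "M i y * c + (\<Sum>j\<in>I. M i j * x j) = M i z" if "i \<in> insert y I" for i
  proof (cases "i = y")
    case True
    then show ?thesis using c by simp
  next
    case False
    then have i: "i \<in> I" using that by simp
    have "(\<Sum>j\<in>I. M i j * x j) = (\<Sum>j\<in>I. kernel_at M y i j * x j) + (\<Sum>j\<in>I. M i y / M y y * (M y j * x j))"
      by (simp add: kernel_at_def algebra_simps flip: sum.distrib)
    also have "\<dots> = M i z - M i y / M y y * M y z + M i y / M y y * (\<Sum>j\<in>I. M y j * x j)"
      by (simp only: x[OF i] sum_distrib_left) (simp add: kernel_at_def)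
    finally show ?thesis
      by (simp add: c_def algebra_simps diff_divide_distrib)
  qed
  then have "\<forall>i\<in>insert y I. (\<Sum>j\<in>insert y I. M i j * x' j) = M i z"
    by (simp only: s) simp
  then show ?case by blast
qed

section \<open>Extension of contractions\<close>

text \<open>If column \<open>z\<close> is the image of \<open>x\<close>, then in the semi-definite space of \<open>D\<close> the vector \<open>x\<close> is the
  orthogonal projection of the basis vector \<open>z\<close> onto the span of the others; the second statement is
  Pythagoras, with the squared distance \<open>D z z - qf I D x\<close>.\<close>

lemma qf_insert_shift:
  assumes psd: "psd_on (insert z I) D" and I: "finite I" "z \<notin> I"
    and x: "\<And>i. i \<in> I \<Longrightarrow> (\<Sum>j\<in>I. D i j * x j) = D i z"
  shows "0 \<le> D z z - qf I D x"
    and "qf (insert z I) D v = qf I D (\<lambda>i. v i + v z * x i) + cnj (v z) * v z * (D z z - qf I D x)"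
proof -
  let ?K = "insert z I"
  have psdI: "psd_on I D" using psd_on_subset[OF psd] I by auto
  have h: "D z i = cnj (D i z)" if "i \<in> I" for i
    by (rule psd_on_hermitian[OF psd]) (use I(1) that in auto)
  have A: "(\<Sum>j\<in>I. D i j * (u j + c * x j)) = (\<Sum>j\<in>I. D i j * u j) + c * D i z" if "i \<in> I" for i c u
    using x[OF that, symmetric] by (simp add: algebra_simps sum.distrib sum_distrib_left)
  have B: "(\<Sum>i\<in>I. cnj (x i) * (\<Sum>j\<in>I. D i j * u j)) = (\<Sum>j\<in>I. D z j * u j)" for u
  proof -
    have "(\<Sum>i\<in>I. cnj (x i) * (\<Sum>j\<in>I. D i j * u j)) = (\<Sum>j\<in>I. (\<Sum>i\<in>I. cnj (x i) * D i j) * u j)"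
      unfolding sum_distrib_left sum_distrib_right by (subst sum.swap) (simp add: mult_ac)
    also have "\<dots> = (\<Sum>j\<in>I. D z j * u j)"
    proof (intro sum.cong refl arg_cong2[where f = "(*)"])
      fix j assume j: "j \<in> I"
      have "(\<Sum>i\<in>I. cnj (x i) * D i j) = (\<Sum>i\<in>I. cnj (D j i * x i))"
        using psd_on_hermitian[OF psdI I(1) j] by (intro sum.cong) (auto simp: mult_ac)
      also have "\<dots> = D z j"
        using arg_cong[OF x[OF j], of cnj] h[OF j] by (simp add: cnj_sum)
      finally show "(\<Sum>i\<in>I. cnj (x i) * D i j) = D z j" .
    qed
    finally show ?thesis .
  qed
  have qfI: "qf I D u = (\<Sum>i\<in>I. cnj (u i) * (\<Sum>j\<in>I. D i j * u j))" for u
    unfolding qf_def by (simp add: sum_distrib_left mult_ac)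
  have qx: "qf I D x = (\<Sum>i\<in>I. cnj (x i) * D i z)"
    unfolding qfI using x by simp
  have qx': "qf I D x = (\<Sum>j\<in>I. D z j * x j)"
    unfolding qfI by (rule B)
  have qK: "qf ?K D v = qf I D v + (\<Sum>i\<in>I. cnj (v i) * D i z) * v z + cnj (v z) * (\<Sum>j\<in>I. D z j * v j) + cnj (v z) * D z z * v z" for v
    unfolding qf_def using I by (simp add: sum.distrib sum_distrib_left sum_distrib_right mult_ac)
  have "qf I D (\<lambda>i. v i + v z * x i) = (\<Sum>i\<in>I. cnj (v i + v z * x i) * ((\<Sum>j\<in>I. D i j * v j) + v z * D i z))"
    unfolding qfI using A by (intro sum.cong refl) metis
  also have "\<dots> = qf I D v + v z * (\<Sum>i\<in>I. cnj (v i) * D i z) + cnj (v z) * (\<Sum>i\<in>I. cnj (x i) * (\<Sum>j\<in>I. D i j * v j))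
      + cnj (v z) * v z * (\<Sum>i\<in>I. cnj (x i) * D i z)"
    unfolding qfI by (simp add: algebra_simps sum.distrib sum_distrib_left)
  finally have "qf I D (\<lambda>i. v i + v z * x i) = qf I D v + v z * (\<Sum>i\<in>I. cnj (v i) * D i z)
      + cnj (v z) * (\<Sum>j\<in>I. D z j * v j) + cnj (v z) * v z * qf I D x"
    unfolding B qx .
  then show eq: "qf ?K D v = qf I D (\<lambda>i. v i + v z * x i) + cnj (v z) * v z * (D z z - qf I D x)"
    unfolding qK by (simp add: algebra_simps)
  \<comment> \<open>the error of the projection\<close>
  define u where "u = (\<lambda>i. if i = z then -1 else x i)"
  have "qf ?K D u = qf I D x - (\<Sum>i\<in>I. cnj (x i) * D i z) - (\<Sum>j\<in>I. D z j * x j) + D z z"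
  proof -
    have "qf I D u = qf I D x" "(\<Sum>i\<in>I. cnj (u i) * D i z) = (\<Sum>i\<in>I. cnj (x i) * D i z)"
      "(\<Sum>j\<in>I. D z j * u j) = (\<Sum>j\<in>I. D z j * x j)"
      using I(2) by (auto intro!: sum.cong qf_cong simp: u_def)
    then show ?thesis unfolding qK by (simp add: u_def)
  qed
  then have "qf ?K D u = D z z - qf I D x"
    by (simp flip: qx qx')
  then show "0 \<le> D z z - qf I D x"
    using psd_onD[OF psd, of u] by simp
qed

text \<open>Here \<open>D\<close> is the form of a semi-definite space, and the rows of \<open>A\<close> are the coordinates of a contraction on the
  span of the basis vectors in \<open>I\<close>. Every further basis vector gets the value of its orthogonal projection to
  the span of the previous ones, which does not increase the norm.\<close>

theorem contraction_extension:
  fixes A :: "nat \<Rightarrow> 'i \<Rightarrow> complex"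
  assumes "finite K" "I \<subseteq> K" "psd_on K D" "psd_on I (\<lambda>i j. D i j - (\<Sum>p<J. cnj (A p i) * A p j))"
  shows "\<exists>A'. (\<forall>p. \<forall>i\<in>I. A' p i = A p i) \<and> psd_on K (\<lambda>i j. D i j - (\<Sum>p<J. cnj (A' p i) * A' p j))"
proof -
  have qA: "qf I (\<lambda>i j. D i j - (\<Sum>p<J. cnj (A p i) * A p j)) v =
      qf I D v - (\<Sum>p<J. cnj (\<Sum>i\<in>I. A p i * v i) * (\<Sum>i\<in>I. A p i * v i))" for I :: "'i set" and A v
  proof -
    have "qf I (\<lambda>i j. cnj (A p i) * A p j) v = cnj (\<Sum>i\<in>I. A p i * v i) * (\<Sum>i\<in>I. A p i * v i)" for p
      using qf_rank_one[of I "\<lambda>i. cnj (A p i)" "\<lambda>i. cnj (A p i)" v] by simp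
    then show ?thesis
      unfolding qf_diff qf_sum by simp
  qed
  have "\<exists>A'. (\<forall>p. \<forall>i\<in>I. A' p i = A p i) \<and> psd_on (I \<union> E) (\<lambda>i j. D i j - (\<Sum>p<J. cnj (A' p i) * A' p j))"
    if "finite E" "E \<subseteq> K - I" for E
    using that
  proof (induction E rule: finite_induct)
    case empty
    then show ?case using assms(4) by auto
  next
    case (insert z E)
    then obtain A' where A': "\<And>p i. i \<in> I \<Longrightarrow> A' p i = A p i"
      and psd': "psd_on (I \<union> E) (\<lambda>i j. D i j - (\<Sum>p<J. cnj (A' p i) * A' p j))" by auto
    let ?I = "I \<union> E"
    have fin: "finite ?I" "z \<notin> ?I" "insert z ?I \<subseteq> K"
      using assms(1,2) insert by (auto dest: finite_subset)
    have psdD: "psd_on (insert z ?I) D"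
      using psd_on_subset[OF assms(3,1) fin(3)] .
    obtain x where x: "\<And>i. i \<in> ?I \<Longrightarrow> (\<Sum>j\<in>?I. D i j * x j) = D i z"
      using psd_on_column_in_range[OF fin(1) psdD fin(2)] by blast
    define A'' where "A'' p = (A' p)(z := \<Sum>i\<in>?I. A' p i * x i)" for p
    have s: "(\<Sum>i\<in>insert z ?I. A'' p i * v i) = (\<Sum>i\<in>?I. A' p i * (v i + v z * x i))" for p v
    proof -
      have "(\<Sum>i\<in>insert z ?I. A'' p i * v i) = (\<Sum>i\<in>?I. A' p i * x i) * v z + (\<Sum>i\<in>?I. A'' p i * v i)"
        using fin by (simp add: A''_def)
      also have "(\<Sum>i\<in>?I. A'' p i * v i) = (\<Sum>i\<in>?I. A' p i * v i)"
        using fin(2) by (intro sum.cong) (auto simp: A''_def)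
      finally show ?thesis
        by (simp add: algebra_simps sum.distrib sum_distrib_left)
    qed
    have "psd_on (insert z ?I) (\<lambda>i j. D i j - (\<Sum>p<J. cnj (A'' p i) * A'' p j))"
      unfolding psd_on_iff
    proof
      fix v
      let ?u = "\<lambda>i. v i + v z * x i"
      have q: "qf (insert z ?I) D v = qf ?I D ?u + cnj (v z) * v z * (D z z - qf ?I D x)"
        by (rule qf_insert_shift(2)[OF psdD fin(1,2)]) (rule x)
      have "0 \<le> qf ?I (\<lambda>i j. D i j - (\<Sum>p<J. cnj (A' p i) * A' p j)) ?u + cnj (v z) * v z * (D z z - qf ?I D x)"
        using psd' qf_insert_shift(1)[OF psdD fin(1,2) x]
        by (intro add_nonneg_nonneg mult_nonneg_nonneg[of "cnj (v z) * v z"]) (auto simp: psd_on_iff)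
      then show "0 \<le> qf (insert z ?I) (\<lambda>i j. D i j - (\<Sum>p<J. cnj (A'' p i) * A'' p j)) v"
        unfolding qA s q by (simp only: diff_add_eq)
    qed
    moreover have "\<forall>p. \<forall>i\<in>I. A'' p i = A p i"
      using A' fin(2) by (auto simp: A''_def)
    ultimately show ?case by auto
  qed
  from this[of "K - I"] show ?thesis
    using assms(1,2) by (simp add: Un_absorb1)
qed

section \<open>Kernels and Shimorin certificates\<close>

text \<open>Repeated points in a list only duplicate rows and columns, so positivity on finite sets suffices.\<close>

lemma kernel_iff_finite: "kernel X k \<longleftrightarrow> (\<forall>Y. finite Y \<and> Y \<subseteq> X \<longrightarrow> psd_on Y k)"
proof
  assume k: "kernel X k"
  show "\<forall>Y. finite Y \<and> Y \<subseteq> X \<longrightarrow> psd_on Y k"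
  proof (intro allI impI)
    fix Y assume Y: "finite Y \<and> Y \<subseteq> X"
    obtain z where z: "bij_betw z {..<card Y} Y"
      using ex_bij_betw_nat_finite[of Y] Y by (auto simp: lessThan_atLeast0)
    have "\<forall>i<card Y. z i \<in> X"
      using bij_betwE[OF z] Y by auto
    then have "psd_on {..<card Y} (\<lambda>i j. k (z i) (z j))"
      using k unfolding kernel_def by blast
    then have "psd_on Y (\<lambda>x y. k (z (inv_into {..<card Y} z x)) (z (inv_into {..<card Y} z y)))"
      by (rule psd_on_reindex) (use z Y inv_into_into[of _ z "{..<card Y}"] in \<open>auto simp: bij_betw_def\<close>)
    moreover have "z (inv_into {..<card Y} z x) = x" if "x \<in> Y" for x
      using z that by (simp add: bij_betw_inv_into_right)
    ultimately show "psd_on Y k"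
      by (simp cong: psd_on_cong)
  qed
next
  assume *: "\<forall>Y. finite Y \<and> Y \<subseteq> X \<longrightarrow> psd_on Y k"
  show "kernel X k"
    unfolding kernel_def
  proof (intro allI impI)
    fix n and z :: "nat \<Rightarrow> 'a"
    assume "\<forall>i<n. z i \<in> X"
    then have "psd_on (z ` {..<n}) k" using * by auto
    then show "psd_on {..<n} (\<lambda>i j. k (z i) (z j))"
      by (rule psd_on_reindex) auto
  qed
qed

lemma kernelI: "(\<And>Y. finite Y \<Longrightarrow> Y \<subseteq> X \<Longrightarrow> psd_on Y k) \<Longrightarrow> kernel X k"
  by (simp add: kernel_iff_finite)

lemma kernel_psd: "kernel X k \<Longrightarrow> finite Y \<Longrightarrow> Y \<subseteq> X \<Longrightarrow> psd_on Y k"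
  by (simp add: kernel_iff_finite)

lemma kernel_psd_reindex: "kernel X k \<Longrightarrow> finite J \<Longrightarrow> f ` J \<subseteq> X \<Longrightarrow> psd_on J (\<lambda>i j. k (f i) (f j))"
  using psd_on_reindex[of "f ` J" k J f] kernel_psd[of X k "f ` J"] by auto

lemma kernel_diag_nonneg: "kernel X k \<Longrightarrow> x \<in> X \<Longrightarrow> 0 \<le> k x x"
  using psd_on_diag[of "{x}" k x] kernel_psd[of X k "{x}"] by auto

lemma kernel_hermitian: "kernel X k \<Longrightarrow> x \<in> X \<Longrightarrow> y \<in> X \<Longrightarrow> k y x = cnj (k x y)"
  using psd_on_hermitian[of "{x, y}" k x y] kernel_psd[of X k "{x, y}"] by auto

lemma kernel_subset: "kernel X k \<Longrightarrow> Y \<subseteq> X \<Longrightarrow> kernel Y k"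
  by (auto simp: kernel_iff_finite)

lemma kernel_cong:
  "(\<And>x y. x \<in> X \<Longrightarrow> y \<in> X \<Longrightarrow> k x y = k' x y) \<Longrightarrow> kernel X k \<longleftrightarrow> kernel X k'"
  unfolding kernel_iff_finite
  by (intro all_cong psd_on_cong) auto

lemma kernel_add: "kernel X k \<Longrightarrow> kernel X l \<Longrightarrow> kernel X (\<lambda>x y. k x y + l x y)"
  unfolding kernel_iff_finite by (auto intro: psd_on_add)

lemma kernel_mult: "kernel X k \<Longrightarrow> kernel X l \<Longrightarrow> kernel X (\<lambda>x y. k x y * l x y)"
  unfolding kernel_iff_finite by (auto intro: psd_on_mult)

lemma kernel_scale: "0 \<le> c \<Longrightarrow> kernel X k \<Longrightarrow> kernel X (\<lambda>x y. c * k x y)"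
  unfolding kernel_iff_finite by (auto intro: psd_on_scale)

lemma kernel_rank_one: "kernel X (\<lambda>x y. f x * cnj (f y))"
  unfolding kernel_iff_finite by (auto intro: psd_on_rank_one)

lemma kernel_kernel_at: "kernel X k \<Longrightarrow> z \<in> X \<Longrightarrow> kernel X (kernel_at k z)"
proof (rule kernelI)
  fix Y assume k: "kernel X k" "z \<in> X" and Y: "finite Y" "Y \<subseteq> X"
  have "psd_on (insert z Y) (kernel_at k z)"
    using k Y by (intro psd_on_kernel_at kernel_psd) auto
  then show "psd_on Y (kernel_at k z)"
    by (rule psd_on_subset) (use Y in auto)
qed

lemma kernel_zero_diag:
  assumes "kernel X k" "x \<in> X" "y \<in> X" "k x x = 0"
  shows "k x y = 0" "k y x = 0"
  using psd_on_zero_diag[of "{x, y}" k x y] kernel_psd[OF assms(1), of "{x, y}"] assms by auto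

text \<open>The block matrix whose positivity on all finite sets expresses that \<open>\<Phi>\<close> is a contractive
  multiplier.\<close>

definition pick_block ::
  "('a \<Rightarrow> 'a \<Rightarrow> complex) \<Rightarrow> ('a \<Rightarrow> 'a \<Rightarrow> complex) \<Rightarrow> nat \<Rightarrow> ('a \<Rightarrow> nat \<Rightarrow> nat \<Rightarrow> complex) \<Rightarrow>
   'a \<times> nat \<Rightarrow> 'a \<times> nat \<Rightarrow> complex" where
  "pick_block k l N \<Phi> i j =
     l (fst i) (fst j) * (if snd i = snd j then 1 else 0)
     - k (fst i) (fst j) * (\<Sum>m<N. \<Phi> (fst i) (snd i) m * cnj (\<Phi> (fst j) (snd j) m))"

lemma psd_on_delta: "psd_on (Y \<times> {..<N :: nat}) (\<lambda>i j. if snd i = snd j then 1 else 0)"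
proof -
  have "psd_on (Y \<times> {..<N}) (\<lambda>i j. \<Sum>r<N. (if snd i = r then 1 else 0) * cnj (if snd j = r then 1 else 0))"
    by (rule psd_on_gram)
  moreover have "(\<Sum>r<N. (if p = r then 1 else 0) * cnj (if q = r then 1 else 0)) = (if p = q then 1 else 0 :: complex)"
    if "p < N" for p q
  proof -
    have "(\<Sum>r<N. (if p = r then 1 else 0) * cnj (if q = r then 1 else 0)) = (\<Sum>r<N. if p = r then if p = q then 1 else 0 else 0 :: complex)"
      by (intro sum.cong) auto
    also have "\<dots> = (if p = q then 1 else 0)"
      using that by (subst sum.delta') auto
    finally show ?thesis .
  qed
  ultimately show ?thesis
    by (rule_tac iffD1[OF psd_on_cong]) auto
qed

lemma psd_on_kernel_delta:
  assumes "finite Y" "psd_on Y k"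
  shows "psd_on (Y \<times> {..<N :: nat}) (\<lambda>i j. k (fst i) (fst j) * (if snd i = snd j then 1 else 0))"
  using assms by (intro psd_on_mult[OF _ psd_on_reindex[of Y k _ fst] psd_on_delta]) auto

lemma psd_on_kernel_gram:
  assumes "finite Y" "psd_on Y k"
  shows "psd_on (Y \<times> {..<N :: nat}) (\<lambda>i j. k (fst i) (fst j) * (\<Sum>m<N. W (fst i) (snd i) m * cnj (W (fst j) (snd j) m)))"
  using assms by (intro psd_on_mult[OF _ psd_on_reindex[of Y k _ fst] psd_on_gram[where f = "\<lambda>m i. W (fst i) (snd i) m"]]) auto

text \<open>This is where the two inequalities of a Shimorin certificate combine: multiplying the Pick matrix
  by \<open>p[z]\<close> keeps it positive.\<close>

lemma shimorin_kernel_at_psd: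
  assumes S: "shimorin_certificate X k l p" and z: "z \<in> X" and Y: "finite Y" "Y \<subseteq> X"
    and psd: "psd_on (Y \<times> {..<N}) (pick_block k l N W)"
  shows "psd_on (Y \<times> {..<N}) (pick_block (kernel_at k z) (kernel_at l z) N W)"
proof -
  have p: "kernel X (p z)" "kernel X (\<lambda>w v. kernel_at l z w v - p z w v * l w v)"
    "kernel X (\<lambda>w v. p z w v * k w v - kernel_at k z w v)"
    using S z by (auto simp: shimorin_certificate_def kernel_le_def)
  let ?K = "Y \<times> {..<N}"
  have "psd_on ?K (\<lambda>i j. p z (fst i) (fst j) * pick_block k l N W i j)"
    using Y by (intro psd_on_mult psd psd_on_reindex[OF kernel_psd[OF p(1) Y]]) auto
  moreover note psd_on_kernel_delta[OF Y(1) kernel_psd[OF p(2) Y], of N]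
    psd_on_kernel_gram[OF Y(1) kernel_psd[OF p(3) Y], of N W]
  ultimately have "psd_on ?K (\<lambda>i j. (p z (fst i) (fst j) * pick_block k l N W i j +
      (kernel_at l z (fst i) (fst j) - p z (fst i) (fst j) * l (fst i) (fst j)) * (if snd i = snd j then 1 else 0)) +
      (p z (fst i) (fst j) * k (fst i) (fst j) - kernel_at k z (fst i) (fst j)) *
      (\<Sum>m<N. W (fst i) (snd i) m * cnj (W (fst j) (snd j) m)))"
    by (intro psd_on_add)
  then show ?thesis
    by (rule iffD1[OF psd_on_cong, rotated]) (simp add: pick_block_def algebra_simps)
qed

text \<open>One more interpolation node: the part of the Pick matrix that does not involve the unknown
  value at \<open>z\<close> is positive by the certificate, and the unknown value is the extension of a contraction.\<close>

lemma shimorin_one_point_extension: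
  assumes k: "kernel X k" and l: "kernel X l" and S: "shimorin_certificate X k l p"
    and z: "z \<in> X" "k z z \<noteq> 0" "l z z \<noteq> 0" and Y: "finite Y" "Y \<subseteq> X" "z \<notin> Y"
    and psd: "psd_on (Y \<times> {..<N}) (pick_block k l N W)"
  shows "\<exists>W'. (\<forall>x\<in>Y. \<forall>p m. W' x p m = W x p m) \<and> psd_on (insert z Y \<times> {..<N}) (pick_block k l N W')"
proof -
  let ?K = "insert z Y \<times> {..<N}" and ?I = "Y \<times> {..<N}"
  have insX: "finite (insert z Y)" "insert z Y \<subseteq> X" using z Y by auto
  define W0 where "W0 x = (if x = z then (\<lambda>p m. 0) else W x)" for x
  \<comment> \<open>the part of the Pick matrix without the unknown value: \<open>kernel_at k z\<close> vanishes as soon as one point is \<open>z\<close>\<close>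
  define D where "D i j = l (fst i) (fst j) * (if snd i = snd j then 1 else 0)
    - kernel_at k z (fst i) (fst j) * (\<Sum>m<N. W0 (fst i) (snd i) m * cnj (W0 (fst j) (snd j) m))" for i j
  have at0: "kernel_at k z z x = 0" "kernel_at k z x z = 0" "kernel_at l z z x = 0" "kernel_at l z x z = 0" for x
    using z by (auto simp: kernel_at_def)
  have "psd_on ?K (pick_block (kernel_at k z) (kernel_at l z) N W0)"
  proof (rule psd_on_zero_extend)
    have "psd_on ?I (pick_block (kernel_at k z) (kernel_at l z) N W)"
      by (rule shimorin_kernel_at_psd[OF S z(1) Y(1,2) psd])
    then show "psd_on ?I (pick_block (kernel_at k z) (kernel_at l z) N W0)"
      by (rule iffD1[OF psd_on_cong, rotated]) (use Y(3) in \<open>auto simp: pick_block_def W0_def\<close>)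
  qed (use at0 Y in \<open>auto simp: pick_block_def\<close>)
  moreover have "psd_on ?K (\<lambda>i j. (l (fst i) z * l z (fst j) / l z z) * (if snd i = snd j then 1 else 0))"
    by (intro psd_on_kernel_delta psd_on_minus_kernel_at kernel_psd[OF l insX]) (use Y in auto)
  ultimately have "psd_on ?K (\<lambda>i j. pick_block (kernel_at k z) (kernel_at l z) N W0 i j +
      (l (fst i) z * l z (fst j) / l z z) * (if snd i = snd j then 1 else 0))"
    by (rule psd_on_add)
  then have psdD: "psd_on ?K D"
    by (rule iffD1[OF psd_on_cong, rotated]) (simp add: pick_block_def D_def kernel_at_def)
  obtain d where d: "k z z = of_real d" "0 \<le> d"
    using kernel_diag_nonneg[OF k z(1)] by (elim nonneg_complex_cases)
  define c where "c = complex_of_real (sqrt d)"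
  have c: "c * c = k z z" "cnj c = c" "c \<noteq> 0"
    using d z by (auto simp: c_def simp flip: of_real_mult)
  \<comment> \<open>the remainder, \<open>k(x, z) k(z, y) / k(z, z)\<close> times the Gram matrix of \<open>W\<close>, has rank at most \<open>N\<close>\<close>
  define A where "A m j = k z (fst j) / c * cnj (W (fst j) (snd j) m)" for m j
  have herm: "cnj (k z x) = k x z" if "x \<in> insert z Y" for x
    using kernel_hermitian[OF k z(1), of x] that insX by auto
  have AA: "cnj (k z x / c * w) * (k z y / c * w') = k x z * k z y / k z z * (cnj w * w')" if "x \<in> insert z Y" for x y w w'
    using herm[OF that] c by (simp add: field_simps)
  have "psd_on ?I (\<lambda>i j. D i j - (\<Sum>m<N. cnj (A m i) * A m j))"
  proof (rule iffD1[OF psd_on_cong, OF _ psd])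
    fix i j assume ij: "i \<in> ?I" "j \<in> ?I"
    then have "fst i \<in> insert z Y" "fst i \<noteq> z" "fst j \<noteq> z" using Y(3) by auto
    then show "pick_block k l N W i j = D i j - (\<Sum>m<N. cnj (A m i) * A m j)"
      unfolding A_def AA[OF \<open>fst i \<in> insert z Y\<close>] sum_distrib_left[symmetric]
      by (simp add: pick_block_def D_def W0_def kernel_at_def algebra_simps)
  qed
  moreover have "finite ?K" "?I \<subseteq> ?K" using Y by auto
  ultimately obtain A' where
    A': "\<And>m i. i \<in> ?I \<Longrightarrow> A' m i = A m i" and psd': "psd_on ?K (\<lambda>i j. D i j - (\<Sum>m<N. cnj (A' m i) * A' m j))"
    using contraction_extension[where K = ?K and I = ?I and D = D and J = N and A = A] psdD by blast
  define W' where "W' x p m = (if x = z then cnj (A' m (z, p) / c) else W x p m)" for x p m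
  have A'_eq: "A' m i = k z (fst i) / c * cnj (W' (fst i) (snd i) m)" if "i \<in> ?K" for m i
  proof (cases "fst i = z")
    case True
    then have "A' m i = A' m (z, snd i)" by (metis prod.collapse)
    with True show ?thesis using c by (simp add: W'_def flip: c(1))
  next
    case False
    then have "i \<in> ?I" using that by auto
    then show ?thesis using A'[of i m] False by (simp add: A_def W'_def)
  qed
  have "psd_on ?K (pick_block k l N W')"
  proof (rule iffD1[OF psd_on_cong, OF _ psd'])
    fix i j assume ij: "i \<in> ?K" "j \<in> ?K"
    then have i: "fst i \<in> insert z Y" by auto
    have "(\<Sum>m<N. cnj (A' m i) * A' m j) =
        k (fst i) z * k z (fst j) / k z z * (\<Sum>m<N. W' (fst i) (snd i) m * cnj (W' (fst j) (snd j) m))"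
      unfolding sum_distrib_left A'_eq[OF ij(1)] A'_eq[OF ij(2)] AA[OF i] by simp
    moreover have "kernel_at k z (fst i) (fst j) * (\<Sum>m<N. W0 (fst i) (snd i) m * cnj (W0 (fst j) (snd j) m)) =
        kernel_at k z (fst i) (fst j) * (\<Sum>m<N. W' (fst i) (snd i) m * cnj (W' (fst j) (snd j) m))"
      using at0 by (cases "fst i = z \<or> fst j = z") (auto simp: W0_def W'_def)
    ultimately show "D i j - (\<Sum>m<N. cnj (A' m i) * A' m j) = pick_block k l N W' i j"
      unfolding D_def pick_block_def by (simp only:) (simp add: kernel_at_def left_diff_distrib)
  qed
  then show ?thesis
    using Y(3) by (intro exI[of _ W']) (auto simp: W'_def)
qed

lemma shimorin_finite_extension:
  assumes k: "kernel X k" and l: "kernel X l" and S: "shimorin_certificate X k l p"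
    and nz: "\<And>z. z \<in> X \<Longrightarrow> k z z \<noteq> 0" "\<And>z. z \<in> X \<Longrightarrow> l z z \<noteq> 0" and Y: "finite Y" "Y \<subseteq> X"
    and E: "finite E" "E \<subseteq> X"
    and psd: "psd_on (Y \<times> {..<N}) (pick_block k l N W)"
  shows "\<exists>W'. (\<forall>x\<in>Y. \<forall>p m. W' x p m = W x p m) \<and> psd_on ((Y \<union> E) \<times> {..<N}) (pick_block k l N W')"
  using E
proof (induction E rule: finite_induct)
  case empty
  then show ?case using psd by auto
next
  case (insert z E)
  then obtain W' where W': "\<forall>x\<in>Y. \<forall>p m. W' x p m = W x p m" "psd_on ((Y \<union> E) \<times> {..<N}) (pick_block k l N W')"
    by auto
  show ?case
  proof (cases "z \<in> Y \<union> E")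
    case True
    then show ?thesis using W' by (auto simp: insert_absorb)
  next
    case False
    then obtain W'' where "\<forall>x\<in>Y \<union> E. \<forall>p m. W'' x p m = W' x p m"
      "psd_on (insert z (Y \<union> E) \<times> {..<N}) (pick_block k l N W'')"
      using shimorin_one_point_extension[OF k l S _ nz, of z "Y \<union> E" N W'] insert Y W' by auto
    then show ?thesis using W' by (intro exI[of _ W'']) auto
  qed
qed

text \<open>Tychonoff's theorem, in the form of the finite intersection property.\<close>

lemma bounded_selection:
  fixes P :: "'j \<Rightarrow> ('i \<Rightarrow> complex) set" and B :: "'i \<Rightarrow> real"
  assumes cl: "\<And>j. j \<in> J \<Longrightarrow> closed (P j)"
    and fip: "\<And>J'. finite J' \<Longrightarrow> J' \<subseteq> J \<Longrightarrow> \<exists>f. (\<forall>i. cmod (f i) \<le> B i) \<and> (\<forall>j\<in>J'. f \<in> P j)"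
  shows "\<exists>f. (\<forall>i. cmod (f i) \<le> B i) \<and> (\<forall>j\<in>J. f \<in> P j)"
proof -
  let ?C = "PiE UNIV (\<lambda>i. cball (0::complex) (B i))"
  have "compactin (product_topology (\<lambda>i. euclidean) UNIV) ?C"
    unfolding compactin_PiE by auto
  then have C: "compact ?C"
    by (simp add: euclidean_product_topology)
  have "?C \<inter> \<Inter>(P ` J) \<noteq> {}"
  proof (rule compact_imp_fip[OF C])
    show "closed S" if "S \<in> P ` J" for S using that cl by auto
    fix \<F> assume "finite \<F>" "\<F> \<subseteq> P ` J"
    then obtain J' where J': "finite J'" "J' \<subseteq> J" "\<F> = P ` J'"
      by (meson finite_subset_image)
    obtain f where "\<forall>i. cmod (f i) \<le> B i" "\<forall>j\<in>J'. f \<in> P j"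
      using fip[OF J'(1,2)] by blast
    then have "f \<in> ?C \<inter> \<Inter>\<F>" unfolding J'(3) by auto
    then show "?C \<inter> \<Inter>\<F> \<noteq> {}" by blast
  qed
  then obtain f where "f \<in> ?C" "f \<in> \<Inter>(P ` J)" by blast
  then show ?thesis by (intro exI[of _ f]) (auto simp: PiE_iff)
qed

lemma closed_psd_on:
  fixes M :: "('c \<Rightarrow> complex) \<Rightarrow> 'i \<Rightarrow> 'i \<Rightarrow> complex"
  assumes "\<And>i j. continuous_on UNIV (\<lambda>f. M f i j)"
  shows "closed {f. psd_on I (M f)}"
proof -
  have "{f. psd_on I (M f)} = (\<Inter>v. {f. Im (qf I (M f) v) = 0} \<inter> {f. 0 \<le> Re (qf I (M f) v)})"
    unfolding psd_on_iff complex_nonneg_iff complex_is_Real_iff by auto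
  moreover have "closed ({f. Im (qf I (M f) v) = 0} \<inter> {f. 0 \<le> Re (qf I (M f) v)})" for v
    unfolding qf_def using assms
    by (intro closed_Int closed_Collect_le closed_Collect_eq continuous_intros)
  ultimately show ?thesis by auto
qed

text \<open>A bound from one diagonal entry: it puts all interpolating values into a fixed compact disc.\<close>

lemma pick_block_bound:
  assumes "psd_on (Y \<times> {..<N}) (pick_block k l N \<Phi>)" "finite Y" "x \<in> Y" "p < N" "m < N"
    and "0 \<le> k x x" "k x x \<noteq> 0"
  shows "cmod (\<Phi> x p m) \<le> sqrt (Re (l x x) / Re (k x x))"
proof -
  have k: "k x x = of_real (Re (k x x))" "0 < Re (k x x)"
    using assms(6,7) by (auto simp: less_eq_complex_def complex_eq_iff)
  have "0 \<le> pick_block k l N \<Phi> (x, p) (x, p)"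
    using assms by (intro psd_on_diag) auto
  also have "pick_block k l N \<Phi> (x, p) (x, p) = l x x - k x x * of_real (\<Sum>m<N. (cmod (\<Phi> x p m))\<^sup>2)"
    by (simp add: pick_block_def cnj_mult_self)
  finally have "0 \<le> Re (l x x - k x x * of_real (\<Sum>m<N. (cmod (\<Phi> x p m))\<^sup>2))"
    by (simp add: less_eq_complex_def del: minus_complex.simps)
  then have "(\<Sum>m<N. (cmod (\<Phi> x p m))\<^sup>2) * Re (k x x) \<le> Re (l x x)"
    by (subst (asm) k(1)) (simp flip: of_real_mult add: mult.commute)
  moreover have "(cmod (\<Phi> x p m))\<^sup>2 \<le> (\<Sum>m<N. (cmod (\<Phi> x p m))\<^sup>2)"
    using assms(5) by (intro member_le_sum) auto
  ultimately have "(cmod (\<Phi> x p m))\<^sup>2 \<le> Re (l x x) / Re (k x x)"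
    using k(2) by (simp add: pos_le_divide_eq) (meson mult_right_mono order_trans less_imp_le)
  then show ?thesis
    by (rule real_le_rsqrt)
qed

text \<open>Finitely many additional nodes are handled one at a time. Since the values at every node are bounded in
  advance, compactness selects values at all points of \<open>X\<close> that are compatible with every finite set.\<close>

theorem shimorin_interpolation:
  fixes X :: "'a set"
  assumes k: "kernel X k" and l: "kernel X l" and S: "shimorin_certificate X k l p"
    and nz: "\<And>z. z \<in> X \<Longrightarrow> k z z \<noteq> 0" "\<And>z. z \<in> X \<Longrightarrow> l z z \<noteq> 0" and Y: "finite Y" "Y \<subseteq> X"
    and psd: "psd_on (Y \<times> {..<N}) (pick_block k l N W)"
  shows "\<exists>\<Phi>. (\<forall>x\<in>Y. \<forall>p<N. \<forall>m<N. \<Phi> x p m = W x p m) \<and>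
    (\<forall>E. finite E \<and> E \<subseteq> X \<longrightarrow> psd_on (E \<times> {..<N}) (pick_block k l N \<Phi>))"
proof -
  define cu :: "('a \<times> nat \<times> nat \<Rightarrow> complex) \<Rightarrow> 'a \<Rightarrow> nat \<Rightarrow> nat \<Rightarrow> complex" where
    "cu f x p m = f (x, p, m)" for f x p m
  define P where "P E = {f. psd_on (E \<times> {..<N}) (pick_block k l N (cu f))} \<inter>
    {f. \<forall>x\<in>Y. \<forall>p\<in>{..<N}. \<forall>m\<in>{..<N}. cu f x p m = W x p m}" for E
  have clP: "closed (P E)" for E
  proof -
    have "{f. \<forall>x\<in>Y. \<forall>p\<in>{..<N}. \<forall>m\<in>{..<N}. cu f x p m = W x p m} =
        (\<Inter>x\<in>Y. \<Inter>p\<in>{..<N}. \<Inter>m\<in>{..<N}. {f. f (x, p, m) = W x p m})"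
      by (auto simp: cu_def)
    moreover have "closed {f. f (x, p, m) = W x p m}" for x p m
      by (intro closed_Collect_eq continuous_intros) auto
    ultimately have "closed {f. \<forall>x\<in>Y. \<forall>p\<in>{..<N}. \<forall>m\<in>{..<N}. cu f x p m = W x p m}"
      by (simp add: closed_INT)
    moreover have "closed {f. psd_on (E \<times> {..<N}) (pick_block k l N (cu f))}"
      unfolding pick_block_def cu_def by (intro closed_psd_on continuous_intros) auto
    ultimately show ?thesis unfolding P_def by (intro closed_Int)
  qed
  have "\<exists>f. (\<forall>i. cmod (f i) \<le> max 0 (sqrt (Re (l (fst i) (fst i)) / Re (k (fst i) (fst i))))) \<and>
      (\<forall>E\<in>{E. finite E \<and> E \<subseteq> X}. f \<in> P E)"
  proof (rule bounded_selection[OF clP])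
    fix J' assume J': "finite J'" "J' \<subseteq> {E. finite E \<and> E \<subseteq> X}"
    then have U: "finite (\<Union>J')" "\<Union>J' \<subseteq> X" by auto
    let ?Z = "Y \<union> \<Union>J'"
    have Z: "finite ?Z" "?Z \<subseteq> X" using U Y by auto
    obtain W' where W': "\<forall>x\<in>Y. \<forall>p m. W' x p m = W x p m" "psd_on (?Z \<times> {..<N}) (pick_block k l N W')"
      using shimorin_finite_extension[OF k l S nz Y U psd] by blast
    define f where "f i = (case i of (x, p, m) \<Rightarrow> if x \<in> ?Z \<and> p < N \<and> m < N then W' x p m else 0)" for i
    have f: "cu f x p m = W' x p m" if "x \<in> ?Z" "p < N" "m < N" for x p m
      using that by (simp add: cu_def f_def)
    have "psd_on (E \<times> {..<N}) (pick_block k l N (cu f))" if "E \<in> J'" for E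
    proof -
      have eq: "cu f x p m = W' x p m" if "x \<in> E" "p < N" "m < N" for x p m
        using \<open>E \<in> J'\<close> that by (intro f) auto
      have "psd_on (E \<times> {..<N}) (pick_block k l N W')"
        by (rule psd_on_subset[OF W'(2)]) (use Z that in auto)
      then show ?thesis
        by (rule iffD1[OF psd_on_cong, rotated]) (auto simp: pick_block_def eq)
    qed
    moreover have "cmod (f (x, p, m)) \<le> max 0 (sqrt (Re (l x x) / Re (k x x)))" for x p m
    proof (cases "x \<in> ?Z \<and> p < N \<and> m < N")
      case True
      then have x: "x \<in> X" using Z by auto
      have "cmod (W' x p m) \<le> sqrt (Re (l x x) / Re (k x x))"
        by (rule pick_block_bound[OF W'(2) Z(1) _ _ _ kernel_diag_nonneg[OF k x] nz(1)[OF x]]) (use True in auto)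
      then show ?thesis using True by (auto simp: f_def)
    qed (auto simp: f_def)
    moreover have "\<forall>x\<in>Y. \<forall>p\<in>{..<N}. \<forall>m\<in>{..<N}. cu f x p m = W x p m"
      using f W'(1) by auto
    ultimately show "\<exists>f. (\<forall>i. cmod (f i) \<le> max 0 (sqrt (Re (l (fst i) (fst i)) / Re (k (fst i) (fst i))))) \<and>
        (\<forall>E\<in>J'. f \<in> P E)"
      by (intro exI[of _ f]) (auto simp: P_def)
  qed
  then obtain f where f: "\<And>E. finite E \<Longrightarrow> E \<subseteq> X \<Longrightarrow> f \<in> P E" by blast
  show ?thesis
  proof (intro exI[of _ "cu f"] conjI allI impI ballI)
    show "cu f x p m = W x p m" if "x \<in> Y" "p < N" "m < N" for x p m
      using f[of "{}"] that by (auto simp: P_def)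
    show "psd_on (E \<times> {..<N}) (pick_block k l N (cu f))" if "finite E \<and> E \<subseteq> X" for E
      using f[of E] that by (simp add: P_def)
  qed
qed

section \<open>Reproducing kernel Hilbert spaces\<close>

lemma sum_mult_le_sqrt_sums:
  fixes a b :: "'i \<Rightarrow> real"
  assumes "\<And>i. i \<in> I \<Longrightarrow> 0 \<le> a i" "\<And>i. i \<in> I \<Longrightarrow> 0 \<le> b i"
  shows "(\<Sum>i\<in>I. sqrt (a i) * sqrt (b i)) \<le> sqrt (\<Sum>i\<in>I. a i) * sqrt (\<Sum>i\<in>I. b i)"
proof -
  have "(\<Sum>i\<in>I. sqrt (a i) * sqrt (b i)) = (\<Sum>i\<in>I. \<bar>sqrt (a i)\<bar> * \<bar>sqrt (b i)\<bar>)"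
    using assms by (intro sum.cong) auto
  also have "\<dots> \<le> L2_set (\<lambda>i. sqrt (a i)) I * L2_set (\<lambda>i. sqrt (b i)) I"
    by (rule L2_set_mult_ineq)
  also have "\<dots> = sqrt (\<Sum>i\<in>I. a i) * sqrt (\<Sum>i\<in>I. b i)"
    using assms by (simp add: L2_set_def)
  finally show ?thesis .
qed

lemma psd_on_Cauchy_Schwarz:
  assumes "finite I" "psd_on I M"
  shows "cmod (\<Sum>i\<in>I. \<Sum>j\<in>I. cnj (u i) * M i j * v j) \<le> sqrt (Re (qf I M u)) * sqrt (Re (qf I M v))"
proof -
  obtain f :: "nat \<Rightarrow> 'a \<Rightarrow> complex" where
    f: "\<And>i j. i \<in> I \<Longrightarrow> j \<in> I \<Longrightarrow> M i j = (\<Sum>r<card I. f r i * cnj (f r j))"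
    using psd_on_gram_decomposition[OF assms] by blast
  define a where "a u r = (\<Sum>i\<in>I. cnj (f r i) * u i)" for u r
  have b: "(\<Sum>i\<in>I. \<Sum>j\<in>I. cnj (u i) * M i j * v j) = (\<Sum>r<card I. cnj (a u r) * a v r)" for u v
  proof -
    have "(\<Sum>i\<in>I. \<Sum>j\<in>I. cnj (u i) * M i j * v j) =
        (\<Sum>i\<in>I. \<Sum>j\<in>I. \<Sum>r<card I. cnj (u i) * f r i * (cnj (f r j) * v j))"
      by (intro sum.cong refl) (simp add: f sum_distrib_left sum_distrib_right mult_ac)
    also have "\<dots> = (\<Sum>i\<in>I. \<Sum>r<card I. \<Sum>j\<in>I. cnj (u i) * f r i * (cnj (f r j) * v j))"
      by (intro sum.cong refl sum.swap)
    also have "\<dots> = (\<Sum>r<card I. \<Sum>i\<in>I. \<Sum>j\<in>I. cnj (u i) * f r i * (cnj (f r j) * v j))"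
      by (rule sum.swap)
    also have "\<dots> = (\<Sum>r<card I. cnj (a u r) * a v r)"
      unfolding a_def cnj_sum sum_product by (intro sum.cong refl) simp
    finally show ?thesis .
  qed
  have q: "Re (qf I M u) = (\<Sum>r<card I. (cmod (a u r))\<^sup>2)" for u
    unfolding qf_def b cnj_mult_self by simp
  have "cmod (\<Sum>r<card I. cnj (a u r) * a v r) \<le> (\<Sum>r<card I. sqrt ((cmod (a u r))\<^sup>2) * sqrt ((cmod (a v r))\<^sup>2))"
    by (rule sum_norm_le) (simp add: norm_mult)
  also have "\<dots> \<le> sqrt (Re (qf I M u)) * sqrt (Re (qf I M v))"
    unfolding q by (rule sum_mult_le_sqrt_sums) auto
  finally show ?thesis unfolding b .
qed

lemma sqrt_le_of_le_mult_sqrt: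
  assumes "q \<le> C * sqrt q" "0 \<le> q" "0 \<le> C"
  shows "sqrt q \<le> C"
proof (cases "q = 0")
  case False
  have "sqrt q * sqrt q \<le> C * sqrt q" using assms by simp
  then show ?thesis using False assms(2) by (subst (asm) mult_le_cancel_right) auto
qed (use assms in simp)

lemma qf_row_sum: "qf I M v = (\<Sum>i\<in>I. cnj (v i) * (\<Sum>j\<in>I. M i j * v j))"
  unfolding qf_def by (simp add: sum_distrib_left mult_ac)

lemma qf_nonneg: "psd_on I M \<Longrightarrow> 0 \<le> Re (qf I M v)" "psd_on I M \<Longrightarrow> qf I M v = of_real (Re (qf I M v))"
  using psd_onD[of I M v] by (auto simp: less_eq_complex_def complex_eq_iff)

text \<open>The functions of norm at most \<open>C\<close> in the space of \<open>k\<close>, described without the space.\<close>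

definition rk_bounded :: "'a set \<Rightarrow> ('a \<Rightarrow> 'a \<Rightarrow> complex) \<Rightarrow> real \<Rightarrow> ('a \<Rightarrow> complex) \<Rightarrow> bool" where
  "rk_bounded X k C f \<longleftrightarrow> 0 \<le> C \<and> (\<forall>x. x \<notin> X \<longrightarrow> f x = 0) \<and>
     (\<forall>Y v. finite Y \<and> Y \<subseteq> X \<longrightarrow> cmod (\<Sum>x\<in>Y. cnj (v x) * f x) \<le> C * sqrt (Re (qf Y k v)))"

text \<open>Coefficients of a combination of kernel functions at the points of \<open>Y\<close> that interpolates \<open>f\<close> on \<open>Y\<close>.\<close>

definition coords :: "('a \<Rightarrow> 'a \<Rightarrow> complex) \<Rightarrow> 'a set \<Rightarrow> ('a \<Rightarrow> complex) \<Rightarrow> 'a \<Rightarrow> complex" where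
  "coords k Y f = (SOME c. \<forall>y\<in>Y. (\<Sum>x\<in>Y. k y x * c x) = f y)"

text \<open>The inner product of the interpolants of \<open>f\<close> and \<open>g\<close> on \<open>Y\<close>, that is, of the projections of \<open>f\<close> and \<open>g\<close>
  to the span of the kernel functions of \<open>Y\<close>.\<close>

definition fin_ip :: "('a \<Rightarrow> 'a \<Rightarrow> complex) \<Rightarrow> 'a set \<Rightarrow> ('a \<Rightarrow> complex) \<Rightarrow> ('a \<Rightarrow> complex) \<Rightarrow> complex" where
  "fin_ip k Y f g = (\<Sum>y\<in>Y. coords k Y f y * cnj (g y))"

lemma rk_boundedD:
  "rk_bounded X k C f \<Longrightarrow> finite Y \<Longrightarrow> Y \<subseteq> X \<Longrightarrow> cmod (\<Sum>x\<in>Y. cnj (v x) * f x) \<le> C * sqrt (Re (qf Y k v))"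
  by (simp add: rk_bounded_def)

lemma rk_bounded_zero: "rk_bounded X k 0 (\<lambda>x. 0)"
  by (simp add: rk_bounded_def)

lemma rk_bounded_add:
  assumes "rk_bounded X k C f" "rk_bounded X k C' g"
  shows "rk_bounded X k (C + C') (\<lambda>x. f x + g x)"
  unfolding rk_bounded_def
proof (intro conjI allI impI)
  fix Y v assume Y: "finite Y \<and> Y \<subseteq> X"
  have "cmod (\<Sum>x\<in>Y. cnj (v x) * (f x + g x)) \<le> cmod (\<Sum>x\<in>Y. cnj (v x) * f x) + cmod (\<Sum>x\<in>Y. cnj (v x) * g x)"
    by (simp add: algebra_simps sum.distrib norm_triangle_ineq)
  also have "\<dots> \<le> C * sqrt (Re (qf Y k v)) + C' * sqrt (Re (qf Y k v))"
    using assms Y by (intro add_mono rk_boundedD) auto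
  finally show "cmod (\<Sum>x\<in>Y. cnj (v x) * (f x + g x)) \<le> (C + C') * sqrt (Re (qf Y k v))"
    by (simp add: algebra_simps)
qed (use assms in \<open>auto simp: rk_bounded_def\<close>)

lemma rk_bounded_scale:
  assumes "rk_bounded X k C f"
  shows "rk_bounded X k (cmod c * C) (\<lambda>x. c * f x)"
  unfolding rk_bounded_def
proof (intro conjI allI impI)
  fix Y v assume Y: "finite Y \<and> Y \<subseteq> X"
  have "cmod (\<Sum>x\<in>Y. cnj (v x) * (c * f x)) = cmod c * cmod (\<Sum>x\<in>Y. cnj (v x) * f x)"
    by (simp add: sum_distrib_left mult_ac flip: norm_mult)
  also have "\<dots> \<le> cmod c * (C * sqrt (Re (qf Y k v)))"
    using assms Y by (intro mult_left_mono rk_boundedD) auto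
  finally show "cmod (\<Sum>x\<in>Y. cnj (v x) * (c * f x)) \<le> cmod c * C * sqrt (Re (qf Y k v))"
    by (simp add: algebra_simps)
qed (use assms in \<open>auto simp: rk_bounded_def\<close>)

context
  fixes X :: "'a set" and k :: "'a \<Rightarrow> 'a \<Rightarrow> complex"
  assumes k: "kernel X k"
begin

text \<open>The Gram matrix on \<open>Y\<close>, bordered by the values of a bounded function and its squared bound, is
  positive semi-definite.\<close>

lemma coords:
  assumes f: "rk_bounded X k C f" and Y: "finite Y" "Y \<subseteq> X" "y \<in> Y"
  shows "(\<Sum>x\<in>Y. k y x * coords k Y f x) = f y"
proof -
  define M where "M i j = (case (i, j) of (Some x, Some y) \<Rightarrow> k x y | (Some x, None) \<Rightarrow> f x
    | (None, Some y) \<Rightarrow> cnj (f y) | (None, None) \<Rightarrow> of_real (C\<^sup>2))" for i j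
  have M: "M (Some x) (Some y) = k x y" "M (Some x) None = f x" "M None (Some y) = cnj (f y)"
    "M None None = of_real (C\<^sup>2)" for x y
    by (auto simp: M_def)
  have psd: "psd_on Y k" using k Y by (auto intro: kernel_psd)
  have "psd_on (insert None (Some ` Y)) M"
    unfolding psd_on_iff
  proof
    fix v :: "'a option \<Rightarrow> complex"
    let ?v = "\<lambda>x. v (Some x)"
    define s where "s = (\<Sum>x\<in>Y. cnj (?v x) * f x)"
    define q where "q = Re (qf Y k ?v)"
    have s': "cnj s = (\<Sum>x\<in>Y. cnj (f x) * ?v x)"
      by (simp add: s_def mult_ac)
    have q: "qf Y k ?v = of_real q" "0 \<le> q"
      using qf_nonneg[OF psd] by (auto simp: q_def)
    have "qf (insert None (Some ` Y)) M v = qf Y k ?v + s * v None + cnj (v None) * cnj s + cnj (v None) * v None * of_real (C\<^sup>2)"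
      using Y unfolding qf_def s_def s'[unfolded s_def]
      by (simp add: sum.reindex sum.distrib M sum_distrib_left sum_distrib_right mult_ac)
    also have "\<dots> = of_real (q + 2 * Re (s * v None) + (cmod (v None))\<^sup>2 * C\<^sup>2)"
      unfolding q(1) cnj_mult_self by (simp add: complex_eq_iff)
    finally have eq: "qf (insert None (Some ` Y)) M v = of_real (q + 2 * Re (s * v None) + (cmod (v None))\<^sup>2 * C\<^sup>2)" .
    have "cmod s \<le> C * sqrt q"
      using rk_boundedD[OF f Y(1,2)] by (simp add: s_def q_def)
    then have "\<bar>Re (s * v None)\<bar> \<le> C * sqrt q * cmod (v None)"
      by (metis abs_Re_le_cmod mult_right_mono norm_ge_zero norm_mult order_trans)
    moreover have "0 \<le> (sqrt q - C * cmod (v None))\<^sup>2" by simp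
    then have "2 * (C * sqrt q * cmod (v None)) \<le> q + (cmod (v None))\<^sup>2 * C\<^sup>2"
      using q by (simp add: power2_eq_square algebra_simps)
    ultimately have "0 \<le> q + 2 * Re (s * v None) + (cmod (v None))\<^sup>2 * C\<^sup>2" by linarith
    then show "0 \<le> qf (insert None (Some ` Y)) M v"
      unfolding eq by (simp only: complex_of_real_nonneg_iff)
  qed
  from psd_on_column_in_range[OF _ this] Y obtain c where
    "\<forall>i\<in>Some ` Y. (\<Sum>j\<in>Some ` Y. M i j * c j) = M i None" by auto
  then have "\<forall>y\<in>Y. (\<Sum>x\<in>Y. k y x * c (Some x)) = f y"
    by (simp add: sum.reindex M)
  then have "\<exists>c. \<forall>y\<in>Y. (\<Sum>x\<in>Y. k y x * c x) = f y"
    by (intro exI[of _ "\<lambda>x. c (Some x)"])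
  then show ?thesis
    unfolding coords_def using someI_ex[where P = "\<lambda>c. \<forall>y\<in>Y. (\<Sum>x\<in>Y. k y x * c x) = f y"] Y(3) by blast
qed

text \<open>Any solution of the interpolation problem for \<open>g\<close> may replace \<open>coords\<close>, so the choice made there is
  immaterial.\<close>

lemma fin_ip_eq:
  assumes f: "rk_bounded X k C f" and Y: "finite Y" "Y \<subseteq> X"
    and d: "\<And>y. y \<in> Y \<Longrightarrow> (\<Sum>x\<in>Y. k y x * d x) = g y"
  shows "fin_ip k Y f g = (\<Sum>x\<in>Y. f x * cnj (d x))"
proof -
  let ?c = "coords k Y f"
  have "fin_ip k Y f g = (\<Sum>y\<in>Y. ?c y * cnj (\<Sum>x\<in>Y. k y x * d x))"
    unfolding fin_ip_def using d by (intro sum.cong) auto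
  also have "\<dots> = (\<Sum>y\<in>Y. \<Sum>x\<in>Y. k x y * ?c y * cnj (d x))"
    unfolding cnj_sum sum_distrib_left
  proof (intro sum.cong refl)
    fix y x assume "y \<in> Y" "x \<in> Y"
    then have "k x y = cnj (k y x)" using Y by (intro kernel_hermitian[OF k]) auto
    then have "cnj (k y x) = k x y" by (rule sym)
    then show "?c y * cnj (k y x * d x) = k x y * ?c y * cnj (d x)" by simp
  qed
  also have "\<dots> = (\<Sum>x\<in>Y. \<Sum>y\<in>Y. k x y * ?c y * cnj (d x))"
    by (rule sum.swap)
  also have "\<dots> = (\<Sum>x\<in>Y. f x * cnj (d x))"
    using coords[OF f Y] by (intro sum.cong refl) (simp flip: sum_distrib_right)
  finally show ?thesis .
qed

lemma fin_ip_coords: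
  assumes "rk_bounded X k C f" "rk_bounded X k C' g" and Y: "finite Y" "Y \<subseteq> X"
  shows "fin_ip k Y f g = (\<Sum>x\<in>Y. f x * cnj (coords k Y g x))"
  by (rule fin_ip_eq[OF assms(1) Y coords[OF assms(2) Y]])

lemma fin_ip_self:
  assumes f: "rk_bounded X k C f" and Y: "finite Y" "Y \<subseteq> X"
  shows "fin_ip k Y f f = qf Y k (coords k Y f)" "fin_ip k Y f f = (\<Sum>x\<in>Y. cnj (coords k Y f x) * f x)"
  unfolding fin_ip_coords[OF f f Y] qf_row_sum using coords[OF f Y] by (auto intro!: sum.cong)

lemma fin_ip_bound:
  assumes f: "rk_bounded X k C f" and Y: "finite Y" "Y \<subseteq> X"
  shows "cmod (\<Sum>x\<in>Y. cnj (v x) * f x) \<le> sqrt (Re (fin_ip k Y f f)) * sqrt (Re (qf Y k v))"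
proof -
  have psd: "psd_on Y k" by (rule kernel_psd[OF k Y])
  have "(\<Sum>x\<in>Y. cnj (v x) * f x) = (\<Sum>x\<in>Y. \<Sum>y\<in>Y. cnj (v x) * k x y * coords k Y f y)"
    using coords[OF f Y] by (intro sum.cong refl) (simp add: sum_distrib_left mult.assoc flip: sum_distrib_left)
  then show ?thesis
    using psd_on_Cauchy_Schwarz[OF Y(1) psd, of v "coords k Y f"] by (simp add: fin_ip_self[OF f Y] mult.commute)
qed

lemma fin_ip_nonneg:
  assumes f: "rk_bounded X k C f" and Y: "finite Y" "Y \<subseteq> X"
  shows "0 \<le> Re (fin_ip k Y f f)" "fin_ip k Y f f = of_real (Re (fin_ip k Y f f))"
  unfolding fin_ip_self(1)[OF f Y] using qf_nonneg[OF kernel_psd[OF k Y]] by auto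

text \<open>The projection to a smaller span has a smaller norm.\<close>

lemma fin_ip_mono:
  assumes f: "rk_bounded X k C f" and Y: "finite Y'" "Y' \<subseteq> X" "Y \<subseteq> Y'"
  shows "Re (fin_ip k Y f f) \<le> Re (fin_ip k Y' f f)"
proof -
  have Y': "finite Y" "Y \<subseteq> X" using Y finite_subset by auto
  define c where "c x = (if x \<in> Y then coords k Y f x else 0)" for x
  let ?q = "Re (fin_ip k Y f f)"
  have "qf Y' k c = qf Y k c"
    by (rule qf_zero_extend) (use Y in \<open>auto simp: c_def\<close>)
  also have "\<dots> = qf Y k (coords k Y f)"
    by (rule qf_cong) (auto simp: c_def)
  finally have 1: "Re (qf Y' k c) = ?q" by (simp add: fin_ip_self(1)[OF f Y'])
  have "(\<Sum>x\<in>Y'. cnj (c x) * f x) = (\<Sum>x\<in>Y. cnj (c x) * f x)"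
    by (rule sum.mono_neutral_right) (use Y in \<open>auto simp: c_def\<close>)
  also have "\<dots> = fin_ip k Y f f"
    unfolding fin_ip_self(2)[OF f Y'] by (simp add: c_def)
  finally have "cmod (\<Sum>x\<in>Y'. cnj (c x) * f x) = ?q"
    using fin_ip_nonneg[OF f Y'] by (metis abs_of_nonneg norm_of_real)
  then have "?q \<le> sqrt (Re (fin_ip k Y' f f)) * sqrt ?q"
    using fin_ip_bound[OF f Y(1,2), of c] 1 by simp
  then have "sqrt ?q \<le> sqrt (Re (fin_ip k Y' f f))"
    using fin_ip_nonneg(1)[OF f Y'] fin_ip_nonneg(1)[OF f Y(1,2)] by (intro sqrt_le_of_le_mult_sqrt) auto
  then show ?thesis by simp
qed

lemma fin_ip_le:
  assumes f: "rk_bounded X k C f" and Y: "finite Y" "Y \<subseteq> X"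
  shows "Re (fin_ip k Y f f) \<le> C\<^sup>2"
proof -
  let ?q = "Re (fin_ip k Y f f)"
  have q: "0 \<le> ?q" using fin_ip_nonneg[OF f Y] by simp
  have C: "0 \<le> C" using f by (simp add: rk_bounded_def)
  have "?q = cmod (fin_ip k Y f f)"
    using fin_ip_nonneg[OF f Y] by (metis abs_of_nonneg norm_of_real)
  also have "\<dots> \<le> C * sqrt ?q"
    using rk_boundedD[OF f Y, of "coords k Y f"] unfolding fin_ip_self(2)[OF f Y, symmetric] fin_ip_self(1)[OF f Y, symmetric] .
  finally have "sqrt ?q \<le> C" using q C by (intro sqrt_le_of_le_mult_sqrt)
  then show ?thesis using q sqrt_le_D by blast
qed

abbreviation (input) fin_filter :: "'a set filter" where "fin_filter \<equiv> finite_subsets_at_top X"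

lemma ev_finite_subset: "eventually (\<lambda>Y. finite Y \<and> Y \<subseteq> X) fin_filter"
  by (auto simp: eventually_finite_subsets_at_top intro!: exI[of _ "{}"])

lemma fin_ip_self_tendsto:
  assumes f: "rk_bounded X k C f"
  shows "\<exists>L. ((\<lambda>Y. fin_ip k Y f f) \<longlongrightarrow> of_real L) fin_filter \<and> L \<le> C\<^sup>2 \<and> (\<forall>Y. finite Y \<and> Y \<subseteq> X \<longrightarrow> Re (fin_ip k Y f f) \<le> L)"
proof -
  let ?S = "(\<lambda>Y. Re (fin_ip k Y f f)) ` {Y. finite Y \<and> Y \<subseteq> X}"
  define L where "L = Sup ?S"
  have bdd: "bdd_above ?S" using fin_ip_le[OF f] by (auto intro!: bdd_aboveI)
  have up: "Re (fin_ip k Y f f) \<le> L" if "finite Y" "Y \<subseteq> X" for Y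
    unfolding L_def using that bdd by (intro cSup_upper) auto
  have "L \<le> C\<^sup>2"
    unfolding L_def using fin_ip_le[OF f] by (intro cSup_least) auto
  moreover have "((\<lambda>Y. Re (fin_ip k Y f f)) \<longlongrightarrow> L) fin_filter"
  proof (rule order_tendstoI)
    fix a assume "a < L"
    then obtain Y where Y: "finite Y" "Y \<subseteq> X" "a < Re (fin_ip k Y f f)"
      unfolding L_def using bdd by (subst (asm) less_cSup_iff) auto
    have "a < Re (fin_ip k Y' f f)" if "finite Y'" "Y' \<subseteq> X" "Y \<subseteq> Y'" for Y'
      using Y(3) fin_ip_mono[OF f that] by linarith
    then show "eventually (\<lambda>Y. a < Re (fin_ip k Y f f)) fin_filter"
      unfolding eventually_finite_subsets_at_top using Y by (intro exI[of _ Y]) auto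
  next
    fix a assume "L < a"
    then show "eventually (\<lambda>Y. Re (fin_ip k Y f f) < a) fin_filter"
      using up by (intro eventually_mono[OF ev_finite_subset]) force
  qed
  then have "((\<lambda>Y. complex_of_real (Re (fin_ip k Y f f))) \<longlongrightarrow> of_real L) fin_filter"
    by (rule tendsto_of_real)
  then have "((\<lambda>Y. fin_ip k Y f f) \<longlongrightarrow> of_real L) fin_filter"
    by (rule Lim_transform_eventually) (intro eventually_mono[OF ev_finite_subset], metis fin_ip_nonneg(2)[OF f])
  ultimately show ?thesis using up by blast
qed

lemma fin_ip_add:
  assumes "rk_bounded X k C f" "rk_bounded X k C' g" "rk_bounded X k C'' h" and Y: "finite Y" "Y \<subseteq> X"
  shows "fin_ip k Y (\<lambda>x. f x + g x) h = fin_ip k Y f h + fin_ip k Y g h"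
  unfolding fin_ip_coords[OF rk_bounded_add[OF assms(1,2)] assms(3) Y] fin_ip_coords[OF assms(1,3) Y]
    fin_ip_coords[OF assms(2,3) Y]
  by (simp add: algebra_simps sum.distrib)

lemma fin_ip_scale:
  assumes "rk_bounded X k C f" "rk_bounded X k C' g" and Y: "finite Y" "Y \<subseteq> X"
  shows "fin_ip k Y (\<lambda>x. c * f x) g = c * fin_ip k Y f g"
  unfolding fin_ip_coords[OF rk_bounded_scale[OF assms(1)] assms(2) Y] fin_ip_coords[OF assms(1,2) Y]
  by (simp add: algebra_simps sum_distrib_left)

lemma fin_ip_cnj:
  assumes "rk_bounded X k C f" "rk_bounded X k C' g" and Y: "finite Y" "Y \<subseteq> X"
  shows "fin_ip k Y g f = cnj (fin_ip k Y f g)"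
  unfolding fin_ip_coords[OF assms(2,1) Y] by (simp add: fin_ip_def mult.commute)

abbreviation (input) "fin_sq f g c Y \<equiv> fin_ip k Y (\<lambda>x. f x + c * g x) (\<lambda>x. f x + c * g x)"

lemma fin_ip_polarization:
  assumes f: "rk_bounded X k C f" and g: "rk_bounded X k C' g" and Y: "finite Y" "Y \<subseteq> X"
  shows "4 * fin_ip k Y f g =
    fin_sq f g 1 Y - fin_sq f g (-1) Y
    + \<i> * fin_sq f g \<i> Y
    - \<i> * fin_sq f g (-\<i>) Y"
proof -
  have e: "fin_sq f g c Y =
      fin_ip k Y f f + cnj c * fin_ip k Y f g + c * fin_ip k Y g f + c * cnj c * fin_ip k Y g g" for c
  proof -
    let ?h = "\<lambda>x. f x + c * g x"
    note cg = rk_bounded_scale[OF g, of c]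
    note h = rk_bounded_add[OF f cg]
    have 1: "fin_ip k Y ?h u = fin_ip k Y f u + c * fin_ip k Y g u" if "rk_bounded X k D u" for u D
      by (simp add: fin_ip_add[OF f cg that Y] fin_ip_scale[OF g that Y])
    have 2: "fin_ip k Y u ?h = fin_ip k Y u f + cnj c * fin_ip k Y u g" if u: "rk_bounded X k D u" for u D
      using arg_cong[OF 1[OF u], of cnj]
      by (simp add: fin_ip_cnj[OF u f Y] fin_ip_cnj[OF u g Y] fin_ip_cnj[OF u h Y])
    show ?thesis
      by (simp add: 1[OF h] 2[OF f] 2[OF g] algebra_simps)
  qed
  show ?thesis
    unfolding e by (simp add: algebra_simps)
qed

definition rk_ip :: "('a \<Rightarrow> complex) \<Rightarrow> ('a \<Rightarrow> complex) \<Rightarrow> complex" where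
  "rk_ip f g = Lim fin_filter (\<lambda>Y. fin_ip k Y f g)"

text \<open>The norms of the projections increase with \<open>Y\<close> and are bounded, so they converge along the directed set
  of finite sets; polarization transfers this to the inner products.\<close>

lemma rk_ip_tendsto:
  assumes f: "rk_bounded X k C f" and g: "rk_bounded X k C' g"
  shows "((\<lambda>Y. fin_ip k Y f g) \<longlongrightarrow> rk_ip f g) fin_filter"
proof -
  have "\<exists>L. (fin_sq f g c \<longlongrightarrow> of_real L) fin_filter" for c
    using fin_ip_self_tendsto[OF rk_bounded_add[OF f rk_bounded_scale[OF g, of c]]] by auto
  then obtain L where L: "\<And>c. (fin_sq f g c \<longlongrightarrow> complex_of_real (L c)) fin_filter"
    by metis
  let ?P = "\<lambda>Y. (fin_sq f g 1 Y - fin_sq f g (-1) Y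
    + \<i> * fin_sq f g \<i> Y
    - \<i> * fin_sq f g (-\<i>) Y) / 4"
  have "(?P \<longlongrightarrow> (of_real (L 1) - of_real (L (-1)) + \<i> * of_real (L \<i>) - \<i> * of_real (L (-\<i>))) / 4) fin_filter"
    by (intro tendsto_intros L) simp
  moreover have "eventually (\<lambda>Y. ?P Y = fin_ip k Y f g) fin_filter"
  proof (rule eventually_mono[OF ev_finite_subset])
    fix Y assume "finite Y \<and> Y \<subseteq> X"
    then have "?P Y = 4 * fin_ip k Y f g / 4"
      by (simp only: fin_ip_polarization[OF f g])
    then show "?P Y = fin_ip k Y f g" by simp
  qed
  ultimately have "((\<lambda>Y. fin_ip k Y f g) \<longlongrightarrow> (of_real (L 1) - of_real (L (-1)) + \<i> * of_real (L \<i>) - \<i> * of_real (L (-\<i>))) / 4) fin_filter"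
    by (rule Lim_transform_eventually)
  then show ?thesis
    unfolding rk_ip_def by (metis tendsto_Lim finite_subsets_at_top_neq_bot)
qed

lemma rk_ip_unique:
  assumes f: "rk_bounded X k C f" and g: "rk_bounded X k C' g"
    and h: "(h \<longlongrightarrow> L) fin_filter" "\<And>Y. finite Y \<Longrightarrow> Y \<subseteq> X \<Longrightarrow> fin_ip k Y f g = h Y"
  shows "rk_ip f g = L"
proof -
  have "((\<lambda>Y. fin_ip k Y f g) \<longlongrightarrow> L) fin_filter"
    by (rule Lim_transform_eventually[OF h(1)]) (auto intro!: eventually_mono[OF ev_finite_subset] simp: h(2))
  then show ?thesis
    using rk_ip_tendsto[OF f g] tendsto_unique[OF finite_subsets_at_top_neq_bot] by blast
qed

lemma rk_ip_self:
  assumes f: "rk_bounded X k C f"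
  shows "Re (rk_ip f f) \<le> C\<^sup>2" "finite Y \<Longrightarrow> Y \<subseteq> X \<Longrightarrow> Re (fin_ip k Y f f) \<le> Re (rk_ip f f)"
  using fin_ip_self_tendsto[OF f] rk_ip_tendsto[OF f f]
  by (metis (no_types, lifting) Re_complex_of_real finite_subsets_at_top_neq_bot tendsto_unique)+

lemma rk_bounded_rk_ip:
  assumes f: "rk_bounded X k C f"
  shows "rk_bounded X k (sqrt (Re (rk_ip f f))) f"
  unfolding rk_bounded_def
proof (intro conjI allI impI)
  show "0 \<le> sqrt (Re (rk_ip f f))"
    using rk_ip_self(2)[OF f, of "{}"] by (simp add: fin_ip_def)
  fix Y v assume Y: "finite Y \<and> Y \<subseteq> X"
  have "cmod (\<Sum>x\<in>Y. cnj (v x) * f x) \<le> sqrt (Re (fin_ip k Y f f)) * sqrt (Re (qf Y k v))"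
    using Y by (intro fin_ip_bound[OF f]) auto
  also have "\<dots> \<le> sqrt (Re (rk_ip f f)) * sqrt (Re (qf Y k v))"
    using Y rk_ip_self(2)[OF f, of Y] qf_nonneg(1)[OF kernel_psd[OF k, of Y]] by (intro mult_right_mono) auto
  finally show "cmod (\<Sum>x\<in>Y. cnj (v x) * f x) \<le> sqrt (Re (rk_ip f f)) * sqrt (Re (qf Y k v))" .
qed (use f in \<open>auto simp: rk_bounded_def\<close>)

lemma rk_bounded_point:
  assumes f: "rk_bounded X k C f" and x: "x \<in> X"
  shows "cmod (f x) \<le> C * sqrt (Re (k x x))"
  using rk_boundedD[OF f, of "{x}" "\<lambda>_. 1"] x by (simp add: qf_def)

lemma rk_bounded_kernel_function:
  assumes w: "w \<in> X"
  shows "rk_bounded X k (sqrt (Re (k w w))) (\<lambda>z. if z \<in> X then k z w else 0)"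
  unfolding rk_bounded_def
proof (intro conjI allI impI)
  show "0 \<le> sqrt (Re (k w w))"
    using kernel_diag_nonneg[OF k w] by (simp add: less_eq_complex_def)
  fix Y and v :: "'a \<Rightarrow> complex" assume Y: "finite Y \<and> Y \<subseteq> X"
  define u where "u x = (if x \<in> Y then v x else 0)" for x :: 'a
  define d where "d x = (if x = w then 1 else 0 :: complex)" for x :: 'a
  let ?K = "insert w Y"
  have K: "finite ?K" "?K \<subseteq> X" using Y w by auto
  have "(\<Sum>x\<in>?K. \<Sum>y\<in>?K. cnj (u x) * k x y * d y) = (\<Sum>x\<in>?K. cnj (u x) * k x w)"
    using K(1) by (intro sum.cong refl) (simp add: d_def if_distrib cong: if_cong)
  also have "\<dots> = (\<Sum>x\<in>Y. cnj (u x) * k x w)"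
    by (rule sum.mono_neutral_right) (use K in \<open>auto simp: u_def\<close>)
  also have "\<dots> = (\<Sum>x\<in>Y. cnj (v x) * (if x \<in> X then k x w else 0))"
    using Y by (intro sum.cong) (auto simp: u_def)
  finally have 1: "(\<Sum>x\<in>?K. \<Sum>y\<in>?K. cnj (u x) * k x y * d y) = (\<Sum>x\<in>Y. cnj (v x) * (if x \<in> X then k x w else 0))" .
  have 2: "qf ?K k u = qf Y k v"
  proof -
    have "qf ?K k u = qf Y k u" by (rule qf_zero_extend) (use K in \<open>auto simp: u_def\<close>)
    also have "\<dots> = qf Y k v" by (rule qf_cong) (auto simp: u_def)
    finally show ?thesis .
  qed
  have 3: "qf ?K k d = k w w"
    unfolding d_def using K by (intro qf_single) auto
  show "cmod (\<Sum>x\<in>Y. cnj (v x) * (if x \<in> X then k x w else 0)) \<le> sqrt (Re (k w w)) * sqrt (Re (qf Y k v))"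
    using psd_on_Cauchy_Schwarz[OF K(1) kernel_psd[OF k K], of u d] unfolding 1 2 3 by (simp add: mult.commute)
qed auto

text \<open>The inner product on the bounded functions is the limit of the inner products of their interpolants.
  Norm convergence dominates pointwise convergence, and the bounds defining \<open>rk_bounded\<close> pass to pointwise
  limits, which gives completeness.\<close>

theorem Moore_Aronszajn: "is_rkhs X k {f. \<exists>C. rk_bounded X k C f} rk_ip"
  unfolding is_rkhs_def
proof (intro conjI ballI allI impI)
  let ?H = "{f. \<exists>C. rk_bounded X k C f}"
  show "f x = 0" if "f \<in> ?H" "x \<notin> X" for f x
    using that by (auto simp: rk_bounded_def)
  show "(\<lambda>x. 0) \<in> ?H" using rk_bounded_zero by blast
  show "(\<lambda>x. f x + g x) \<in> ?H" if "f \<in> ?H" "g \<in> ?H" for f g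
    using that rk_bounded_add by blast
  show "(\<lambda>x. c * f x) \<in> ?H" if "f \<in> ?H" for f c
    using that rk_bounded_scale by blast
  show "rk_ip (\<lambda>x. f x + g x) h = rk_ip f h + rk_ip g h" if fgh: "f \<in> ?H" "g \<in> ?H" "h \<in> ?H" for f g h
  proof -
    obtain C C' C'' where b: "rk_bounded X k C f" "rk_bounded X k C' g" "rk_bounded X k C'' h" using fgh by auto
    show ?thesis
      by (rule rk_ip_unique[OF rk_bounded_add[OF b(1,2)] b(3)
          tendsto_add[OF rk_ip_tendsto[OF b(1,3)] rk_ip_tendsto[OF b(2,3)]] fin_ip_add[OF b]])
  qed
  show "rk_ip (\<lambda>x. c * f x) g = c * rk_ip f g" if fg: "f \<in> ?H" "g \<in> ?H" for f g c
  proof -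
    obtain C C' where b: "rk_bounded X k C f" "rk_bounded X k C' g" using fg by auto
    show ?thesis
      by (rule rk_ip_unique[OF rk_bounded_scale[OF b(1)] b(2)
          tendsto_mult[OF tendsto_const rk_ip_tendsto[OF b]] fin_ip_scale[OF b]])
  qed
  show "rk_ip g f = cnj (rk_ip f g)" if fg: "f \<in> ?H" "g \<in> ?H" for f g
  proof -
    obtain C C' where b: "rk_bounded X k C f" "rk_bounded X k C' g" using fg by auto
    show ?thesis
      by (rule rk_ip_unique[OF b(2,1) tendsto_cnj[OF rk_ip_tendsto[OF b]] fin_ip_cnj[OF b]])
  qed
  show "0 < Re (rk_ip f f)" if f: "f \<in> ?H" "f \<noteq> (\<lambda>x. 0)" for f
  proof -
    obtain C where C: "rk_bounded X k C f" using f by auto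
    obtain x where x: "f x \<noteq> 0" using f(2) by auto
    then have xX: "x \<in> X" using C by (auto simp: rk_bounded_def)
    have "cmod (f x) \<le> sqrt (Re (rk_ip f f)) * sqrt (Re (k x x))"
      by (rule rk_bounded_point[OF rk_bounded_rk_ip[OF C] xX])
    moreover have "0 \<le> sqrt (Re (rk_ip f f))"
      using rk_bounded_rk_ip[OF C] by (simp add: rk_bounded_def)
    ultimately show ?thesis
      using x by (cases "Re (rk_ip f f) = 0") auto
  qed
  show "\<exists>f\<in>?H. (\<lambda>n. sqrt (Re (rk_ip (\<lambda>x. F n x - f x) (\<lambda>x. F n x - f x)))) \<longlonglongrightarrow> 0"
    if F: "(\<forall>n. F n \<in> ?H) \<and> (\<forall>e>0. \<exists>M. \<forall>m\<ge>M. \<forall>n\<ge>M. sqrt (Re (rk_ip (\<lambda>x. F m x - F n x) (\<lambda>x. F m x - F n x))) < e)" for F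
  proof -
    obtain C where C: "\<And>n. rk_bounded X k (C n) (F n)" using F by (simp add: choice_iff) blast
    have D: "rk_bounded X k (C m + C n) (\<lambda>x. F m x - F n x)" for m n
      using rk_bounded_add[OF C[of m] rk_bounded_scale[OF C[of n], of "-1"]] by simp
    define N where "N m n = sqrt (Re (rk_ip (\<lambda>x. F m x - F n x) (\<lambda>x. F m x - F n x)))" for m n
    have ND: "rk_bounded X k (N m n) (\<lambda>x. F m x - F n x)" for m n
      unfolding N_def by (rule rk_bounded_rk_ip[OF D])
    have Cau: "\<exists>M. \<forall>m\<ge>M. \<forall>n\<ge>M. N m n < e" if "0 < e" for e
      using F that by (auto simp: N_def)
    have "convergent (\<lambda>n. F n x)" for x
    proof (cases "x \<in> X")
      case False
      then have "F n x = 0" for n using C[of n] by (auto simp: rk_bounded_def)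
      then show ?thesis by (simp add: convergent_const)
    next
      case True
      have "Cauchy (\<lambda>n. F n x)"
        unfolding Cauchy_def dist_norm
      proof (intro allI impI)
        fix e :: real assume e: "0 < e"
        let ?s = "sqrt (Re (k x x))"
        have s: "0 \<le> ?s" using kernel_diag_nonneg[OF k True] by (simp add: less_eq_complex_def)
        obtain M where M: "\<And>m n. M \<le> m \<Longrightarrow> M \<le> n \<Longrightarrow> N m n < e / (?s + 1)"
          using Cau[of "e / (?s + 1)"] e s by (metis add_nonneg_pos divide_pos_pos zero_less_one)
        have "norm (F m x - F n x) < e" if "M \<le> m" "M \<le> n" for m n
        proof -
          have "norm (F m x - F n x) \<le> N m n * ?s" by (rule rk_bounded_point[OF ND True])
          also have "\<dots> \<le> e / (?s + 1) * ?s"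
            using M[OF that] s by (intro mult_right_mono) auto
          also have "\<dots> < e"
          proof -
            have "e / (s + 1) * s < e" if "0 \<le> s" for s :: real
              using that e by (simp add: field_simps)
            then show ?thesis using s by blast
          qed
          finally show ?thesis .
        qed
        then show "\<exists>M. \<forall>m\<ge>M. \<forall>n\<ge>M. norm (F m x - F n x) < e" by blast
      qed
      then show ?thesis by (simp add: Cauchy_convergent_iff)
    qed
    then obtain f where f: "\<And>x. (\<lambda>n. F n x) \<longlonglongrightarrow> f x"
      unfolding convergent_def by metis
    have bd: "rk_bounded X k e (\<lambda>x. F m x - f x)" if e: "0 < e" and M: "\<And>n. M \<le> n \<Longrightarrow> N m n < e" for e m M
      unfolding rk_bounded_def
    proof (intro conjI allI impI)
      show "0 \<le> e" using e by simp
      show "F m x - f x = 0" if x: "x \<notin> X" for x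
      proof -
        have "F n x = 0" for n using C[of n] x by (auto simp: rk_bounded_def)
        then show ?thesis using f[of x] by (simp add: LIMSEQ_const_iff)
      qed
      fix Y v assume Y: "finite Y \<and> Y \<subseteq> X"
      have "(\<lambda>n. cmod (\<Sum>x\<in>Y. cnj (v x) * (F m x - F n x))) \<longlonglongrightarrow> cmod (\<Sum>x\<in>Y. cnj (v x) * (F m x - f x))"
        by (intro tendsto_intros f)
      moreover have "cmod (\<Sum>x\<in>Y. cnj (v x) * (F m x - F n x)) \<le> e * sqrt (Re (qf Y k v))" if "M \<le> n" for n
      proof -
        have "cmod (\<Sum>x\<in>Y. cnj (v x) * (F m x - F n x)) \<le> N m n * sqrt (Re (qf Y k v))"
          using rk_boundedD[OF ND] Y by blast
        also have "\<dots> \<le> e * sqrt (Re (qf Y k v))"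
          using M[OF that] qf_nonneg(1)[OF kernel_psd[OF k, of Y]] Y by (intro mult_right_mono) auto
        finally show ?thesis .
      qed
      ultimately show "cmod (\<Sum>x\<in>Y. cnj (v x) * (F m x - f x)) \<le> e * sqrt (Re (qf Y k v))"
        by (intro LIMSEQ_le_const2) auto
    qed
    have small: "\<exists>M. \<forall>m\<ge>M. rk_bounded X k e (\<lambda>x. F m x - f x)" if e: "0 < e" for e
      using Cau[OF e] bd[OF e] by meson
    obtain M where "rk_bounded X k 1 (\<lambda>x. F M x - f x)" using small[of 1] by auto
    from rk_bounded_add[OF C[of M] rk_bounded_scale[OF this, of "-1"]] have fH: "f \<in> ?H" by auto
    moreover have "(\<lambda>n. sqrt (Re (rk_ip (\<lambda>x. F n x - f x) (\<lambda>x. F n x - f x)))) \<longlonglongrightarrow> 0"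
    proof (rule LIMSEQ_I)
      fix e :: real assume "0 < e"
      then obtain M where M: "\<And>m. M \<le> m \<Longrightarrow> rk_bounded X k (e / 2) (\<lambda>x. F m x - f x)"
        using small[of "e / 2"] by auto
      have "norm (sqrt (Re (rk_ip (\<lambda>x. F n x - f x) (\<lambda>x. F n x - f x))) - 0) < e" if "M \<le> n" for n
      proof -
        have "sqrt (Re (rk_ip (\<lambda>x. F n x - f x) (\<lambda>x. F n x - f x))) \<le> e / 2"
          using rk_ip_self(1)[OF M[OF that]] \<open>0 < e\<close> by (metis real_sqrt_le_iff real_sqrt_abs abs_of_pos half_gt_zero)
        moreover have "0 \<le> sqrt (Re (rk_ip (\<lambda>x. F n x - f x) (\<lambda>x. F n x - f x)))"
          using rk_bounded_rk_ip[OF M[OF that]] by (simp add: rk_bounded_def)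
        ultimately show ?thesis using \<open>0 < e\<close> by simp
      qed
      then show "\<exists>M. \<forall>n\<ge>M. norm (sqrt (Re (rk_ip (\<lambda>x. F n x - f x) (\<lambda>x. F n x - f x))) - 0) < e" by blast
    qed
    ultimately show ?thesis by blast
  qed
  fix w assume w: "w \<in> X"
  note kw = rk_bounded_kernel_function[OF w]
  then show "(\<lambda>z. if z \<in> X then k z w else 0) \<in> ?H" by blast
  fix f assume "f \<in> ?H"
  then obtain C where C: "rk_bounded X k C f" by auto
  have "eventually (\<lambda>Y. fin_ip k Y f (\<lambda>z. if z \<in> X then k z w else 0) = f w) fin_filter"
    unfolding eventually_finite_subsets_at_top
  proof (intro exI[of _ "{w}"] conjI allI impI)
    fix Y assume Y: "finite Y \<and> {w} \<subseteq> Y \<and> Y \<subseteq> X"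
    have "fin_ip k Y f (\<lambda>z. if z \<in> X then k z w else 0) = (\<Sum>x\<in>Y. f x * cnj (if x = w then 1 else 0))"
      by (rule fin_ip_eq[OF C]) (use Y in \<open>auto simp: if_distrib cong: if_cong\<close>)
    also have "\<dots> = f w" using Y by (simp add: if_distrib cong: if_cong)
    finally show "fin_ip k Y f (\<lambda>z. if z \<in> X then k z w else 0) = f w" .
  qed (use w in auto)
  then have "((\<lambda>Y. fin_ip k Y f (\<lambda>z. if z \<in> X then k z w else 0)) \<longlongrightarrow> f w) fin_filter"
    by (rule tendsto_eventually)
  then show "rk_ip f (\<lambda>z. if z \<in> X then k z w else 0) = f w"
    by (intro rk_ip_unique[OF C kw]) auto
qed

end

lemma is_rkhs_rkhs: "kernel X k \<Longrightarrow> is_rkhs X k (fst (rkhs X k)) (snd (rkhs X k))"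
  unfolding rkhs_def
  by (rule someI[of "\<lambda>R. is_rkhs X k (fst R) (snd R)" "({f. \<exists>C. rk_bounded X k C f}, rk_ip X k)"])
    (simp add: Moore_Aronszajn)

text \<open>Now for an arbitrary reproducing kernel Hilbert space of \<open>k\<close>, because \<open>rkhs\<close> is obtained by choice; its
  members turn out to be exactly the bounded functions.\<close>

context
  fixes X :: "'a set" and k :: "'a \<Rightarrow> 'a \<Rightarrow> complex" and H ip
  assumes k: "kernel X k" and R: "is_rkhs X k H ip"
begin

definition "kcomb c Y = (\<lambda>z. \<Sum>x\<in>Y. c x * (if z \<in> X then k z x else 0))"

lemma rkhs_zero_off: "f \<in> H \<Longrightarrow> x \<notin> X \<Longrightarrow> f x = 0"
  using R unfolding is_rkhs_def by meson
lemma rkhs_zero: "(\<lambda>x. 0) \<in> H"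
  using R unfolding is_rkhs_def by meson
lemma rkhs_add: "f \<in> H \<Longrightarrow> g \<in> H \<Longrightarrow> (\<lambda>x. f x + g x) \<in> H"
  using R unfolding is_rkhs_def by meson
lemma rkhs_scale: "f \<in> H \<Longrightarrow> (\<lambda>x. c * f x) \<in> H"
  using R unfolding is_rkhs_def by meson
lemma ip_add: "f \<in> H \<Longrightarrow> g \<in> H \<Longrightarrow> h \<in> H \<Longrightarrow> ip (\<lambda>x. f x + g x) h = ip f h + ip g h"
  using R unfolding is_rkhs_def by meson
lemma ip_scale: "f \<in> H \<Longrightarrow> g \<in> H \<Longrightarrow> ip (\<lambda>x. c * f x) g = c * ip f g"
  using R unfolding is_rkhs_def by meson
lemma ip_cnj: "f \<in> H \<Longrightarrow> g \<in> H \<Longrightarrow> ip g f = cnj (ip f g)"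
  using R unfolding is_rkhs_def by meson
lemma ip_pos: "f \<in> H \<Longrightarrow> f \<noteq> (\<lambda>x. 0) \<Longrightarrow> 0 < Re (ip f f)"
  using R unfolding is_rkhs_def by meson
lemma rkhs_complete:
  "(\<And>n. F n \<in> H) \<Longrightarrow> (\<And>e. 0 < e \<Longrightarrow> \<exists>M. \<forall>m\<ge>M. \<forall>n\<ge>M. sqrt (Re (ip (\<lambda>x. F m x - F n x) (\<lambda>x. F m x - F n x))) < e)
   \<Longrightarrow> \<exists>f\<in>H. (\<lambda>n. sqrt (Re (ip (\<lambda>x. F n x - f x) (\<lambda>x. F n x - f x)))) \<longlonglongrightarrow> 0"
  for F :: "nat \<Rightarrow> 'a \<Rightarrow> complex"
  using R unfolding is_rkhs_def by blast
lemma rkhs_kernel_function: "w \<in> X \<Longrightarrow> (\<lambda>z. if z \<in> X then k z w else 0) \<in> H"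
  using R unfolding is_rkhs_def by meson
lemma rkhs_reproducing: "w \<in> X \<Longrightarrow> f \<in> H \<Longrightarrow> ip f (\<lambda>z. if z \<in> X then k z w else 0) = f w"
  using R unfolding is_rkhs_def by meson

lemma ip_zero: "g \<in> H \<Longrightarrow> ip (\<lambda>x. 0) g = 0" "g \<in> H \<Longrightarrow> ip g (\<lambda>x. 0) = 0"
  using ip_scale[OF rkhs_zero, of g 0] ip_cnj[of "\<lambda>x. 0" g] rkhs_zero by auto

lemma ip_add_right: "f \<in> H \<Longrightarrow> g \<in> H \<Longrightarrow> h \<in> H \<Longrightarrow> ip h (\<lambda>x. f x + g x) = ip h f + ip h g"
  using ip_add[of f g h] ip_cnj[of h f] ip_cnj[of h g] ip_cnj[of "\<lambda>x. f x + g x" h] rkhs_add[of f g] by simp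

lemma ip_scale_right: "f \<in> H \<Longrightarrow> g \<in> H \<Longrightarrow> ip g (\<lambda>x. c * f x) = cnj c * ip g f"
  using ip_scale[of f g c] ip_cnj[of g f] ip_cnj[of "\<lambda>x. c * f x" g] rkhs_scale[of f c] by simp

lemma rkhs_diff: "f \<in> H \<Longrightarrow> g \<in> H \<Longrightarrow> (\<lambda>x. f x - g x) \<in> H"
  using rkhs_add[OF _ rkhs_scale[of g "-1"], of f] by simp

lemma ip_diff: "f \<in> H \<Longrightarrow> g \<in> H \<Longrightarrow> h \<in> H \<Longrightarrow> ip (\<lambda>x. f x - g x) h = ip f h - ip g h"
  using ip_add[OF _ rkhs_scale[of g "-1"], of f h] ip_scale[of g h "-1"] by simp

lemma ip_diff_right: "f \<in> H \<Longrightarrow> g \<in> H \<Longrightarrow> h \<in> H \<Longrightarrow> ip h (\<lambda>x. f x - g x) = ip h f - ip h g"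
  using ip_add_right[OF _ rkhs_scale[of g "-1"], of f h] ip_scale_right[of g h "-1"] by simp

lemma ip_self: "f \<in> H \<Longrightarrow> 0 \<le> Re (ip f f)" "f \<in> H \<Longrightarrow> ip f f = of_real (Re (ip f f))"
proof -
  assume f: "f \<in> H"
  show "0 \<le> Re (ip f f)" using ip_pos[OF f] ip_zero(1)[OF f] by (cases "f = (\<lambda>x. 0)") auto
  show "ip f f = of_real (Re (ip f f))" using ip_cnj[OF f f] by (auto simp: complex_eq_iff)
qed

lemma ip_Cauchy_Schwarz:
  assumes f: "f \<in> H" and g: "g \<in> H"
  shows "cmod (ip f g) \<le> sqrt (Re (ip f f)) * sqrt (Re (ip g g))"
proof (cases "g = (\<lambda>x. 0)")
  case True
  then show ?thesis using ip_zero[OF f] ip_zero[OF g] by simp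
next
  case False
  define q where "q = Re (ip g g)"
  have q: "0 < q" "ip g g = of_real q" using ip_pos[OF g False] ip_self[OF g] by (auto simp: q_def)
  define c where "c = ip f g / of_real q"
  let ?h = "\<lambda>x. f x - c * g x"
  have cg: "(\<lambda>x. c * g x) \<in> H" by (rule rkhs_scale[OF g])
  have "ip ?h ?h = ip f f - cnj c * ip f g - c * ip g f + c * cnj c * ip g g"
    using f g cg rkhs_diff[OF f cg]
    by (simp add: ip_diff ip_diff_right ip_scale ip_scale_right algebra_simps)
  also have "\<dots> = ip f f - cnj (ip f g) * ip f g / of_real q"
    using q ip_cnj[OF f g] by (simp add: c_def field_simps)
  also have "\<dots> = of_real (Re (ip f f) - (cmod (ip f g))\<^sup>2 / q)"
    unfolding cnj_mult_self using ip_self(2)[OF f] by (metis of_real_diff of_real_divide)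
  finally have "0 \<le> Re (ip f f) - (cmod (ip f g))\<^sup>2 / q"
    using ip_self(1)[OF rkhs_diff[OF f cg]] by simp
  then have "(cmod (ip f g))\<^sup>2 \<le> Re (ip f f) * q"
    using q by (simp add: field_simps)
  then show ?thesis
    unfolding q_def[symmetric] real_sqrt_mult[symmetric] by (rule real_le_rsqrt)
qed

lemma kcomb:
  assumes "finite Y" "Y \<subseteq> X"
  shows "kcomb c Y \<in> H" "\<And>f. f \<in> H \<Longrightarrow> ip f (kcomb c Y) = (\<Sum>x\<in>Y. cnj (c x) * f x)"
proof -
  have "kcomb c Y \<in> H \<and> (\<forall>f\<in>H. ip f (kcomb c Y) = (\<Sum>x\<in>Y. cnj (c x) * f x))"
    using assms
  proof (induction Y rule: finite_induct)
    case empty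
    then show ?case using rkhs_zero ip_zero by (auto simp: kcomb_def)
  next
    case (insert y Y)
    let ?ky = "\<lambda>z. if z \<in> X then k z y else 0"
    have eq: "kcomb c (insert y Y) = (\<lambda>z. c y * ?ky z + kcomb c Y z)"
      using insert by (auto simp: kcomb_def)
    have y: "?ky \<in> H" using insert by (intro rkhs_kernel_function) auto
    have IH: "kcomb c Y \<in> H" "\<And>f. f \<in> H \<Longrightarrow> ip f (kcomb c Y) = (\<Sum>x\<in>Y. cnj (c x) * f x)"
      using insert by auto
    show ?case
      unfolding eq
    proof (intro conjI ballI)
      show "(\<lambda>z. c y * ?ky z + kcomb c Y z) \<in> H" by (rule rkhs_add[OF rkhs_scale[OF y] IH(1)])
      fix f assume f: "f \<in> H"
      have yX: "y \<in> X" using insert by auto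
      show "ip f (\<lambda>z. c y * ?ky z + kcomb c Y z) = (\<Sum>x\<in>insert y Y. cnj (c x) * f x)"
        unfolding ip_add_right[OF rkhs_scale[OF y] IH(1) f] ip_scale_right[OF y f] IH(2)[OF f]
          rkhs_reproducing[OF yX f] using insert by simp
    qed
  qed
  then show "kcomb c Y \<in> H" "\<And>f. f \<in> H \<Longrightarrow> ip f (kcomb c Y) = (\<Sum>x\<in>Y. cnj (c x) * f x)" by auto
qed

lemma kcomb_apply: "z \<in> X \<Longrightarrow> kcomb c Y z = (\<Sum>x\<in>Y. k z x * c x)"
  by (auto simp: kcomb_def mult.commute)

lemma ip_kcomb_self:
  assumes "finite Y" "Y \<subseteq> X"
  shows "ip (kcomb c Y) (kcomb c Y) = qf Y k c"
  unfolding kcomb(2)[OF assms kcomb(1)[OF assms]] qf_row_sum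
  using assms kcomb_apply by (intro sum.cong) auto

lemma rkhs_bounded:
  assumes f: "f \<in> H"
  shows "rk_bounded X k (sqrt (Re (ip f f))) f"
  unfolding rk_bounded_def
proof (intro conjI allI impI)
  show "0 \<le> sqrt (Re (ip f f))" using ip_self(1)[OF f] by simp
  show "f x = 0" if "x \<notin> X" for x using rkhs_zero_off[OF f that] .
  fix Y v assume "finite Y \<and> Y \<subseteq> X"
  then show "cmod (\<Sum>x\<in>Y. cnj (v x) * f x) \<le> sqrt (Re (ip f f)) * sqrt (Re (qf Y k v))"
    using ip_Cauchy_Schwarz[OF f kcomb(1), of Y v] by (simp add: kcomb(2)[OF _ _ f] ip_kcomb_self)
qed

text \<open>A bounded function is the limit of its interpolants on an increasing sequence of finite sets that
  exhausts its norm; the limit agrees with the function at every point, because adding that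
  point to the finite sets does not change the limit.\<close>

lemma rk_bounded_mem:
  assumes F: "rk_bounded X k C F"
  shows "F \<in> H" "Re (ip F F) \<le> C\<^sup>2"
proof -
  define \<phi> where "\<phi> Y = Re (fin_ip k Y F F)" for Y
  define G where "G Y = kcomb (coords k Y F) Y" for Y
  have GH: "G Y \<in> H" if "finite Y" "Y \<subseteq> X" for Y unfolding G_def using that by (rule kcomb(1))
  have Gval: "G Y x = F x" if "finite Y" "Y \<subseteq> X" "x \<in> Y" for Y x
    unfolding G_def using that by (subst kcomb_apply) (auto intro: coords[OF k F])
  have fin: "fin_ip k Y F F = of_real (\<phi> Y)" if "finite Y" "Y \<subseteq> X" for Y
    unfolding \<phi>_def by (rule fin_ip_nonneg(2)[OF k F that])
  have ipG: "ip (G Y') (G Y) = of_real (\<phi> Y)" if Y: "finite Y'" "Y' \<subseteq> X" "Y \<subseteq> Y'" for Y Y'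
  proof -
    have Y': "finite Y" "Y \<subseteq> X" using Y finite_subset by auto
    have "ip (G Y') (G Y) = (\<Sum>x\<in>Y. cnj (coords k Y F x) * G Y' x)"
      unfolding G_def[of Y] by (rule kcomb(2)[OF Y' GH[OF Y(1,2)]])
    also have "\<dots> = (\<Sum>x\<in>Y. cnj (coords k Y F x) * F x)"
      using Gval[OF Y(1,2)] Y(3) by (intro sum.cong) auto
    also have "\<dots> = of_real (\<phi> Y)"
      unfolding fin_ip_self(2)[OF k F Y', symmetric] by (rule fin[OF Y'])
    finally show ?thesis .
  qed
  have dist: "Re (ip (\<lambda>x. G Y' x - G Y x) (\<lambda>x. G Y' x - G Y x)) = \<phi> Y' - \<phi> Y"
    if Y: "finite Y'" "Y' \<subseteq> X" "Y \<subseteq> Y'" for Y Y'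
  proof -
    have Y': "finite Y" "Y \<subseteq> X" using Y finite_subset by auto
    have "ip (G Y) (G Y') = of_real (\<phi> Y)"
      using ip_cnj[OF GH[OF Y(1,2)] GH[OF Y']] ipG[OF Y] by simp
    then show ?thesis
      using ipG[OF Y] ipG[OF Y(1,2) order_refl] ipG[OF Y' order_refl] GH[OF Y(1,2)] GH[OF Y']
      by (simp add: ip_diff ip_diff_right rkhs_diff)
  qed
  let ?S = "\<phi> ` {Y. finite Y \<and> Y \<subseteq> X}"
  define L where "L = Sup ?S"
  have bdd: "bdd_above ?S" using fin_ip_le[OF k F] by (auto intro!: bdd_aboveI simp: \<phi>_def)
  have up: "\<phi> Y \<le> L" if "finite Y" "Y \<subseteq> X" for Y
    unfolding L_def using that bdd by (intro cSup_upper) auto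
  have LC: "L \<le> C\<^sup>2"
    unfolding L_def using fin_ip_le[OF k F] by (intro cSup_least) (auto simp: \<phi>_def)
  have "\<exists>Y. finite Y \<and> Y \<subseteq> X \<and> L - 1 / Suc n < \<phi> Y" for n
  proof -
    have "L - 1 / Suc n < L" by simp
    then have "L - 1 / Suc n < Sup ?S" unfolding L_def .
    then show ?thesis using bdd by (subst (asm) less_cSup_iff) auto
  qed
  then obtain Y where Y: "\<And>n. finite (Y n)" "\<And>n. Y n \<subseteq> X" "\<And>n. L - 1 / Suc n < \<phi> (Y n)" by metis
  define Z where "Z n = (\<Union>i\<le>n. Y i)" for n
  have Z: "finite (Z n)" "Z n \<subseteq> X" for n using Y by (auto simp: Z_def)
  have Zmono: "Z m \<subseteq> Z n" if "m \<le> n" for m n using that by (force simp: Z_def)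
  have close: "Re (ip (\<lambda>x. G Y' x - G (Z n) x) (\<lambda>x. G Y' x - G (Z n) x)) \<le> 1 / Suc n"
    if "finite Y'" "Y' \<subseteq> X" "Z n \<subseteq> Y'" for Y' n
  proof -
    have "\<phi> (Y n) \<le> \<phi> (Z n)"
      unfolding \<phi>_def by (rule fin_ip_mono[OF k F Z]) (auto simp: Z_def)
    then show ?thesis using dist[OF that] up[OF that(1,2)] Y(3)[of n] by linarith
  qed
  have "\<exists>f\<in>H. (\<lambda>n. sqrt (Re (ip (\<lambda>x. G (Z n) x - f x) (\<lambda>x. G (Z n) x - f x)))) \<longlonglongrightarrow> 0"
  proof (rule rkhs_complete)
    show "G (Z n) \<in> H" for n by (rule GH[OF Z])
    fix e :: real assume e: "0 < e"
    then obtain M where M: "1 / Suc M < e\<^sup>2"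
      by (meson nat_approx_posE zero_less_power)
    have one: "sqrt (Re (ip (\<lambda>x. G (Z n) x - G (Z m) x) (\<lambda>x. G (Z n) x - G (Z m) x))) < e" if "M \<le> m" "m \<le> n" for m n
    proof -
      have "Re (ip (\<lambda>x. G (Z n) x - G (Z m) x) (\<lambda>x. G (Z n) x - G (Z m) x)) \<le> 1 / Suc m"
        by (rule close[OF Z Zmono[OF that(2)]])
      also have "\<dots> \<le> 1 / Suc M" using that by (simp add: frac_le)
      also have "\<dots> < e\<^sup>2" by (rule M)
      finally show ?thesis using e by (metis abs_of_pos real_sqrt_abs real_sqrt_less_iff)
    qed
    have sym: "ip (\<lambda>x. G (Z n) x - G (Z m) x) (\<lambda>x. G (Z n) x - G (Z m) x) =
        ip (\<lambda>x. G (Z m) x - G (Z n) x) (\<lambda>x. G (Z m) x - G (Z n) x)" for m n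
      by (simp add: ip_diff ip_diff_right rkhs_diff GH[OF Z])
    have "sqrt (Re (ip (\<lambda>x. G (Z n) x - G (Z m) x) (\<lambda>x. G (Z n) x - G (Z m) x))) < e" if "M \<le> m" "M \<le> n" for m n
      using one[of m n] one[of n m] sym[of m n] that by (cases "m \<le> n") auto
    then show "\<exists>M. \<forall>m\<ge>M. \<forall>n\<ge>M. sqrt (Re (ip (\<lambda>x. G (Z m) x - G (Z n) x) (\<lambda>x. G (Z m) x - G (Z n) x))) < e" by blast
  qed
  then obtain f where f: "f \<in> H" and lim: "(\<lambda>n. sqrt (Re (ip (\<lambda>x. G (Z n) x - f x) (\<lambda>x. G (Z n) x - f x)))) \<longlonglongrightarrow> 0" by blast
  have "F x = f x" for x
  proof (cases "x \<in> X")
    case False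
    then show ?thesis using F rkhs_zero_off[OF f] by (simp add: rk_bounded_def)
  next
    case True
    let ?s = "sqrt (Re (k x x))"
    have "cmod (F x - f x) \<le> sqrt (1 / Suc n) * ?s + sqrt (Re (ip (\<lambda>x. G (Z n) x - f x) (\<lambda>x. G (Z n) x - f x))) * ?s" for n
    proof -
      let ?Z = "insert x (Z n)"
      have Z': "finite ?Z" "?Z \<subseteq> X" "Z n \<subseteq> ?Z" using Z True by auto
      have s: "0 \<le> ?s" using kernel_diag_nonneg[OF k True] by (simp add: less_eq_complex_def)
      have "cmod (F x - f x) = cmod ((G ?Z x - G (Z n) x) + (G (Z n) x - f x))"
        using Gval[OF Z'(1,2), of x] by simp
      also have "\<dots> \<le> cmod (G ?Z x - G (Z n) x) + cmod (G (Z n) x - f x)"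
        by (rule norm_triangle_ineq)
      also have "\<dots> \<le> sqrt (Re (ip (\<lambda>x. G ?Z x - G (Z n) x) (\<lambda>x. G ?Z x - G (Z n) x))) * ?s +
          sqrt (Re (ip (\<lambda>x. G (Z n) x - f x) (\<lambda>x. G (Z n) x - f x))) * ?s"
        using rk_bounded_point[OF k rkhs_bounded[OF rkhs_diff[OF GH[OF Z'(1,2)] GH[OF Z, of n]]] True]
          rk_bounded_point[OF k rkhs_bounded[OF rkhs_diff[OF GH[OF Z, of n] f]] True] by (rule add_mono)
      also have "\<dots> \<le> sqrt (1 / Suc n) * ?s + sqrt (Re (ip (\<lambda>x. G (Z n) x - f x) (\<lambda>x. G (Z n) x - f x))) * ?s"
        using close[OF Z'] s by (intro add_mono mult_right_mono order_refl) auto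
      finally show ?thesis .
    qed
    moreover have "(\<lambda>n. sqrt (1 / Suc n) * ?s + sqrt (Re (ip (\<lambda>x. G (Z n) x - f x) (\<lambda>x. G (Z n) x - f x))) * ?s) \<longlonglongrightarrow> sqrt 0 * ?s + 0 * ?s"
      using LIMSEQ_inverse_real_of_nat by (intro tendsto_intros lim) (simp add: inverse_eq_divide)
    ultimately have "cmod (F x - f x) \<le> 0"
      by (intro LIMSEQ_le_const[where X = "\<lambda>n. sqrt (1 / Suc n) * ?s + sqrt (Re (ip (\<lambda>x. G (Z n) x - f x) (\<lambda>x. G (Z n) x - f x))) * ?s"]) auto
    then show ?thesis by simp
  qed
  then have Ff: "F = f" by auto
  then show FH: "F \<in> H" using f by simp
  have "Re (ip F F) \<le> (sqrt (Re (ip (\<lambda>x. G (Z n) x - F x) (\<lambda>x. G (Z n) x - F x))))\<^sup>2 + C\<^sup>2" for n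
  proof -
    have 1: "ip F (G (Z n)) = of_real (\<phi> (Z n))"
      unfolding G_def kcomb(2)[OF Z FH] fin_ip_self(2)[OF k F Z, symmetric] by (rule fin[OF Z])
    then have 2: "ip (G (Z n)) F = of_real (\<phi> (Z n))"
      using ip_cnj[OF FH GH[OF Z]] by simp
    have "Re (ip (\<lambda>x. G (Z n) x - F x) (\<lambda>x. G (Z n) x - F x)) = Re (ip F F) - \<phi> (Z n)"
      using FH GH[OF Z] 1 2 ipG[OF Z order_refl] by (simp add: ip_diff ip_diff_right rkhs_diff)
    then show ?thesis
      using up[OF Z, of n] LC real_sqrt_pow2[OF ip_self(1)[OF rkhs_diff[OF GH[OF Z] FH]], of n] by linarith
  qed
  moreover have "(\<lambda>n. (sqrt (Re (ip (\<lambda>x. G (Z n) x - F x) (\<lambda>x. G (Z n) x - F x))))\<^sup>2 + C\<^sup>2) \<longlonglongrightarrow> 0\<^sup>2 + C\<^sup>2"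
    using lim unfolding Ff by (intro tendsto_intros)
  ultimately show "Re (ip F F) \<le> C\<^sup>2"
    by (intro LIMSEQ_le_const[where X = "\<lambda>n. (sqrt (Re (ip (\<lambda>x. G (Z n) x - F x) (\<lambda>x. G (Z n) x - F x))))\<^sup>2 + C\<^sup>2"]) auto
qed

text \<open>If all finite sections stayed below the norm by \<open>e\<close>, then \<open>g\<close> would be bounded by a constant smaller than
  its norm.\<close>

lemma rkhs_norm_approx:
  assumes g: "g \<in> H" and e: "0 < e"
  shows "\<exists>Y. finite Y \<and> Y \<subseteq> X \<and> Re (ip g g) - e \<le> Re (fin_ip k Y g g)"
proof (rule ccontr)
  assume "\<not> ?thesis"
  then have lt: "Re (fin_ip k Y g g) < Re (ip g g) - e" if "finite Y" "Y \<subseteq> X" for Y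
    using that by (meson not_le)
  note b = rkhs_bounded[OF g]
  have pos: "0 \<le> Re (ip g g) - e" using lt[of "{}"] by (simp add: fin_ip_def)
  have "rk_bounded X k (sqrt (Re (ip g g) - e)) g"
    unfolding rk_bounded_def
  proof (intro conjI allI impI)
    show "0 \<le> sqrt (Re (ip g g) - e)" using pos by simp
    show "g x = 0" if "x \<notin> X" for x using rkhs_zero_off[OF g that] .
    fix Y v assume Y: "finite Y \<and> Y \<subseteq> X"
    have "cmod (\<Sum>x\<in>Y. cnj (v x) * g x) \<le> sqrt (Re (fin_ip k Y g g)) * sqrt (Re (qf Y k v))"
      using fin_ip_bound[OF k b] Y by blast
    also have "\<dots> \<le> sqrt (Re (ip g g) - e) * sqrt (Re (qf Y k v))"
      using lt[of Y] Y qf_nonneg(1)[OF kernel_psd[OF k, of Y]] by (intro mult_right_mono) auto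
    finally show "cmod (\<Sum>x\<in>Y. cnj (v x) * g x) \<le> sqrt (Re (ip g g) - e) * sqrt (Re (qf Y k v))" .
  qed
  from rk_bounded_mem(2)[OF this] have "Re (ip g g) \<le> Re (ip g g) - e"
    using real_sqrt_pow2[OF pos] by linarith
  with e show False by simp
qed

end

section \<open>Contractive multipliers\<close>

text \<open>The form of the Pick matrix is the squared norm of a combination of kernel functions of \<open>l\<close> minus that of
  its image under the adjoint of multiplication by \<open>\<Phi>\<close>.\<close>

lemma qf_pick_block:
  fixes v :: "'a \<times> nat \<Rightarrow> complex"
  assumes "finite E"
  shows "qf (E \<times> {..<N}) (pick_block k l N \<Phi>) v =
    (\<Sum>p<N. qf E l (\<lambda>x. v (x, p))) - (\<Sum>m<N. qf E k (\<lambda>x. \<Sum>p<N. cnj (\<Phi> x p m) * v (x, p)))"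
proof -
  have 1: "qf (E \<times> {..<N}) (\<lambda>i j. l (fst i) (fst j) * (if snd i = snd j then 1 else 0)) v =
      (\<Sum>p<N. qf E l (\<lambda>x. v (x, p)))"
  proof -
    have "qf (E \<times> {..<N}) (\<lambda>i j. l (fst i) (fst j) * (if snd i = snd j then 1 else 0)) v =
        (\<Sum>x\<in>E. \<Sum>p<N. \<Sum>y\<in>E. \<Sum>q<N. if q = p then cnj (v (x, p)) * l x y * v (y, p) else 0)"
      unfolding qf_def sum.cartesian_product' by (intro sum.cong refl) auto
    also have "\<dots> = (\<Sum>x\<in>E. \<Sum>p<N. \<Sum>y\<in>E. cnj (v (x, p)) * l x y * v (y, p))"
      by (intro sum.cong refl) simp
    also have "\<dots> = (\<Sum>p<N. qf E l (\<lambda>x. v (x, p)))"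
      unfolding qf_def by (rule sum.swap)
    finally show ?thesis .
  qed
  have 2: "qf (E \<times> {..<N}) (\<lambda>i j. k (fst i) (fst j) * (\<Phi> (fst i) (snd i) m * cnj (\<Phi> (fst j) (snd j) m))) v =
      qf E k (\<lambda>x. \<Sum>p<N. cnj (\<Phi> x p m) * v (x, p))" for m
  proof -
    have "qf (E \<times> {..<N}) (\<lambda>i j. k (fst i) (fst j) * (\<Phi> (fst i) (snd i) m * cnj (\<Phi> (fst j) (snd j) m))) v =
        (\<Sum>x\<in>E. \<Sum>p<N. \<Sum>y\<in>E. \<Sum>q<N. (\<Phi> x p m * cnj (v (x, p))) * k x y * (cnj (\<Phi> y q m) * v (y, q)))"
      unfolding qf_def sum.cartesian_product' by (intro sum.cong refl) (auto simp: mult_ac)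
    also have "\<dots> = (\<Sum>x\<in>E. \<Sum>y\<in>E. \<Sum>p<N. \<Sum>q<N. (\<Phi> x p m * cnj (v (x, p))) * k x y * (cnj (\<Phi> y q m) * v (y, q)))"
      by (intro sum.cong refl sum.swap)
    also have "\<dots> = qf E k (\<lambda>x. \<Sum>p<N. cnj (\<Phi> x p m) * v (x, p))"
      unfolding qf_def cnj_sum
      by (intro sum.cong refl) (simp flip: sum_distrib_left sum_distrib_right)
    finally show ?thesis .
  qed
  have "qf (E \<times> {..<N}) (pick_block k l N \<Phi>) v =
     qf (E \<times> {..<N}) (\<lambda>i j. l (fst i) (fst j) * (if snd i = snd j then 1 else 0)) v -
     qf (E \<times> {..<N}) (\<lambda>i j. \<Sum>m<N. k (fst i) (fst j) * (\<Phi> (fst i) (snd i) m * cnj (\<Phi> (fst j) (snd j) m))) v"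
    unfolding qf_diff[symmetric] by (rule qf_cong) (simp_all add: pick_block_def sum_distrib_left)
  then show ?thesis
    unfolding qf_sum 1 2 .
qed

lemma mult_apply_adjoint:
  "(\<Sum>p<N. \<Sum>x\<in>E. cnj (v (x, p)) * mult_apply N \<Phi> f p x) =
   (\<Sum>m<N. \<Sum>x\<in>E. cnj (\<Sum>p<N. cnj (\<Phi> x p m) * v (x, p)) * f m x)"
proof -
  have "(\<Sum>p<N. \<Sum>x\<in>E. cnj (v (x, p)) * mult_apply N \<Phi> f p x) =
      (\<Sum>p<N. \<Sum>x\<in>E. \<Sum>m<N. \<Phi> x p m * cnj (v (x, p)) * f m x)"
    by (simp add: mult_apply_def sum_distrib_left mult_ac)
  also have "\<dots> = (\<Sum>x\<in>E. \<Sum>p<N. \<Sum>m<N. \<Phi> x p m * cnj (v (x, p)) * f m x)"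
    by (rule sum.swap)
  also have "\<dots> = (\<Sum>x\<in>E. \<Sum>m<N. \<Sum>p<N. \<Phi> x p m * cnj (v (x, p)) * f m x)"
    by (intro sum.cong refl sum.swap)
  also have "\<dots> = (\<Sum>m<N. \<Sum>x\<in>E. \<Sum>p<N. \<Phi> x p m * cnj (v (x, p)) * f m x)"
    by (rule sum.swap)
  also have "\<dots> = (\<Sum>m<N. \<Sum>x\<in>E. cnj (\<Sum>p<N. cnj (\<Phi> x p m) * v (x, p)) * f m x)"
    by (simp add: sum_distrib_right)
  finally show ?thesis .
qed

text \<open>Multiplication by \<open>\<Phi>\<close> is a contraction exactly if its adjoint is one on the finite combinations
  of kernel functions, which is the positivity of the Pick matrices.\<close>

theorem contractive_multiplier_iff:
  assumes k: "kernel X k" and l: "kernel X l"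
  shows "contractive_multiplier X k l N \<Phi> \<longleftrightarrow>
    (\<forall>E. finite E \<and> E \<subseteq> X \<longrightarrow> psd_on (E \<times> {..<N}) (pick_block k l N \<Phi>))"
proof -
  define Hk ik where "Hk = fst (rkhs X k)" and "ik = snd (rkhs X k)"
  define Hl il where "Hl = fst (rkhs X l)" and "il = snd (rkhs X l)"
  have Rk: "is_rkhs X k Hk ik" and Rl: "is_rkhs X l Hl il"
    using is_rkhs_rkhs[OF k] is_rkhs_rkhs[OF l] by (auto simp: Hk_def ik_def Hl_def il_def)
  define nk where "nk f = (\<Sum>q<N. Re (ik (f q) (f q)))" for f
  define nl where "nl f = (\<Sum>q<N. Re (il (f q) (f q)))" for f
  have cm: "contractive_multiplier X k l N \<Phi> \<longleftrightarrow>
      (\<forall>f. (\<forall>q<N. f q \<in> Hk) \<longrightarrow> (\<forall>q<N. mult_apply N \<Phi> f q \<in> Hl) \<and> nl (mult_apply N \<Phi> f) \<le> nk f)"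
    unfolding contractive_multiplier_def multipliers_def rkhs_tensor_def rkhs_tensor_norm_def
      nk_def nl_def Hk_def ik_def Hl_def il_def by auto
  define adj where "adj v m x = (\<Sum>p<N. cnj (\<Phi> x p m) * v (x, p))" for v :: "'a \<times> nat \<Rightarrow> complex" and m x
  have block: "Re (qf (E \<times> {..<N}) (pick_block k l N \<Phi>) v) =
      (\<Sum>p<N. Re (qf E l (\<lambda>x. v (x, p)))) - (\<Sum>m<N. Re (qf E k (adj v m)))" if "finite E" for E v
    unfolding qf_pick_block[OF that] adj_def by simp
  have real: "qf (E \<times> {..<N}) (pick_block k l N \<Phi>) v = of_real (Re (qf (E \<times> {..<N}) (pick_block k l N \<Phi>) v))"
    if E: "finite E" "E \<subseteq> X" for E v
  proof -
    have "Im (qf E l u) = 0" "Im (qf E k u) = 0" for u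
      using psd_onD[OF kernel_psd[OF k E]] psd_onD[OF kernel_psd[OF l E]] by (auto simp: less_eq_complex_def)
    then show ?thesis unfolding qf_pick_block[OF E(1)] by (simp add: complex_eq_iff)
  qed
  have nn: "0 \<le> Re (qf E k u)" "0 \<le> Re (qf E l u)" if E: "finite E" "E \<subseteq> X" for E u
    using qf_nonneg(1)[OF kernel_psd[OF k E]] qf_nonneg(1)[OF kernel_psd[OF l E]] by auto
  show ?thesis
    unfolding cm
  proof (intro iffI allI impI)
    fix E
    assume *: "\<forall>f. (\<forall>q<N. f q \<in> Hk) \<longrightarrow> (\<forall>q<N. mult_apply N \<Phi> f q \<in> Hl) \<and> nl (mult_apply N \<Phi> f) \<le> nk f"
      and E': "finite E \<and> E \<subseteq> X"
    then have E: "finite E" "E \<subseteq> X" by auto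
    show "psd_on (E \<times> {..<N}) (pick_block k l N \<Phi>)"
      unfolding psd_on_iff
    proof
      fix v
      define u where "u m = kcomb X k (adj v m) E" for m
      have u: "u m \<in> Hk" for m unfolding u_def by (rule kcomb(1)[OF k Rk E])
      let ?Mu = "mult_apply N \<Phi> u"
      have Mu: "?Mu q \<in> Hl" if "q < N" for q using * u that by blast
      define T where "T = (\<Sum>m<N. Re (qf E k (adj v m)))"
      define Q where "Q = (\<Sum>p<N. Re (qf E l (\<lambda>x. v (x, p))))"
      have T0: "0 \<le> T" "0 \<le> Q" unfolding T_def Q_def using nn[OF E] by (auto intro: sum_nonneg)
      have nku: "nk u = T"
        unfolding nk_def T_def u_def ip_kcomb_self[OF k Rk E] ..
      have "(\<Sum>p<N. \<Sum>x\<in>E. cnj (v (x, p)) * ?Mu p x) = (\<Sum>m<N. \<Sum>x\<in>E. cnj (adj v m x) * u m x)"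
        unfolding mult_apply_adjoint adj_def ..
      also have "\<dots> = (\<Sum>m<N. qf E k (adj v m))"
        unfolding kcomb(2)[OF k Rk E u, symmetric] unfolding u_def ip_kcomb_self[OF k Rk E] ..
      also have "\<dots> = of_real T"
        unfolding T_def of_real_sum using qf_nonneg(2)[OF kernel_psd[OF k E]] by (intro sum.cong) auto
      finally have "T = cmod (\<Sum>p<N. \<Sum>x\<in>E. cnj (v (x, p)) * ?Mu p x)" using T0 by simp
      also have "\<dots> \<le> (\<Sum>p<N. cmod (\<Sum>x\<in>E. cnj (v (x, p)) * ?Mu p x))" by (rule norm_sum)
      also have "\<dots> \<le> (\<Sum>p<N. sqrt (Re (il (?Mu p) (?Mu p))) * sqrt (Re (qf E l (\<lambda>x. v (x, p)))))"
        using rk_boundedD[OF rkhs_bounded[OF l Rl Mu] E] by (intro sum_mono) auto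
      also have "\<dots> \<le> sqrt (nl ?Mu) * sqrt Q"
        unfolding nl_def Q_def using ip_self(1)[OF l Rl Mu] nn[OF E] by (intro sum_mult_le_sqrt_sums) auto
      also have "\<dots> \<le> sqrt T * sqrt Q"
        using * u nku T0 by (intro mult_right_mono) auto
      finally have "sqrt T \<le> sqrt Q" using T0 by (intro sqrt_le_of_le_mult_sqrt) (auto simp: mult.commute)
      then have "0 \<le> Q - T" by simp
      then show "0 \<le> qf (E \<times> {..<N}) (pick_block k l N \<Phi>) v"
        by (subst real[OF E]) (simp only: complex_of_real_nonneg_iff block[OF E(1)] T_def Q_def)
    qed
  next
    fix f
    assume "\<forall>E. finite E \<and> E \<subseteq> X \<longrightarrow> psd_on (E \<times> {..<N}) (pick_block k l N \<Phi>)"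
      and f': "\<forall>q<N. f q \<in> Hk"
    then have psd: "psd_on (E \<times> {..<N}) (pick_block k l N \<Phi>)" if "finite E" "E \<subseteq> X" for E using that by auto
    have f: "f q \<in> Hk" if "q < N" for q using f' that by auto
    have nk0: "0 \<le> nk f" unfolding nk_def using ip_self(1)[OF k Rk f] by (auto intro: sum_nonneg)
    have main: "cmod (\<Sum>p<N. \<Sum>x\<in>E. cnj (v (x, p)) * mult_apply N \<Phi> f p x) \<le> sqrt (nk f) * sqrt (\<Sum>p<N. Re (qf E l (\<lambda>x. v (x, p))))"
      if E: "finite E" "E \<subseteq> X" for E v
    proof -
      have "cmod (\<Sum>p<N. \<Sum>x\<in>E. cnj (v (x, p)) * mult_apply N \<Phi> f p x) = cmod (\<Sum>m<N. \<Sum>x\<in>E. cnj (adj v m x) * f m x)"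
        unfolding mult_apply_adjoint adj_def ..
      also have "\<dots> \<le> (\<Sum>m<N. cmod (\<Sum>x\<in>E. cnj (adj v m x) * f m x))" by (rule norm_sum)
      also have "\<dots> \<le> (\<Sum>m<N. sqrt (Re (ik (f m) (f m))) * sqrt (Re (qf E k (adj v m))))"
        using rk_boundedD[OF rkhs_bounded[OF k Rk f] E] by (intro sum_mono) auto
      also have "\<dots> \<le> sqrt (nk f) * sqrt (\<Sum>m<N. Re (qf E k (adj v m)))"
        unfolding nk_def using ip_self(1)[OF k Rk f] nn[OF E] by (intro sum_mult_le_sqrt_sums) auto
      also have "\<dots> \<le> sqrt (nk f) * sqrt (\<Sum>p<N. Re (qf E l (\<lambda>x. v (x, p))))"
        using psd_onD[OF psd[OF E], of v] block[OF E(1), of v] nk0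
        by (intro mult_left_mono) (auto simp: less_eq_complex_def)
      finally show ?thesis .
    qed
    let ?g = "mult_apply N \<Phi> f"
    have "rk_bounded X l (sqrt (nk f)) (?g q)" if q: "q < N" for q
      unfolding rk_bounded_def
    proof (intro conjI allI impI)
      show "0 \<le> sqrt (nk f)" using nk0 by simp
      show "?g q x = 0" if "x \<notin> X" for x
        unfolding mult_apply_def using rkhs_zero_off[OF k Rk f that] by (intro sum.neutral) auto
      fix E and v :: "'a \<Rightarrow> complex" assume E: "finite E \<and> E \<subseteq> X"
      define v' where "v' i = (if snd i = q then v (fst i) else 0)" for i :: "'a \<times> nat"
      have "(\<Sum>p<N. \<Sum>x\<in>E. cnj (v' (x, p)) * ?g p x) = (\<Sum>p<N. if p = q then \<Sum>x\<in>E. cnj (v x) * ?g q x else 0)"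
        by (intro sum.cong refl) (auto simp: v'_def)
      also have "\<dots> = (\<Sum>x\<in>E. cnj (v x) * ?g q x)" using q by simp
      finally have 1: "(\<Sum>p<N. \<Sum>x\<in>E. cnj (v' (x, p)) * ?g p x) = (\<Sum>x\<in>E. cnj (v x) * ?g q x)" .
      have "(\<Sum>p<N. Re (qf E l (\<lambda>x. v' (x, p)))) = (\<Sum>p<N. if p = q then Re (qf E l v) else 0)"
        by (intro sum.cong refl) (auto simp: v'_def qf_def)
      also have "\<dots> = Re (qf E l v)" using q by simp
      finally show "cmod (\<Sum>x\<in>E. cnj (v x) * ?g q x) \<le> sqrt (nk f) * sqrt (Re (qf E l v))"
        using main[of E v'] E 1 by simp
    qed
    note bd = this
    have gH: "?g q \<in> Hl" if "q < N" for q
      by (rule rk_bounded_mem(1)[OF l Rl bd[OF that]])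
    have fin: "(\<Sum>p<N. Re (fin_ip l E (?g p) (?g p))) \<le> nk f" if E: "finite E" "E \<subseteq> X" for E
    proof -
      define S where "S = (\<Sum>p<N. Re (fin_ip l E (?g p) (?g p)))"
      define v where "v i = coords l E (?g (snd i)) (fst i)" for i
      have S0: "0 \<le> S" unfolding S_def using fin_ip_nonneg(1)[OF l bd E] by (intro sum_nonneg) auto
      have "(\<Sum>p<N. \<Sum>x\<in>E. cnj (v (x, p)) * ?g p x) = (\<Sum>p<N. fin_ip l E (?g p) (?g p))"
        by (intro sum.cong refl) (simp add: v_def fin_ip_self(2)[OF l bd E])
      also have "\<dots> = of_real S"
        unfolding S_def of_real_sum using fin_ip_nonneg(2)[OF l bd E] by (intro sum.cong refl) auto
      finally have 1: "cmod (\<Sum>p<N. \<Sum>x\<in>E. cnj (v (x, p)) * ?g p x) = S" using S0 by simp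
      have 2: "(\<Sum>p<N. Re (qf E l (\<lambda>x. v (x, p)))) = S"
        unfolding S_def by (intro sum.cong refl) (simp add: v_def fin_ip_self(1)[OF l bd E])
      have "S \<le> sqrt (nk f) * sqrt S" using main[OF E, of v] unfolding 1 2 .
      then have "sqrt S \<le> sqrt (nk f)" using S0 nk0 by (intro sqrt_le_of_le_mult_sqrt) auto
      then show ?thesis by (simp add: S_def)
    qed
    have "nl ?g \<le> nk f"
    proof (rule field_le_epsilon)
      fix e :: real assume e: "0 < e"
      have "\<exists>Y. finite Y \<and> Y \<subseteq> X \<and> (q < N \<longrightarrow> Re (il (?g q) (?g q)) - e / Suc N \<le> Re (fin_ip l Y (?g q) (?g q)))" for q
        using rkhs_norm_approx[OF l Rl gH, of q "e / Suc N"] e by (cases "q < N") auto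
      then obtain Y where Y: "\<And>q. finite (Y q)" "\<And>q. Y q \<subseteq> X"
        "\<And>q. q < N \<Longrightarrow> Re (il (?g q) (?g q)) - e / Suc N \<le> Re (fin_ip l (Y q) (?g q) (?g q))" by metis
      define E where "E = (\<Union>q<N. Y q)"
      have E: "finite E" "E \<subseteq> X" using Y by (auto simp: E_def)
      have "nl ?g - N * (e / Suc N) = (\<Sum>q<N. Re (il (?g q) (?g q)) - e / Suc N)"
        by (simp add: nl_def sum_subtractf)
      also have "\<dots> \<le> (\<Sum>q<N. Re (fin_ip l E (?g q) (?g q)))"
      proof (rule sum_mono)
        fix q assume q: "q \<in> {..<N}"
        then have "Re (fin_ip l (Y q) (?g q) (?g q)) \<le> Re (fin_ip l E (?g q) (?g q))"
          by (intro fin_ip_mono[OF l bd E]) (auto simp: E_def)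
        then show "Re (il (?g q) (?g q)) - e / Suc N \<le> Re (fin_ip l E (?g q) (?g q))"
          using Y(3)[of q] q by simp
      qed
      also have "\<dots> \<le> nk f" by (rule fin[OF E])
      finally have "nl ?g \<le> nk f + N * (e / Suc N)" by simp
      also have "N * (e / Suc N) \<le> e" using e by (simp add: field_simps)
      finally show "nl ?g \<le> nk f + e" by simp
    qed
    then show "(\<forall>q<N. ?g q \<in> Hl) \<and> nl ?g \<le> nk f" using gH by auto
  qed
qed

section \<open>Complete Pick pairs\<close>

text \<open>The nodes of a Pick problem may coincide, but positivity then forces the targets to coincide as well.\<close>

lemma psd_pick_block_equal_nodes:
  fixes n N :: nat
  assumes psd: "psd_on ({..<n} \<times> {..<N}) (pick_block (\<lambda>i j. k (z i) (z j)) (\<lambda>i j. l (z i) (z j)) N W)"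
    and ij: "i < n" "j < n" "z i = z j" and k: "0 \<le> k (z i) (z i)" "k (z i) (z i) \<noteq> 0" and pm: "p < N" "m < N"
  shows "W i p m = W j p m"
proof (rule ccontr)
  assume ne: "W i p m \<noteq> W j p m"
  then have "i \<noteq> j" by auto
  let ?E = "{i, j}" and ?k = "\<lambda>i j. k (z i) (z j)" and ?l = "\<lambda>i j. l (z i) (z j)"
  have psd': "psd_on (?E \<times> {..<N}) (pick_block ?k ?l N W)"
    by (rule psd_on_subset[OF psd]) (use ij in auto)
  define v where "v x = (if snd x = p then if fst x = i then 1 else -1 else 0 :: complex)" for x :: "nat \<times> nat"
  define c where "c = k (z i) (z i)"
  obtain r where r: "c = of_real r" "0 < r"
    using k unfolding c_def by (metis nonneg_complex_cases less_eq_real_def of_real_0)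
  have 1: "qf ?E ?l (\<lambda>x. v (x, q)) = 0" for q
    using \<open>i \<noteq> j\<close> ij(3) by (simp add: qf_def v_def)
  have *: "(\<Sum>q<N. cnj (W x q t) * v (x, q)) = cnj (W x p t) * (if x = i then 1 else -1)" for x t
  proof -
    have "(\<Sum>q<N. cnj (W x q t) * v (x, q)) = (\<Sum>q<N. if q = p then cnj (W x p t) * (if x = i then 1 else -1) else 0)"
      by (intro sum.cong) (auto simp: v_def)
    then show ?thesis using pm by simp
  qed
  have 2: "qf ?E ?k (\<lambda>x. \<Sum>q<N. cnj (W x q t) * v (x, q)) = of_real (r * (cmod (W i p t - W j p t))\<^sup>2)" for t
  proof -
    have "qf ?E ?k u = c * (cnj (u i + u j) * (u i + u j))" for u
      using \<open>i \<noteq> j\<close> ij(3) by (simp add: qf_def c_def algebra_simps)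
    moreover have "cmod (cnj (W i p t) - cnj (W j p t)) = cmod (W i p t - W j p t)"
      by (metis complex_cnj_diff complex_mod_cnj)
    ultimately show ?thesis
      unfolding * using \<open>i \<noteq> j\<close> by (simp only: cnj_mult_self complex_mod_cnj r(1) of_real_mult) simp
  qed
  have "0 \<le> qf (?E \<times> {..<N}) (pick_block ?k ?l N W) v"
    by (rule psd_onD[OF psd'])
  also have "\<dots> = - of_real (\<Sum>t<N. r * (cmod (W i p t - W j p t))\<^sup>2)"
    unfolding qf_pick_block[OF finite.insertI[OF finite.insertI[OF finite.emptyI]]] 1 2 by simp
  finally have "(\<Sum>t<N. r * (cmod (W i p t - W j p t))\<^sup>2) \<le> 0"
    by (simp add: less_eq_complex_def)
  moreover have "0 < (\<Sum>t<N. r * (cmod (W i p t - W j p t))\<^sup>2)"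
    using pm ne r by (intro sum_pos2[of _ m]) auto
  ultimately show False by simp
qed

theorem shimorin_imp_complete_pick_pair:
  assumes k: "kernel X k" and l: "kernel X l" and S: "shimorin_certificate X k l p"
    and nz: "\<And>z. z \<in> X \<Longrightarrow> k z z \<noteq> 0" "\<And>z. z \<in> X \<Longrightarrow> l z z \<noteq> 0"
  shows "complete_pick_pair X k l"
  unfolding complete_pick_pair_def
proof (intro allI impI, elim conjE)
  fix n N and z :: "nat \<Rightarrow> 'a" and W :: "nat \<Rightarrow> nat \<Rightarrow> nat \<Rightarrow> complex"
  assume "1 \<le> n" "1 \<le> N" and z: "\<forall>i<n. z i \<in> X"
    and "psd_on ({..<n} \<times> {..<N})
          (\<lambda>(i, p) (j, q). l (z i) (z j) * (if p = q then 1 else 0)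
             - k (z i) (z j) * (\<Sum>m<N. W i p m * cnj (W j q m)))"
  then have psd: "psd_on ({..<n} \<times> {..<N}) (pick_block (\<lambda>i j. k (z i) (z j)) (\<lambda>i j. l (z i) (z j)) N W)"
    by (simp add: pick_block_def[abs_def] case_prod_unfold)
  define Y where "Y = z ` {..<n}"
  have Y: "finite Y" "Y \<subseteq> X" using z by (auto simp: Y_def)
  define idx where "idx = inv_into {..<n} z"
  have idx: "idx y < n" "z (idx y) = y" if "y \<in> Y" for y
    using that inv_into_into[of y z "{..<n}"] f_inv_into_f[of y z "{..<n}"] by (auto simp: idx_def Y_def)
  have "psd_on (Y \<times> {..<N}) (\<lambda>i j. pick_block (\<lambda>i j. k (z i) (z j)) (\<lambda>i j. l (z i) (z j)) N W
      (idx (fst i), snd i) (idx (fst j), snd j))"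
    by (rule psd_on_reindex[OF psd]) (use Y idx in auto)
  then have "psd_on (Y \<times> {..<N}) (pick_block k l N (\<lambda>y. W (idx y)))"
    by (rule iffD1[OF psd_on_cong, rotated]) (auto simp: pick_block_def idx)
  from shimorin_interpolation[OF k l S nz Y this] obtain \<Phi> where
    \<Phi>: "\<forall>x\<in>Y. \<forall>p<N. \<forall>m<N. \<Phi> x p m = W (idx x) p m"
    "\<forall>E. finite E \<and> E \<subseteq> X \<longrightarrow> psd_on (E \<times> {..<N}) (pick_block k l N \<Phi>)" by blast
  show "\<exists>\<Phi>. contractive_multiplier X k l N \<Phi> \<and> (\<forall>i<n. \<forall>p<N. \<forall>q<N. \<Phi> (z i) p q = W i p q)"
  proof (intro exI[of _ \<Phi>] conjI allI impI)
    show "contractive_multiplier X k l N \<Phi>"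
      using \<Phi>(2) contractive_multiplier_iff[OF k l] by blast
    fix i p q assume i: "i < n" "p < N" "q < N"
    then have zi: "z i \<in> Y" "z i \<in> X" using z by (auto simp: Y_def)
    then have "\<Phi> (z i) p q = W (idx (z i)) p q" using \<Phi>(1) i by blast
    also have "\<dots> = W i p q"
      by (rule psd_pick_block_equal_nodes[where k = k and l = l and z = z and n = n and N = N, OF psd])
        (use idx[OF zi(1)] i kernel_diag_nonneg[OF k zi(2)] nz(1)[OF zi(2)] in auto)
    finally show "\<Phi> (z i) p q = W i p q" .
  qed
qed

text \<open>Here the data are single rows whose Gram matrix is \<open>V\<close>. The interpolating multiplier extends
  \<open>V\<close> to the additional point \<open>z\<close>, and passing to the Schur complement at \<open>z\<close> removes the
  unknown values.\<close>

theorem complete_pick_pair_necessity: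
  assumes P: "complete_pick_pair X k l" and k: "kernel X k" and l: "kernel X l"
    and Y: "finite Y" "Y \<subseteq> X" "z \<in> X" "k z z \<noteq> 0"
    and V: "psd_on Y V" "psd_on Y (\<lambda>x y. l x y - k x y * V x y)"
  shows "psd_on Y (\<lambda>x y. kernel_at l z x y - kernel_at k z x y * V x y)"
proof (cases "Y = {}")
  case True
  then show ?thesis by (simp add: psd_on_iff qf_def)
next
  case False
  obtain f :: "nat \<Rightarrow> 'a \<Rightarrow> complex" where
    f: "\<And>i j. i \<in> Y \<Longrightarrow> j \<in> Y \<Longrightarrow> V i j = (\<Sum>r<card Y. f r i * cnj (f r j))"
    using psd_on_gram_decomposition[OF Y(1) V(1)] by blast
  define N where "N = card Y"
  have N: "1 \<le> N" using False Y(1) by (simp add: N_def Suc_le_eq card_gt_0_iff)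
  obtain w where w: "bij_betw w {..<N} Y"
    using ex_bij_betw_nat_finite[OF Y(1)] by (auto simp: lessThan_atLeast0 N_def)
  have wY: "w i \<in> Y" if "i < N" for i using bij_betwE[OF w] that by auto
  define U where "U x p m = (if p = (0::nat) then f m x else 0)" for x p m
  have "psd_on (Y \<times> {..<N}) (pick_block k l N U)"
  proof -
    define e where "e i = (if snd i = (0::nat) then 1 else 0 :: complex)" for i :: "'a \<times> nat"
    have "psd_on (Y \<times> {..<N}) (\<lambda>i j. (l (fst i) (fst j) - k (fst i) (fst j) * V (fst i) (fst j)) * (e i * cnj (e j)))"
      using Y by (intro psd_on_mult psd_on_rank_one psd_on_reindex[OF V(2), of _ fst]) auto
    moreover have "psd_on (Y \<times> {..<N}) (\<lambda>i j. (l (fst i) (fst j) * (if snd i = snd j then 1 else 0)) * ((1 - e i) * cnj (1 - e j)))"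
      using Y by (intro psd_on_mult[OF _ psd_on_kernel_delta psd_on_rank_one] kernel_psd[OF l]) auto
    ultimately have "psd_on (Y \<times> {..<N}) (\<lambda>i j. (l (fst i) (fst j) - k (fst i) (fst j) * V (fst i) (fst j)) * (e i * cnj (e j)) +
        (l (fst i) (fst j) * (if snd i = snd j then 1 else 0)) * ((1 - e i) * cnj (1 - e j)))"
      by (rule psd_on_add)
    then show ?thesis
      by (rule iffD1[OF psd_on_cong, rotated]) (auto simp: pick_block_def U_def e_def f N_def)
  qed
  then have "psd_on ({..<N} \<times> {..<N}) (\<lambda>i j. pick_block k l N U (w (fst i), snd i) (w (fst j), snd j))"
    by (rule psd_on_reindex) (use Y wY in auto)
  then have "psd_on ({..<N} \<times> {..<N})
          (\<lambda>(i, p) (j, q). l (w i) (w j) * (if p = q then 1 else 0)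
             - k (w i) (w j) * (\<Sum>m<N. U (w i) p m * cnj (U (w j) q m)))"
    by (simp add: pick_block_def[abs_def] case_prod_unfold)
  then obtain \<Phi> where \<Phi>: "contractive_multiplier X k l N \<Phi>" "\<forall>i<N. \<forall>p<N. \<forall>q<N. \<Phi> (w i) p q = U (w i) p q"
    using P[unfolded complete_pick_pair_def, rule_format, of N N w "\<lambda>i. U (w i)"] N wY Y(2) by blast
  have \<Phi>U: "\<Phi> y p q = U y p q" if "y \<in> Y" "p < N" "q < N" for y p q
  proof -
    have "y \<in> w ` {..<N}" using that(1) w by (simp add: bij_betw_def)
    then obtain i where "i < N" "y = w i" by blast
    then show ?thesis using \<Phi>(2) that by blast
  qed
  let ?K = "insert z Y"
  have K: "finite ?K" "?K \<subseteq> X" "z \<in> ?K" using Y by auto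
  define V' where "V' x y = (\<Sum>m<N. \<Phi> x 0 m * cnj (\<Phi> y 0 m))" for x y
  have V'V: "V' x y = V x y" if "x \<in> Y" "y \<in> Y" for x y
    using that N \<Phi>U by (simp add: V'_def f N_def U_def)
  have "psd_on (?K \<times> {..<N}) (pick_block k l N \<Phi>)"
    using \<Phi>(1) contractive_multiplier_iff[OF k l] K by blast
  then have "psd_on ?K (\<lambda>x y. pick_block k l N \<Phi> (x, 0) (y, 0))"
    by (rule psd_on_reindex) (use K N in auto)
  then have "psd_on ?K (\<lambda>x y. l x y - k x y * V' x y)"
    by (simp add: pick_block_def V'_def)
  moreover have "psd_on ?K (\<lambda>x y. k x z * k z y / k z z * V' x y)"
    unfolding V'_def using K by (intro psd_on_mult psd_on_minus_kernel_at[OF kernel_psd[OF k]] psd_on_gram) auto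
  ultimately have "psd_on ?K (\<lambda>x y. (l x y - k x y * V' x y) + k x z * k z y / k z z * V' x y)"
    by (rule psd_on_add)
  then have psd: "psd_on ?K (\<lambda>x y. l x y - kernel_at k z x y * V' x y)"
    by (rule iffD1[OF psd_on_cong, rotated]) (simp add: kernel_at_def left_diff_distrib)
  have "kernel_at k z x z = 0" "kernel_at k z z x = 0" for x using Y(4) by (auto simp: kernel_at_def)
  then have "kernel_at (\<lambda>x y. l x y - kernel_at k z x y * V' x y) z = (\<lambda>x y. kernel_at l z x y - kernel_at k z x y * V' x y)"
    unfolding kernel_at_def[of "\<lambda>x y. l x y - kernel_at k z x y * V' x y"] kernel_at_def[of l] by (intro ext) simp
  then have "psd_on ?K (\<lambda>x y. kernel_at l z x y - kernel_at k z x y * V' x y)"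
    using psd_on_kernel_at[OF psd K(1,3)] by simp
  then have "psd_on Y (\<lambda>x y. kernel_at l z x y - kernel_at k z x y * V' x y)"
    by (rule psd_on_subset) (use K in auto)
  then show ?thesis
    by (rule iffD1[OF psd_on_cong, rotated]) (simp add: V'V)
qed

text \<open>One direction of the theorem of McCullough and Quiggin. The induction is on the number
  of points: positivity for the base point \<open>y\<close> among the points themselves is the induction
  hypothesis, and interpolation transfers it to the base point \<open>z\<close>.\<close>

theorem complete_pick_kernel_imp_kernel_at_quotient:
  assumes P: "complete_pick_pair X t t" and t: "kernel X t" and B: "B \<subseteq> X"
    and nz: "\<And>x y. x \<in> B \<Longrightarrow> y \<in> B \<Longrightarrow> t x y \<noteq> 0" and z: "z \<in> B"
  shows "kernel B (\<lambda>x y. kernel_at t z x y / t x y)"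
proof (rule kernelI)
  fix Y assume "finite Y" "Y \<subseteq> B"
  then show "psd_on Y (\<lambda>x y. kernel_at t z x y / t x y)"
    using z
  proof (induction Y arbitrary: z rule: finite_induct)
    case empty
    then show ?case by (simp add: psd_on_iff qf_def)
  next
    case (insert y Y)
    let ?K = "insert y Y"
    have yB: "y \<in> B" and K: "finite ?K" "?K \<subseteq> X" using insert B by auto
    have tnz: "t x x' \<noteq> 0" if "x \<in> ?K" "x' \<in> ?K" for x x' using that insert nz by auto
    define V where "V x x' = kernel_at t y x x' / t x x'" for x x'
    have V0: "V y x = 0" "V x y = 0" for x
      using nz[OF yB yB] by (auto simp: V_def kernel_at_def)
    have "psd_on ?K V"
      by (rule psd_on_zero_extend[OF K(1) _ insert.IH[OF _ yB, folded V_def]])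
        (use V0 insert in \<open>auto simp: V_def\<close>)
    moreover have tV: "t x x' - t x x' * V x x' = t x y * t y x' / t y y" if "x \<in> ?K" "x' \<in> ?K" for x x'
      using tnz[OF that] by (simp add: V_def kernel_at_def)
    have "psd_on ?K (\<lambda>x x'. t x y * t y x' / t y y)"
      by (rule psd_on_minus_kernel_at[OF kernel_psd[OF t K] K(1)]) simp
    then have "psd_on ?K (\<lambda>x x'. t x x' - t x x' * V x x')"
      by (rule iffD1[OF psd_on_cong, rotated]) (simp add: tV)
    ultimately have "psd_on ?K (\<lambda>x x'. kernel_at t z x x' - kernel_at t z x x' * V x x')"
      using B insert.prems nz by (intro complete_pick_pair_necessity[OF P t t K]) auto
    then have "psd_on ?K (\<lambda>x x'. (kernel_at t z x x' - kernel_at t z x x' * V x x') * ((1 / t x y) * cnj (1 / t x' y)))"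
      using K by (intro psd_on_mult psd_on_rank_one) auto
    then have "psd_on ?K (\<lambda>x x'. t y y * ((kernel_at t z x x' - kernel_at t z x x' * V x x') * ((1 / t x y) * cnj (1 / t x' y))))"
      using kernel_diag_nonneg[OF t, of y] yB B by (intro psd_on_scale) auto
    then show ?case
    proof (rule iffD1[OF psd_on_cong, rotated])
      fix x x' assume x: "x \<in> ?K" "x' \<in> ?K"
      have c: "cnj (t x' y) = t y x'" using kernel_hermitian[OF t, of x' y] x K by auto
      have "1 - V x x' = t x y * t y x' / (t y y * t x x')"
        using tnz[OF x] by (simp add: V_def kernel_at_def diff_divide_distrib)
      then have "kernel_at t z x x' - kernel_at t z x x' * V x x' = kernel_at t z x x' * (t x y * t y x' / (t y y * t x x'))"
        by (metis mult.right_neutral right_diff_distrib)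
      then show "t y y * ((kernel_at t z x x' - kernel_at t z x x' * V x x') * ((1 / t x y) * cnj (1 / t x' y))) =
          kernel_at t z x x' / t x x'"
        using tnz x by (simp add: c)
    qed
  qed
qed

section \<open>Strong Shimorin certificates\<close>

lemma kernel_minus_kernel_at: "kernel X k \<Longrightarrow> z \<in> X \<Longrightarrow> kernel X (\<lambda>x y. k x z * k z y / k z z)"
proof (rule kernelI)
  fix Y assume k: "kernel X k" "z \<in> X" and Y: "finite Y" "Y \<subseteq> X"
  have "psd_on (insert z Y) (\<lambda>x y. k x z * k z y / k z z)"
    using k Y by (intro psd_on_minus_kernel_at kernel_psd) auto
  then show "psd_on Y (\<lambda>x y. k x z * k z y / k z z)"
    by (rule psd_on_subset) (use Y in auto)
qed

text \<open>If \<open>h\<close> is the Gram function of vectors in the unit ball, this is, up to a factor, the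
  Gram function of their images under the ball automorphism that vanishes at \<open>z\<close>.\<close>

lemma kernel_ball_automorphism:
  assumes h: "kernel X h" and z: "z \<in> X" "h z z = of_real r" "r < 1"
  shows "kernel X (\<lambda>w v. (1 - h w z) * (1 - h z v) / (1 - h z z) - (1 - h w v))"
proof -
  define c where "c = h z z"
  have r0: "0 \<le> r" using kernel_diag_nonneg[OF h z(1)] z(2) by simp
  have "1 - c = of_real (1 - r)" by (simp add: c_def z(2))
  moreover have "complex_of_real (1 - r) \<noteq> 0" unfolding of_real_eq_0_iff using z(3) by simp
  ultimately have c1: "1 - c \<noteq> 0" by simp
  have "1 / (c * (1 - c)) = of_real (1 / (r * (1 - r)))"
    by (simp add: c_def z(2))
  moreover have "0 \<le> 1 / (r * (1 - r))" using r0 z(3) by simp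
  ultimately have "0 \<le> 1 / (c * (1 - c))" by (simp only: complex_of_real_nonneg_iff)
  then have "kernel X (\<lambda>w v. kernel_at h z w v + 1 / (c * (1 - c)) * ((h w z - c) * cnj (h v z - c)))"
    by (intro kernel_add kernel_kernel_at h z kernel_scale kernel_rank_one)
  then show ?thesis
  proof (rule iffD1[OF kernel_cong, rotated])
    fix w v assume wv: "w \<in> X" "v \<in> X"
    have "cnj (h v z - c) = h z v - c"
      using kernel_hermitian[OF h wv(2) z(1)] by (simp add: c_def z(2))
    moreover have "kernel_at h z w v + 1 / (c * (1 - c)) * ((h w z - c) * (h z v - c)) =
        (1 - h w z) * (1 - h z v) / (1 - c) - (1 - h w v)"
    proof (cases "c = 0")
      case True
      then have "h w z = 0" "h z v = 0"
        using kernel_zero_diag[OF h z(1)] wv by (auto simp: c_def)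
      then show ?thesis using True by (simp add: kernel_at_def c_def)
    next
      case False
      have "(1 - a) * (1 - b) / (1 - c) - (1 - d) = d - a * b / c + 1 / (c * (1 - c)) * ((a - c) * (b - c))" for a b d
        using False c1 by (simp add: divide_simps) (simp add: algebra_simps)
      then show ?thesis by (simp add: kernel_at_def c_def)
    qed
    ultimately show "kernel_at h z w v + 1 / (c * (1 - c)) * ((h w z - c) * cnj (h v z - c)) =
        (1 - h w z) * (1 - h z v) / (1 - h z z) - (1 - h w v)"
      by (simp add: c_def)
  qed
qed

text \<open>The certificate is \<open>p[z] = t\<^sup>z / t\<close>. With \<open>\<ell> = t g\<close>, the difference \<open>\<ell>\<^sup>z - p[z] \<ell>\<close> is the product of a
  rank one kernel and \<open>g\<^sup>z\<close>; with \<open>k = (1 - h) t\<close>, the difference \<open>p[z] k - k\<^sup>z\<close> is the product of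
  the same rank one kernel and the kernel of the ball automorphism.\<close>

theorem factorization_imp_shimorin_certificate:
  assumes t: "kernel X t" and h: "kernel X h" and g: "kernel X g" and k: "kernel X k"
    and tnz: "\<And>x y. x \<in> X \<Longrightarrow> y \<in> X \<Longrightarrow> t x y \<noteq> 0"
    and quot: "\<And>z. z \<in> X \<Longrightarrow> kernel X (\<lambda>x y. kernel_at t z x y / t x y)"
    and eqs: "\<And>x y. x \<in> X \<Longrightarrow> y \<in> X \<Longrightarrow> k x y = (1 - h x y) * t x y"
      "\<And>x y. x \<in> X \<Longrightarrow> y \<in> X \<Longrightarrow> l x y = t x y * g x y"
    and nz: "\<And>z. z \<in> X \<Longrightarrow> k z z \<noteq> 0" "\<And>z. z \<in> X \<Longrightarrow> l z z \<noteq> 0"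
  shows "shimorin_certificate X k l (\<lambda>z x y. kernel_at t z x y / t x y)"
  unfolding shimorin_certificate_def kernel_le_def
proof (intro ballI conjI)
  fix z assume z: "z \<in> X"
  show "kernel X (\<lambda>x y. kernel_at t z x y / t x y)" by (rule quot[OF z])
  note T = kernel_minus_kernel_at[OF t z]
  have "kernel X (\<lambda>w v. t w z * t z v / t z z * kernel_at g z w v)"
    by (rule kernel_mult[OF T kernel_kernel_at[OF g z]])
  then show "kernel X (\<lambda>w v. kernel_at l z w v - kernel_at t z w v / t w v * l w v)"
  proof (rule iffD1[OF kernel_cong, rotated])
    fix w v assume wv: "w \<in> X" "v \<in> X"
    have "kernel_at t z w v / t w v * l w v = kernel_at t z w v * g w v"
      using tnz wv by (simp add: eqs)
    then show "t w z * t z v / t z z * kernel_at g z w v = kernel_at l z w v - kernel_at t z w v / t w v * l w v"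
      using wv z by (simp add: kernel_at_def eqs algebra_simps)
  qed
  obtain a where a: "t z z = of_real a" "0 \<le> a" using kernel_diag_nonneg[OF t z] by (elim nonneg_complex_cases)
  obtain b where b: "k z z = of_real b" "0 \<le> b" using kernel_diag_nonneg[OF k z] by (elim nonneg_complex_cases)
  obtain r where r: "h z z = of_real r" "0 \<le> r" using kernel_diag_nonneg[OF h z] by (elim nonneg_complex_cases)
  have "complex_of_real b = of_real ((1 - r) * a)"
    using eqs(1)[OF z z] a b r by simp
  then have "b = (1 - r) * a" by (simp only: of_real_eq_iff)
  moreover have "0 < b" using b nz(1)[OF z] by (cases "b = 0") auto
  ultimately have "r < 1" using a(2) by (metis diff_gt_0_iff_gt mult_pos_pos not_less zero_less_mult_iff)
  have "kernel X (\<lambda>w v. t w z * t z v / t z z * ((1 - h w z) * (1 - h z v) / (1 - h z z) - (1 - h w v)))"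
    by (rule kernel_mult[OF T kernel_ball_automorphism[OF h z r(1) \<open>r < 1\<close>]])
  then show "kernel X (\<lambda>w v. kernel_at t z w v / t w v * k w v - kernel_at k z w v)"
  proof (rule iffD1[OF kernel_cong, rotated])
    fix w v assume wv: "w \<in> X" "v \<in> X"
    have 1: "kernel_at t z w v / t w v * k w v = kernel_at t z w v * (1 - h w v)"
      using tnz wv by (simp add: eqs)
    have 2: "k w z * k z v / k z z = t w z * t z v / t z z * ((1 - h w z) * (1 - h z v) / (1 - h z z))"
      using wv z by (simp add: eqs mult_ac)
    have 3: "T * (B - c) = (a - T) * c - (c * a - T * B)" for T B c a :: complex
      by (simp add: algebra_simps)
    show "t w z * t z v / t z z * ((1 - h w z) * (1 - h z v) / (1 - h z z) - (1 - h w v)) =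
        kernel_at t z w v / t w v * k w v - kernel_at k z w v"
      unfolding 1 unfolding kernel_at_def 2 eqs(1)[OF wv] by (rule 3)
  qed
qed

text \<open>For \<open>s = 1 / (1 - \<theta>)\<close> the quotient \<open>s\<^sup>z / s\<close> is the automorphism kernel of \<open>\<theta>\<close> times a rank one kernel.\<close>

lemma kernel_at_quotient_of_reciprocal:
  assumes \<theta>: "kernel X \<theta>" and s: "kernel X s" and s_eq: "\<And>x y. x \<in> X \<Longrightarrow> y \<in> X \<Longrightarrow> s x y = 1 / (1 - \<theta> x y)"
    and ne: "\<And>x y. x \<in> X \<Longrightarrow> y \<in> X \<Longrightarrow> \<theta> x y \<noteq> 1" and z: "z \<in> X" and lt: "Re (\<theta> z z) < 1"
  shows "kernel X (\<lambda>x y. kernel_at s z x y / s x y)"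
proof -
  obtain r where r: "\<theta> z z = of_real r" "0 \<le> r" using kernel_diag_nonneg[OF \<theta> z] by (elim nonneg_complex_cases)
  then have r1: "r < 1" using lt by simp
  then have "0 \<le> complex_of_real (1 - r)" by (simp only: complex_of_real_nonneg_iff)
  then have "kernel X (\<lambda>w v. of_real (1 - r) *
      (((1 - \<theta> w z) * (1 - \<theta> z v) / (1 - \<theta> z z) - (1 - \<theta> w v)) * (s w z * cnj (s v z))))"
    by (intro kernel_scale kernel_mult kernel_rank_one kernel_ball_automorphism[OF \<theta> z r(1) r1])
  then show ?thesis
  proof (rule iffD1[OF kernel_cong, rotated])
    fix w v assume wv: "w \<in> X" "v \<in> X"
    have "1 - \<theta> w v \<noteq> 0" "1 - \<theta> w z \<noteq> 0" "1 - \<theta> z v \<noteq> 0" "1 - \<theta> z z \<noteq> 0" using ne wv z by fastforce+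
    moreover have c: "cnj (s v z) = s z v" using kernel_hermitian[OF s wv(2) z] by (rule sym)
    moreover have "of_real (1 - r) = 1 - \<theta> z z" using r by simp
    ultimately show "of_real (1 - r) * (((1 - \<theta> w z) * (1 - \<theta> z v) / (1 - \<theta> z z) - (1 - \<theta> w v)) * (s w z * cnj (s v z))) =
        kernel_at s z w v / s w v"
      unfolding c using wv z by (simp only: kernel_at_def s_eq) (simp add: divide_simps)
  qed
qed

lemma complete_pick_kernelI:
  assumes s: "kernel X s" and nz: "\<And>x y. x \<in> X \<Longrightarrow> y \<in> X \<Longrightarrow> s x y \<noteq> 0"
    and quot: "\<And>z. z \<in> X \<Longrightarrow> kernel X (\<lambda>x y. kernel_at s z x y / s x y)"
  shows "complete_pick_kernel X s"
proof -
  have 0: "kernel X (\<lambda>x y. 0)" by (simp add: kernel_iff_finite psd_on_zero)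
  have 1: "kernel X (\<lambda>x y. 1)" using kernel_rank_one[of X "\<lambda>_. 1"] by simp
  have "shimorin_certificate X s s (\<lambda>z x y. kernel_at s z x y / s x y)"
    by (rule factorization_imp_shimorin_certificate[OF s 0 1 s nz quot]) (use nz in auto)
  then show ?thesis
    using shimorin_imp_complete_pick_pair[OF s s] nz s unfolding complete_pick_kernel_def by blast
qed

section \<open>Multi-indices and formal power series\<close>

lemma le_vec_iff: "a \<le> b \<longleftrightarrow> (\<forall>i. a $ i \<le> (b :: nat ^ 'd) $ i)"
  by (simp add: less_eq_vec_def)

lemma finite_atMost_vec: "finite {..b :: nat ^ 'd}"
proof -
  have "{..b} \<subseteq> vec_lambda ` (Pi UNIV (\<lambda>i. {..b $ i}))"
  proof
    fix a assume "a \<in> {..b}"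
    then have "a = vec_lambda (vec_nth a)" "vec_nth a \<in> Pi UNIV (\<lambda>i. {..b $ i})"
      by (auto simp: le_vec_iff)
    then show "a \<in> vec_lambda ` (Pi UNIV (\<lambda>i. {..b $ i}))" by blast
  qed
  moreover have "finite (Pi UNIV (\<lambda>i::'d. {..b $ i}))"
    using finite_PiE[of "UNIV :: 'd set" "\<lambda>i. {..b $ i}"] by (simp add: PiE_UNIV_domain)
  ultimately show ?thesis by (meson finite_imageI finite_subset)
qed

lemma vec_add_diff_cancel: "a \<le> b \<Longrightarrow> a + (b - a) = (b :: nat ^ 'd)" "a \<le> b \<Longrightarrow> b - a + a = (b :: nat ^ 'd)"
  by (auto simp: vec_eq_iff le_vec_iff)

lemma vec_le_add: "a \<le> a + (b :: nat ^ 'd)" "b \<le> a + (b :: nat ^ 'd)"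
  by (auto simp: le_vec_iff)

lemma vec_add_diff: "a + b - a = (b :: nat ^ 'd)" "a + b - b = (a :: nat ^ 'd)"
  by (auto simp: vec_eq_iff)

lemma vec_zero_le: "0 \<le> (b :: nat ^ 'd)"
  by (simp add: le_vec_iff)

lemma vec_le_zero: "b \<le> 0 \<longleftrightarrow> b = (0 :: nat ^ 'd)"
  by (auto simp: le_vec_iff vec_eq_iff)

lemma atMost_vec_zero [simp]: "{..0 :: nat ^ 'd} = {0}"
  by (auto simp: vec_le_zero)

lemma vec_diff_le: "b - a \<le> (b :: nat ^ 'd)"
  by (simp add: le_vec_iff)

lemma vec_diff_diff: "b - a - c = b - c - (a :: nat ^ 'd)"
  by (simp add: vec_eq_iff add.commute)

lemma vec_diff_eq_zero: "a \<le> b \<Longrightarrow> b - a = 0 \<longleftrightarrow> a = (b :: nat ^ 'd)"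
  by (auto simp: vec_eq_iff le_vec_iff le_antisym)

lemma vec_diff_zero: "b - 0 = (b :: nat ^ 'd)" "b - b = (0 :: nat ^ 'd)"
  by (auto simp: vec_eq_iff)

lemma mdeg_add: "mdeg (a + b) = mdeg a + mdeg b"
  by (simp add: mdeg_def sum.distrib)

lemma mdeg_mono: "a \<le> b \<Longrightarrow> mdeg a \<le> mdeg b"
  by (auto simp: mdeg_def le_vec_iff intro: sum_mono)

lemma mdeg_strict_mono: "a \<le> b \<Longrightarrow> a \<noteq> b \<Longrightarrow> mdeg a < mdeg b"
  using mdeg_add_less[of "b - a" a] by (simp add: vec_add_diff_cancel vec_diff_eq_zero)

lemma mdeg_zero: "mdeg a = 0 \<longleftrightarrow> a = 0"
  by (auto simp: mdeg_def vec_eq_iff)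

lemma sum_pairs_eq: "(\<Sum>(w, u)\<in>{(w, u). w + u = (b :: nat ^ 'd)}. f w u) = (\<Sum>w\<in>{..b}. f w (b - w))"
  by (rule sum.reindex_bij_witness[where j = fst and i = "\<lambda>w. (w, b - w)"])
    (auto simp: vec_add_diff_cancel vec_le_add vec_add_diff)

lemma finite_pairs: "finite {(w, u). w + u = (b :: nat ^ 'd)}"
  by (rule finite_subset[of _ "{..b} \<times> {..b}"]) (auto simp: finite_atMost_vec vec_le_add)

lemma ps_mult_eq: "ps_mult c c' b = (\<Sum>w\<in>{..b}. c w * c' (b - w))"
  unfolding ps_mult_def by (rule sum_pairs_eq)

lemma atMost_vec_split: "(\<Sum>w\<in>{..b :: nat ^ 'd}. f w) = f 0 + (\<Sum>w\<in>{..b} - {0}. f w)"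
  by (rule sum.remove) (auto simp: finite_atMost_vec vec_zero_le)

lemma atMost_vec_split_top: "(\<Sum>w\<in>{..b :: nat ^ 'd}. f w) = f b + (\<Sum>w\<in>{..b} - {b}. f w)"
  by (rule sum.remove) (auto simp: finite_atMost_vec)

lemma sum_atMost_reflect: "(\<Sum>w\<in>{..b :: nat ^ 'd}. f w) = (\<Sum>w\<in>{..b}. f (b - w))"
proof -
  have "b - (b - a) = a" if "a \<le> b" for a using that by (auto simp: vec_eq_iff le_vec_iff)
  then show ?thesis
    by (intro sum.reindex_bij_witness[where j = "\<lambda>w. b - w" and i = "\<lambda>w. b - w"]) (auto simp: vec_diff_le)
qed

lemma sum_atMost_triangle:
  "(\<Sum>w\<in>{..b :: nat ^ 'd}. \<Sum>u\<in>{..b - w}. F w u) = (\<Sum>u\<in>{..b}. \<Sum>w\<in>{..b - u}. F w u)"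
proof -
  have fin: "finite {..c}" for c :: "nat ^ 'd" by (rule finite_atMost_vec)
  have "(w \<le> b \<and> u \<le> b - w) = (u \<le> b \<and> w \<le> b - u)" for u w :: "nat ^ 'd"
  proof -
    have "w $ i \<le> b $ i \<and> u $ i \<le> b $ i - w $ i \<longleftrightarrow> u $ i \<le> b $ i \<and> w $ i \<le> b $ i - u $ i" for i by auto
    then show ?thesis unfolding le_vec_iff vector_minus_component by blast
  qed
  then have "(\<Sum>(w, u)\<in>(SIGMA w:{..b}. {..b - w}). F w u) = (\<Sum>(u, w)\<in>(SIGMA u:{..b}. {..b - u}). F w u)"
    by (intro sum.reindex_bij_witness[where i = "\<lambda>(u, w). (w, u)" and j = "\<lambda>(u, w). (w, u)"]) auto
  then show ?thesis
    using fin by (simp add: sum.Sigma)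
qed

section \<open>The master certificate\<close>

text \<open>The amount by which \<open>\<theta> * k\<close> exceeds \<open>k\<close> off the origin; these are the coefficients of the kernel
  \<open>h\<close> in \<open>k = (1 - h) s\<close>.\<close>

definition master_defect :: "(nat ^ 'd \<Rightarrow> real) \<Rightarrow> nat ^ 'd \<Rightarrow> real" where
  "master_defect k b = (if b = 0 then 0 else ps_mult (master k) k b - k b)"

lemma master_zero [simp]: "master k 0 = 0"
  by (simp add: master.simps)

lemma master_recursion:
  fixes k :: "nat ^ 'd \<Rightarrow> real"
  assumes "k 0 = 1" "b \<noteq> 0"
  shows "ps_mult (master k) k b = master k b + (\<Sum>(w, u)\<in>{(w, u). w + u = b \<and> w \<noteq> 0 \<and> u \<noteq> 0}. master k w * k u)"
proof -
  let ?A = "{(w, u). w + u = b \<and> w \<noteq> 0 \<and> u \<noteq> 0}"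
  have "ps_mult (master k) k b = (\<Sum>(w, u)\<in>{(w, u). w + u = b} - {(0, b)}. master k w * k u)"
    unfolding ps_mult_def by (rule sum.mono_neutral_right) (auto simp: finite_pairs)
  also have "{(w, u). w + u = b} - {(0, b)} = insert (b, 0) ?A"
    using assms(2) by auto
  also have "(\<Sum>(w, u)\<in>insert (b, 0) ?A. master k w * k u) = master k b + (\<Sum>(w, u)\<in>?A. master k w * k u)"
  proof -
    have "finite ?A" by (rule finite_subset[OF _ finite_pairs[of b]]) auto
    then show ?thesis using assms(1) by (subst sum.insert) auto
  qed
  finally show ?thesis .
qed

lemma mdeg_one_no_pairs:
  assumes "mdeg (b :: nat ^ 'd) = 1"
  shows "{(w, u). w + u = b \<and> w \<noteq> 0 \<and> u \<noteq> 0} = {}"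
proof -
  have "w = 0 \<or> u = 0" if "w + u = b" for w u :: "nat ^ 'd"
    using that assms mdeg_add[of w u] mdeg_zero[of w] mdeg_zero[of u] by auto
  then show ?thesis by auto
qed

context
  fixes k :: "nat ^ 'd \<Rightarrow> real"
  assumes k0: "k 0 = 1" and kpos: "\<And>a. 0 < k a"
begin

lemma master_nonneg: "0 \<le> master k b"
  using kpos[of b] by (subst master.simps) (auto intro: less_imp_le)

text \<open>The two cases of the maximum in the recursion: either it is attained by the second argument, and then
  \<open>\<theta> * k\<close> and \<open>k\<close> agree at \<open>b\<close>, or \<open>\<theta>\<close> vanishes at \<open>b\<close>. This complementarity drives the proof of
  \<open>lp_condition_imp_nonneg\<close>.\<close>

lemma master_cases:
  assumes "b \<noteq> 0"
  shows "master_defect k b = 0 \<or> (0 \<le> master_defect k b \<and> master k b = 0)" "0 \<le> master_defect k b" "master k b \<le> k b"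
proof -
  let ?S = "\<Sum>(w, u)\<in>{(w, u). w + u = b \<and> w \<noteq> 0 \<and> u \<noteq> 0}. master k w * k u"
  have S: "0 \<le> ?S"
    using master_nonneg kpos by (intro sum_nonneg) (auto intro: mult_nonneg_nonneg less_imp_le)
  have d: "master_defect k b = master k b + ?S - k b"
    using master_recursion[of k b] k0 assms by (simp add: master_defect_def)
  have t: "master k b = (if mdeg b = 1 then k b else max 0 (k b - ?S))"
    using assms by (subst master.simps) simp
  have "?S = 0" if "mdeg b = 1"
    unfolding mdeg_one_no_pairs[OF that] by simp
  then show "master_defect k b = 0 \<or> (0 \<le> master_defect k b \<and> master k b = 0)"
    unfolding d using t by (auto simp: max_def split: if_splits)
  then show "0 \<le> master_defect k b" using master_nonneg[of b] by auto
  show "master k b \<le> k b" unfolding t using S kpos[of b] by auto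
qed

lemma master_defect_nonneg: "0 \<le> master_defect k b"
  using master_cases(2)[of b] by (cases "b = 0") (auto simp: master_defect_def)

lemma master_le: "master k b \<le> k b"
  using master_cases(3)[of b] k0 by (cases "b = 0") auto

lemma master_times_k: "b \<noteq> 0 \<Longrightarrow> (\<Sum>w\<in>{..b}. master k w * k (b - w)) = k b + master_defect k b"
  by (simp add: master_defect_def flip: ps_mult_eq)

end

text \<open>The coefficients of \<open>1 / (1 - t)\<close> for a series \<open>t\<close> without constant term.\<close>

function reciprocal :: "(nat ^ 'd \<Rightarrow> real) \<Rightarrow> nat ^ 'd \<Rightarrow> real" where
  "reciprocal t b = (if b = 0 then 1
     else \<Sum>(w, u)\<in>{(w, u). w + u = b \<and> w \<noteq> 0}. t w * reciprocal t u)"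
  by pat_completeness auto
termination
  by (relation "Wellfounded.measure (\<lambda>(t, b). mdeg b)") (auto simp: mdeg_add mdeg_zero neq0_conv[symmetric] simp del: neq0_conv)

declare reciprocal.simps [simp del]

lemma reciprocal_zero [simp]: "reciprocal t 0 = 1"
  by (simp add: reciprocal.simps)

lemma reciprocal_eq:
  assumes "t 0 = 0" "b \<noteq> 0"
  shows "reciprocal t b = (\<Sum>w\<in>{..b}. t w * reciprocal t (b - w))"
proof -
  have "reciprocal t b = (\<Sum>(w, u)\<in>{(w, u). w + u = b \<and> w \<noteq> 0}. t w * reciprocal t u)"
    using assms(2) by (subst reciprocal.simps) simp
  also have "\<dots> = (\<Sum>(w, u)\<in>{(w, u). w + u = b}. t w * reciprocal t u)"
    by (rule sum.mono_neutral_left) (auto simp: finite_pairs assms(1))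
  also have "\<dots> = (\<Sum>w\<in>{..b}. t w * reciprocal t (b - w))"
    by (rule sum_pairs_eq)
  finally show ?thesis .
qed

lemma ps_mult_one_minus:
  "ps_mult (\<lambda>a. ps_one a - t a) c b = c b - (\<Sum>w\<in>{..b}. t w * c (b - w))"
proof -
  have "(\<Sum>w\<in>{..b}. ps_one w * c (b - w)) = (\<Sum>w\<in>{..b}. if w = 0 then c b else 0)"
    by (intro sum.cong) (auto simp: ps_one_def vec_diff_zero)
  also have "\<dots> = c b" by (simp add: finite_atMost_vec vec_zero_le)
  finally show ?thesis
    by (simp add: ps_mult_eq left_diff_distrib sum_subtractf)
qed

lemma ps_reciprocal_eq:
  assumes t: "t 0 = 0"
  shows "ps_reciprocal (\<lambda>a. ps_one a - t a) = reciprocal t"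
  unfolding ps_reciprocal_def
proof (rule the_equality)
  show "ps_mult (\<lambda>a. ps_one a - t a) (reciprocal t) = ps_one"
  proof
    fix b
    show "ps_mult (\<lambda>a. ps_one a - t a) (reciprocal t) b = ps_one b"
      unfolding ps_mult_one_minus using reciprocal_eq[of t b] t t
      by (cases "b = 0") (auto simp: ps_one_def)
  qed
  fix c assume c: "ps_mult (\<lambda>a. ps_one a - t a) c = ps_one"
  have c': "c b = ps_one b + (\<Sum>w\<in>{..b} - {0}. t w * c (b - w))" for b
    using fun_cong[OF c, of b] t unfolding ps_mult_one_minus atMost_vec_split[of _ b] by simp
  have "c b = reciprocal t b" for b
  proof (induction "mdeg b" arbitrary: b rule: less_induct)
    case less
    have "c (b - w) = reciprocal t (b - w)" if "w \<in> {..b} - {0}" for w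
    proof (rule less)
      have "b - w \<noteq> b"
      proof
        assume e: "b - w = b"
        have "b - w + w = b" using that by (simp add: vec_add_diff_cancel)
        with e that show False by simp
      qed
      then show "mdeg (b - w) < mdeg b" by (rule mdeg_strict_mono[OF vec_diff_le])
    qed
    then have "(\<Sum>w\<in>{..b} - {0}. t w * c (b - w)) = (\<Sum>w\<in>{..b} - {0}. t w * reciprocal t (b - w))"
      by (intro sum.cong) auto
    then show ?case
      using c'[of b] reciprocal_eq[of t b] t t
      by (cases "b = 0") (auto simp: ps_one_def atMost_vec_split[of _ b])
  qed
  then show "c = reciprocal t" by auto
qed

lemma mdeg_diff_less: "w \<le> b \<Longrightarrow> w \<noteq> 0 \<Longrightarrow> mdeg (b - w) < mdeg b"
  using mdeg_add_less[of w "b - w"] by (simp add: vec_add_diff_cancel)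

lemma reciprocal_nonneg:
  assumes "t 0 = 0" "\<And>a. 0 \<le> t a"
  shows "0 \<le> reciprocal t b"
proof (induction "mdeg b" arbitrary: b rule: less_induct)
  case less
  have "0 \<le> (\<Sum>w\<in>{..b}. t w * reciprocal t (b - w))"
  proof (rule sum_nonneg)
    fix w assume w: "w \<in> {..b}"
    show "0 \<le> t w * reciprocal t (b - w)"
    proof (cases "w = 0")
      case False
      then show ?thesis using less[OF mdeg_diff_less[of w b]] assms w by simp
    qed (use assms in simp)
  qed
  then show ?case
    using reciprocal_eq[of t b] assms(1) by (cases "b = 0") auto
qed

text \<open>The linear programming form of the interpolation property: \<open>y\<close> are the squared norms of mutually
  orthogonal Taylor coefficients, and the unknown coefficient at \<open>b\<close> contributes a nonnegative term, which has
  been dropped from the inequality at \<open>b\<close>.\<close>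

definition lp_condition :: "(nat ^ 'd \<Rightarrow> real) \<Rightarrow> (nat ^ 'd \<Rightarrow> real) \<Rightarrow> bool" where
  "lp_condition k l \<longleftrightarrow> (\<forall>b y. b \<noteq> 0 \<and> (\<forall>a. 0 \<le> y a) \<and>
     (\<forall>a. a \<le> b \<and> a \<noteq> b \<longrightarrow> (\<Sum>u\<in>{..a}. k (a - u) * y u) \<le> l a)
     \<longrightarrow> (\<Sum>u\<in>{..b} - {b}. k (b - u) * y u) \<le> l b)"

abbreviation (input) master_factor_nonneg :: "(nat ^ 'd \<Rightarrow> real) \<Rightarrow> (nat ^ 'd \<Rightarrow> real) \<Rightarrow> bool" where
  "master_factor_nonneg kc lc \<equiv> \<forall>b. 0 \<le> ps_mult (\<lambda>a. ps_one a - master kc a) lc b"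

text \<open>Determined by complementary slackness, from small multi-indices upwards.\<close>

function extremal :: "(nat ^ 'd \<Rightarrow> real) \<Rightarrow> (nat ^ 'd \<Rightarrow> real) \<Rightarrow> nat ^ 'd \<Rightarrow> nat ^ 'd \<Rightarrow> real" where
  "extremal k l b a = (if 0 < master_defect k (b - a) then 0
     else l a - (\<Sum>u\<in>{..a} - {a}. k (a - u) * extremal k l b u))"
  by pat_completeness auto
termination
  by (relation "Wellfounded.measure (\<lambda>(k, l, b, a). mdeg a)") (auto intro: mdeg_strict_mono)

declare extremal.simps [simp del]

text \<open>The extremal \<open>y\<close> satisfies the complementary slackness conditions with respect to \<open>\<theta>\<close>: it
  vanishes at \<open>b - c\<close> if \<open>\<theta> * k\<close> exceeds \<open>k\<close> at \<open>c\<close>, and otherwise the constraint at \<open>b - c\<close> is an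
  equality. That it is feasible follows, one multi-index at a time, from the hypothesis itself.\<close>

theorem lp_condition_imp_nonneg:
  assumes k0: "k 0 = 1" and kpos: "\<And>a. 0 < k a" and lpos: "\<And>a. 0 < l a"
    and lp: "lp_condition k l"
  shows "0 \<le> ps_mult (\<lambda>a. ps_one a - master k a) l b"
proof (cases "b = 0")
  case True
  then show ?thesis using less_imp_le[OF lpos] by (simp add: ps_mult_one_minus)
next
  case b: False
  define y where "y = extremal k l b"
  define slack where "slack a = l a - (\<Sum>u\<in>{..a}. k (a - u) * y u)" for a
  have split: "(\<Sum>u\<in>{..a}. k (a - u) * y u) = y a + (\<Sum>u\<in>{..a} - {a}. k (a - u) * y u)" for a
    by (subst atMost_vec_split_top) (simp add: k0 vec_diff_zero)
  have y: "y a = (if 0 < master_defect k (b - a) then 0 else l a - (\<Sum>u\<in>{..a} - {a}. k (a - u) * y u))" for a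
    unfolding y_def by (subst extremal.simps) simp
  \<comment> \<open>the hypothesis at \<open>a\<close>, for \<open>y\<close> restricted to the multi-indices below \<open>a\<close>, leaves room for \<open>y\<^sub>a\<close>\<close>
  have ind: "a \<le> b \<and> a \<noteq> b \<longrightarrow> 0 \<le> y a \<and> 0 \<le> slack a" for a
  proof (induction "mdeg a" arbitrary: a rule: less_induct)
    case less
    show ?case
    proof
      assume a: "a \<le> b \<and> a \<noteq> b"
      have IH: "0 \<le> y u" "0 \<le> slack u" if "u \<le> a" "u \<noteq> a" for u
        using less[of u] mdeg_strict_mono[OF that] that a by (auto dest: order_trans order_antisym)
      have "(\<Sum>u\<in>{..a} - {a}. k (a - u) * y u) \<le> l a"
      proof (cases "a = 0")
        case True
        then show ?thesis using less_imp_le[OF lpos[of a]] by simp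
      next
        case False
        define y' where "y' u = (if u \<le> a \<and> u \<noteq> a then y u else 0)" for u
        have "(\<Sum>u\<in>{..c}. k (c - u) * y' u) \<le> l c" if c: "c \<le> a" "c \<noteq> a" for c
        proof -
          have "(\<Sum>u\<in>{..c}. k (c - u) * y' u) = (\<Sum>u\<in>{..c}. k (c - u) * y u)"
            using c by (intro sum.cong) (auto simp: y'_def dest: order_trans order_antisym)
          then show ?thesis using IH(2)[OF c] by (simp add: slack_def)
        qed
        moreover have "0 \<le> y' u" for u using IH(1) by (simp add: y'_def)
        ultimately have "(\<Sum>u\<in>{..a} - {a}. k (a - u) * y' u) \<le> l a"
          using lp False unfolding lp_condition_def by blast
        also have "(\<Sum>u\<in>{..a} - {a}. k (a - u) * y' u) = (\<Sum>u\<in>{..a} - {a}. k (a - u) * y u)"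
          by (intro sum.cong) (auto simp: y'_def)
        finally show ?thesis .
      qed
      then show "0 \<le> y a \<and> 0 \<le> slack a"
        unfolding slack_def split using y[of a] by auto
    qed
  qed
  define y' where "y' u = (if u \<le> b \<and> u \<noteq> b then y u else 0)" for u
  have y'y: "(\<Sum>u\<in>{..c}. k (c - u) * y' u) = (\<Sum>u\<in>{..c}. k (c - u) * y u)" if c: "c \<le> b" "c \<noteq> b" for c
    using c by (intro sum.cong) (auto simp: y'_def dest: order_trans order_antisym)
  have "(\<Sum>u\<in>{..b} - {b}. k (b - u) * y' u) \<le> l b"
  proof -
    have "0 \<le> y' u" for u using ind by (simp add: y'_def)
    moreover have "(\<Sum>u\<in>{..c}. k (c - u) * y' u) \<le> l c" if "c \<le> b \<and> c \<noteq> b" for c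
      using y'y ind[of c] that by (simp add: slack_def)
    ultimately show ?thesis using lp b unfolding lp_condition_def by blast
  qed
  moreover have "(\<Sum>w\<in>{..b}. master k w * l (b - w)) = (\<Sum>u\<in>{..b} - {b}. k (b - u) * y' u)"
  proof -
    have "master k w * l (b - w) = (\<Sum>u\<in>{..b - w}. master k w * (k (b - w - u) * y' u))" if w: "w \<in> {..b}" for w
    proof (cases "master k w = 0")
      case False
      then have "w \<noteq> 0" by auto
      then have "master_defect k w = 0" using master_cases(1)[of k w] k0 kpos False by auto
      have bw: "b - w \<le> b" "b - w \<noteq> b"
        using mdeg_diff_less[of w b] w \<open>w \<noteq> 0\<close> by (auto simp: vec_diff_le)
      have "b - (b - w) = w" using w by (auto simp: vec_eq_iff le_vec_iff)
      then have "slack (b - w) = 0"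
        using y[of "b - w"] \<open>master_defect k w = 0\<close> by (simp add: slack_def split)
      then show ?thesis using y'y[OF bw] by (simp add: slack_def flip: sum_distrib_left)
    qed simp
    then have "(\<Sum>w\<in>{..b}. master k w * l (b - w)) = (\<Sum>w\<in>{..b}. \<Sum>u\<in>{..b - w}. master k w * (k (b - w - u) * y' u))"
      by (rule sum.cong[OF refl])
    also have "\<dots> = (\<Sum>u\<in>{..b}. \<Sum>w\<in>{..b - u}. master k w * (k (b - w - u) * y' u))"
      by (rule sum_atMost_triangle)
    also have "\<dots> = (\<Sum>u\<in>{..b}. y' u * (\<Sum>w\<in>{..b - u}. master k w * k (b - u - w)))"
      by (simp add: sum_distrib_left vec_diff_diff[of b] mult_ac)
    also have "\<dots> = (\<Sum>u\<in>{..b} - {b}. y' u * (\<Sum>w\<in>{..b - u}. master k w * k (b - u - w)))"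
      by (subst atMost_vec_split_top) (simp add: y'_def)
    also have "\<dots> = (\<Sum>u\<in>{..b} - {b}. k (b - u) * y' u)"
    proof (intro sum.cong refl)
      fix u assume u: "u \<in> {..b} - {b}"
      then have "b - u \<noteq> 0" by (simp add: vec_diff_eq_zero)
      then have "(\<Sum>w\<in>{..b - u}. master k w * k (b - u - w)) = k (b - u) + master_defect k (b - u)"
        using master_times_k[of k "b - u"] k0 kpos by blast
      moreover have "y' u * master_defect k (b - u) = 0"
        using y[of u] master_defect_nonneg[of k "b - u"] k0 kpos by (auto simp: y'_def)
      ultimately show "y' u * (\<Sum>w\<in>{..b - u}. master k w * k (b - u - w)) = k (b - u) * y' u"
        by (simp add: algebra_simps)
    qed
    finally show ?thesis .
  qed
  ultimately show ?thesis by (simp add: ps_mult_one_minus)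
qed

text \<open>Both sequences solve the recursion \<open>s = 1 + t s\<close>, the right one with a nonnegative surplus.\<close>

lemma reciprocal_le_of_nonneg:
  assumes t: "t 0 = 0" "\<And>a. 0 \<le> t a" and l: "l 0 = 1"
    and nn: "\<And>b. 0 \<le> ps_mult (\<lambda>a. ps_one a - t a) l b"
  shows "reciprocal t b \<le> l b"
proof (induction "mdeg b" arbitrary: b rule: less_induct)
  case less
  show ?case
  proof (cases "b = 0")
    case False
    have "(\<Sum>w\<in>{..b}. t w * reciprocal t (b - w)) \<le> (\<Sum>w\<in>{..b}. t w * l (b - w))"
    proof (rule sum_mono)
      fix w assume w: "w \<in> {..b}"
      show "t w * reciprocal t (b - w) \<le> t w * l (b - w)"
        using less[OF mdeg_diff_less[of w b]] t w by (cases "w = 0") (auto intro: mult_left_mono)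
    qed
    also have "\<dots> \<le> l b" using nn[of b] by (simp add: ps_mult_one_minus)
    finally show ?thesis using reciprocal_eq[of t b] t(1) False by simp
  qed (simp add: l)
qed

lemma le_reciprocal_master:
  assumes k0: "k 0 = 1" and kpos: "\<And>a. 0 < k a"
  shows "k b \<le> reciprocal (master k) b"
proof (induction "mdeg b" arbitrary: b rule: less_induct)
  case less
  show ?case
  proof (cases "b = 0")
    case False
    have "k b \<le> (\<Sum>w\<in>{..b}. master k w * k (b - w))"
      using master_times_k[of k b] master_defect_nonneg[of k b] k0 kpos False by simp
    also have "\<dots> \<le> (\<Sum>w\<in>{..b}. master k w * reciprocal (master k) (b - w))"
    proof (rule sum_mono)
      fix w assume w: "w \<in> {..b}"
      show "master k w * k (b - w) \<le> master k w * reciprocal (master k) (b - w)"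
        using less[OF mdeg_diff_less[of w b]] master_nonneg[of k w] k0 kpos w by (cases "w = 0") (auto intro: mult_left_mono)
    qed
    also have "\<dots> = reciprocal (master k) b" using reciprocal_eq[of "master k" b] False by simp
    finally show ?thesis .
  qed (simp add: k0)
qed

section \<open>Monomials and power series\<close>

lemma has_sum_minus:
  fixes f g :: "'i \<Rightarrow> complex"
  shows "(f has_sum S) A \<Longrightarrow> (g has_sum T) A \<Longrightarrow> ((\<lambda>a. f a - g a) has_sum S - T) A"
  using has_sum_add[of f A S "\<lambda>a. - g a" "- T"] has_sum_cmult_right[of g A T "-1"] by simp

lemma has_sum_finite_sum:
  fixes f :: "'j \<Rightarrow> 'i \<Rightarrow> 'a :: topological_comm_monoid_add"
  shows "(\<And>j. j \<in> J \<Longrightarrow> (f j has_sum S j) A) \<Longrightarrow> ((\<lambda>a. \<Sum>j\<in>J. f j a) has_sum (\<Sum>j\<in>J. S j)) A"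
  by (induction J rule: infinite_finite_induct) (auto intro: has_sum_add)

lemma has_sum_finite_approx:
  fixes T :: "'i \<Rightarrow> complex"
  assumes T: "(T has_sum S) UNIV" and A: "finite A" and B: "B summable_on UNIV" "\<And>c. 0 \<le> B c"
    and le: "\<And>c. c \<notin> A \<Longrightarrow> norm (T c) \<le> e * B c" and e: "0 \<le> e"
  shows "norm (S - (\<Sum>c\<in>A. T c)) \<le> e * infsum B UNIV"
proof -
  have 1: "(T has_sum S - (\<Sum>c\<in>A. T c)) (UNIV - A)"
    by (rule has_sum_Diff[OF T has_sum_finite[OF A]]) simp
  have Bs: "(\<lambda>c. e * B c) summable_on UNIV - A"
    by (intro summable_on_cmult_right summable_on_subset_banach[OF B(1)]) auto
  have "norm (S - (\<Sum>c\<in>A. T c)) \<le> infsum (\<lambda>c. e * B c) (UNIV - A)"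
    using norm_infsum_le[OF 1 has_sum_infsum[OF Bs]] le by auto
  also have "\<dots> \<le> infsum (\<lambda>c. e * B c) UNIV"
    by (rule infsum_mono_neutral[OF Bs summable_on_cmult_right[OF B(1)]]) (use B(2) e in auto)
  also have "\<dots> = e * infsum B UNIV" by (rule infsum_cmult_right')
  finally show ?thesis .
qed

lemma mpow_zero_right [simp]: "mpow z 0 = 1"
  by (simp add: mpow_def)

lemma mpow_add: "mpow z (a + b) = mpow z a * mpow z b"
  by (simp add: mpow_def power_add prod.distrib)

lemma mpow_mult: "mpow (z * w) a = mpow z a * mpow w a"
  by (simp add: mpow_def power_mult_distrib prod.distrib)

lemma mpow_vcnj: "mpow (vcnj z) a = cnj (mpow z a)"
  by (simp add: mpow_def vcnj_def cnj_prod)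

lemma mpow_times_vcnj: "mpow (z * vcnj w) a = mpow z a * cnj (mpow w a)"
  by (simp add: mpow_mult mpow_vcnj)

lemma cmod_mpow: "cmod (mpow z a) = (\<Prod>j\<in>UNIV. cmod (z $ j) ^ (a $ j))"
  by (simp add: mpow_def prod_norm norm_power flip: prod_norm)

lemma cmod_mpow_squared: "(\<Prod>j\<in>UNIV. cmod (z $ j) ^ (2 * a $ j)) = (cmod (mpow z a))\<^sup>2"
  unfolding cmod_mpow by (simp add: prod_power_distrib mult.commute flip: power_mult)

lemma cmod_mpow_mono: "(\<And>j. cmod (z $ j) \<le> cmod (w $ j)) \<Longrightarrow> cmod (mpow z a) \<le> cmod (mpow w a)"
  unfolding cmod_mpow by (intro prod_mono) (auto intro: power_mono)

lemma cmod_mpow_const: "(\<And>j. cmod (z $ j) = r) \<Longrightarrow> cmod (mpow z a) = r ^ mdeg a"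
  by (simp add: cmod_mpow mdeg_def power_sum)

lemma cmod_mpow_le: "(\<And>j. cmod (z $ j) \<le> r) \<Longrightarrow> cmod (mpow z a) \<le> r ^ mdeg a"
  unfolding cmod_mpow mdeg_def power_sum by (intro prod_mono) (auto intro: power_mono)

lemma norm_vec_le:
  fixes z :: "complex ^ 'd"
  assumes "\<And>j. cmod (z $ j) \<le> r"
  shows "norm z \<le> real CARD('d) * r"
proof -
  have "norm z \<le> (\<Sum>j\<in>UNIV. norm (z $ j))" unfolding norm_vec_def by (rule L2_set_le_sum) simp
  also have "\<dots> \<le> (\<Sum>j\<in>(UNIV :: 'd set). r)" using assms by (intro sum_mono)
  finally show ?thesis by simp
qed

definition ps_term :: "(nat ^ 'd \<Rightarrow> real) \<Rightarrow> complex ^ 'd \<Rightarrow> nat ^ 'd \<Rightarrow> complex" where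
  "ps_term c x a = of_real (c a) * mpow x a"

lemma ps_term_diag: "ps_term c (z * vcnj z) a = of_real (c a * (cmod (mpow z a))\<^sup>2)"
  by (simp add: ps_term_def mpow_times_vcnj complex_norm_square[symmetric])

lemma ps_eval_eq: "ps_eval c x = infsum (ps_term c x) UNIV"
  by (simp add: ps_eval_def ps_term_def[abs_def])

lemma ps_has_sum: "ps_term c x summable_on UNIV \<Longrightarrow> (ps_term c x has_sum ps_eval c x) UNIV"
  by (simp add: ps_eval_eq)

lemma norm_ps_term: "norm (ps_term c x a) = \<bar>c a\<bar> * cmod (mpow x a)"
  by (simp add: ps_term_def norm_mult)

lemma ps_summable_iff: "ps_term c x summable_on UNIV \<longleftrightarrow> (\<lambda>a. \<bar>c a\<bar> * cmod (mpow x a)) summable_on UNIV"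
  unfolding summable_on_iff_abs_summable_on_complex norm_ps_term ..

lemma ps_summable_mono:
  assumes "ps_term c x summable_on UNIV" "\<And>a. \<bar>c' a\<bar> \<le> \<bar>c a\<bar>" "\<And>j. cmod (x' $ j) \<le> cmod (x $ j)"
  shows "ps_term c' x' summable_on UNIV"
proof -
  have "(\<lambda>a. norm (ps_term c' x' a)) summable_on UNIV"
    by (rule Infinite_Sum.abs_summable_on_comparison_test'[OF assms(1)[unfolded ps_summable_iff]])
      (auto simp: norm_ps_term intro!: mult_mono assms(2) cmod_mpow_mono assms(3))
  then show ?thesis
    by (rule abs_summable_summable)
qed

lemma ps_mult_has_sum:
  assumes f: "ps_term c x summable_on UNIV" and g: "ps_term c' x summable_on UNIV"
  shows "(ps_term (ps_mult c c') x has_sum ps_eval c x * ps_eval c' x) UNIV"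
proof -
  let ?f = "ps_term c x" and ?g = "ps_term c' x"
  let ?F = "\<lambda>(w, u). ?f w * ?g u"
  have fa: "(\<lambda>w. norm (?f w)) summable_on UNIV" and ga: "(\<lambda>w. norm (?g w)) summable_on UNIV"
    using f g by (simp_all add: summable_on_iff_abs_summable_on_complex)
  have "(\<lambda>p. norm (?F p)) summable_on UNIV \<times> UNIV"
    unfolding Infinite_Sum.abs_summable_on_Sigma_iff
  proof (intro conjI ballI)
    show "(\<lambda>y. norm (?F (w, y))) summable_on UNIV" for w
      using summable_on_cmult_right[OF ga, of "norm (?f w)"] by (simp add: norm_mult)
    have "infsum (\<lambda>y. norm (?F (w, y))) UNIV = norm (?f w) * infsum (\<lambda>y. norm (?g y)) UNIV" for w
      using infsum_cmult_right[of "norm (?f w)" "\<lambda>y. norm (?g y)" UNIV] ga by (simp add: norm_mult)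
    then show "(\<lambda>w. norm (infsum (\<lambda>y. norm (?F (w, y))) UNIV)) summable_on UNIV"
      using summable_on_cmult_left[OF fa, of "infsum (\<lambda>y. norm (?g y)) UNIV"]
      by (simp add: norm_mult infsum_nonneg)
  qed
  then have summ: "?F summable_on UNIV \<times> UNIV"
    by (rule abs_summable_summable)
  have "((\<lambda>w. ?f w * ps_eval c' x) has_sum ps_eval c x * ps_eval c' x) UNIV"
    by (rule has_sum_cmult_left[OF ps_has_sum[OF f]])
  then have prod: "(?F has_sum ps_eval c x * ps_eval c' x) (UNIV \<times> UNIV)"
    by (intro has_sum_SigmaI[OF _ _ summ, where g = "\<lambda>w. ?f w * ps_eval c' x"])
      (auto intro: has_sum_cmult_right[OF ps_has_sum[OF g]])
  let ?B = "\<lambda>b. {(w, u). w + u = (b :: nat ^ 'a)}"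
  have "((\<lambda>p. ?F (snd p)) has_sum ps_eval c x * ps_eval c' x) (Sigma UNIV ?B)"
    using prod
    by (subst has_sum_reindex_bij_witness[where i = "\<lambda>(w, u). (w + u, (w, u))" and j = snd and T = "UNIV \<times> UNIV" and h = ?F]) auto
  then have "((\<lambda>b. \<Sum>p\<in>?B b. ?F p) has_sum ps_eval c x * ps_eval c' x) UNIV"
    by (rule has_sum_SigmaD) (auto intro!: has_sum_finiteI simp: finite_pairs)
  moreover have "(\<Sum>p\<in>?B b. ?F p) = ps_term (ps_mult c c') x b" for b
  proof -
    have "(\<Sum>p\<in>?B b. ?F p) = (\<Sum>(w, u)\<in>?B b. of_real (c w * c' u) * mpow x b)"
      by (intro sum.cong refl) (auto simp: ps_term_def mpow_add)
    then show ?thesis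
      unfolding ps_term_def ps_mult_def of_real_sum sum_distrib_right by (simp add: case_prod_unfold)
  qed
  ultimately show ?thesis by simp
qed

lemma ps_one_has_sum: "(ps_term ps_one x has_sum 1) UNIV"
proof -
  have "(ps_term ps_one x has_sum 1) {0}"
    by (rule has_sum_finiteI) (auto simp: ps_term_def ps_one_def)
  then show ?thesis
    by (rule iffD1[OF has_sum_cong_neutral, rotated -1]) (auto simp: ps_term_def ps_one_def)
qed

lemma ps_one_minus_has_sum:
  assumes "ps_term t x summable_on UNIV"
  shows "(ps_term (\<lambda>a. ps_one a - t a) x has_sum 1 - ps_eval t x) UNIV"
  using has_sum_minus[OF ps_one_has_sum ps_has_sum[OF assms]] by (simp add: ps_term_def[abs_def] left_diff_distrib)

text \<open>The mixed terms are dominated by the sum of the diagonal terms at the two points.\<close>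

lemma ps_summable_product:
  assumes c: "\<And>a. 0 \<le> c a" and z: "ps_term c (z * vcnj z) summable_on UNIV" and w: "ps_term c (w * vcnj w) summable_on UNIV"
  shows "ps_term c (z * vcnj w) summable_on UNIV"
proof -
  have "(\<lambda>a. \<bar>c a\<bar> * cmod (mpow (z * vcnj z) a) + \<bar>c a\<bar> * cmod (mpow (w * vcnj w) a)) summable_on UNIV"
    using z w unfolding ps_summable_iff by (rule summable_on_add)
  then have "(\<lambda>a. norm (ps_term c (z * vcnj w) a)) summable_on UNIV"
  proof (rule Infinite_Sum.abs_summable_on_comparison_test')
    fix a
    let ?p = "cmod (mpow z a)" and ?q = "cmod (mpow w a)"
    have "?p * ?q \<le> ?p * ?p + ?q * ?q"
    proof -
      have "0 \<le> ?p * ?q" by simp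
      then show ?thesis
        using sum_squares_bound[of ?p ?q] unfolding power2_eq_square mult.assoc by linarith
    qed
    then have "c a * (?p * ?q) \<le> c a * (?p * ?p + ?q * ?q)"
      using c by (intro mult_left_mono) auto
    then show "norm (ps_term c (z * vcnj w) a) \<le> \<bar>c a\<bar> * cmod (mpow (z * vcnj z) a) + \<bar>c a\<bar> * cmod (mpow (w * vcnj w) a)"
      using c[of a] by (simp add: norm_ps_term mpow_times_vcnj norm_mult algebra_simps)
  qed
  then show ?thesis by (rule abs_summable_summable)
qed

lemma conv_domain_term: "c a * (\<Prod>j\<in>UNIV. cmod (y $ j) ^ (2 * a $ j)) = c a * cmod (mpow (y * vcnj y) a)"
  by (simp add: cmod_mpow_squared mpow_times_vcnj norm_mult power2_eq_square)

lemma conv_domain_iff: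
  assumes "\<And>a. 0 \<le> c a"
  shows "x \<in> conv_domain c \<longleftrightarrow> (\<exists>r>0. \<forall>y. norm (x - y) < r \<longrightarrow> ps_term c (y * vcnj y) summable_on UNIV)"
  unfolding conv_domain_def ps_summable_iff conv_domain_term using assms by auto

lemma conv_domain_summable:
  assumes "\<And>a. 0 \<le> c a" "x \<in> conv_domain c"
  shows "ps_term c (x * vcnj x) summable_on UNIV"
  using assms by (auto simp: conv_domain_iff)

lemma subset_conv_domain:
  assumes "\<And>a. 0 \<le> c a" "open \<Omega>" "\<And>x. x \<in> \<Omega> \<Longrightarrow> ps_term c (x * vcnj x) summable_on UNIV"
  shows "\<Omega> \<subseteq> conv_domain c"
proof
  fix x assume "x \<in> \<Omega>"
  then obtain r where "0 < r" "ball x r \<subseteq> \<Omega>" using assms(2) open_contains_ball by blast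
  then show "x \<in> conv_domain c"
    unfolding conv_domain_iff[OF assms(1)] using assms(3) by (intro exI[of _ r]) (auto simp: dist_norm subset_iff)
qed

lemma conv_domain_mono:
  assumes "\<And>a. 0 \<le> c a" "\<And>a. c a \<le> c' a"
  shows "conv_domain c' \<subseteq> conv_domain c"
proof
  have c': "0 \<le> c' a" for a using assms order_trans by blast
  fix x assume "x \<in> conv_domain c'"
  then show "x \<in> conv_domain c"
    unfolding conv_domain_iff[OF assms(1)] conv_domain_iff[OF c']
    using ps_summable_mono[of c' _ c] assms c' by (metis abs_of_nonneg order_refl)
qed

text \<open>The convergence domain is open, so the point can be moved outwards in all coordinates at once.\<close>

lemma conv_domain_polydisc:
  fixes c :: "nat ^ 'd \<Rightarrow> real"
  assumes c: "\<And>a. 0 \<le> c a" and x: "x \<in> conv_domain c"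
  obtains y where "\<And>j. cmod (x $ j) < cmod (y $ j)" "ps_term c (y * vcnj y) summable_on UNIV"
proof -
  obtain r where r: "0 < r" "\<And>y. norm (x - y) < r \<Longrightarrow> ps_term c (y * vcnj y) summable_on UNIV"
    using x unfolding conv_domain_iff[OF c] by blast
  define e where "e = r / (2 * (real CARD('d) + 1))"
  have e: "0 < e" using r by (simp add: e_def)
  define y :: "complex ^ 'd" where "y = (\<chi> j. x $ j + of_real e * (if x $ j = 0 then 1 else sgn (x $ j)))"
  have "norm (x - y) \<le> real CARD('d) * e"
    using e by (intro norm_vec_le) (simp add: y_def norm_mult norm_sgn)
  also have "\<dots> = real CARD('d) * r / (2 * (real CARD('d) + 1))" by (simp add: e_def)
  also have "\<dots> < r"
  proof -
    have "n * r / (2 * (n + 1)) < r" if "0 \<le> n" for n :: real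
    proof -
      have "n * r < r * (2 * (n + 1))"
        using mult_nonneg_nonneg[OF that less_imp_le[OF r(1)]] r(1) by (simp add: algebra_simps)
      then show ?thesis using that by (simp add: pos_divide_less_eq)
    qed
    then show ?thesis by simp
  qed
  finally have "norm (x - y) < r" .
  moreover have "cmod (x $ j) < cmod (y $ j)" for j
  proof (cases "x $ j = 0")
    case True
    then show ?thesis using e by (simp add: y_def)
  next
    case False
    then have "y $ j = x $ j * of_real (1 + e / cmod (x $ j))"
      by (simp add: y_def sgn_eq field_simps)
    then have "cmod (y $ j) = cmod (x $ j) * \<bar>1 + e / cmod (x $ j)\<bar>"
      by (simp only: norm_mult norm_of_real)
    also have "\<dots> = cmod (x $ j) + e" using e False by (simp add: field_simps)
    finally show ?thesis using e by simp
  qed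
  ultimately show ?thesis using r(2) that by blast
qed

lemma qf_has_sum:
  assumes "\<And>i j. i \<in> I \<Longrightarrow> j \<in> I \<Longrightarrow> ((\<lambda>a. M a i j) has_sum S i j) A"
  shows "((\<lambda>a. qf I (M a) v) has_sum qf I S v) A"
  unfolding qf_def
proof (rule has_sum_finite_sum)
  fix i assume i: "i \<in> I"
  show "((\<lambda>a. \<Sum>j\<in>I. cnj (v i) * M a i j * v j) has_sum (\<Sum>j\<in>I. cnj (v i) * S i j * v j)) A"
    by (rule has_sum_finite_sum, rule has_sum_cmult_left, rule has_sum_cmult_right, rule assms[OF i])
qed

text \<open>The moments of a finite combination of points diagonalize every form whose kernel is a diagonal
  power series.\<close>

definition moment :: "'i set \<Rightarrow> ('i \<Rightarrow> complex ^ 'd) \<Rightarrow> ('i \<Rightarrow> complex) \<Rightarrow> nat ^ 'd \<Rightarrow> complex" where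
  "moment I z v a = (\<Sum>i\<in>I. v i * cnj (mpow (z i) a))"

lemma qf_monomial: "qf I (\<lambda>i j. ps_term c (z i * vcnj (z j)) a) v = of_real (c a * (cmod (moment I z v a))\<^sup>2)"
proof -
  have "qf I (\<lambda>i j. ps_term c (z i * vcnj (z j)) a) v = of_real (c a) * qf I (\<lambda>i j. mpow (z i) a * cnj (mpow (z j) a)) v"
    unfolding qf_scale[symmetric] by (rule qf_cong) (auto simp: ps_term_def mpow_times_vcnj)
  also have "qf I (\<lambda>i j. mpow (z i) a * cnj (mpow (z j) a)) v = cnj (moment I z v a) * moment I z v a"
    unfolding qf_rank_one moment_def by (simp add: mult.commute)
  finally show ?thesis by (simp add: cnj_mult_self)
qed

lemma diag_qf_has_sum:
  assumes "\<And>i j. i \<in> I \<Longrightarrow> j \<in> I \<Longrightarrow> (ps_term c (z i * vcnj (z j)) has_sum f (z i) (z j)) UNIV"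
  shows "((\<lambda>a. complex_of_real (c a * (cmod (moment I z v a))\<^sup>2)) has_sum qf I (\<lambda>i j. f (z i) (z j)) v) UNIV"
  using qf_has_sum[where M = "\<lambda>a i j. ps_term c (z i * vcnj (z j)) a", OF assms, of I v] unfolding qf_monomial by simp

lemma has_sum_complex_nonneg:
  assumes "(f has_sum S) A" "\<And>x. x \<in> A \<Longrightarrow> 0 \<le> f x"
  shows "0 \<le> (S :: complex)"
  using infsum_nonneg_complex[of f A] assms by (metis has_sum_imp_summable infsumI)

lemma kernel_of_coefficients:
  assumes c: "\<And>a. 0 \<le> c a" and f: "\<And>z w. z \<in> X \<Longrightarrow> w \<in> X \<Longrightarrow> (ps_term c (z * vcnj w) has_sum f z w) UNIV"
  shows "kernel X f"
proof (rule kernelI)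
  fix Y assume Y: "finite Y" "Y \<subseteq> X"
  show "psd_on Y f"
    unfolding psd_on_iff
  proof
    fix v
    have "((\<lambda>a. complex_of_real (c a * (cmod (moment Y (\<lambda>z. z) v a))\<^sup>2)) has_sum qf Y f v) UNIV"
      using Y by (intro diag_qf_has_sum[where z = "\<lambda>z. z"] f) auto
    then show "0 \<le> qf Y f v"
      by (rule has_sum_complex_nonneg) (use c in \<open>simp flip: of_real_mult of_real_power\<close>)
  qed
qed

section \<open>Discrete Fourier analysis on a box of multi-indices\<close>

text \<open>The characters of the product of cyclic groups of orders \<open>b\<^sub>j + 1\<close>: up to a power of the radius, the
  monomial of exponent \<open>c\<close> takes the value \<open>box_char b g c\<close> at the point \<open>g\<close> of the grid below.\<close>

definition box_char :: "nat ^ 'd \<Rightarrow> nat ^ 'd \<Rightarrow> nat ^ 'd \<Rightarrow> complex" where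
  "box_char b a g = (\<Prod>j\<in>UNIV. exp (2 * of_real pi * \<i> * of_nat (a $ j) / of_nat (b $ j + 1)) ^ (g $ j))"

text \<open>Exponents that differ by multiples of \<open>b\<^sub>j + 1\<close> cannot be distinguished on the grid.\<close>

definition box_red :: "nat ^ 'd \<Rightarrow> nat ^ 'd \<Rightarrow> nat ^ 'd" where
  "box_red b a = (\<chi> j. a $ j mod (b $ j + 1))"

definition box_size :: "nat ^ 'd \<Rightarrow> nat" where
  "box_size b = (\<Prod>j\<in>UNIV. b $ j + 1)"

definition grid :: "nat ^ 'd \<Rightarrow> real \<Rightarrow> nat ^ 'd \<Rightarrow> complex ^ 'd" where
  "grid b \<rho> g = (\<chi> j. of_real \<rho> * exp (2 * of_real pi * \<i> * of_nat (g $ j) / of_nat (b $ j + 1)))"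

lemma box_size_pos: "0 < box_size b"
  by (simp add: box_size_def)

lemma box_red_le: "box_red b a \<le> b"
  using less_Suc_eq_le by (auto simp: box_red_def le_vec_iff mod_less_eq_dividend intro: less_Suc_eq_le[THEN iffD1])

lemma box_red_le': "box_red b a \<le> a"
  by (auto simp: box_red_def le_vec_iff)

lemma box_red_id: "a \<le> b \<Longrightarrow> box_red b a = a"
  by (auto simp: box_red_def le_vec_iff vec_eq_iff less_Suc_eq_le)

lemma box_red_neq: "\<not> a \<le> b \<Longrightarrow> box_red b a \<noteq> a"
  using box_red_le[of b a] by auto

lemma sum_box_prod:
  fixes f :: "'d::finite \<Rightarrow> nat \<Rightarrow> complex"
  shows "(\<Sum>g\<in>{..b}. \<Prod>j\<in>UNIV. f j (g $ j)) = (\<Prod>j\<in>UNIV. \<Sum>n\<in>{..b $ j}. f j n)"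
proof -
  have "(\<Prod>j\<in>UNIV. \<Sum>n\<in>{..b $ j}. f j n) = (\<Sum>g\<in>Pi\<^sub>E UNIV (\<lambda>j. {..b $ j}). \<Prod>j\<in>UNIV. f j (g j))"
    by (rule prod_sum_PiE) auto
  also have "\<dots> = (\<Sum>g\<in>{..b}. \<Prod>j\<in>UNIV. f j (g $ j))"
    by (rule sum.reindex_bij_witness[where i = vec_nth and j = vec_lambda]) (auto simp: le_vec_iff)
  finally show ?thesis by simp
qed

lemma box_char_orthogonal:
  "(\<Sum>g\<in>{..b}. box_char b a g * cnj (box_char b c g)) =
    (if box_red b a = box_red b c then of_nat (box_size b) else 0)"
proof -
  define \<omega> where "\<omega> j n = exp (2 * of_real pi * \<i> * of_nat n / of_nat (b $ j + 1))" for j n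
  have nz: "\<omega> j n \<noteq> 0" and nrm: "cnj (\<omega> j n) = inverse (\<omega> j n)" and pow: "\<omega> j n ^ (b $ j + 1) = 1" for j n
  proof -
    show "\<omega> j n \<noteq> 0" by (simp add: \<omega>_def)
    have "\<omega> j n = cis (2 * pi * n / (b $ j + 1))"
      by (simp add: \<omega>_def cis_conv_exp mult_ac)
    then show "cnj (\<omega> j n) = inverse (\<omega> j n)"
      by (simp only: cis_cnj cis_inverse)
    show "\<omega> j n ^ (b $ j + 1) = 1"
      unfolding \<omega>_def by (rule complex_root_unity) simp
  qed
  have "(\<Sum>g\<in>{..b}. box_char b a g * cnj (box_char b c g)) =
      (\<Sum>g\<in>{..b}. \<Prod>j\<in>UNIV. (\<omega> j (a $ j) * inverse (\<omega> j (c $ j))) ^ (g $ j))"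
    unfolding box_char_def cnj_prod complex_cnj_power prod.distrib[symmetric] power_mult_distrib \<omega>_def[symmetric] nrm ..
  also have "\<dots> = (\<Prod>j\<in>UNIV. \<Sum>n\<in>{..b $ j}. (\<omega> j (a $ j) * inverse (\<omega> j (c $ j))) ^ n)"
    by (rule sum_box_prod)
  also have "\<dots> = (\<Prod>j\<in>UNIV. if a $ j mod (b $ j + 1) = c $ j mod (b $ j + 1) then of_nat (b $ j + 1) else 0)"
  proof (intro prod.cong refl)
    fix j
    let ?z = "\<omega> j (a $ j) * inverse (\<omega> j (c $ j))"
    have "?z = 1 \<longleftrightarrow> \<omega> j (a $ j) = \<omega> j (c $ j)" using nz[of j "c $ j"] by (simp add: field_simps)
    also have "\<dots> \<longleftrightarrow> a $ j mod (b $ j + 1) = c $ j mod (b $ j + 1)"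
      unfolding \<omega>_def by (rule complex_root_unity_eq) simp
    finally have one: "?z = 1 \<longleftrightarrow> a $ j mod (b $ j + 1) = c $ j mod (b $ j + 1)" .
    have "?z ^ (b $ j + 1) = 1" unfolding power_mult_distrib power_inverse pow by simp
    then have "?z \<noteq> 1 \<Longrightarrow> (\<Sum>n\<in>{..b $ j}. ?z ^ n) = 0"
      using geometric_sum[of ?z "b $ j + 1"] by (simp add: lessThan_Suc_atMost)
    then show "(\<Sum>n\<in>{..b $ j}. ?z ^ n) = (if a $ j mod (b $ j + 1) = c $ j mod (b $ j + 1) then of_nat (b $ j + 1) else 0)"
      using one by (cases "?z = 1") auto
  qed
  also have "\<dots> = (if box_red b a = box_red b c then of_nat (box_size b) else 0)"
    by (auto simp: box_red_def vec_eq_iff box_size_def of_nat_prod)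
  finally show ?thesis .
qed

lemma box_char_symmetric: "box_char b a g = box_char b g a"
  unfolding box_char_def exp_of_nat_mult[symmetric] by (simp add: mult_ac)

lemma mpow_grid: "mpow (grid b \<rho> g) c = of_real (\<rho> ^ mdeg c) * box_char b g c"
  unfolding mpow_def grid_def box_char_def vec_lambda_beta power_mult_distrib prod.distrib mdeg_def power_sum by simp

lemma grid_coordinate: "0 \<le> \<rho> \<Longrightarrow> cmod (grid b \<rho> g $ j) = \<rho>"
proof -
  assume "0 \<le> \<rho>"
  have "2 * of_real pi * \<i> * of_nat (g $ j) / of_nat (b $ j + 1) = \<i> * of_real (2 * pi * (g $ j) / (b $ j + 1))" by simp
  then have "cmod (exp (2 * of_real pi * \<i> * of_nat (g $ j) / of_nat (b $ j + 1))) = 1"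
    by (simp only: norm_exp_i_times)
  then show ?thesis using \<open>0 \<le> \<rho>\<close> by (simp add: grid_def norm_mult)
qed

text \<open>Weights on the grid with prescribed moments on the box. Beyond the box the moments are determined
  by aliasing, but carry additional powers of \<open>\<rho>\<close>.\<close>

definition grid_weight :: "nat ^ 'd \<Rightarrow> real \<Rightarrow> (nat ^ 'd \<Rightarrow> complex) \<Rightarrow> nat ^ 'd \<Rightarrow> complex" where
  "grid_weight b \<rho> x g = (\<Sum>a\<in>{..b}. x a * of_real (1 / (\<rho> ^ mdeg a * box_size b)) * box_char b a g)"

lemma moment_grid:
  assumes \<rho>: "0 < \<rho>"
  shows "moment {..b} (grid b \<rho>) (grid_weight b \<rho> x) c =
    x (box_red b c) * of_real (\<rho> ^ (mdeg c - mdeg (box_red b c)))"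
proof -
  have "moment {..b} (grid b \<rho>) (grid_weight b \<rho> x) c =
      (\<Sum>g\<in>{..b}. \<Sum>a\<in>{..b}. x a * of_real (\<rho> ^ mdeg c / (\<rho> ^ mdeg a * box_size b)) * (box_char b a g * cnj (box_char b c g)))"
    unfolding moment_def grid_weight_def mpow_grid sum_distrib_right
    by (intro sum.cong refl) (simp add: box_char_symmetric[of b _ c])
  also have "\<dots> = (\<Sum>a\<in>{..b}. \<Sum>g\<in>{..b}. x a * of_real (\<rho> ^ mdeg c / (\<rho> ^ mdeg a * box_size b)) * (box_char b a g * cnj (box_char b c g)))"
    by (rule sum.swap)
  also have "\<dots> = (\<Sum>a\<in>{..b}. if a = box_red b c then x (box_red b c) * of_real (\<rho> ^ mdeg c / \<rho> ^ mdeg (box_red b c)) else 0)"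
    unfolding sum_distrib_left[symmetric] box_char_orthogonal
    using box_size_pos[of b] by (intro sum.cong refl) (auto simp: box_red_id)
  also have "\<dots> = x (box_red b c) * of_real (\<rho> ^ mdeg c / \<rho> ^ mdeg (box_red b c))"
    by (simp add: finite_atMost_vec box_red_le)
  also have "\<rho> ^ mdeg c / \<rho> ^ mdeg (box_red b c) = \<rho> ^ (mdeg c - mdeg (box_red b c))"
    using \<rho> mdeg_mono[OF box_red_le'[of b c]] by (simp add: power_diff)
  finally show ?thesis .
qed

lemma moment_grid_box: "0 < \<rho> \<Longrightarrow> c \<le> b \<Longrightarrow> moment {..b} (grid b \<rho>) (grid_weight b \<rho> x) c = x c"
  by (simp add: moment_grid box_red_id)

text \<open>The extra powers of \<open>\<rho>\<close> that aliasing produces: one of them is kept, the others are traded for powers of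
  the fixed radius \<open>q\<close>, at which the series converges.\<close>

lemma power_diff_le:
  fixes \<rho> q :: real
  assumes "0 < \<rho>" "\<rho> \<le> q" "q \<le> 1" "m < n" "m \<le> M"
  shows "\<rho> ^ (n - m) \<le> \<rho> * (q ^ n / q ^ (M + 1))"
proof -
  have "\<rho> ^ (n - m) = \<rho> * \<rho> ^ (n - m - 1)"
    using assms(4) by (metis Suc_diff_1 power_Suc zero_less_diff)
  also have "\<dots> \<le> \<rho> * q ^ (n - m - 1)" using assms by (intro mult_left_mono power_mono) auto
  also have "q ^ (n - m - 1) \<le> q ^ n / q ^ (M + 1)"
  proof -
    have "q ^ (n - m - 1) * q ^ (M + 1) = q ^ (n - m - 1 + (M + 1))" by (simp add: power_add)
    also have "\<dots> \<le> q ^ n" using assms by (intro power_decreasing) auto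
    finally show ?thesis using assms by (simp add: pos_le_divide_eq)
  qed
  finally show ?thesis using assms by simp
qed

lemma moment_grid_outside:
  assumes "0 < \<rho>" "\<rho> \<le> r" "r \<le> 1" "\<not> c \<le> b"
  shows "cmod (moment {..b} (grid b \<rho>) (grid_weight b \<rho> x) c) \<le>
    \<rho> * ((\<Sum>a\<in>{..b}. cmod (x a)) / r ^ (mdeg b + 1)) * r ^ mdeg c"
proof -
  have lt: "mdeg (box_red b c) < mdeg c"
    by (rule mdeg_strict_mono[OF box_red_le' box_red_neq[OF assms(4)]])
  have "cmod (moment {..b} (grid b \<rho>) (grid_weight b \<rho> x) c) = cmod (x (box_red b c)) * \<rho> ^ (mdeg c - mdeg (box_red b c))"
    using assms by (simp add: moment_grid norm_mult norm_power)
  also have "\<dots> \<le> (\<Sum>a\<in>{..b}. cmod (x a)) * (\<rho> * (r ^ mdeg c / r ^ (mdeg b + 1)))"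
    using assms lt mdeg_mono[OF box_red_le]
    by (intro mult_mono power_diff_le member_le_sum sum_nonneg) (auto simp: box_red_le finite_atMost_vec)
  finally show ?thesis by (simp add: algebra_simps)
qed

section \<open>Holomorphy of power series and the identity theorem\<close>

definition mpow_deriv :: "nat ^ 'd \<Rightarrow> complex ^ 'd \<Rightarrow> complex ^ 'd \<Rightarrow> complex" where
  "mpow_deriv a x h = (\<Sum>j\<in>UNIV. of_nat (a $ j) * h $ j * x $ j ^ (a $ j - 1) * (\<Prod>i\<in>UNIV - {j}. x $ i ^ (a $ i)))"

lemma mpow_has_derivative: "((\<lambda>x. mpow x a) has_derivative mpow_deriv a x) (at x within S)"
  unfolding mpow_def mpow_deriv_def
  by (intro has_derivative_prod has_derivative_power bounded_linear.has_derivative[OF bounded_linear_vec_nth] has_derivative_ident)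

lemma mpow_deriv_linear: "mpow_deriv a x (c *s h) = c * mpow_deriv a x h"
  by (simp add: mpow_deriv_def sum_distrib_left mult_ac)

text \<open>The derivative of \<open>t\<^sup>n\<close> on the disc of radius \<open>r\<close> is dominated by the values on a larger circle.\<close>

lemma power_deriv_bound:
  fixes r R :: real
  assumes "0 < r" "r < R"
  obtains M where "0 \<le> M" "\<And>n. of_nat n * r ^ (n - 1) \<le> M * R ^ n"
proof -
  have "(\<lambda>n. of_nat n * (r / R) ^ n) \<longlonglongrightarrow> 0"
    using assms by (intro powser_times_n_limit_0) simp
  then have "Bseq (\<lambda>n. of_nat n * (r / R) ^ n)" by (auto intro: convergent_imp_Bseq convergentI)
  then obtain K where K: "0 < K" "\<And>n. norm (of_nat n * (r / R) ^ n) \<le> K" by (auto elim: BseqE)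
  have "of_nat n * r ^ (n - 1) \<le> K / r * R ^ n" for n
  proof (cases n)
    case (Suc m)
    have "of_nat n * (r / R) ^ n \<le> K" using K(2)[of n] by simp
    then have "of_nat n * r ^ n \<le> K * R ^ n" using assms by (simp add: field_simps power_divide)
    moreover have "r ^ n = r * r ^ (n - 1)" using Suc by simp
    ultimately show ?thesis using assms by (simp add: field_simps)
  qed (use K assms in simp)
  then show ?thesis using K assms that[of "K / r"] by simp
qed

lemma mpow_deriv_bound:
  fixes y :: "complex ^ 'd"
  assumes "\<And>j. 0 < r j" "\<And>j. r j < cmod (y $ j)"
  obtains M where "0 \<le> M" "\<And>a x h. (\<And>j. cmod (x $ j) \<le> r j) \<Longrightarrow> cmod (mpow_deriv a x h) \<le> M * norm h * cmod (mpow y a)"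
proof -
  have "\<exists>M. 0 \<le> M \<and> (\<forall>n. of_nat n * r j ^ (n - 1) \<le> M * cmod (y $ j) ^ n)" for j
    using power_deriv_bound[OF assms] by metis
  then obtain M where M: "\<And>j. 0 \<le> M j" "\<And>j n. of_nat n * r j ^ (n - 1) \<le> M j * cmod (y $ j) ^ n"
    by metis
  show ?thesis
  proof (rule that[of "\<Sum>j\<in>UNIV. M j"])
    show "0 \<le> (\<Sum>j\<in>UNIV. M j)" using M by (simp add: sum_nonneg)
    fix a and x h :: "complex ^ 'd" assume x: "\<And>j. cmod (x $ j) \<le> r j"
    have "cmod (mpow_deriv a x h) \<le> (\<Sum>j\<in>UNIV. M j * norm h * cmod (mpow y a))"
      unfolding mpow_deriv_def
    proof (rule sum_norm_le)
      fix j :: 'd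
      have "cmod (of_nat (a $ j) * h $ j * x $ j ^ (a $ j - 1) * (\<Prod>i\<in>UNIV - {j}. x $ i ^ (a $ i))) =
          cmod (h $ j) * ((of_nat (a $ j) * cmod (x $ j) ^ (a $ j - 1)) * (\<Prod>i\<in>UNIV - {j}. cmod (x $ i) ^ (a $ i)))"
        by (simp add: norm_mult norm_power flip: prod_norm)
      also have "\<dots> \<le> norm h * ((M j * cmod (y $ j) ^ (a $ j)) * (\<Prod>i\<in>UNIV - {j}. cmod (y $ i) ^ (a $ i)))"
      proof -
        have "of_nat (a $ j) * cmod (x $ j) ^ (a $ j - 1) \<le> of_nat (a $ j) * r j ^ (a $ j - 1)"
          using x by (intro mult_left_mono power_mono) auto
        also have "\<dots> \<le> M j * cmod (y $ j) ^ (a $ j)" by (rule M(2))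
        finally have A: "of_nat (a $ j) * cmod (x $ j) ^ (a $ j - 1) \<le> M j * cmod (y $ j) ^ (a $ j)" .
        have "cmod (x $ i) \<le> cmod (y $ i)" for i using x assms(2) by (meson order_trans less_imp_le)
        then have B: "(\<Prod>i\<in>UNIV - {j}. cmod (x $ i) ^ (a $ i)) \<le> (\<Prod>i\<in>UNIV - {j}. cmod (y $ i) ^ (a $ i))"
          by (intro prod_mono) (auto intro: power_mono)
        show ?thesis
          by (rule mult_mono[OF Finite_Cartesian_Product.norm_nth_le mult_mono[OF A B]])
            (use M(1) in \<open>auto intro!: mult_nonneg_nonneg prod_nonneg\<close>)
      qed
      also have "\<dots> = M j * norm h * cmod (mpow y a)"
        unfolding cmod_mpow by (subst prod.remove[of UNIV j]) (auto simp: mult_ac)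
      finally show "cmod (of_nat (a $ j) * h $ j * x $ j ^ (a $ j - 1) * (\<Prod>i\<in>UNIV - {j}. x $ i ^ (a $ i))) \<le>
        M j * norm h * cmod (mpow y a)" .
    qed
    then show "cmod (mpow_deriv a x h) \<le> (\<Sum>j\<in>UNIV. M j) * norm h * cmod (mpow y a)"
      by (simp add: sum_distrib_right)
  qed
qed

lemma multi_index_enumeration:
  obtains e :: "nat \<Rightarrow> nat ^ 'd" where "bij_betw e UNIV UNIV"
proof -
  have "inj (\<lambda>n. (\<chi> j. n) :: nat ^ 'd)" by (auto simp: inj_def vec_eq_iff)
  then have "infinite (range (\<lambda>n. (\<chi> j. n) :: nat ^ 'd))" by (rule range_inj_infinite)
  then have "infinite (UNIV :: (nat ^ 'd) set)" by (meson finite_subset subset_UNIV)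
  with countableI_type[of "UNIV :: (nat ^ 'd) set"] show ?thesis
    by (intro that[OF bij_betw_from_nat_into])
qed

text \<open>Termwise differentiation along an enumeration of the multi-indices. On a polydisc strictly inside the one
  of \<open>y\<close> the differentiated terms are dominated by a multiple of the terms at \<open>y\<close>.\<close>

theorem power_series_has_derivative:
  fixes C :: "nat ^ 'd \<Rightarrow> complex"
  assumes y: "(\<lambda>a. C a * mpow y a) summable_on UNIV" and z: "\<And>j. cmod (z $ j) < cmod (y $ j)"
  shows "\<exists>D. ((\<lambda>x. \<Sum>\<^sub>\<infinity>a. C a * mpow x a) has_derivative D) (at z) \<and> (\<forall>c v. D (c *s v) = c * D v)"
proof -
  obtain e :: "nat \<Rightarrow> nat ^ 'd" where e: "bij_betw e UNIV UNIV" by (rule multi_index_enumeration)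
  define r where "r j = (cmod (z $ j) + cmod (y $ j)) / 2" for j
  have r: "0 < r j" "r j < cmod (y $ j)" "cmod (z $ j) < r j" for j
  proof -
    have "0 < (s + t) / 2 \<and> (s + t) / 2 < t \<and> s < (s + t) / 2" if "0 \<le> s" "s < t" for s t :: real
      using that by simp
    then have "0 < r j \<and> r j < cmod (y $ j) \<and> cmod (z $ j) < r j"
      unfolding r_def using z[of j] by (metis norm_ge_zero)
    then show "0 < r j" "r j < cmod (y $ j)" "cmod (z $ j) < r j" by auto
  qed
  obtain M where M: "0 \<le> M" "\<And>a x h. (\<And>j. cmod (x $ j) \<le> r j) \<Longrightarrow> cmod (mpow_deriv a x h) \<le> M * norm h * cmod (mpow y a)"
    using mpow_deriv_bound[OF r(1,2)] by blast
  define S where "S = (\<Inter>j. {x. cmod (x $ j) < r j})"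
  have S: "convex S" "open S" "z \<in> S"
  proof -
    have "{x. cmod (x $ j) < r j} = (\<lambda>x. x $ j) -` ball 0 (r j)" for j by auto
    then show "convex S" unfolding S_def
      by (auto intro!: convex_INT convex_linear_vimage[OF bounded_linear.linear[OF bounded_linear_vec_nth]])
    show "open S" unfolding S_def by (intro open_INT ballI open_Collect_less continuous_intros) auto
    show "z \<in> S" using r by (auto simp: S_def)
  qed
  have xr: "cmod (x $ j) \<le> r j" if "x \<in> S" for x j using that by (auto simp: S_def intro: less_imp_le)
  define t where "t a = cmod (C a) * cmod (mpow y a)" for a
  have t: "t summable_on UNIV"
    using y unfolding summable_on_iff_abs_summable_on_complex by (simp add: norm_mult t_def[abs_def])
  have te: "summable (\<lambda>i. t (e i))"
    using t by (intro summable_on_imp_summable) (simp add: summable_on_reindex_bij_betw[OF e])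
  have sumF: "(\<lambda>a. C a * mpow x a) summable_on UNIV" if "x \<in> S" for x
  proof -
    have "(\<lambda>a. norm (C a * mpow x a)) summable_on UNIV"
    proof (rule Infinite_Sum.abs_summable_on_comparison_test'[OF t])
      fix a
      have "cmod (mpow x a) \<le> cmod (mpow y a)"
        using xr[OF that] r(2) by (intro cmod_mpow_mono) (meson less_imp_le order_trans)
      then show "norm (C a * mpow x a) \<le> t a" by (simp add: norm_mult t_def mult_left_mono)
    qed
    then show ?thesis by (rule abs_summable_summable)
  qed
  have dterm: "norm (C a * mpow_deriv a x h) \<le> M * norm h * t a" if "x \<in> S" for a x h
    using mult_left_mono[OF M(2)[OF xr[OF that], of a h] norm_ge_zero[of "C a"]] by (simp add: norm_mult t_def mult_ac)
  have sumD: "(\<lambda>a. C a * mpow_deriv a x h) summable_on UNIV" if "x \<in> S" for x h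
  proof -
    have "(\<lambda>a. norm (C a * mpow_deriv a x h)) summable_on UNIV"
      by (rule Infinite_Sum.abs_summable_on_comparison_test'[OF summable_on_cmult_right[OF t]]) (rule dterm[OF that])
    then show ?thesis by (rule abs_summable_summable)
  qed
  define g' where "g' x h = (\<Sum>\<^sub>\<infinity>a. C a * mpow_deriv a x h)" for x h
  have enum: "(\<lambda>i. u (e i)) sums infsum u UNIV" if "u summable_on UNIV" for u :: "nat ^ 'd \<Rightarrow> complex"
  proof -
    have "(u has_sum infsum u UNIV) UNIV" using that by simp
    then have "((\<lambda>i. u (e i)) has_sum infsum u UNIV) UNIV"
      by (simp add: has_sum_reindex_bij_betw[OF e])
    then show ?thesis by (rule has_sum_imp_sums)
  qed
  have "\<exists>g. \<forall>x\<in>S. (\<lambda>n. C (e n) * mpow x (e n)) sums (g x) \<and> (g has_derivative g' x) (at x within S)"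
  proof (rule has_derivative_series[where f = "\<lambda>n x. C (e n) * mpow x (e n)"
        and f' = "\<lambda>n x h. C (e n) * mpow_deriv (e n) x h" and x = z, OF S(1) _ _ S(3) enum[OF sumF[OF S(3)]]])
    show "((\<lambda>x. C (e n) * mpow x (e n)) has_derivative (\<lambda>h. C (e n) * mpow_deriv (e n) x h)) (at x within S)" for n x
      by (rule has_derivative_mult_right[OF mpow_has_derivative])
    fix \<epsilon> :: real assume \<epsilon>: "0 < \<epsilon>"
    have "(\<lambda>n. M * (\<Sum>i. t (e (i + n)))) \<longlonglongrightarrow> M * 0"
      by (intro tendsto_intros suminf_exist_split2 te)
    then have "eventually (\<lambda>n. M * (\<Sum>i. t (e (i + n))) < \<epsilon>) sequentially"
      using \<epsilon> by (intro order_tendstoD) simp_all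
    then show "\<forall>\<^sub>F n in sequentially. \<forall>x\<in>S. \<forall>h. norm ((\<Sum>i<n. C (e i) * mpow_deriv (e i) x h) - g' x h) \<le> \<epsilon> * norm h"
    proof (rule eventually_mono, intro ballI allI)
      fix n x and h :: "complex ^ 'd" assume n: "M * (\<Sum>i. t (e (i + n))) < \<epsilon>" and x: "x \<in> S"
      let ?u = "\<lambda>i. C (e i) * mpow_deriv (e i) x h"
      have "?u sums g' x h" unfolding g'_def by (rule enum[OF sumD[OF x]])
      then have tail: "(\<lambda>i. ?u (i + n)) sums (g' x h - (\<Sum>i<n. ?u i))"
        by (rule sums_split_initial_segment)
      have st: "summable (\<lambda>i. M * norm h * t (e (i + n)))"
        using te by (intro summable_mult summable_ignore_initial_segment)
      have "norm (g' x h - (\<Sum>i<n. ?u i)) = norm (\<Sum>i. ?u (i + n))"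
        using tail by (simp add: sums_iff)
      also have "\<dots> \<le> (\<Sum>i. norm (?u (i + n)))"
        by (rule summable_norm) (rule summable_comparison_test'[OF st], use dterm[OF x] in auto)
      also have "\<dots> \<le> (\<Sum>i. M * norm h * t (e (i + n)))"
        by (rule suminf_le[OF dterm[OF x] _ st]) (rule summable_comparison_test'[OF st], use dterm[OF x] in auto)
      also have "\<dots> = M * (\<Sum>i. t (e (i + n))) * norm h"
        using te by (subst suminf_mult) (auto simp: mult_ac intro: summable_ignore_initial_segment)
      also have "\<dots> \<le> \<epsilon> * norm h" using n by (intro mult_right_mono) auto
      finally show "norm ((\<Sum>i<n. ?u i) - g' x h) \<le> \<epsilon> * norm h" by (simp add: norm_minus_commute)
    qed
  qed
  then obtain g where g: "\<And>x. x \<in> S \<Longrightarrow> (\<lambda>n. C (e n) * mpow x (e n)) sums (g x)"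
    "\<And>x. x \<in> S \<Longrightarrow> (g has_derivative g' x) (at x within S)" by blast
  have "(g has_derivative g' z) (at z)"
    using g(2)[OF S(3)] unfolding at_within_open[OF S(3,2)] .
  then have "((\<lambda>x. \<Sum>\<^sub>\<infinity>a. C a * mpow x a) has_derivative g' z) (at z)"
    by (rule has_derivative_transform_within_open[OF _ S(2,3)]) (rule sums_unique2[OF g(1) enum[OF sumF]])
  moreover have "g' z (c *s v) = c * g' z v" for c v
    unfolding g'_def mpow_deriv_linear by (subst infsum_cmult_right'[symmetric]) (simp add: mult_ac)
  ultimately show ?thesis by blast
qed

lemma holomorphic_several_line:
  assumes f: "holomorphic_several \<Omega> f" and line: "\<And>t. t \<in> T \<Longrightarrow> p + t *s u \<in> \<Omega>"
  shows "(\<lambda>t. f (p + t *s u)) holomorphic_on T"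
  unfolding holomorphic_on_def
proof
  fix t assume t: "t \<in> T"
  obtain D where D: "(f has_derivative D) (at (p + t *s u))" "\<And>c v. D (c *s v) = c * D v"
    using f line[OF t] unfolding holomorphic_several_def by blast
  have "linear (\<lambda>t::complex. t *s u)"
    by (rule linearI) (auto simp: vec_eq_iff algebra_simps)
  then have "((\<lambda>t. t *s u) has_derivative (\<lambda>t. t *s u)) (at t)"
    by (simp add: bounded_linear_imp_has_derivative linear_conv_bounded_linear)
  then have "((\<lambda>t. p + t *s u) has_derivative (\<lambda>t. t *s u)) (at t)"
    using has_derivative_add[OF has_derivative_const[of p]] by fastforce
  from diff_chain_at[OF this D(1)]
  have "((\<lambda>t. f (p + t *s u)) has_derivative (\<lambda>s. D u * s)) (at t)"
    by (simp add: o_def D(2) mult.commute)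
  then have "((\<lambda>t. f (p + t *s u)) has_field_derivative D u) (at t)"
    by (simp add: has_field_derivative_def)
  then show "(\<lambda>t. f (p + t *s u)) field_differentiable at t within T"
    using field_differentiable_at_within field_differentiable_def by blast
qed

text \<open>The set of points near which \<open>f\<close> and \<open>g\<close> agree is open, and closed in \<open>\<Omega>\<close> by the identity theorem for one
  variable on complex lines.\<close>

theorem holomorphic_several_identity:
  fixes \<Omega> :: "(complex ^ 'd) set"
  assumes \<Omega>: "open \<Omega>" "connected \<Omega>" "0 \<in> \<Omega>"
    and f: "holomorphic_several \<Omega> f" and g: "holomorphic_several \<Omega> g"
    and r: "0 < r" "\<And>z. z \<in> \<Omega> \<Longrightarrow> norm z < r \<Longrightarrow> f z = g z" and z: "z \<in> \<Omega>"
  shows "f z = g z"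
proof -
  define S where "S = {z \<in> \<Omega>. \<exists>e>0. \<forall>y\<in>ball z e. y \<in> \<Omega> \<longrightarrow> f y = g y}"
  have "open S"
    unfolding open_contains_ball
  proof
    fix z assume "z \<in> S"
    then obtain e where e: "z \<in> \<Omega>" "0 < e" "\<And>y. y \<in> ball z e \<Longrightarrow> y \<in> \<Omega> \<Longrightarrow> f y = g y" by (auto simp: S_def)
    obtain d where d: "0 < d" "ball z d \<subseteq> \<Omega>" using \<Omega>(1) e(1) open_contains_ball by blast
    have "ball z (min d e) \<subseteq> S"
    proof
      fix w assume w: "w \<in> ball z (min d e)"
      then obtain e' where "0 < e'" "ball w e' \<subseteq> ball z (min d e)" by (rule openE[OF open_ball])
      then show "w \<in> S" unfolding S_def using w d e(3) by (auto intro!: exI[of _ e'])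
    qed
    then show "\<exists>e>0. ball z e \<subseteq> S" using d e by (intro exI[of _ "min d e"]) auto
  qed
  moreover have "\<exists>T. open T \<and> w \<in> T \<and> T \<inter> \<Omega> \<subseteq> - S" if w: "w \<in> \<Omega> - S" for w
  proof -
    obtain d where d: "0 < d" "ball w (2 * d) \<subseteq> \<Omega>"
    proof -
      obtain d where "0 < d" "ball w d \<subseteq> \<Omega>" using \<Omega>(1) w open_contains_ball by blast
      then show ?thesis using that[of "d / 2"] by simp
    qed
    have "ball w d \<inter> \<Omega> \<subseteq> - S"
    proof (intro subsetI ComplI, elim IntE)
      fix p assume p: "p \<in> ball w d" "p \<in> S"
      then obtain e where e: "0 < e" "\<And>y. y \<in> ball p e \<Longrightarrow> y \<in> \<Omega> \<Longrightarrow> f y = g y" by (auto simp: S_def)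
      \<comment> \<open>every point of the ball about \<open>p\<close> is joined to \<open>p\<close> by a complex line inside \<open>\<Omega>\<close>\<close>
      have "f y = g y" if y: "y \<in> ball p d" for y
      proof -
        define u where "u = y - p"
        have nu: "norm u < d" using y by (simp add: u_def dist_norm norm_minus_commute)
        have ns: "norm (t *s u) = cmod t * norm u" for t
          unfolding norm_vec_def by (simp add: norm_mult L2_set_right_distrib)
        define T where "T = {t. cmod t * norm u < d}"
        have "T = (if u = 0 then UNIV else ball 0 (d / norm u))"
          using d(1) by (auto simp: T_def field_simps)
        then have T: "open T" "connected T" by (auto intro: convex_connected)
        have inT: "0 \<in> T" "1 \<in> T" using d nu by (auto simp: T_def)
        have line: "p + t *s u \<in> \<Omega>" if "t \<in> T" for t
        proof -
          have "dist w (p + t *s u) \<le> dist w p + norm (t *s u)"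
            using dist_triangle[of w "p + t *s u" p] by (simp add: dist_norm)
          then have "p + t *s u \<in> ball w (2 * d)" using p that by (simp add: ns T_def)
          then show ?thesis using d(2) by blast
        qed
        define U where "U = {t. cmod t * norm u < min d e}"
        have "U = (if u = 0 then UNIV else ball 0 (min d e / norm u))"
          using d(1) e(1) by (auto simp: U_def field_simps)
        then have "open U" by auto
        then have U: "open U" "0 \<in> U" "U \<subseteq> T" using d(1) e(1) by (auto simp: U_def T_def)
        have "f (p + 1 *s u) = g (p + 1 *s u)"
        proof (rule analytic_continuation_open[where f = "\<lambda>t. f (p + t *s u)" and g = "\<lambda>t. g (p + t *s u)",
              OF U(1) T(1) _ T(2) U(3)])
          show "(\<lambda>t. f (p + t *s u)) holomorphic_on T" "(\<lambda>t. g (p + t *s u)) holomorphic_on T"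
            using holomorphic_several_line[OF f line] holomorphic_several_line[OF g line] by auto
          fix t assume "t \<in> U"
          then show "f (p + t *s u) = g (p + t *s u)"
            using U(3) line by (intro e(2)) (auto simp: dist_norm ns U_def)
        qed (use U inT in auto)
        then show ?thesis by (simp add: u_def)
      qed
      moreover have "w \<in> ball p d" using p by (simp add: dist_commute)
      moreover obtain e' where "0 < e'" "ball w e' \<subseteq> ball p d"
        using openE[OF open_ball \<open>w \<in> ball p d\<close>] by blast
      ultimately have "w \<in> S" unfolding S_def using w by (auto intro!: exI[of _ e'])
      then show False using w by simp
    qed
    then show ?thesis using d by (intro exI[of _ "ball w d"]) auto
  qed
  then have "\<exists>T. open T \<and> T \<inter> \<Omega> = \<Omega> - S"
  proof -
    assume *: "\<And>w. w \<in> \<Omega> - S \<Longrightarrow> \<exists>T. open T \<and> w \<in> T \<and> T \<inter> \<Omega> \<subseteq> - S"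
    then obtain T where T: "\<And>w. w \<in> \<Omega> - S \<Longrightarrow> open (T w) \<and> w \<in> T w \<and> T w \<inter> \<Omega> \<subseteq> - S" by metis
    have "open (\<Union>w\<in>\<Omega> - S. T w)" using T by blast
    moreover have "(\<Union>w\<in>\<Omega> - S. T w) \<inter> \<Omega> = \<Omega> - S" using T by blast
    ultimately show ?thesis by blast
  qed
  then obtain T where T: "open T" "T \<inter> \<Omega> = \<Omega> - S" by blast
  have "0 \<in> S" unfolding S_def using r \<Omega>(3) by (auto intro!: exI[of _ r])
  have "\<Omega> \<subseteq> S"
  proof (rule ccontr)
    assume "\<not> \<Omega> \<subseteq> S"
    then have "T \<inter> \<Omega> \<noteq> {}" using T(2) by blast
    moreover have "S \<inter> T \<inter> \<Omega> = {}" "\<Omega> \<subseteq> S \<union> T" "S \<inter> \<Omega> \<noteq> {}" using T(2) \<open>0 \<in> S\<close> \<Omega>(3) by auto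
    ultimately show False using connectedD[OF \<Omega>(2) \<open>open S\<close> T(1)] by blast
  qed
  then have "z \<in> S" using z by blast
  then show ?thesis using z by (auto simp: S_def dest: bspec[of _ _ z])
qed

section \<open>Diagonal holomorphic kernels\<close>

lemma diag_series_cnj:
  assumes "(ps_term c (z * vcnj w) has_sum S) UNIV"
  shows "(ps_term c (w * vcnj z) has_sum cnj S) UNIV"
proof -
  have "((\<lambda>a. cnj (ps_term c (z * vcnj w) a)) has_sum cnj S) UNIV"
    using assms by (simp only: has_sum_cnj_iff)
  then show ?thesis
    by (simp add: ps_term_def[abs_def] mpow_times_vcnj mult_ac)
qed

lemma ps_eval_cnj: "cnj (ps_eval c (z * vcnj w)) = ps_eval c (w * vcnj z)"
proof -
  have "cnj (ps_eval c (z * vcnj w)) = infsum (\<lambda>a. cnj (ps_term c (z * vcnj w) a)) UNIV"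
    by (simp add: ps_eval_eq)
  then show ?thesis
    by (simp add: ps_eval_eq ps_term_def[abs_def] mpow_times_vcnj mult_ac)
qed

lemma diag_series_holomorphic:
  fixes c :: "nat ^ 'd \<Rightarrow> real"
  assumes c: "\<And>a. 0 \<le> c a" and \<Omega>: "\<Omega> \<subseteq> conv_domain c" and w: "ps_term c (w * vcnj w) summable_on UNIV"
  shows "holomorphic_several \<Omega> (\<lambda>z. ps_eval c (z * vcnj w))"
  unfolding holomorphic_several_def
proof
  fix z assume "z \<in> \<Omega>"
  then obtain y where y: "\<And>j. cmod (z $ j) < cmod (y $ j)" "ps_term c (y * vcnj y) summable_on UNIV"
    using conv_domain_polydisc[of c z, OF c] \<Omega> by blast
  have e: "ps_term c (x * vcnj w) = (\<lambda>a. (of_real (c a) * cnj (mpow w a)) * mpow x a)" for x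
    by (auto simp: ps_term_def mpow_times_vcnj)
  have "ps_term c (y * vcnj w) summable_on UNIV" by (rule ps_summable_product[OF c y(2) w])
  then have "(\<lambda>a. (of_real (c a) * cnj (mpow w a)) * mpow y a) summable_on UNIV" unfolding e .
  from power_series_has_derivative[OF this y(1)]
  show "\<exists>D. ((\<lambda>z. ps_eval c (z * vcnj w)) has_derivative D) (at z) \<and> (\<forall>c v. D (c *s v) = c * D v)"
    unfolding ps_eval_eq e .
qed

lemma holomorphic_several_cong:
  assumes "\<And>z. z \<in> \<Omega> \<Longrightarrow> f z = g z" "open \<Omega>" "holomorphic_several \<Omega> f"
  shows "holomorphic_several \<Omega> g"
  unfolding holomorphic_several_def
proof
  fix z assume z: "z \<in> \<Omega>"
  obtain D where "(f has_derivative D) (at z)" "\<forall>c v. D (c *s v) = c * D v"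
    using assms(3) z unfolding holomorphic_several_def by blast
  moreover have "(g has_derivative D) (at z)"
    by (rule has_derivative_transform_within_open[OF calculation(1) assms(2) z]) (rule assms(1))
  ultimately show "\<exists>D. (g has_derivative D) (at z) \<and> (\<forall>c v. D (c *s v) = c * D v)" by blast
qed

theorem diagonal_holomorphic_kernelI:
  fixes c :: "nat ^ 'd \<Rightarrow> real"
  assumes c: "\<And>a. 0 < c a" and \<Omega>: "open \<Omega>" "\<Omega> \<subseteq> conv_domain c"
    and f: "\<And>z w. z \<in> \<Omega> \<Longrightarrow> w \<in> \<Omega> \<Longrightarrow> f z w = ps_eval c (z * vcnj w)"
  shows "diagonal_holomorphic_kernel \<Omega> f c"
proof -
  have c0: "0 \<le> c a" for a using c[of a] by simp
  have self: "ps_term c (z * vcnj z) summable_on UNIV" if "z \<in> \<Omega>" for z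
    using conv_domain_summable[of c z, OF c0] \<Omega>(2) that by blast
  have hs: "(ps_term c (z * vcnj w) has_sum f z w) UNIV" if "z \<in> \<Omega>" "w \<in> \<Omega>" for z w
    using ps_has_sum[OF ps_summable_product[OF c0 self[OF that(1)] self[OF that(2)]]] f[OF that] by simp
  have hol: "holomorphic_several \<Omega> (\<lambda>z. ps_eval c (z * vcnj w))" if "w \<in> \<Omega>" for w
    by (rule diag_series_holomorphic[OF c0 \<Omega>(2) self[OF that]])
  show ?thesis
    unfolding diagonal_holomorphic_kernel_def
  proof (intro conjI ballI allI)
    show "kernel \<Omega> f" by (rule kernel_of_coefficients[OF c0 hs])
    show "holomorphic_several \<Omega> (\<lambda>z. f z w)" if "w \<in> \<Omega>" for w
      by (rule holomorphic_several_cong[OF _ \<Omega>(1) hol[OF that]]) (simp add: f that)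
    show "holomorphic_several \<Omega> (\<lambda>w. cnj (f z w))" if "z \<in> \<Omega>" for z
      by (rule holomorphic_several_cong[OF _ \<Omega>(1) hol[OF that]]) (simp add: f that ps_eval_cnj)
    show "\<exists>r>0. \<forall>z\<in>\<Omega> \<inter> ball 0 r. \<forall>w\<in>\<Omega> \<inter> ball 0 r.
        ((\<lambda>a. of_real (c a) * mpow z a * mpow (vcnj w) a) has_sum f z w) UNIV"
      using hs by (intro exI[of _ 1]) (simp add: ps_term_def[abs_def] mpow_mult mult.assoc)
  qed (rule c)
qed

lemma ps_summable_const:
  fixes c :: "nat ^ 'd \<Rightarrow> real"
  shows "ps_term c (\<chi> j. of_real r) summable_on UNIV \<longleftrightarrow> (\<lambda>a. \<bar>c a\<bar> * \<bar>r\<bar> ^ mdeg a) summable_on UNIV"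
  unfolding ps_summable_iff by (subst cmod_mpow_const[of _ "\<bar>r\<bar>"]) auto

lemma ball_contains_const:
  fixes \<Omega> :: "(complex ^ 'd) set"
  assumes "0 < r"
  obtains \<rho> where "0 < \<rho>" "\<rho> \<le> 1" "\<And>z :: complex ^ 'd. (\<And>j. cmod (z $ j) \<le> \<rho>) \<Longrightarrow> z \<in> ball 0 r"
proof -
  define \<rho> where "\<rho> = min 1 (r / (real CARD('d) + 1))"
  have \<rho>: "0 < \<rho>" "\<rho> \<le> 1" using assms by (auto simp: \<rho>_def)
  have "norm z < r" if "\<And>j. cmod (z $ j) \<le> \<rho>" for z :: "complex ^ 'd"
  proof -
    have "norm z \<le> real CARD('d) * \<rho>" by (rule norm_vec_le[OF that])
    also have "\<dots> \<le> real CARD('d) * (r / (real CARD('d) + 1))" by (intro mult_left_mono) (auto simp: \<rho>_def)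
    also have "\<dots> < r"
    proof -
      have "n * (r / (n + 1)) < r" if "0 \<le> n" for n :: real
        using that assms by (simp add: field_simps)
      then show ?thesis by simp
    qed
    finally show ?thesis .
  qed
  then show ?thesis using that[OF \<rho>] by simp
qed

lemma ps_summable_radius:
  fixes c :: "nat ^ 'd \<Rightarrow> real"
  assumes "ps_term c ((\<chi> j. of_real q) * vcnj (\<chi> j. of_real q)) summable_on UNIV"
  shows "(\<lambda>a. \<bar>c a\<bar> * (q\<^sup>2) ^ mdeg a) summable_on UNIV"
proof -
  have "(\<chi> j. of_real q) * vcnj (\<chi> j. of_real q) = (\<chi> j. of_real (q\<^sup>2) :: complex ^ 'd)"
    by (simp add: vec_eq_iff vcnj_def power2_eq_square)
  with assms have "(\<lambda>a. \<bar>c a\<bar> * \<bar>q\<^sup>2\<bar> ^ mdeg a) summable_on UNIV"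
    by (simp only: ps_summable_const)
  then show ?thesis by simp
qed

lemma le_of_le_add_small:
  fixes A :: real
  assumes "0 < q" "\<And>\<rho>. 0 < \<rho> \<Longrightarrow> \<rho> \<le> q \<Longrightarrow> A \<le> B + \<rho> * M"
  shows "A \<le> B"
proof -
  have "((\<lambda>\<rho>. B + \<rho> * M) \<longlongrightarrow> B + 0 * M) (at_right 0)" by (intro tendsto_intros)
  moreover have "eventually (\<lambda>\<rho>. A \<le> B + \<rho> * M) (at_right 0)"
    using assms by (auto simp: eventually_at_right_field intro!: exI[of _ q])
  ultimately have "A \<le> B + 0 * M" by (rule tendsto_lowerbound) simp
  then show ?thesis by simp
qed

text \<open>On combinations of grid points with prescribed moments \<open>x\<close> on the box, a kernel with a diagonal
  expansion acts as the diagonal matrix of its coefficients, up to an error of the order of the mesh.\<close>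

lemma grid_form_approx:
  assumes \<rho>: "0 < \<rho>" "\<rho> \<le> q" "q \<le> 1" and \<gamma>: "(\<lambda>a. \<bar>\<gamma> a\<bar> * (q\<^sup>2) ^ mdeg a) summable_on UNIV"
    and f: "\<And>i j. (ps_term \<gamma> (grid b \<rho> i * vcnj (grid b \<rho> j)) has_sum f i j) UNIV"
  shows "cmod (qf {..b} f (grid_weight b \<rho> x) - of_real (\<Sum>a\<in>{..b}. \<gamma> a * (cmod (x a))\<^sup>2)) \<le>
    \<rho> * (((\<Sum>a\<in>{..b}. cmod (x a)) / q ^ (mdeg b + 1))\<^sup>2 * infsum (\<lambda>a. \<bar>\<gamma> a\<bar> * (q\<^sup>2) ^ mdeg a) UNIV)"
proof -
  define K where "K = (\<Sum>a\<in>{..b}. cmod (x a)) / q ^ (mdeg b + 1)"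
  let ?m = "moment {..b} (grid b \<rho>) (grid_weight b \<rho> x)"
  let ?T = "\<lambda>a. complex_of_real (\<gamma> a * (cmod (?m a))\<^sup>2)"
  have hs: "(?T has_sum qf {..b} f (grid_weight b \<rho> x)) UNIV"
  proof -
    have "((\<lambda>a. qf {..b} (\<lambda>i j. ps_term \<gamma> (grid b \<rho> i * vcnj (grid b \<rho> j)) a) (grid_weight b \<rho> x)) has_sum
        qf {..b} f (grid_weight b \<rho> x)) UNIV"
      by (rule qf_has_sum) (rule f)
    then show ?thesis unfolding qf_monomial .
  qed
  have "norm (qf {..b} f (grid_weight b \<rho> x) - (\<Sum>a\<in>{..b}. ?T a)) \<le>
      \<rho> * infsum (\<lambda>a. K\<^sup>2 * (\<bar>\<gamma> a\<bar> * (q\<^sup>2) ^ mdeg a)) UNIV"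
  proof (rule has_sum_finite_approx[OF hs finite_atMost_vec summable_on_cmult_right[OF \<gamma>]])
    fix a assume "a \<notin> {..b}"
    then have "cmod (?m a) \<le> \<rho> * (K * q ^ mdeg a)"
      using moment_grid_outside[OF \<rho>, of a b x] by (simp add: K_def mult.assoc)
    then have "(cmod (?m a))\<^sup>2 \<le> (\<rho> * (K * q ^ mdeg a))\<^sup>2" by (intro power_mono) auto
    also have "\<dots> = \<rho>\<^sup>2 * (K\<^sup>2 * (q\<^sup>2) ^ mdeg a)" by (simp add: power_mult_distrib mult_ac flip: power_mult)
    also have "\<dots> \<le> \<rho> * (K\<^sup>2 * (q\<^sup>2) ^ mdeg a)"
      using \<rho> by (intro mult_right_mono) (auto simp: power2_eq_square mult_left_le)
    finally show "norm (?T a) \<le> \<rho> * (K\<^sup>2 * (\<bar>\<gamma> a\<bar> * (q\<^sup>2) ^ mdeg a))"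
      using mult_left_mono[of "(cmod (?m a))\<^sup>2" "\<rho> * (K\<^sup>2 * (q\<^sup>2) ^ mdeg a)" "\<bar>\<gamma> a\<bar>"]
      by (simp add: norm_mult norm_power mult_ac)
  qed (use \<rho> in auto)
  also have "infsum (\<lambda>a. K\<^sup>2 * (\<bar>\<gamma> a\<bar> * (q\<^sup>2) ^ mdeg a)) UNIV = K\<^sup>2 * infsum (\<lambda>a. \<bar>\<gamma> a\<bar> * (q\<^sup>2) ^ mdeg a) UNIV"
    by (rule infsum_cmult_right')
  also have "(\<Sum>a\<in>{..b}. ?T a) = of_real (\<Sum>a\<in>{..b}. \<gamma> a * (cmod (x a))\<^sup>2)"
    unfolding of_real_sum using \<rho> by (intro sum.cong refl) (simp add: moment_grid_box)
  finally show ?thesis by (simp add: K_def)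
qed

text \<open>Evaluating the kernel on weighted grids that shrink to the origin extracts the coefficients.\<close>

theorem kernel_coefficient_nonneg:
  fixes \<gamma> :: "nat ^ 'd \<Rightarrow> real"
  assumes g: "kernel X g" and r: "0 < r" "ball 0 r \<subseteq> X"
    and s: "\<And>z w. z \<in> ball 0 r \<Longrightarrow> w \<in> ball 0 r \<Longrightarrow> (ps_term \<gamma> (z * vcnj w) has_sum g z w) UNIV"
  shows "0 \<le> \<gamma> b"
proof -
  obtain q where q: "0 < q" "q \<le> 1" "\<And>z :: complex ^ 'd. (\<And>j. cmod (z $ j) \<le> q) \<Longrightarrow> z \<in> ball 0 r"
    using ball_contains_const[OF r(1)] by blast
  have "(\<chi> j. of_real q) \<in> ball (0 :: complex ^ 'd) r" using q by simp
  then have \<gamma>s: "(\<lambda>a. \<bar>\<gamma> a\<bar> * (q\<^sup>2) ^ mdeg a) summable_on UNIV"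
    using s by (intro ps_summable_radius) (auto simp: summable_on_def)
  define x :: "nat ^ 'd \<Rightarrow> complex" where "x a = (if a = b then 1 else 0)" for a
  have "(\<Sum>a\<in>{..b}. \<gamma> a * (cmod (x a))\<^sup>2) = (\<Sum>a\<in>{..b}. if a = b then \<gamma> b else 0)"
    by (intro sum.cong) (auto simp: x_def)
  then have xb: "(\<Sum>a\<in>{..b}. \<gamma> a * (cmod (x a))\<^sup>2) = \<gamma> b" by (simp add: finite_atMost_vec)
  show ?thesis
  proof (rule le_of_le_add_small[OF q(1)])
    fix \<rho> assume \<rho>: "0 < \<rho>" "\<rho> \<le> q"
    let ?p = "grid b \<rho>" and ?v = "grid_weight b \<rho> x"
    have p: "?p i \<in> ball 0 r" for i
      using \<rho> by (intro q(3)) (simp add: grid_coordinate)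
    have "psd_on {..b} (\<lambda>i j. g (?p i) (?p j))"
      using p r(2) by (intro kernel_psd_reindex[OF g]) (auto simp: finite_atMost_vec)
    then have "0 \<le> Re (qf {..b} (\<lambda>i j. g (?p i) (?p j)) ?v)" by (rule qf_nonneg(1))
    then show "0 \<le> \<gamma> b + \<rho> * (((\<Sum>a\<in>{..b}. cmod (x a)) / q ^ (mdeg b + 1))\<^sup>2 *
        infsum (\<lambda>a. \<bar>\<gamma> a\<bar> * (q\<^sup>2) ^ mdeg a) UNIV)"
      using grid_form_approx[OF \<rho> q(2) \<gamma>s s[OF p p], of x]
        abs_Re_le_cmod[of "qf {..b} (\<lambda>i j. g (?p i) (?p j)) ?v - of_real (\<gamma> b)"] unfolding xb by simp
  qed
qed

text \<open>The local expansion at the origin holds on all of \<open>\<Omega>\<close>. For fixed \<open>z\<close> and small \<open>w\<close> this is the identity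
  theorem along a bounded connected neighbourhood of a path from the origin to \<open>z\<close>, because for small \<open>w\<close> the
  series converges on any given ball. Positivity of \<open>f\<close> on \<open>z\<close> and a small grid then bounds the
  sum of \<open>c\<^sub>a |z\<^sup>a|\<^sup>2\<close> by \<open>f z z\<close>, so the series converges absolutely at \<open>(z, z)\<close>, hence on
  \<open>\<Omega> \<times> \<Omega>\<close>, and the identity theorem applies once more.\<close>

theorem diagonal_holomorphic_kernel_expansion:
  fixes \<Omega> :: "(complex ^ 'd) set"
  assumes D: "diagonal_holomorphic_kernel \<Omega> f c" and dom: "is_domain \<Omega>" and z0: "0 \<in> \<Omega>"
  shows "\<Omega> \<subseteq> conv_domain c"
    and "\<And>z w. z \<in> \<Omega> \<Longrightarrow> w \<in> \<Omega> \<Longrightarrow> (ps_term c (z * vcnj w) has_sum f z w) UNIV"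
proof -
  have k: "kernel \<Omega> f" and cpos: "\<And>a. 0 < c a"
    and hol: "\<And>w. w \<in> \<Omega> \<Longrightarrow> holomorphic_several \<Omega> (\<lambda>z. f z w)"
    using D by (auto simp: diagonal_holomorphic_kernel_def)
  have c0: "0 \<le> c a" for a using cpos[of a] by simp
  have \<Omega>: "open \<Omega>" "connected \<Omega>" using dom by (auto simp: is_domain_def)
  obtain r1 where r1: "0 < r1" "\<And>z w. z \<in> \<Omega> \<inter> ball 0 r1 \<Longrightarrow> w \<in> \<Omega> \<inter> ball 0 r1 \<Longrightarrow> (ps_term c (z * vcnj w) has_sum f z w) UNIV"
    using D unfolding diagonal_holomorphic_kernel_def ps_term_def[abs_def] mpow_mult mult.assoc by blast
  obtain r2 where r2: "0 < r2" "ball 0 r2 \<subseteq> \<Omega>" using \<Omega>(1) z0 open_contains_ball by blast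
  define r where "r = min r1 r2"
  have r: "0 < r" "ball 0 r \<subseteq> \<Omega>"
    and loc: "\<And>z w. z \<in> ball 0 r \<Longrightarrow> w \<in> ball 0 r \<Longrightarrow> (ps_term c (z * vcnj w) has_sum f z w) UNIV"
    using r1 r2 by (auto simp: r_def subset_iff)
  obtain \<rho>0 where \<rho>0: "0 < \<rho>0" "\<rho>0 \<le> 1" "\<And>z :: complex ^ 'd. (\<And>j. cmod (z $ j) \<le> \<rho>0) \<Longrightarrow> z \<in> ball 0 r"
    using ball_contains_const[OF r(1)] by blast
  have cs: "(\<lambda>a. c a * (q\<^sup>2) ^ mdeg a) summable_on UNIV" if q: "0 < q" "q \<le> \<rho>0" for q
  proof -
    have "(\<lambda>a. \<bar>c a\<bar> * (q\<^sup>2) ^ mdeg a) summable_on UNIV"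
    proof (rule ps_summable_radius)
      have "(\<chi> j. of_real q) \<in> ball (0 :: complex ^ 'd) r" using q \<rho>0 by (intro \<rho>0(3)) simp
      then show "ps_term c ((\<chi> j. of_real q) * vcnj (\<chi> j. of_real q)) summable_on UNIV"
        using loc by (auto simp: summable_on_def)
    qed
    then show ?thesis using c0 by simp
  qed
  have small: "ps_term c x summable_on UNIV" if "\<And>j. cmod (x $ j) \<le> \<rho>0\<^sup>2" for x
    by (rule ps_summable_mono[of c "\<chi> j. of_real (\<rho>0\<^sup>2)"]) (use cs[OF \<rho>0(1)] c0 that in \<open>simp_all add: ps_summable_const del: of_real_power\<close>)
  \<comment> \<open>for fixed \<open>z\<close> and sufficiently small \<open>w\<close> the expansion continues from the origin to \<open>z\<close>\<close>
  have ext: "\<exists>\<epsilon>>0. \<forall>w. norm w < \<epsilon> \<longrightarrow> (ps_term c (z * vcnj w) has_sum f z w) UNIV" if z: "z \<in> \<Omega>" for z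
  proof -
    obtain g where g: "path g" "path_image g \<subseteq> \<Omega>" "pathstart g = 0" "pathfinish g = z"
      using \<Omega> z0 z connected_open_path_connected[of \<Omega>] unfolding path_connected_def by blast
    obtain R where R: "0 < R" "path_image g \<subseteq> ball 0 R"
      using bounded_subset_ballD[OF bounded_path_image[OF g(1)]] by blast
    define N where "N = connected_component_set (\<Omega> \<inter> ball 0 R) 0"
    have N: "open N" "connected N" "N \<subseteq> \<Omega>" "N \<subseteq> ball 0 R"
      unfolding N_def using \<Omega>(1) connected_component_subset[of "\<Omega> \<inter> ball 0 R" 0]
      by (auto intro!: open_connected_component)
    have "path_image g \<subseteq> N"
      unfolding N_def using g(2) R(2) connected_path_image[OF g(1)] pathstart_in_path_image[of g] g(3)
      by (intro connected_component_maximal) auto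
    then have zN: "z \<in> N" "0 \<in> N"
      using pathfinish_in_path_image[of g] pathstart_in_path_image[of g] g(3,4) by auto
    \<comment> \<open>for these \<open>w\<close> the series converges at \<open>(x, w)\<close> for all \<open>x\<close> in the ball of radius \<open>R\<close>\<close>
    define \<epsilon> where "\<epsilon> = min r (\<rho>0\<^sup>2 / R)"
    have \<epsilon>: "0 < \<epsilon>" using r(1) R(1) \<rho>0(1) by (simp add: \<epsilon>_def)
    have "(ps_term c (z * vcnj w) has_sum f z w) UNIV" if w: "norm w < \<epsilon>" for w
    proof -
      have w\<Omega>: "w \<in> ball 0 r" "w \<in> \<Omega>" using w r(2) by (auto simp: \<epsilon>_def subset_iff)
      let ?y = "(\<chi> j. of_real R) :: complex ^ 'd"
      have sm: "ps_term c (x * vcnj w) summable_on UNIV" if "\<And>j. cmod (x $ j) \<le> R" for x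
      proof (rule small)
        fix j
        have "cmod (w $ j) \<le> \<rho>0\<^sup>2 / R"
          using w Finite_Cartesian_Product.norm_nth_le[of w j] by (simp add: \<epsilon>_def)
        then have "cmod (x $ j) * cmod (w $ j) \<le> R * (\<rho>0\<^sup>2 / R)"
          using that[of j] R by (intro mult_mono) auto
        then show "cmod ((x * vcnj w) $ j) \<le> \<rho>0\<^sup>2"
          using R by (simp add: vcnj_def norm_mult)
      qed
      have xR: "cmod (x $ j) < R" if "x \<in> N" for x j
        using that N(4) Finite_Cartesian_Product.norm_nth_le[of x j] by auto
      have e: "ps_term c (x * vcnj w) = (\<lambda>a. (of_real (c a) * cnj (mpow w a)) * mpow x a)" for x
        by (auto simp: ps_term_def mpow_times_vcnj)
      have H1: "holomorphic_several N (\<lambda>x. ps_eval c (x * vcnj w))"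
        unfolding holomorphic_several_def ps_eval_eq e
      proof
        fix x assume "x \<in> N"
        then show "\<exists>D. ((\<lambda>x. \<Sum>\<^sub>\<infinity>a. (of_real (c a) * cnj (mpow w a)) * mpow x a) has_derivative D) (at x) \<and> (\<forall>c v. D (c *s v) = c * D v)"
          using R sm[of ?y] xR by (intro power_series_has_derivative[of _ ?y]) (auto simp: e)
      qed
      have H2: "holomorphic_several N (\<lambda>x. f x w)"
        using hol[OF w\<Omega>(2)] N(3) unfolding holomorphic_several_def by blast
      have "f z w = ps_eval c (z * vcnj w)"
      proof (rule holomorphic_several_identity[OF N(1,2) zN(2) H2 H1 r(1) _ zN(1)])
        show "f x w = ps_eval c (x * vcnj w)" if "norm x < r" for x
          using loc[of x w] that w\<Omega>(1) by (simp add: ps_eval_eq infsumI)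
      qed
      moreover have "ps_term c (z * vcnj w) summable_on UNIV"
        using xR[OF zN(1)] by (intro sm) (auto intro: less_imp_le)
      ultimately show ?thesis using ps_has_sum by simp
    qed
    then show ?thesis using \<epsilon> by blast
  qed
  \<comment> \<open>the Cauchy-Schwarz inequality for \<open>z\<close> and the grids that shrink to the origin\<close>
  have bound: "(\<Sum>a\<in>{..b}. c a * (cmod (mpow z a))\<^sup>2) \<le> Re (f z z)" if z: "z \<in> \<Omega>" for z b
  proof -
    define x where "x a = cnj (mpow z a)" for a
    define A where "A = (\<Sum>a\<in>{..b}. c a * (cmod (mpow z a))\<^sup>2)"
    obtain \<epsilon> where \<epsilon>: "0 < \<epsilon>" "\<And>w. norm w < \<epsilon> \<Longrightarrow> (ps_term c (z * vcnj w) has_sum f z w) UNIV"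
      using ext[OF z] by blast
    obtain \<rho>1 where \<rho>1: "0 < \<rho>1" "\<rho>1 \<le> 1" "\<And>w :: complex ^ 'd. (\<And>j. cmod (w $ j) \<le> \<rho>1) \<Longrightarrow> w \<in> ball 0 \<epsilon>"
      using ball_contains_const[OF \<epsilon>(1)] by blast
    \<comment> \<open>small enough for both expansions at the grid points, and for dominating the mixed series by \<open>B\<close>\<close>
    define q where "q = min (min \<rho>0 \<rho>1) (\<rho>0\<^sup>2 / (norm z + 1))"
    have nz1: "0 < norm z + 1" using norm_ge_zero[of z] by linarith
    have q: "0 < q" "q \<le> 1" "q \<le> \<rho>0" "q \<le> \<rho>1" "q * norm z \<le> \<rho>0\<^sup>2"
    proof -
      show "0 < q" "q \<le> 1" "q \<le> \<rho>0" "q \<le> \<rho>1" using \<rho>0 \<rho>1 nz1 by (auto simp: q_def)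
      have "q * norm z \<le> \<rho>0\<^sup>2 / (norm z + 1) * (norm z + 1)"
        using \<open>0 < q\<close> nz1 by (intro mult_mono) (auto simp: q_def)
      then show "q * norm z \<le> \<rho>0\<^sup>2" using nz1 by simp
    qed
    define K where "K = (\<Sum>a\<in>{..b}. cmod (x a)) / q ^ (mdeg b + 1)"
    have K: "0 \<le> K" using q by (simp add: K_def sum_nonneg)
    define B where "B a = K * (c a * (\<rho>0\<^sup>2) ^ mdeg a)" for a
    have Bs: "B summable_on UNIV" unfolding B_def[abs_def] by (intro summable_on_cmult_right cs[OF \<rho>0(1)]) simp
    have B0: "0 \<le> B a" for a using K c0 by (simp add: B_def)
    define M where "M = K\<^sup>2 * infsum (\<lambda>a. c a * (q\<^sup>2) ^ mdeg a) UNIV"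
    have "A \<le> Re (f z z) + \<rho> * (M + 2 * infsum B UNIV)" if \<rho>: "0 < \<rho>" "\<rho> \<le> q" for \<rho>
    proof -
      let ?p = "grid b \<rho>" and ?v = "grid_weight b \<rho> x"
      let ?m = "moment {..b} ?p ?v"
      have pr: "?p i \<in> ball 0 r" and p\<epsilon>: "norm (?p i) < \<epsilon>" for i
        using \<rho>0(3)[of "?p i"] \<rho>1(3)[of "?p i"] \<rho> q by (auto simp: grid_coordinate)
      have out: "cmod (?m a) \<le> \<rho> * (K * q ^ mdeg a)" if "\<not> a \<le> b" for a
        using moment_grid_outside[OF \<rho> q(2) that, of x] by (simp add: K_def)
      have inb: "?m a = x a" if "a \<le> b" for a using \<rho> that by (rule_tac moment_grid_box)
      define Q where "Q = qf {..b} (\<lambda>i j. f (?p i) (?p j)) ?v"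
      have "cmod (Q - of_real A) \<le> \<rho> * M"
        using grid_form_approx[OF \<rho> q(2) _ loc[OF pr pr], of x] cs[OF q(1,3)] c0
        by (simp add: Q_def A_def K_def M_def x_def)
      then have Q: "Re Q \<le> A + \<rho> * M"
        using abs_Re_le_cmod[of "Q - of_real A"] by simp
      define S where "S = (\<Sum>g\<in>{..b}. f z (?p g) * ?v g)"
      let ?U = "\<lambda>a. of_real (c a) * mpow z a * ?m a"
      have "((\<lambda>a. \<Sum>g\<in>{..b}. ps_term c (z * vcnj (?p g)) a * ?v g) has_sum S) UNIV"
        unfolding S_def by (intro has_sum_finite_sum has_sum_cmult_left \<epsilon>(2) p\<epsilon>)
      then have "(?U has_sum S) UNIV"
        by (simp add: ps_term_def mpow_times_vcnj moment_def sum_distrib_left mult_ac)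
      then have "norm (S - (\<Sum>a\<in>{..b}. ?U a)) \<le> \<rho> * infsum B UNIV"
      proof (rule has_sum_finite_approx[OF _ finite_atMost_vec Bs B0])
        fix a assume "a \<notin> {..b}"
        then have "\<not> a \<le> b" by simp
        then have "cmod (mpow z a) * cmod (?m a) \<le> norm z ^ mdeg a * (\<rho> * (K * q ^ mdeg a))"
          using K q \<rho> by (intro mult_mono out cmod_mpow_le Finite_Cartesian_Product.norm_nth_le) auto
        also have "\<dots> = \<rho> * (K * (q * norm z) ^ mdeg a)" by (simp add: power_mult_distrib mult_ac)
        also have "\<dots> \<le> \<rho> * (K * (\<rho>0\<^sup>2) ^ mdeg a)"
          using K q \<rho> by (intro mult_left_mono mult_mono power_mono) auto
        finally have "c a * (cmod (mpow z a) * cmod (?m a)) \<le> c a * (\<rho> * (K * (\<rho>0\<^sup>2) ^ mdeg a))"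
          using c0 by (rule mult_left_mono)
        then show "norm (?U a) \<le> \<rho> * B a"
          using c0[of a] by (simp add: B_def norm_mult mult_ac)
      qed (use \<rho> in auto)
      moreover have "(\<Sum>a\<in>{..b}. ?U a) = of_real A"
        unfolding A_def of_real_sum by (intro sum.cong refl) (simp add: inb x_def mult.assoc cnj_mult_self)
      ultimately have S: "A - \<rho> * infsum B UNIV \<le> Re S"
        using abs_Re_le_cmod[of "S - of_real A"] by simp
      \<comment> \<open>positivity for the functional that subtracts the weighted grid from the point evaluation at \<open>z\<close>\<close>
      define P where "P i = (case i of None \<Rightarrow> z | Some g \<Rightarrow> ?p g)" for i
      define V where "V i = (case i of None \<Rightarrow> 1 | Some g \<Rightarrow> - ?v g)" for i
      let ?J = "insert None (Some ` {..b})"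
      have fin: "finite ?J" by (simp add: finite_atMost_vec)
      have "psd_on ?J (\<lambda>i j. f (P i) (P j))"
        using pr r(2) z fin by (intro kernel_psd_reindex[OF k]) (auto simp: P_def)
      then have "0 \<le> Re (qf ?J (\<lambda>i j. f (P i) (P j)) V)" by (rule qf_nonneg(1))
      also have "qf ?J (\<lambda>i j. f (P i) (P j)) V = f z z - S - cnj S + Q"
      proof -
        have h: "f (?p g) z = cnj (f z (?p g))" for g
          using pr r(2) z by (intro kernel_hermitian[OF k]) auto
        show ?thesis
          unfolding qf_def S_def Q_def using finite_atMost_vec[of b]
          by (simp add: sum.reindex P_def V_def sum.distrib h sum_negf sum_subtractf sum_distrib_left mult_ac)
      qed
      finally show ?thesis using S Q by (simp add: algebra_simps)
    qed
    then have "A \<le> Re (f z z)" by (rule le_of_le_add_small[OF q(1)])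
    then show ?thesis by (simp add: A_def)
  qed
  have self: "ps_term c (z * vcnj z) summable_on UNIV" if z: "z \<in> \<Omega>" for z
  proof -
    have "(\<lambda>a. c a * (cmod (mpow z a))\<^sup>2) summable_on UNIV"
    proof (rule nonneg_bdd_above_summable_on)
      show "bdd_above (sum (\<lambda>a. c a * (cmod (mpow z a))\<^sup>2) ` {F. F \<subseteq> UNIV \<and> finite F})"
      proof (rule bdd_aboveI2)
        fix F :: "(nat ^ 'd) set" assume "F \<in> {F. F \<subseteq> UNIV \<and> finite F}"
        then have F: "finite F" by simp
        have "a \<le> (\<Sum>a\<in>F. a)" if "a \<in> F" for a
          using F that vec_le_add(1)[of a "\<Sum>a\<in>F - {a}. a"] by (simp add: sum.remove)
        then have "(\<Sum>a\<in>F. c a * (cmod (mpow z a))\<^sup>2) \<le> (\<Sum>a\<in>{..\<Sum>a\<in>F. a}. c a * (cmod (mpow z a))\<^sup>2)"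
          using c0 by (intro sum_mono2) (auto simp: finite_atMost_vec)
        also have "\<dots> \<le> Re (f z z)" by (rule bound[OF z])
        finally show "(\<Sum>a\<in>F. c a * (cmod (mpow z a))\<^sup>2) \<le> Re (f z z)" .
      qed
    qed (use c0 in simp)
    then show ?thesis
      unfolding ps_summable_iff using c0 by (simp add: mpow_times_vcnj norm_mult power2_eq_square)
  qed
  show sub: "\<Omega> \<subseteq> conv_domain c" by (rule subset_conv_domain[OF c0 \<Omega>(1) self])
  fix z w assume z: "z \<in> \<Omega>" and w: "w \<in> \<Omega>"
  obtain \<epsilon> where \<epsilon>: "0 < \<epsilon>" "\<And>y. norm y < \<epsilon> \<Longrightarrow> (ps_term c (w * vcnj y) has_sum f w y) UNIV"
    using ext[OF w] by blast
  have "f z w = ps_eval c (z * vcnj w)"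
  proof (rule holomorphic_several_identity[OF \<Omega> z0 hol[OF w] diag_series_holomorphic[OF c0 sub self[OF w]] \<epsilon>(1) _ z])
    fix y assume y: "y \<in> \<Omega>" "norm y < \<epsilon>"
    have "(ps_term c (y * vcnj w) has_sum cnj (f w y)) UNIV"
      by (rule diag_series_cnj[OF \<epsilon>(2)[OF y(2)]])
    then show "f y w = ps_eval c (y * vcnj w)"
      using kernel_hermitian[OF k w y(1)] by (simp add: ps_eval_eq infsumI)
  qed
  then show "(ps_term c (z * vcnj w) has_sum f z w) UNIV"
    using ps_has_sum[OF ps_summable_product[OF c0 self[OF z] self[OF w]]] by simp
qed

section \<open>The certificate on the domains of convergence\<close>

lemma sum_atMost_convolution:
  fixes G :: "nat ^ 'd \<Rightarrow> nat ^ 'd \<Rightarrow> real"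
  shows "(\<Sum>a\<in>{..b}. \<Sum>w\<in>{..a}. G w (a - w)) = (\<Sum>w\<in>{..b}. \<Sum>u\<in>{..b - w}. G w u)"
proof -
  have fin: "finite {..c}" for c :: "nat ^ 'd" by (rule finite_atMost_vec)
  have "(\<Sum>(a, w)\<in>(SIGMA a:{..b}. {..a}). G w (a - w)) = (\<Sum>(w, u)\<in>(SIGMA w:{..b}. {..b - w}). G w u)"
  proof (rule sum.reindex_bij_witness[where i = "\<lambda>(w, u). (w + u, w)" and j = "\<lambda>(a, w). (w, a - w)"])
    fix p assume "p \<in> (SIGMA w:{..b}. {..b - w})"
    then obtain w u where p: "p = (w, u)" "w \<le> b" "u \<le> b - w" by auto
    have "w + u \<le> b"
      unfolding le_vec_iff
    proof
      fix i
      show "(w + u) $ i \<le> b $ i" using p(2,3)[unfolded le_vec_iff, rule_format, of i] by simp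
    qed
    then show "(case p of (w, u) \<Rightarrow> (w + u, w)) \<in> (SIGMA a:{..b}. {..a})"
      using p by (auto simp: vec_le_add)
  next
    fix p assume "p \<in> (SIGMA a:{..b}. {..a})"
    then obtain a w where p: "p = (a, w)" "a \<le> b" "w \<le> a" by auto
    have "a - w \<le> b - w" using p(2) by (auto simp: le_vec_iff intro: diff_le_mono)
    then show "(case p of (a, w) \<Rightarrow> (w, a - w)) \<in> (SIGMA w:{..b}. {..b - w})"
      using p by auto
  qed (auto simp: vec_add_diff vec_add_diff_cancel)
  then show ?thesis using fin by (simp add: sum.Sigma)
qed

lemma ps_eval_continuous:
  assumes y: "ps_term t y summable_on UNIV" and x: "\<And>j. cmod (x $ j) < cmod (y $ j)"
  shows "continuous (at x) (ps_eval t)"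
proof -
  have e: "ps_term t x = (\<lambda>a. of_real (t a) * mpow x a)" for x by (auto simp: ps_term_def)
  have "(\<lambda>a. of_real (t a) * mpow y a) summable_on UNIV" using y unfolding e .
  from power_series_has_derivative[OF this x] show ?thesis
    unfolding ps_eval_eq[abs_def] e by (auto intro: has_derivative_continuous)
qed

context
  fixes t :: "nat ^ 'd \<Rightarrow> real"
  assumes t0: "t 0 = 0" and tpos: "\<And>a. 0 \<le> t a"
begin

lemma reciprocal_times: "ps_mult (\<lambda>a. ps_one a - t a) (reciprocal t) = ps_one"
proof
  fix b
  show "ps_mult (\<lambda>a. ps_one a - t a) (reciprocal t) b = ps_one b"
    unfolding ps_mult_one_minus using reciprocal_eq[of t b] t0
    by (cases "b = 0") (auto simp: ps_one_def)
qed

lemma le_reciprocal: "t b \<le> reciprocal t b"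
proof (cases "b = 0")
  case False
  have "t b * reciprocal t (b - b) \<le> (\<Sum>w\<in>{..b}. t w * reciprocal t (b - w))"
    using reciprocal_nonneg[of t, OF t0 tpos] tpos by (intro member_le_sum) (auto simp: finite_atMost_vec)
  then show ?thesis using reciprocal_eq[of t b] t0 False by (simp add: vec_diff_zero)
qed (simp add: t0)

lemma ps_eval_reciprocal:
  assumes "ps_term (reciprocal t) x summable_on UNIV"
  shows "(1 - ps_eval t x) * ps_eval (reciprocal t) x = 1" "ps_term t x summable_on UNIV"
proof -
  have rn: "0 \<le> reciprocal t a" for a by (rule reciprocal_nonneg[of t, OF t0 tpos])
  show ts: "ps_term t x summable_on UNIV"
    by (rule ps_summable_mono[OF assms]) (use le_reciprocal tpos rn in auto)
  have m: "(ps_term (\<lambda>a. ps_one a - t a) x has_sum 1 - ps_eval t x) UNIV"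
    by (rule ps_one_minus_has_sum[OF ts])
  then have ms: "ps_term (\<lambda>a. ps_one a - t a) x summable_on UNIV"
    and me: "ps_eval (\<lambda>a. ps_one a - t a) x = 1 - ps_eval t x"
    by (auto simp: summable_on_def ps_eval_eq infsumI)
  have "(ps_term ps_one x has_sum (1 - ps_eval t x) * ps_eval (reciprocal t) x) UNIV"
    using ps_mult_has_sum[OF ms assms] unfolding reciprocal_times me .
  then show "(1 - ps_eval t x) * ps_eval (reciprocal t) x = 1"
    using ps_one_has_sum has_sum_unique by blast
qed

lemma ps_eval_self:
  assumes "ps_term t (z * vcnj z) summable_on UNIV"
  shows "0 \<le> ps_eval t (z * vcnj z)" "ps_eval t (z * vcnj z) = of_real (\<Sum>\<^sub>\<infinity>a. t a * (cmod (mpow z a))\<^sup>2)"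
    "(\<lambda>a. t a * (cmod (mpow z a))\<^sup>2) summable_on UNIV"
proof -
  have e: "ps_term t (z * vcnj z) = (\<lambda>a. of_real (t a * (cmod (mpow z a))\<^sup>2))"
    by (auto simp: ps_term_def mpow_times_vcnj cnj_mult_self)
  show s: "(\<lambda>a. t a * (cmod (mpow z a))\<^sup>2) summable_on UNIV"
    using assms tpos unfolding ps_summable_iff by (simp add: mpow_times_vcnj norm_mult power2_eq_square)
  have "((\<lambda>a. complex_of_real (t a * (cmod (mpow z a))\<^sup>2)) has_sum of_real (\<Sum>\<^sub>\<infinity>a. t a * (cmod (mpow z a))\<^sup>2)) UNIV"
    using s by (intro has_sum_of_real) simp
  then show eq: "ps_eval t (z * vcnj z) = of_real (\<Sum>\<^sub>\<infinity>a. t a * (cmod (mpow z a))\<^sup>2)"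
    unfolding ps_eval_eq e by (rule infsumI)
  show "0 \<le> ps_eval t (z * vcnj z)"
    unfolding eq complex_of_real_nonneg_iff using tpos by (intro infsum_nonneg) simp
qed

text \<open>The partial sums \<open>S\<close> of the reciprocal over boxes satisfy \<open>S \<le> 1 + \<theta> S\<close>.\<close>

lemma reciprocal_summable:
  assumes ts: "ps_term t (z * vcnj z) summable_on UNIV" and lt: "Re (ps_eval t (z * vcnj z)) < 1"
  shows "ps_term (reciprocal t) (z * vcnj z) summable_on UNIV"
proof -
  have rn: "0 \<le> reciprocal t a" for a by (rule reciprocal_nonneg[of t, OF t0 tpos])
  define m where "m a = (cmod (mpow z a))\<^sup>2" for a
  have m: "0 \<le> m a" "m (a + b) = m a * m b" "m 0 = 1" for a b
    by (auto simp: m_def mpow_add norm_mult power_mult_distrib)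
  define T where "T = (\<Sum>\<^sub>\<infinity>a. t a * m a)"
  have T: "T < 1" "(\<lambda>a. t a * m a) summable_on UNIV" "0 \<le> T"
    using lt ps_eval_self[OF ts] tpos m(1) by (auto simp: T_def m_def intro!: infsum_nonneg)
  have bound: "(\<Sum>a\<in>{..b}. reciprocal t a * m a) \<le> 1 / (1 - T)" for b
  proof -
    define S where "S = (\<Sum>a\<in>{..b}. reciprocal t a * m a)"
    have S0: "0 \<le> S" unfolding S_def using rn m by (intro sum_nonneg) auto
    have trm: "reciprocal t a * m a = (if a = 0 then 1 else 0) + (\<Sum>w\<in>{..a}. (t w * m w) * (reciprocal t (a - w) * m (a - w)))" for a
    proof (cases "a = 0")
      case False
      have "m a = m w * m (a - w)" if "w \<le> a" for w
        using m(2)[of w "a - w"] that by (simp add: vec_add_diff_cancel)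
      then have "(\<Sum>w\<in>{..a}. (t w * m w) * (reciprocal t (a - w) * m (a - w))) = (\<Sum>w\<in>{..a}. t w * reciprocal t (a - w) * m a)"
        by (intro sum.cong) auto
      then show ?thesis using reciprocal_eq[of t a] t0 False by (simp add: sum_distrib_right)
    qed (simp add: m t0)
    have "S = 1 + (\<Sum>a\<in>{..b}. \<Sum>w\<in>{..a}. (t w * m w) * (reciprocal t (a - w) * m (a - w)))"
      unfolding S_def by (subst trm) (simp add: sum.distrib finite_atMost_vec vec_zero_le)
    also have "\<dots> = 1 + (\<Sum>w\<in>{..b}. \<Sum>u\<in>{..b - w}. (t w * m w) * (reciprocal t u * m u))"
      by (rule arg_cong[OF sum_atMost_convolution[where G = "\<lambda>w u. (t w * m w) * (reciprocal t u * m u)"]])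
    also have "\<dots> \<le> 1 + (\<Sum>w\<in>{..b}. \<Sum>u\<in>{..b}. (t w * m w) * (reciprocal t u * m u))"
      using rn m tpos
      by (intro add_mono order_refl sum_mono sum_mono2) (auto simp: finite_atMost_vec intro: order_trans vec_diff_le)
    also have "\<dots> = 1 + (\<Sum>w\<in>{..b}. t w * m w) * S"
      by (simp add: S_def sum_product)
    also have "\<dots> \<le> 1 + T * S"
      using S0 tpos m unfolding T_def
      by (intro add_mono order_refl mult_right_mono finite_sum_le_infsum T(2)) (auto simp: finite_atMost_vec)
    finally have "S * (1 - T) \<le> 1" by (simp add: algebra_simps)
    then show ?thesis unfolding S_def[symmetric] using T(1) by (simp add: pos_le_divide_eq)
  qed
  have "(\<lambda>a. reciprocal t a * m a) summable_on UNIV"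
  proof (rule nonneg_bdd_above_summable_on)
    show "bdd_above (sum (\<lambda>a. reciprocal t a * m a) ` {F. F \<subseteq> UNIV \<and> finite F})"
    proof (rule bdd_aboveI2)
      fix F :: "(nat ^ 'd) set" assume "F \<in> {F. F \<subseteq> UNIV \<and> finite F}"
      then have F: "finite F" by simp
      have "a \<le> (\<Sum>a\<in>F. a)" if "a \<in> F" for a
        using F that vec_le_add(1)[of a "\<Sum>a\<in>F - {a}. a"] by (simp add: sum.remove)
      then have "(\<Sum>a\<in>F. reciprocal t a * m a) \<le> (\<Sum>a\<in>{..\<Sum>a\<in>F. a}. reciprocal t a * m a)"
        using rn m by (intro sum_mono2) (auto simp: finite_atMost_vec)
      also have "\<dots> \<le> 1 / (1 - T)" by (rule bound)
      finally show "(\<Sum>a\<in>F. reciprocal t a * m a) \<le> 1 / (1 - T)" .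
    qed
  qed (use rn m in simp)
  then show ?thesis
    unfolding ps_summable_iff using rn by (simp add: m_def mpow_times_vcnj norm_mult power2_eq_square)
qed

text \<open>Where both series converge, \<open>(1 - t) / (1 - t) = 1\<close> forces \<open>t < 1\<close> on the diagonal. Conversely \<open>t < 1\<close> is an
  open condition by continuity, and gives convergence of the reciprocal.\<close>

theorem conv_domain_reciprocal:
  "conv_domain (reciprocal t) = {z \<in> conv_domain t. Re (ps_eval t (z * vcnj z)) < 1}"
proof (intro equalityI subsetI)
  have rn: "0 \<le> reciprocal t a" for a by (rule reciprocal_nonneg[of t, OF t0 tpos])
  fix z assume z: "z \<in> conv_domain (reciprocal t)"
  then have s: "ps_term (reciprocal t) (z * vcnj z) summable_on UNIV"
    using conv_domain_summable[of "reciprocal t" z, OF rn] by blast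
  have "0 \<le> ps_eval (reciprocal t) (z * vcnj z)"
  proof (rule has_sum_complex_nonneg[OF ps_has_sum[OF s]])
    show "0 \<le> ps_term (reciprocal t) (z * vcnj z) a" for a
      using rn[of a] by (auto simp: ps_term_def mpow_times_vcnj intro!: mult_nonneg_nonneg)
  qed
  then obtain S where S: "ps_eval (reciprocal t) (z * vcnj z) = of_real S" "0 \<le> S" by (rule nonneg_complex_cases)
  obtain T where T: "ps_eval t (z * vcnj z) = of_real T"
    using ps_eval_self(2)[OF ps_eval_reciprocal(2)[OF s]] by blast
  have "complex_of_real ((1 - T) * S) = of_real 1"
    using ps_eval_reciprocal(1)[OF s] by (simp add: S T)
  then have "(1 - T) * S = 1" by (simp only: of_real_eq_iff)
  then have "0 < (1 - T) * S" by simp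
  then have "T < 1" using S(2) by (simp add: zero_less_mult_iff)
  moreover have "z \<in> conv_domain t"
    using conv_domain_mono[of t "reciprocal t", OF tpos le_reciprocal] z by blast
  ultimately show "z \<in> {z \<in> conv_domain t. Re (ps_eval t (z * vcnj z)) < 1}" by (simp add: T)
next
  have rn: "0 \<le> reciprocal t a" for a by (rule reciprocal_nonneg[of t, OF t0 tpos])
  fix z assume "z \<in> {z \<in> conv_domain t. Re (ps_eval t (z * vcnj z)) < 1}"
  then have z: "z \<in> conv_domain t" "Re (ps_eval t (z * vcnj z)) < 1" by auto
  obtain y where y: "\<And>j. cmod (z $ j) < cmod (y $ j)" "ps_term t (y * vcnj y) summable_on UNIV"
    using conv_domain_polydisc[of t z, OF tpos z(1)] by blast
  have "cmod ((z * vcnj z) $ j) < cmod ((y * vcnj y) $ j)" for j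
    using y(1)[of j] by (simp add: vcnj_def norm_mult mult_strict_mono')
  then have "continuous (at (z * vcnj z)) (ps_eval t)"
    by (rule ps_eval_continuous[OF y(2)])
  moreover have "continuous (at z) (\<lambda>z :: complex ^ 'd. z * vcnj z)"
    unfolding isCont_def by (rule vec_tendstoI) (auto simp: vcnj_def intro!: tendsto_intros)
  ultimately have "continuous (at z) (\<lambda>z. Re (ps_eval t (z * vcnj z)))"
    by (intro continuous_Re) (rule isCont_o2)
  then have "((\<lambda>z. Re (ps_eval t (z * vcnj z))) \<longlongrightarrow> Re (ps_eval t (z * vcnj z))) (nhds z)"
    using tendsto_at_iff_tendsto_nhds[of "\<lambda>z. Re (ps_eval t (z * vcnj z))" z] by (simp add: continuous_at)
  then have "eventually (\<lambda>z. Re (ps_eval t (z * vcnj z)) < 1) (nhds z)"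
    using z(2) by (rule order_tendstoD(2))
  then obtain e where e: "0 < e" "\<And>x. dist x z < e \<Longrightarrow> Re (ps_eval t (x * vcnj x)) < 1"
    by (auto simp: eventually_nhds_metric)
  obtain r where r: "0 < r" "\<And>x. norm (z - x) < r \<Longrightarrow> ps_term t (x * vcnj x) summable_on UNIV"
    using z(1) unfolding conv_domain_iff[of t, OF tpos] by blast
  show "z \<in> conv_domain (reciprocal t)"
    unfolding conv_domain_iff[of "reciprocal t", OF rn]
    using e r by (intro exI[of _ "min e r"]) (auto intro!: reciprocal_summable simp: dist_norm norm_minus_commute)
qed

end

text \<open>Under the condition on the coefficients of \<open>(1 - \<theta>) \<ell>\<close>, the series \<open>\<theta>\<close>, \<open>master_defect\<close> and
  \<open>(1 - \<theta>) \<ell>\<close> all define kernels, and the certificates are made of these.\<close>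

context
  fixes kc lc :: "nat ^ 'd \<Rightarrow> real"
  assumes k0: "kc 0 = 1" and kpos: "\<And>a. 0 < kc a" and l0: "lc 0 = 1" and lpos: "\<And>a. 0 < lc a"
    and C: "\<And>b. 0 \<le> ps_mult (\<lambda>a. ps_one a - master kc a) lc b"
begin

text \<open>The coefficients satisfy \<open>\<theta> \<le> k \<le> 1 / (1 - \<theta>) \<le> \<ell>\<close>.\<close>

lemma master_conv_domains:
  "conv_domain lc \<subseteq> conv_domain (reciprocal (master kc))"
  "conv_domain (reciprocal (master kc)) \<subseteq> conv_domain kc"
  "conv_domain kc \<subseteq> conv_domain (master kc)"
proof -
  have t: "0 \<le> master kc a" for a using master_nonneg[of kc a] k0 kpos by blast
  have rn: "0 \<le> reciprocal (master kc) a" for a by (rule reciprocal_nonneg[of "master kc", OF master_zero t])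
  show "conv_domain lc \<subseteq> conv_domain (reciprocal (master kc))"
    using reciprocal_le_of_nonneg[of "master kc" lc] t l0 C by (intro conv_domain_mono rn) auto
  show "conv_domain (reciprocal (master kc)) \<subseteq> conv_domain kc"
    using le_reciprocal_master[of kc] k0 kpos by (intro conv_domain_mono) (auto intro: less_imp_le)
  show "conv_domain kc \<subseteq> conv_domain (master kc)"
    using master_le[of kc] k0 kpos by (intro conv_domain_mono t) auto
qed

context
  fixes \<Omega> :: "(complex ^ 'd) set" and k l
  assumes \<Omega>: "open \<Omega>" "\<Omega> \<subseteq> conv_domain lc"
    and kser: "\<And>z w. z \<in> \<Omega> \<Longrightarrow> w \<in> \<Omega> \<Longrightarrow> (ps_term kc (z * vcnj w) has_sum k z w) UNIV"
    and lser: "\<And>z w. z \<in> \<Omega> \<Longrightarrow> w \<in> \<Omega> \<Longrightarrow> (ps_term lc (z * vcnj w) has_sum l z w) UNIV"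
begin

abbreviation (input) "\<theta> \<equiv> master kc"
abbreviation (input) "sc \<equiv> reciprocal (master kc)"

lemma master_certificate_series:
  assumes z: "z \<in> \<Omega>" and w: "w \<in> \<Omega>"
  shows "(ps_term \<theta> (z * vcnj w) has_sum ps_eval \<theta> (z * vcnj w)) UNIV"
    and "ps_eval \<theta> (z * vcnj w) \<noteq> 1"
    and "(ps_term sc (z * vcnj w) has_sum master_kernel kc z w) UNIV"
    and "(ps_term (master_defect kc) (z * vcnj w) has_sum 1 - (1 - ps_eval \<theta> (z * vcnj w)) * k z w) UNIV"
    and "(ps_term (ps_mult (\<lambda>a. ps_one a - \<theta> a) lc) (z * vcnj w) has_sum (1 - ps_eval \<theta> (z * vcnj w)) * l z w) UNIV"
proof -
  let ?x = "z * vcnj w"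
  have t: "0 \<le> \<theta> a" for a using master_nonneg[of kc a] k0 kpos by blast
  have rn: "0 \<le> sc a" for a by (rule reciprocal_nonneg[of \<theta>, OF master_zero t])
  have self: "ps_term sc (y * vcnj y) summable_on UNIV" if "y \<in> \<Omega>" for y
    by (rule conv_domain_summable[of sc, OF rn]) (use master_conv_domains(1) \<Omega>(2) that in blast)
  have ss: "ps_term sc ?x summable_on UNIV"
    by (rule ps_summable_product[of sc, OF rn self[OF z] self[OF w]])
  note rec = ps_eval_reciprocal[of \<theta>, OF master_zero t ss]
  show th: "(ps_term \<theta> ?x has_sum ps_eval \<theta> ?x) UNIV" by (rule ps_has_sum[OF rec(2)])
  show ne: "ps_eval \<theta> ?x \<noteq> 1" using rec(1) by auto
  then have "ps_eval sc ?x = 1 / (1 - ps_eval \<theta> ?x)" using rec(1) by (simp add: field_simps)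
  then show "(ps_term sc ?x has_sum master_kernel kc z w) UNIV"
    using ps_has_sum[OF ss] by (simp add: master_kernel_def)
  have om: "(ps_term (\<lambda>a. ps_one a - \<theta> a) ?x has_sum 1 - ps_eval \<theta> ?x) UNIV"
    by (rule ps_one_minus_has_sum[OF rec(2)])
  then have oms: "ps_term (\<lambda>a. ps_one a - \<theta> a) ?x summable_on UNIV"
    and ome: "ps_eval (\<lambda>a. ps_one a - \<theta> a) ?x = 1 - ps_eval \<theta> ?x"
    by (auto simp: summable_on_def ps_eval_eq infsumI)
  have ser: "(ps_term (ps_mult (\<lambda>a. ps_one a - \<theta> a) c) ?x has_sum (1 - ps_eval \<theta> ?x) * S) UNIV"
    if "(ps_term c ?x has_sum S) UNIV" for c S
  proof -
    have "ps_term c ?x summable_on UNIV" "ps_eval c ?x = S"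
      using that by (auto simp: summable_on_def ps_eval_eq infsumI)
    then show ?thesis using ps_mult_has_sum[OF oms, of c] by (simp add: ome)
  qed
  show "(ps_term (ps_mult (\<lambda>a. ps_one a - \<theta> a) lc) ?x has_sum (1 - ps_eval \<theta> ?x) * l z w) UNIV"
    by (rule ser[OF lser[OF z w]])
  have "ps_mult (\<lambda>a. ps_one a - \<theta> a) kc a = ps_one a - master_defect kc a" for a
    unfolding ps_mult_one_minus using master_times_k[of kc a] k0 kpos
    by (cases "a = 0") (auto simp: ps_one_def master_defect_def)
  then have eq: "ps_mult (\<lambda>a. ps_one a - \<theta> a) kc = (\<lambda>a. ps_one a - master_defect kc a)" by auto
  have "((\<lambda>a. ps_term ps_one ?x a - ps_term (\<lambda>a. ps_one a - master_defect kc a) ?x a) has_sum 1 - (1 - ps_eval \<theta> ?x) * k z w) UNIV"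
    by (rule has_sum_minus[OF ps_one_has_sum ser[OF kser[OF z w], unfolded eq]])
  then show "(ps_term (master_defect kc) ?x has_sum 1 - (1 - ps_eval \<theta> ?x) * k z w) UNIV"
    by (simp add: ps_term_def[abs_def] algebra_simps)
qed

theorem master_certificate_consequences:
  "master_kernel_defined kc \<Omega>"
  "strong_shimorin_certificate \<Omega> k l (master_kernel kc)"
  "\<exists>g. kernel \<Omega> g \<and> (\<forall>z\<in>\<Omega>. \<forall>w\<in>\<Omega>. l z w = g z w * master_kernel kc z w)"
  "diagonal_holomorphic_kernel \<Omega> (master_kernel kc) sc"
  "\<exists>p. shimorin_certificate \<Omega> k l p"
  "complete_pick_pair \<Omega> k l"
proof -
  let ?T = "\<lambda>z w. ps_eval \<theta> (z * vcnj w)" and ?s = "master_kernel kc"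
  define h where "h z w = 1 - (1 - ?T z w) * k z w" for z w
  define g where "g z w = (1 - ?T z w) * l z w" for z w
  have t: "0 \<le> \<theta> a" for a using master_nonneg[of kc a] k0 kpos by blast
  have rn: "0 \<le> sc a" for a by (rule reciprocal_nonneg[of \<theta>, OF master_zero t])
  note ser = master_certificate_series
  show "master_kernel_defined kc \<Omega>"
    unfolding master_kernel_defined_def using ser(1,2) by (auto simp: ps_term_def[abs_def] summable_on_def)
  have s: "kernel \<Omega> ?s" by (rule kernel_of_coefficients[OF rn ser(3)])
  have th: "kernel \<Omega> ?T" by (rule kernel_of_coefficients[OF t ser(1)])
  have hk: "kernel \<Omega> h"
    unfolding h_def using master_defect_nonneg[of kc] k0 kpos
    by (intro kernel_of_coefficients[of "master_defect kc"] ser(4)) auto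
  have gk: "kernel \<Omega> g" unfolding g_def by (rule kernel_of_coefficients[OF C ser(5)])
  have kk: "kernel \<Omega> k" using kpos less_imp_le by (intro kernel_of_coefficients[OF _ kser]) blast+
  have lk: "kernel \<Omega> l" using lpos less_imp_le by (intro kernel_of_coefficients[OF _ lser]) blast+
  have s_eq: "?s z w = 1 / (1 - ?T z w)" for z w by (simp add: master_kernel_def)
  have nz: "1 - ?T z w \<noteq> 0" if "z \<in> \<Omega>" "w \<in> \<Omega>" for z w using ser(2)[OF that] by simp
  have snz: "?s z w \<noteq> 0" if "z \<in> \<Omega>" "w \<in> \<Omega>" for z w using nz[OF that] by (simp add: s_eq)
  have keq: "k z w = (1 - h z w) * ?s z w" if "z \<in> \<Omega>" "w \<in> \<Omega>" for z w
    using nz[OF that] by (simp add: h_def s_eq)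
  have leq: "l z w = ?s z w * g z w" if "z \<in> \<Omega>" "w \<in> \<Omega>" for z w
    using nz[OF that] by (simp add: g_def s_eq)
  have lt: "Re (?T z z) < 1" if "z \<in> \<Omega>" for z
    using that \<Omega>(2) master_conv_domains(1) conv_domain_reciprocal[of \<theta>, OF master_zero t] by blast
  have quot: "kernel \<Omega> (\<lambda>x y. kernel_at ?s z x y / ?s x y)" if "z \<in> \<Omega>" for z
    by (rule kernel_at_quotient_of_reciprocal[OF th s s_eq ser(2) that lt[OF that]])
  have pick: "complete_pick_kernel \<Omega> ?s"
    by (rule complete_pick_kernelI[OF s snz quot])
  show "strong_shimorin_certificate \<Omega> k l ?s"
    unfolding strong_shimorin_certificate_def using pick hk gk keq leq by blast
  show "\<exists>g. kernel \<Omega> g \<and> (\<forall>z\<in>\<Omega>. \<forall>w\<in>\<Omega>. l z w = g z w * ?s z w)"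
    using gk leq by (intro exI[of _ g]) (auto simp: mult.commute)
  show "diagonal_holomorphic_kernel \<Omega> ?s sc"
  proof (rule diagonal_holomorphic_kernelI[OF _ \<Omega>(1)])
    show "0 < sc a" for a using kpos[of a] le_reciprocal_master[of kc a, OF k0 kpos] by linarith
    show "\<Omega> \<subseteq> conv_domain sc" using \<Omega>(2) master_conv_domains(1) by blast
    show "?s z w = ps_eval sc (z * vcnj w)" if "z \<in> \<Omega>" "w \<in> \<Omega>" for z w
      using ser(3)[OF that] by (simp add: ps_eval_eq infsumI)
  qed
  have diag: "S \<noteq> 0" if f: "(ps_term c (z * vcnj z) has_sum S) UNIV" and c: "c 0 = 1" "\<And>a. 0 < c a" for c S and z :: "complex ^ 'd"
  proof -
    have "0 \<le> c a" for a using c(2)[of a] by simp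
    then have "complex_of_real (c 0 * (cmod (mpow z 0))\<^sup>2) = 0" if "S = 0"
      using nonneg_has_sum_le_0D_complex[OF f, of 0] that
      by (auto simp: ps_term_def mpow_times_vcnj c intro!: mult_nonneg_nonneg)
    then show ?thesis using c by auto
  qed
  have knz: "k z z \<noteq> 0" if "z \<in> \<Omega>" for z by (rule diag[of kc, OF kser[OF that that] k0 kpos])
  have lnz: "l z z \<noteq> 0" if "z \<in> \<Omega>" for z by (rule diag[of lc, OF lser[OF that that] l0 lpos])
  have cert: "shimorin_certificate \<Omega> k l (\<lambda>z x y. kernel_at ?s z x y / ?s x y)"
    by (rule factorization_imp_shimorin_certificate[OF s hk gk kk snz quot keq leq knz lnz])
  then show "\<exists>p. shimorin_certificate \<Omega> k l p" by blast
  show "complete_pick_pair \<Omega> k l"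
    by (rule shimorin_imp_complete_pick_pair[OF kk lk cert knz lnz])
qed

end

end

section \<open>From interpolation to the linear programming condition\<close>

lemma box_char_red: "box_char b c g = box_char b (box_red b c) g"
proof -
  have "exp (2 * of_real pi * \<i> * of_nat n / of_nat (m + 1)) = exp (2 * of_real pi * \<i> * of_nat (n mod (m + 1)) / of_nat (m + 1))" for n m :: nat
    by (subst complex_root_unity_eq) auto
  then show ?thesis by (simp only: box_char_def box_red_def vec_lambda_beta)
qed

lemma box_char_zero: "box_char b 0 g = 1" "box_char b g 0 = 1"
  by (auto simp: box_char_def)

lemma ps_finite_has_sum:
  assumes "finite U" "\<And>a. a \<notin> U \<Longrightarrow> c a = 0"
  shows "(ps_term c x has_sum (\<Sum>a\<in>U. ps_term c x a)) UNIV"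
proof -
  have "(ps_term c x has_sum (\<Sum>a\<in>U. ps_term c x a)) U" by (rule has_sum_finite[OF assms(1)])
  then show ?thesis
    by (rule iffD1[OF has_sum_cong_neutral, rotated -1]) (use assms(2) in \<open>auto simp: ps_term_def\<close>)
qed

lemma qf_times_rank_one: "qf I (\<lambda>i j. M i j * (f i * cnj (f j))) v = qf I M (\<lambda>i. v i * cnj (f i))"
  unfolding qf_def by (intro sum.cong refl) (simp add: mult_ac)

lemma moment_shift: "moment I z (\<lambda>i. v i * cnj (mpow (z i) u)) c = moment I z v (c + u)"
  unfolding moment_def by (intro sum.cong refl) (simp add: mpow_add mult_ac)

text \<open>A form that is positive up to rapidly decreasing terms is positive on all vectors that vanish at
  the origin of the grid: for such vectors the sum of all Fourier coefficients is zero, so that the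
  coefficient at \<open>b\<close>, which has the smallest weight, is controlled by the others.\<close>

lemma grid_form_nonneg:
  fixes \<mu>c :: "nat ^ 'd \<Rightarrow> real"
  assumes b: "b \<noteq> 0" and pos: "\<And>a. a \<le> b \<Longrightarrow> a \<noteq> b \<Longrightarrow> 0 < \<mu>c a"
    and q: "0 < q" "q \<le> 1" and summ: "(\<lambda>a. \<bar>\<mu>c a\<bar> * (q\<^sup>2) ^ mdeg a) summable_on UNIV"
  obtains \<rho>0 where "0 < \<rho>0" "\<rho>0 \<le> q"
    "\<And>\<rho> F v. 0 < \<rho> \<Longrightarrow> \<rho> \<le> \<rho>0 \<Longrightarrow>
       (\<And>x y. x \<in> {..b} - {0} \<Longrightarrow> y \<in> {..b} - {0} \<Longrightarrow> (ps_term \<mu>c (grid b \<rho> x * vcnj (grid b \<rho> y)) has_sum F x y) UNIV) \<Longrightarrow>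
       0 \<le> Re (qf ({..b} - {0}) F v)"
proof -
  let ?I = "{..b} - {0}" and ?U = "{..b} - {b}"
  have U: "finite ?U" "?U \<noteq> {}" "finite ?I" using b finite_atMost_vec[of b] vec_zero_le[of b] by auto
  define lam where "lam = Min (\<mu>c ` ?U)"
  have lam: "0 < lam" "\<And>a. a \<in> ?U \<Longrightarrow> lam \<le> \<mu>c a" using U pos by (auto simp: lam_def)
  define N where "N = real (card ?U) + 1"
  define K where "K = N / (q ^ (mdeg b + 1))\<^sup>2"
  have N: "1 \<le> N" by (simp add: N_def)
  have K: "0 < K" using N q by (simp add: K_def)
  define B where "B a = K * (\<bar>\<mu>c a\<bar> * (q\<^sup>2) ^ mdeg a)" for a
  have Bs: "B summable_on UNIV" unfolding B_def[abs_def] by (intro summable_on_cmult_right summ)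
  have B0: "0 \<le> B a" for a using K by (simp add: B_def)
  have Bi: "0 \<le> infsum B UNIV" using B0 by (intro infsum_nonneg) auto
  define \<rho>0 where "\<rho>0 = min q (sqrt (lam / (infsum B UNIV + 1)))"
  have \<rho>0: "0 < \<rho>0" "\<rho>0 \<le> q" using q lam(1) Bi by (auto simp: \<rho>0_def)
  have \<rho>0_sq: "\<rho>\<^sup>2 * infsum B UNIV \<le> lam" if "0 < \<rho>" "\<rho> \<le> \<rho>0" for \<rho>
  proof -
    have "\<rho>\<^sup>2 \<le> (sqrt (lam / (infsum B UNIV + 1)))\<^sup>2"
      using that by (intro power_mono) (auto simp: \<rho>0_def)
    also have "\<dots> = lam / (infsum B UNIV + 1)" using lam(1) Bi by simp
    finally have "\<rho>\<^sup>2 * infsum B UNIV \<le> lam / (infsum B UNIV + 1) * infsum B UNIV"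
      using Bi by (rule mult_right_mono)
    also have "\<dots> \<le> lam" using Bi lam(1) by (simp add: field_simps)
    finally show ?thesis .
  qed
  show ?thesis
  proof (rule that[OF \<rho>0])
    fix \<rho> F and v :: "nat ^ 'd \<Rightarrow> complex"
    assume \<rho>: "0 < \<rho>" "\<rho> \<le> \<rho>0"
      and F: "\<And>x y. x \<in> ?I \<Longrightarrow> y \<in> ?I \<Longrightarrow> (ps_term \<mu>c (grid b \<rho> x * vcnj (grid b \<rho> y)) has_sum F x y) UNIV"
    have \<rho>q: "\<rho> \<le> q" using \<rho> \<rho>0 by simp
    define \<mu> where "\<mu> a = (\<Sum>g\<in>?I. v g * cnj (box_char b a g))" for a
    have m: "moment ?I (grid b \<rho>) v c = of_real (\<rho> ^ mdeg c) * \<mu> (box_red b c)" for c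
      unfolding moment_def \<mu>_def mpow_grid sum_distrib_left
      by (intro sum.cong refl) (simp add: box_char_symmetric[of b _ c] box_char_red[of b c] mult_ac)
    have "(\<Sum>a\<in>{..b}. \<mu> a) = (\<Sum>g\<in>?I. v g * (\<Sum>a\<in>{..b}. box_char b 0 a * cnj (box_char b g a)))"
      unfolding \<mu>_def by (subst sum.swap) (simp add: sum_distrib_left box_char_zero box_char_symmetric)
    also have "\<dots> = 0"
      unfolding box_char_orthogonal by (intro sum.neutral) (auto simp: box_red_id vec_zero_le)
    finally have "\<mu> b = - (\<Sum>a\<in>?U. \<mu> a)"
      unfolding atMost_vec_split_top by (simp add: eq_neg_iff_add_eq_0)
    then have "cmod (\<mu> b) \<le> (\<Sum>a\<in>?U. cmod (\<mu> a))" using norm_sum by (metis norm_minus_cancel)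
    then have "(cmod (\<mu> b))\<^sup>2 \<le> (\<Sum>a\<in>?U. cmod (\<mu> a))\<^sup>2" by (intro power_mono) auto
    also have "\<dots> \<le> N * (\<Sum>a\<in>?U. (cmod (\<mu> a))\<^sup>2)"
    proof -
      have "(\<Sum>a\<in>?U. cmod (\<mu> a))\<^sup>2 \<le> (\<Sum>a\<in>?U. (cmod (\<mu> a))\<^sup>2) * card ?U"
        by (rule sum_squared_le_sum_of_squares)
      also have "\<dots> \<le> (\<Sum>a\<in>?U. (cmod (\<mu> a))\<^sup>2) * N"
        by (intro mult_left_mono sum_nonneg) (auto simp: N_def)
      finally show ?thesis by (simp add: mult.commute)
    qed
    finally have \<mu>b: "(cmod (\<mu> b))\<^sup>2 \<le> N * (\<Sum>a\<in>?U. (cmod (\<mu> a))\<^sup>2)" .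
    define S where "S = (\<Sum>a\<in>?U. (\<rho> ^ mdeg a * cmod (\<mu> a))\<^sup>2)"
    have S0: "0 \<le> S" unfolding S_def by (intro sum_nonneg) auto
    have pw: "(\<rho> ^ mdeg c * cmod (\<mu> a))\<^sup>2 \<le> \<rho>\<^sup>2 * (q ^ mdeg c / q ^ (mdeg b + 1))\<^sup>2 * (\<rho> ^ mdeg a * cmod (\<mu> a))\<^sup>2"
      if "mdeg a < mdeg c" "a \<le> b" for a c
    proof -
      have "\<rho> ^ mdeg c = \<rho> ^ (mdeg c - mdeg a) * \<rho> ^ mdeg a" using that by (simp flip: power_add)
      also have "\<dots> \<le> \<rho> * (q ^ mdeg c / q ^ (mdeg b + 1)) * \<rho> ^ mdeg a"
        using \<rho> \<rho>q q that mdeg_mono[OF that(2)] by (intro mult_right_mono power_diff_le) auto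
      finally have "\<rho> ^ mdeg c * cmod (\<mu> a) \<le> \<rho> * (q ^ mdeg c / q ^ (mdeg b + 1)) * \<rho> ^ mdeg a * cmod (\<mu> a)"
        by (rule mult_right_mono) simp
      then have "(\<rho> ^ mdeg c * cmod (\<mu> a))\<^sup>2 \<le> (\<rho> * (q ^ mdeg c / q ^ (mdeg b + 1)) * \<rho> ^ mdeg a * cmod (\<mu> a))\<^sup>2"
        using \<rho> by (intro power_mono) auto
      then show ?thesis by (simp only: power_mult_distrib mult_ac)
    qed
    have tail: "(\<rho> ^ mdeg c * cmod (\<mu> (box_red b c)))\<^sup>2 \<le> \<rho>\<^sup>2 * (K * (q\<^sup>2) ^ mdeg c) * S" if c: "c \<notin> ?U" for c
    proof -
      let ?a = "box_red b c"
      have E: "\<rho>\<^sup>2 * (K * (q\<^sup>2) ^ mdeg c) = N * (\<rho>\<^sup>2 * (q ^ mdeg c / q ^ (mdeg b + 1))\<^sup>2)"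
        by (simp add: K_def power_divide mult_ac flip: power_mult)
      have "(\<rho> ^ mdeg c * cmod (\<mu> ?a))\<^sup>2 \<le> N * (\<rho>\<^sup>2 * (q ^ mdeg c / q ^ (mdeg b + 1))\<^sup>2) * S"
      proof (cases "?a = b")
        case False
        then have aU: "?a \<in> ?U" using box_red_le by auto
        have "\<not> c \<le> b" using c False box_red_id[of c b] by auto
        then have "mdeg ?a < mdeg c" by (intro mdeg_strict_mono[OF box_red_le' box_red_neq])
        then have "(\<rho> ^ mdeg c * cmod (\<mu> ?a))\<^sup>2 \<le> \<rho>\<^sup>2 * (q ^ mdeg c / q ^ (mdeg b + 1))\<^sup>2 * (\<rho> ^ mdeg ?a * cmod (\<mu> ?a))\<^sup>2"
          by (rule pw[OF _ box_red_le])
        also have "\<dots> \<le> \<rho>\<^sup>2 * (q ^ mdeg c / q ^ (mdeg b + 1))\<^sup>2 * S"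
          unfolding S_def using aU U by (intro mult_left_mono member_le_sum) auto
        also have "\<dots> \<le> N * (\<rho>\<^sup>2 * (q ^ mdeg c / q ^ (mdeg b + 1))\<^sup>2 * S)"
          using N S0 by (intro mult_right_mono[of 1 N, simplified]) auto
        finally show ?thesis by (simp add: mult.assoc)
      next
        case True
        have "mdeg b \<le> mdeg c" using mdeg_mono[OF box_red_le'[of b c]] True by simp
        then have lt: "mdeg a < mdeg c" if "a \<in> ?U" for a
          using mdeg_strict_mono[of a b] that by auto
        have "(\<rho> ^ mdeg c * cmod (\<mu> ?a))\<^sup>2 = (\<rho> ^ mdeg c)\<^sup>2 * (cmod (\<mu> b))\<^sup>2"
          by (simp add: True power_mult_distrib)
        also have "\<dots> \<le> (\<rho> ^ mdeg c)\<^sup>2 * (N * (\<Sum>a\<in>?U. (cmod (\<mu> a))\<^sup>2))"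
          using \<mu>b by (rule mult_left_mono) simp
        also have "\<dots> = N * (\<Sum>a\<in>?U. (\<rho> ^ mdeg c * cmod (\<mu> a))\<^sup>2)"
          by (simp add: power_mult_distrib sum_distrib_left mult_ac)
        also have "\<dots> \<le> N * (\<Sum>a\<in>?U. \<rho>\<^sup>2 * (q ^ mdeg c / q ^ (mdeg b + 1))\<^sup>2 * (\<rho> ^ mdeg a * cmod (\<mu> a))\<^sup>2)"
          using N lt by (intro mult_left_mono sum_mono pw) auto
        finally show ?thesis by (simp add: S_def sum_distrib_left mult_ac)
      qed
      then show ?thesis unfolding E .
    qed
    let ?T = "\<lambda>c. complex_of_real (\<mu>c c * (cmod (moment ?I (grid b \<rho>) v c))\<^sup>2)"
    have msq: "(cmod (moment ?I (grid b \<rho>) v c))\<^sup>2 = (\<rho> ^ mdeg c * cmod (\<mu> (box_red b c)))\<^sup>2" for c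
      using \<rho>(1) by (simp add: m norm_mult norm_power)
    have hs: "(?T has_sum qf ?I F v) UNIV"
    proof -
      have "((\<lambda>a. qf ?I (\<lambda>i j. ps_term \<mu>c (grid b \<rho> i * vcnj (grid b \<rho> j)) a) v) has_sum qf ?I F v) UNIV"
        by (rule qf_has_sum) (rule F)
      then show ?thesis unfolding qf_monomial .
    qed
    have "norm (qf ?I F v - (\<Sum>c\<in>?U. ?T c)) \<le> (\<rho>\<^sup>2 * S) * infsum B UNIV"
    proof (rule has_sum_finite_approx[OF hs U(1) Bs B0])
      fix c assume "c \<notin> ?U"
      from mult_left_mono[OF tail[OF this] abs_ge_zero[of "\<mu>c c"]]
      show "norm (?T c) \<le> \<rho>\<^sup>2 * S * B c"
        unfolding msq using \<rho>(1) by (simp add: B_def norm_mult norm_power mult_ac)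
    qed (use S0 in auto)
    moreover have "lam * S \<le> Re (\<Sum>c\<in>?U. ?T c)"
    proof -
      have "lam * S \<le> (\<Sum>c\<in>?U. \<mu>c c * (\<rho> ^ mdeg c * cmod (\<mu> c))\<^sup>2)"
        unfolding S_def sum_distrib_left using lam(2) by (intro sum_mono mult_right_mono) auto
      also have "\<dots> = (\<Sum>c\<in>?U. \<mu>c c * (cmod (moment ?I (grid b \<rho>) v c))\<^sup>2)"
        by (intro sum.cong refl) (simp add: msq box_red_id)
      finally show ?thesis by simp
    qed
    moreover have "(\<rho>\<^sup>2 * S) * infsum B UNIV \<le> lam * S"
      using mult_right_mono[OF \<rho>0_sq[OF \<rho>] S0] by (simp add: mult_ac)
    ultimately show "0 \<le> Re (qf ?I F v)"
      using abs_Re_le_cmod[of "qf ?I F v - (\<Sum>c\<in>?U. ?T c)"] by simp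
  qed
qed

text \<open>The nodes are the points of a small grid except one, and the multiplier takes the row
  \<open>(\<surd>y\<^sub>u z\<^sup>u)\<^sub>u\<close> as its values there. Interpolating the remaining grid point and testing with
  the character at \<open>b\<close> gives the inequality at \<open>b\<close> up to terms that vanish with the mesh size.\<close>

theorem complete_pick_pair_imp_lp_condition:
  fixes kc lc :: "nat ^ 'd \<Rightarrow> real"
  assumes P: "complete_pick_pair X k l" and k: "kernel X k" and l: "kernel X l"
    and r: "0 < r" "ball 0 r \<subseteq> X"
    and kser: "\<And>z w. z \<in> ball 0 r \<Longrightarrow> w \<in> ball 0 r \<Longrightarrow> (ps_term kc (z * vcnj w) has_sum k z w) UNIV"
    and lser: "\<And>z w. z \<in> ball 0 r \<Longrightarrow> w \<in> ball 0 r \<Longrightarrow> (ps_term lc (z * vcnj w) has_sum l z w) UNIV"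
    and k0: "kc 0 = 1" and kpos: "\<And>a. 0 < kc a" and lpos: "\<And>a. 0 < lc a"
    and nz: "\<And>z. z \<in> X \<Longrightarrow> k z z \<noteq> 0" "\<And>z. z \<in> X \<Longrightarrow> l z z \<noteq> 0"
  shows "lp_condition kc lc"
  unfolding lp_condition_def
proof (intro allI impI, elim conjE)
  fix b and y :: "nat ^ 'd \<Rightarrow> real"
  assume b: "b \<noteq> 0" and y: "\<forall>a. 0 \<le> y a"
    and con: "\<forall>a. a \<le> b \<and> a \<noteq> b \<longrightarrow> (\<Sum>u\<in>{..a}. kc (a - u) * y u) \<le> lc a"
  let ?U = "{..b} - {b}" and ?I = "{..b} - {0}"
  have fin: "finite {..b}" "finite ?U" "finite ?I" using finite_atMost_vec[of b] by auto
  obtain q where q: "0 < q" "q \<le> 1" "\<And>z :: complex ^ 'd. (\<And>j. cmod (z $ j) \<le> q) \<Longrightarrow> z \<in> ball 0 r"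
    using ball_contains_const[OF r(1)] by blast
  have series_at_q: "(\<lambda>a. \<bar>c a\<bar> * (q\<^sup>2) ^ mdeg a) summable_on UNIV"
    if c: "\<And>z w. z \<in> ball 0 r \<Longrightarrow> w \<in> ball 0 r \<Longrightarrow> \<exists>S. (ps_term c (z * vcnj w) has_sum S) UNIV" for c :: "nat ^ 'd \<Rightarrow> real"
  proof -
    have "(\<chi> j. of_real q) \<in> ball (0 :: complex ^ 'd) r" using q by simp
    then show ?thesis unfolding summable_on_def by (intro ps_summable_radius[unfolded summable_on_def] c)
  qed
  \<comment> \<open>scaling by \<open>\<tau> < 1\<close> makes the constraints strict\<close>
  have strict: "\<tau> * (\<Sum>u\<in>?U. kc (b - u) * y u) \<le> lc b" if \<tau>: "0 < \<tau>" "\<tau> < 1" for \<tau>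
  proof -
    define y' where "y' u = (if u \<in> ?U then \<tau> * y u else 0)" for u
    have y'0: "0 \<le> y' u" for u using y \<tau> by (simp add: y'_def)
    define V where "V z w = (\<Sum>u\<in>?U. ps_term y' (z * vcnj w) u)" for z w :: "complex ^ 'd"
    have Vser: "(ps_term y' (z * vcnj w) has_sum V z w) UNIV" for z w
      unfolding V_def by (rule ps_finite_has_sum[OF fin(2)]) (auto simp: y'_def)
    define \<mu>c where "\<mu>c a = lc a - ps_mult kc y' a" for a
    have \<mu>ser: "(ps_term \<mu>c (z * vcnj w) has_sum l z w - k z w * V z w) UNIV"
      if "z \<in> ball 0 r" "w \<in> ball 0 r" for z w
    proof -
      have "ps_term kc (z * vcnj w) summable_on UNIV" "ps_eval kc (z * vcnj w) = k z w"
        using kser[OF that] by (auto simp: summable_on_def ps_eval_eq infsumI)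
      moreover have "ps_term y' (z * vcnj w) summable_on UNIV" "ps_eval y' (z * vcnj w) = V z w"
        using Vser by (auto simp: summable_on_def ps_eval_eq infsumI)
      ultimately have "(ps_term (ps_mult kc y') (z * vcnj w) has_sum k z w * V z w) UNIV"
        using ps_mult_has_sum[of kc "z * vcnj w" y'] by simp
      from has_sum_minus[OF lser[OF that] this] show ?thesis
        by (simp add: ps_term_def[abs_def] \<mu>c_def left_diff_distrib)
    qed
    have \<mu>pos: "0 < \<mu>c a" if a: "a \<le> b" "a \<noteq> b" for a
    proof -
      have "ps_mult kc y' a = (\<Sum>u\<in>{..a}. kc (a - u) * y' u)"
        unfolding ps_mult_eq by (subst sum_atMost_reflect) (auto intro!: sum.cong simp: vec_eq_iff le_vec_iff arg_cong[where f = y'])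
      also have "\<dots> = \<tau> * (\<Sum>u\<in>{..a}. kc (a - u) * y u)"
        unfolding sum_distrib_left using a by (intro sum.cong) (auto simp: y'_def dest: order_trans order_antisym)
      also have "\<dots> \<le> \<tau> * lc a" using con a \<tau> by (intro mult_left_mono) auto
      also have "\<dots> < lc a" using \<tau> lpos[of a] by simp
      finally show ?thesis by (simp add: \<mu>c_def)
    qed
    have "(\<lambda>a. \<bar>\<mu>c a\<bar> * (q\<^sup>2) ^ mdeg a) summable_on UNIV"
      by (rule series_at_q) (use \<mu>ser in blast)
    then obtain \<rho>0 where \<rho>0: "0 < \<rho>0" "\<rho>0 \<le> q"
      and form: "\<And>\<rho> F v. 0 < \<rho> \<Longrightarrow> \<rho> \<le> \<rho>0 \<Longrightarrow>
       (\<And>x y. x \<in> ?I \<Longrightarrow> y \<in> ?I \<Longrightarrow> (ps_term \<mu>c (grid b \<rho> x * vcnj (grid b \<rho> y)) has_sum F x y) UNIV) \<Longrightarrow>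
       0 \<le> Re (qf ?I F v)"
      using grid_form_nonneg[where \<mu>c = \<mu>c, OF b \<mu>pos q(1,2)] by blast
    define x where "x a = (if a = b then 1 else 0 :: complex)" for a
    define E where "E = (1 / q ^ (mdeg b + 1))\<^sup>2 * infsum (\<lambda>a. \<bar>lc a\<bar> * (q\<^sup>2) ^ mdeg a) UNIV"
    have ls: "(\<lambda>a. \<bar>lc a\<bar> * (q\<^sup>2) ^ mdeg a) summable_on UNIV"
      by (rule series_at_q) (use lser in blast)
    have main: "(\<Sum>u\<in>?U. y' u * (kc (b - u) - (kc (b - u))\<^sup>2 * \<rho>\<^sup>2)) \<le> lc b + \<rho> * E"
      if \<rho>: "0 < \<rho>" "\<rho> \<le> \<rho>0" for \<rho>
    proof -
      have \<rho>q: "\<rho> \<le> q" and \<rho>1: "\<rho> \<le> 1" using \<rho> \<rho>0 q(2) by auto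
      let ?p = "grid b \<rho>" and ?v = "grid_weight b \<rho> x"
      have pr: "?p i \<in> ball 0 r" for i using \<rho> \<rho>q by (intro q(3)) (simp add: grid_coordinate)
      then have pX: "?p i \<in> X" for i using r(2) by blast
      let ?Y = "?p ` ?I" and ?z = "?p 0"
      have Y: "finite ?Y" "?Y \<subseteq> X" using fin(3) pX by auto
      have pullY: "psd_on ?Y M" if "psd_on ?I (\<lambda>i j. M (?p i) (?p j))" for M
      proof -
        have "psd_on ?Y (\<lambda>x y. M (?p (inv_into ?I ?p x)) (?p (inv_into ?I ?p y)))"
          by (rule psd_on_reindex[OF that fin(3) Y(1)]) (rule image_subsetI, erule inv_into_into)
        then show ?thesis
          by (rule iffD1[OF psd_on_cong, rotated]) (simp add: f_inv_into_f)
      qed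
      have Vpsd: "psd_on A V" for A
        unfolding V_def
      proof (rule psd_on_sum)
        fix u
        have "psd_on A (\<lambda>z w. of_real (y' u) * (mpow z u * cnj (mpow w u)))"
          using y'0 by (intro psd_on_scale psd_on_rank_one) simp
        then show "psd_on A (\<lambda>z w. ps_term y' (z * vcnj w) u)"
          by (simp add: ps_term_def mpow_times_vcnj)
      qed
      have "psd_on ?I (\<lambda>i j. l (?p i) (?p j) - k (?p i) (?p j) * V (?p i) (?p j))"
        unfolding psd_on_iff
      proof
        fix v
        let ?F = "\<lambda>i j. l (?p i) (?p j) - k (?p i) (?p j) * V (?p i) (?p j)"
        have "0 \<le> Re (qf ?I ?F v)"
          by (rule form[OF \<rho>]) (rule \<mu>ser[OF pr pr])
        moreover have "((\<lambda>a. complex_of_real (\<mu>c a * (cmod (moment ?I ?p v a))\<^sup>2)) has_sum qf ?I ?F v) UNIV"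
          by (rule diag_qf_has_sum) (rule \<mu>ser[OF pr pr])
        then have "((\<lambda>a. Im (complex_of_real (\<mu>c a * (cmod (moment ?I ?p v a))\<^sup>2))) has_sum Im (qf ?I ?F v)) UNIV"
          by (rule has_sum_Im)
        then have "((\<lambda>a :: nat ^ 'd. 0 :: real) has_sum Im (qf ?I ?F v)) UNIV" by (simp only: Im_complex_of_real)
        then have "Im (qf ?I ?F v) = 0" using has_sum_unique[OF _ has_sum_0_simp] by blast
        ultimately show "0 \<le> qf ?I ?F v" by (simp add: less_eq_complex_def)
      qed
      then have "psd_on ?Y (\<lambda>x y. l x y - k x y * V x y)"
        by (rule pullY[where M = "\<lambda>x y. l x y - k x y * V x y"])
      then have "psd_on ?Y (\<lambda>x y. kernel_at l ?z x y - kernel_at k ?z x y * V x y)"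
        by (intro complete_pick_pair_necessity[OF P k l Y pX nz(1)[OF pX] Vpsd])
      then have "psd_on ?I (\<lambda>i j. kernel_at l ?z (?p i) (?p j) - kernel_at k ?z (?p i) (?p j) * V (?p i) (?p j))"
        by (rule psd_on_reindex[OF _ Y(1) fin(3) order_refl])
      then have ineq: "Re (qf ?I (\<lambda>i j. kernel_at k ?z (?p i) (?p j) * V (?p i) (?p j)) ?v) \<le>
          Re (qf ?I (\<lambda>i j. kernel_at l ?z (?p i) (?p j)) ?v)"
        using psd_onD[of ?I "\<lambda>i j. kernel_at l ?z (?p i) (?p j) - kernel_at k ?z (?p i) (?p j) * V (?p i) (?p j)" ?v]
        unfolding qf_diff by (simp add: less_eq_complex_def)
      define L where "L i j = l (?p i) (?p j)" for i j
      define M where "M i j = k (?p i) (?p j)" for i j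
      have Lpsd: "psd_on {..b} L" and Mpsd: "psd_on {..b} M"
        unfolding L_def M_def using kernel_psd_reindex[OF l fin(1), of ?p] kernel_psd_reindex[OF k fin(1), of ?p] pX by auto
      have 0: "0 \<in> {..b}" using vec_zero_le by simp
      have L00: "L 0 0 \<noteq> 0" and M00: "M 0 0 \<noteq> 0" using nz pX by (auto simp: L_def M_def)
      have at: "kernel_at L 0 i j = kernel_at l ?z (?p i) (?p j)" "kernel_at M 0 i j = kernel_at k ?z (?p i) (?p j)" for i j
        by (auto simp: kernel_at_def L_def M_def)
      have at0: "kernel_at L 0 0 j = 0" "kernel_at L 0 j 0 = 0" "kernel_at M 0 0 j = 0" "kernel_at M 0 j 0 = 0" for j
        using L00 M00 by (auto simp: kernel_at_def)
      have ext: "qf ?I (\<lambda>i j. kernel_at M 0 i j * W i j) u = qf {..b} (\<lambda>i j. kernel_at M 0 i j * W i j) u"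
        "qf ?I (kernel_at L 0) u = qf {..b} (kernel_at L 0) u" for u W
        by (rule qf_zero_extend[symmetric]; use fin(1) at0 in auto)+
      have mom: "moment {..b} ?p ?v c = x (box_red b c) * of_real (\<rho> ^ (mdeg c - mdeg (box_red b c)))" for c
        by (rule moment_grid[OF \<rho>(1)])
      \<comment> \<open>passing to the Schur complement lowers the form of \<open>\<ell>\<close>, whose moments other than the one at \<open>b\<close> are small\<close>
      have "Re (qf {..b} (kernel_at L 0) ?v) \<le> Re (qf {..b} L ?v)"
      proof -
        define s where "s = (\<Sum>j\<in>{..b}. L 0 j * ?v j)"
        obtain d where d: "L 0 0 = of_real d" "0 \<le> d" using psd_on_diag[OF Lpsd fin(1) 0] by (elim nonneg_complex_cases)
        have "qf {..b} (kernel_at L 0) ?v = qf {..b} L ?v - of_real ((cmod s)\<^sup>2 / d)"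
          unfolding qf_kernel_at[OF Lpsd fin(1) 0] s_def[symmetric] cnj_mult_self d by simp
        then show ?thesis using d by simp
      qed
      also have "\<dots> \<le> lc b + \<rho> * E"
      proof -
        have "(\<Sum>a\<in>{..b}. cmod (x a)) = 1" using fin(1) by (simp add: x_def if_distrib cong: if_cong)
        moreover have "(\<Sum>a\<in>{..b}. lc a * (cmod (x a))\<^sup>2) = (\<Sum>a\<in>{..b}. if a = b then lc b else 0)"
          by (intro sum.cong) (auto simp: x_def)
        then have "(\<Sum>a\<in>{..b}. lc a * (cmod (x a))\<^sup>2) = lc b" using fin(1) by simp
        ultimately have "cmod (qf {..b} L ?v - of_real (lc b)) \<le> \<rho> * E"
          using grid_form_approx[OF \<rho>(1) \<rho>q q(2) ls lser[OF pr pr], of x] by (simp add: L_def[abs_def] E_def)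
        then show ?thesis
          using abs_Re_le_cmod[of "qf {..b} L ?v - of_real (lc b)"] by simp
      qed
      finally have upper: "Re (qf {..b} (kernel_at L 0) ?v) \<le> lc b + \<rho> * E" .
      \<comment> \<open>the Schur complement changes one entry of the vector by \<open>s\<close>; the terms at \<open>0\<close> and \<open>b - u\<close> bound the form for every \<open>s\<close>\<close>
      have lower: "kc (b - u) - (kc (b - u))\<^sup>2 * \<rho>\<^sup>2 \<le> Re (qf {..b} (kernel_at M 0) (\<lambda>g. ?v g * cnj (mpow (?p g) u)))"
        if u: "u \<in> ?U" for u
      proof -
        let ?w = "\<lambda>g. ?v g * cnj (mpow (?p g) u)"
        define s where "s = (\<Sum>j\<in>{..b}. M 0 j * ?w j) / M 0 0"
        let ?w' = "\<lambda>g. ?w g - (if g = 0 then s else 0)"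
        define m where "m = mdeg (b - u)"
        have bu: "b - u \<noteq> 0" using u by (simp add: vec_diff_eq_zero)
        then have m1: "1 \<le> m" using mdeg_zero[of "b - u"] by (simp add: m_def)
        have "qf {..b} (kernel_at M 0) ?w = qf {..b} M ?w'"
          unfolding s_def by (rule kernel_at_minimizer[OF Mpsd fin(1) 0 M00])
        moreover have hs: "((\<lambda>c. complex_of_real (kc c * (cmod (moment {..b} ?p ?w' c))\<^sup>2)) has_sum qf {..b} M ?w') UNIV"
          unfolding M_def by (rule diag_qf_has_sum) (rule kser[OF pr pr])
        have mom': "moment {..b} ?p ?w' c = x (box_red b (c + u)) * of_real (\<rho> ^ (mdeg (c + u) - mdeg (box_red b (c + u)))) - s * of_real (\<rho> ^ mdeg c)" for c
        proof -
          have "moment {..b} ?p ?w' c = moment {..b} ?p ?w c - (\<Sum>g\<in>{..b}. if g = 0 then s * cnj (mpow (?p 0) c) else 0)"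
            unfolding moment_def sum_subtractf[symmetric] by (intro sum.cong refl) (auto simp: left_diff_distrib)
          also have "\<dots> = moment {..b} ?p ?v (c + u) - s * cnj (mpow (?p 0) c)"
            unfolding moment_shift using fin(1) 0 by simp
          finally show ?thesis by (simp add: mom mpow_grid box_char_zero)
        qed
        have "(\<Sum>c\<in>{0, b - u}. kc c * (cmod (moment {..b} ?p ?w' c))\<^sup>2) \<le> Re (qf {..b} M ?w')"
        proof (rule finite_sum_le_has_sum)
          show "((\<lambda>c. kc c * (cmod (moment {..b} ?p ?w' c))\<^sup>2) has_sum Re (qf {..b} M ?w')) UNIV"
            using has_sum_Re[OF hs] by (simp only: Re_complex_of_real)
        qed (use kpos less_imp_le in \<open>auto intro!: mult_nonneg_nonneg\<close>)
        moreover have "moment {..b} ?p ?w' 0 = - s"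
          using u by (simp add: mom' x_def box_red_id mdeg_def)
        moreover have "moment {..b} ?p ?w' (b - u) = 1 - s * of_real (\<rho> ^ m)"
          using u by (simp add: mom' x_def box_red_id vec_add_diff_cancel m_def)
        ultimately have "(cmod s)\<^sup>2 + kc (b - u) * (cmod (1 - s * of_real (\<rho> ^ m)))\<^sup>2 \<le> Re (qf {..b} (kernel_at M 0) ?w)"
          using bu k0 by simp
        moreover have "kc (b - u) - (kc (b - u))\<^sup>2 * \<rho>\<^sup>2 \<le> (cmod s)\<^sup>2 + kc (b - u) * (cmod (1 - s * of_real (\<rho> ^ m)))\<^sup>2"
        proof -
          define \<kappa> \<sigma> where "\<kappa> = kc (b - u)" and "\<sigma> = cmod s"
          have \<kappa>: "0 < \<kappa>" using kpos by (simp add: \<kappa>_def)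
          have "\<rho> ^ m \<le> \<rho> ^ 1" using \<rho> \<rho>1 m1 by (intro power_decreasing) auto
          then have "cmod (s * of_real (\<rho> ^ m)) \<le> \<sigma> * \<rho>"
            using \<rho>(1) by (simp add: norm_mult norm_power \<sigma>_def mult_left_mono)
          then have le: "1 - \<sigma> * \<rho> \<le> cmod (1 - s * of_real (\<rho> ^ m))"
            using norm_triangle_ineq2[of 1 "s * of_real (\<rho> ^ m)"] by simp
          have "1 - 2 * (\<sigma> * \<rho>) \<le> (cmod (1 - s * of_real (\<rho> ^ m)))\<^sup>2"
          proof -
            have "0 \<le> (cmod (1 - s * of_real (\<rho> ^ m)) - 1)\<^sup>2" by simp
            then show ?thesis using le by (simp add: power2_eq_square algebra_simps)
          qed
          then have "\<kappa> * (1 - 2 * (\<sigma> * \<rho>)) \<le> \<kappa> * (cmod (1 - s * of_real (\<rho> ^ m)))\<^sup>2"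
            using \<kappa> by (intro mult_left_mono) auto
          moreover have "0 \<le> (\<sigma> - \<kappa> * \<rho>)\<^sup>2" by simp
          ultimately have "\<kappa> - \<kappa>\<^sup>2 * \<rho>\<^sup>2 \<le> \<sigma>\<^sup>2 + \<kappa> * (cmod (1 - s * of_real (\<rho> ^ m)))\<^sup>2"
            by (simp add: power2_eq_square algebra_simps)
          then show ?thesis by (simp add: \<kappa>_def \<sigma>_def)
        qed
        ultimately show ?thesis by linarith
      qed
      have "(\<Sum>u\<in>?U. y' u * (kc (b - u) - (kc (b - u))\<^sup>2 * \<rho>\<^sup>2)) \<le>
          (\<Sum>u\<in>?U. y' u * Re (qf {..b} (kernel_at M 0) (\<lambda>g. ?v g * cnj (mpow (?p g) u))))"
        using lower y'0 by (intro sum_mono mult_left_mono) auto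
      also have "\<dots> = Re (qf {..b} (\<lambda>i j. kernel_at M 0 i j * V (?p i) (?p j)) ?v)"
      proof -
        have "qf {..b} (\<lambda>i j. kernel_at M 0 i j * V (?p i) (?p j)) ?v =
            qf {..b} (\<lambda>i j. \<Sum>u\<in>?U. of_real (y' u) * (kernel_at M 0 i j * (mpow (?p i) u * cnj (mpow (?p j) u)))) ?v"
          by (rule qf_cong) (simp_all add: V_def ps_term_def mpow_times_vcnj sum_distrib_left mult_ac)
        also have "\<dots> = (\<Sum>u\<in>?U. of_real (y' u) * qf {..b} (kernel_at M 0) (\<lambda>g. ?v g * cnj (mpow (?p g) u)))"
          unfolding qf_sum qf_scale qf_times_rank_one ..
        finally show ?thesis by simp
      qed
      also have "\<dots> \<le> Re (qf {..b} (kernel_at L 0) ?v)"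
        using ineq unfolding at[symmetric] ext .
      also note upper
      finally show ?thesis .
    qed
    have "((\<lambda>\<rho>. lc b + \<rho> * E) \<longlongrightarrow> lc b + 0 * E) (at_right 0)"
      by (intro tendsto_intros)
    moreover have "((\<lambda>\<rho>. \<Sum>u\<in>?U. y' u * (kc (b - u) - (kc (b - u))\<^sup>2 * \<rho>\<^sup>2)) \<longlongrightarrow>
        (\<Sum>u\<in>?U. y' u * (kc (b - u) - (kc (b - u))\<^sup>2 * 0\<^sup>2))) (at_right 0)"
      by (intro tendsto_intros)
    moreover have "eventually (\<lambda>\<rho>. (\<Sum>u\<in>?U. y' u * (kc (b - u) - (kc (b - u))\<^sup>2 * \<rho>\<^sup>2)) \<le> lc b + \<rho> * E) (at_right 0)"
      using main \<rho>0(1) by (auto simp: eventually_at_right_field intro!: exI[of _ \<rho>0])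
    ultimately have "(\<Sum>u\<in>?U. y' u * (kc (b - u) - (kc (b - u))\<^sup>2 * 0\<^sup>2)) \<le> lc b + 0 * E"
      by (intro tendsto_le[of "at_right (0::real)"]) auto
    moreover have "(\<Sum>u\<in>?U. y' u * kc (b - u)) = \<tau> * (\<Sum>u\<in>?U. kc (b - u) * y u)"
      unfolding sum_distrib_left by (intro sum.cong) (auto simp: y'_def)
    ultimately show ?thesis by simp
  qed
  have "((\<lambda>\<tau>. \<tau> * (\<Sum>u\<in>?U. kc (b - u) * y u)) \<longlongrightarrow> 1 * (\<Sum>u\<in>?U. kc (b - u) * y u)) (at_left 1)"
    by (intro tendsto_intros)
  moreover have "eventually (\<lambda>\<tau>. \<tau> * (\<Sum>u\<in>?U. kc (b - u) * y u) \<le> lc b) (at_left 1)"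
    using strict by (auto simp: eventually_at_left_field intro!: exI[of _ 0])
  ultimately have "1 * (\<Sum>u\<in>?U. kc (b - u) * y u) \<le> lc b"
    by (rule tendsto_upperbound) simp
  then show "(\<Sum>u\<in>?U. kc (b - u) * y u) \<le> lc b" by simp
qed

section \<open>Complete Caratheodory pairs\<close>

text \<open>The Toeplitz matrix of \<open>c\<close> without the weights \<open>\<surd>(k\<^sub>a / \<ell>\<^sub>b)\<close>. Substituting \<open>x\<^sub>b = v\<^sub>b / \<surd>\<ell>\<^sub>b\<close> moves the weights into the
  norms, and the contraction property becomes the inequality of weighted norms in \<open>coeff_contraction\<close>.\<close>

definition toeplitz :: "(nat ^ 'd) set \<Rightarrow> nat \<Rightarrow> (nat ^ 'd \<Rightarrow> nat \<Rightarrow> nat \<Rightarrow> complex) \<Rightarrow>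
    (nat ^ 'd \<Rightarrow> nat \<Rightarrow> complex) \<Rightarrow> nat ^ 'd \<Rightarrow> nat \<Rightarrow> complex" where
  "toeplitz F J c x a m = (\<Sum>b\<in>F. \<Sum>p<J. if a \<le> b then c (b - a) m p * x b p else 0)"

abbreviation wnorm2 :: "(nat ^ 'd \<Rightarrow> real) \<Rightarrow> (nat ^ 'd) set \<Rightarrow> nat \<Rightarrow> (nat ^ 'd \<Rightarrow> nat \<Rightarrow> complex) \<Rightarrow> real" where
  "wnorm2 w F J x \<equiv> \<Sum>a\<in>F. w a * (\<Sum>m<J. (cmod (x a m))\<^sup>2)"

definition coeff_contraction :: "(nat ^ 'd \<Rightarrow> real) \<Rightarrow> (nat ^ 'd \<Rightarrow> real) \<Rightarrow> (nat ^ 'd) set \<Rightarrow> nat \<Rightarrow>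
    (nat ^ 'd \<Rightarrow> nat \<Rightarrow> nat \<Rightarrow> complex) \<Rightarrow> bool" where
  "coeff_contraction kc lc F J c \<longleftrightarrow> (\<forall>x. wnorm2 kc F J (toeplitz F J c x) \<le>
     wnorm2 lc F J x)"

lemma coeff_contractionD:
  "coeff_contraction kc lc F J c \<Longrightarrow> (wnorm2 kc F J (toeplitz F J c x)) \<le>
     wnorm2 lc F J x"
  by (simp add: coeff_contraction_def)

lemma toeplitz_cong:
  assumes "\<And>b p. b \<in> F \<Longrightarrow> p < J \<Longrightarrow> a \<le> b \<Longrightarrow> c (b - a) m p = c' (b - a) m p"
    "\<And>b p. b \<in> F \<Longrightarrow> p < J \<Longrightarrow> x b p = x' b p"
  shows "toeplitz F J c x a m = toeplitz F J c' x' a m"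
  unfolding toeplitz_def using assms by (intro sum.cong refl) auto

lemma contraction_on_iff_coeff_contraction:
  assumes kpos: "\<And>a. 0 < kc a" and lpos: "\<And>a. 0 < lc a"
  shows "contraction_on (F \<times> {..<J}) (\<lambda>(a, p) (b, q). if a \<le> b then c (b - a) p q * of_real (sqrt (kc a / lc b)) else 0)
    \<longleftrightarrow> coeff_contraction kc lc F J c"
proof -
  let ?M = "\<lambda>(a, p) (b, q). if a \<le> b then c (b - a) p q * of_real (sqrt (kc a / lc b)) else 0"
  have row: "(\<Sum>j\<in>F \<times> {..<J}. ?M (a, m) j * v j) = of_real (sqrt (kc a)) * toeplitz F J c (\<lambda>b p. v (b, p) / of_real (sqrt (lc b))) a m" for a m v
    unfolding toeplitz_def sum.cartesian_product' sum_distrib_left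
    by (intro sum.cong refl) (auto simp: real_sqrt_divide)
  have L: "(\<Sum>i\<in>F \<times> {..<J}. (cmod (\<Sum>j\<in>F \<times> {..<J}. ?M i j * v j))\<^sup>2) =
      (\<Sum>a\<in>F. kc a * (\<Sum>m<J. (cmod (toeplitz F J c (\<lambda>b p. v (b, p) / of_real (sqrt (lc b))) a m))\<^sup>2))" for v
  proof -
    have "(\<Sum>i\<in>F \<times> {..<J}. (cmod (\<Sum>j\<in>F \<times> {..<J}. ?M i j * v j))\<^sup>2) =
        (\<Sum>a\<in>F. \<Sum>m<J. (cmod (\<Sum>j\<in>F \<times> {..<J}. ?M (a, m) j * v j))\<^sup>2)"
      by (rule sum.cartesian_product')
    then show ?thesis
      unfolding row sum_distrib_left
      using less_imp_le[OF kpos] by (simp add: norm_mult power_mult_distrib)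
  qed
  have R: "(\<Sum>j\<in>F \<times> {..<J}. (cmod (v j))\<^sup>2) = (\<Sum>b\<in>F. lc b * (\<Sum>p<J. (cmod (v (b, p) / of_real (sqrt (lc b))))\<^sup>2))" for v
    unfolding sum.cartesian_product' sum_distrib_left
    using lpos by (intro sum.cong refl) (auto simp: norm_divide power_divide less_imp_le less_imp_neq[symmetric])
  show ?thesis
  proof
    assume *: "contraction_on (F \<times> {..<J}) ?M"
    show "coeff_contraction kc lc F J c"
      unfolding coeff_contraction_def
    proof
      fix x :: "nat ^ 'a \<Rightarrow> nat \<Rightarrow> complex"
      define v where "v i = x (fst i) (snd i) * of_real (sqrt (lc (fst i)))" for i
      have "(\<lambda>b p. v (b, p) / of_real (sqrt (lc b))) = x"
        using lpos less_imp_neq[OF lpos] by (auto simp: v_def fun_eq_iff)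
      moreover have "v (b, p) / of_real (sqrt (lc b)) = x b p" for b p
        using less_imp_neq[OF lpos[of b]] by (auto simp: v_def)
      ultimately show "wnorm2 kc F J (toeplitz F J c x) \<le> wnorm2 lc F J x"
        using *[unfolded contraction_on_def, rule_format, of v] unfolding L R by simp
    qed
  next
    assume "coeff_contraction kc lc F J c"
    then show "contraction_on (F \<times> {..<J}) ?M"
      unfolding contraction_on_def L R by (blast intro: coeff_contractionD)
  qed
qed

lemma coinvariant_zero: "coinvariant F \<Longrightarrow> 0 \<in> F"
  unfolding coinvariant_def using vec_zero_le by blast

lemma coinvariantD: "coinvariant F \<Longrightarrow> b \<in> F \<Longrightarrow> a \<le> b \<Longrightarrow> a \<in> F"
  unfolding coinvariant_def by blast

lemma coinvariant_atMost: "coinvariant {..b}"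
  unfolding coinvariant_def by (auto intro: order_trans)

lemma finite_subset_atMost_vec:
  assumes "finite A"
  obtains b :: "nat ^ 'd" where "A \<subseteq> {..b}"
proof (rule that[of "\<Sum>a\<in>A. a"], rule subsetI)
  fix a assume "a \<in> A"
  then have "(\<Sum>a\<in>A. a) = a + (\<Sum>a\<in>A - {a}. a)" by (rule sum.remove[OF assms])
  then show "a \<in> {..\<Sum>a\<in>A. a}" using vec_le_add(1)[of a "\<Sum>a\<in>A - {a}. a"] by simp
qed

lemma coeff_contraction_cong:
  assumes F: "coinvariant F" and c: "\<And>a m p. a \<in> F \<Longrightarrow> m < J \<Longrightarrow> p < J \<Longrightarrow> c a m p = c' a m p"
  shows "coeff_contraction kc lc F J c \<longleftrightarrow> coeff_contraction kc lc F J c'"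
proof -
  have "toeplitz F J c x a m = toeplitz F J c' x a m" if "m < J" for x a m
    by (rule toeplitz_cong) (use c[OF coinvariantD[OF F _ vec_diff_le]] that in auto)
  then show ?thesis by (simp add: coeff_contraction_def)
qed

text \<open>Extend the vector by zero and drop rows.\<close>

lemma coeff_contraction_subset:
  assumes con: "coeff_contraction kc lc G J c" and G: "finite G" "F \<subseteq> G" and kpos: "\<And>a. 0 < kc a"
  shows "coeff_contraction kc lc F J c"
  unfolding coeff_contraction_def
proof
  fix x :: "nat ^ 'a \<Rightarrow> nat \<Rightarrow> complex"
  define x' where "x' b p = (if b \<in> F then x b p else 0)" for b p
  have t: "toeplitz F J c x a m = toeplitz G J c x' a m" for a m
    unfolding toeplitz_def using G by (intro sum.mono_neutral_cong_left) (auto simp: x'_def intro!: sum.neutral sum.cong)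
  have "wnorm2 kc F J (toeplitz F J c x) \<le> wnorm2 kc G J (toeplitz G J c x')"
    unfolding t using G kpos less_imp_le by (intro sum_mono2) (auto intro!: mult_nonneg_nonneg sum_nonneg)
  also have "\<dots> \<le> wnorm2 lc G J x'" by (rule coeff_contractionD[OF con])
  also have "\<dots> = wnorm2 lc F J x"
    using G by (intro sum.mono_neutral_cong_right) (auto simp: x'_def)
  finally show "wnorm2 kc F J (toeplitz F J c x) \<le> wnorm2 lc F J x" .
qed

text \<open>Reindexing by the sum \<open>a + w\<close>. Since \<open>b\<close> is maximal, \<open>w \<noteq> 0\<close> and \<open>a + w \<in> insert b F\<close> force \<open>a \<noteq> b\<close>, so
  that nothing is lost by excluding \<open>b\<close> from the range of \<open>a\<close>.\<close>

lemma sum_shift_pairs: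
  fixes G :: "nat ^ 'd \<Rightarrow> real"
  assumes F: "finite F" "coinvariant (insert b F)" "b \<notin> F" and max: "\<And>a. a \<in> F \<Longrightarrow> \<not> b \<le> a"
    and G: "\<And>a. a \<notin> insert b F \<Longrightarrow> G a = 0"
  shows "(\<Sum>w\<in>insert b F - {0}. \<Sum>a\<in>F. f w a * G (a + w)) =
    (\<Sum>a\<in>insert b F - {0}. (\<Sum>w\<in>{..a} - {0}. f w (a - w)) * G a)"
proof -
  let ?K = "insert b F"
  have K: "finite ?K" using F by simp
  have inF: "a \<in> F" if "a + w \<in> ?K" "w \<noteq> 0" for a w
  proof -
    have "a \<in> ?K" using coinvariantD[OF F(2) that(1)] vec_le_add by blast
    moreover have "a \<noteq> b"
    proof
      assume "a = b"
      moreover have "a + w \<noteq> a" using that(2) by simp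
      ultimately have "a + w \<in> F" using that(1) by auto
      then show False using max[of "a + w"] \<open>a = b\<close> vec_le_add(1) by blast
    qed
    ultimately show ?thesis by simp
  qed
  let ?P = "{(w, a). w \<noteq> 0 \<and> w \<in> ?K \<and> a \<in> F \<and> a + w \<in> ?K}"
  have "(\<Sum>w\<in>?K - {0}. \<Sum>a\<in>F. f w a * G (a + w)) = (\<Sum>(w, a)\<in>(?K - {0}) \<times> F. f w a * G (a + w))"
    by (simp add: sum.cartesian_product)
  also have "\<dots> = (\<Sum>(w, a)\<in>?P. f w a * G (a + w))"
  proof (rule sum.mono_neutral_right)
    show "\<forall>i\<in>(?K - {0}) \<times> F - ?P. (case i of (w, a) \<Rightarrow> f w a * G (a + w)) = 0"
    proof
      fix i assume "i \<in> (?K - {0}) \<times> F - ?P"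
      then obtain w a where "i = (w, a)" "a + w \<notin> ?K" by (cases i) auto
      then show "(case i of (w, a) \<Rightarrow> f w a * G (a + w)) = 0" using G[of "a + w"] by simp
    qed
  qed (use K F(1) in auto)
  also have "\<dots> = (\<Sum>(a, w)\<in>(SIGMA a:?K - {0}. {..a} - {0}). f w (a - w) * G a)"
  proof (rule sum.reindex_bij_witness[where j = "\<lambda>(w, a). (a + w, w)" and i = "\<lambda>(a, w). (w, a - w)"])
    fix p assume "p \<in> ?P"
    then obtain w a where p: "p = (w, a)" "w \<noteq> 0" "w \<in> ?K" "a \<in> F" "a + w \<in> ?K" by auto
    have "a + w \<noteq> 0" using p(2) vec_le_add(2)[of w a] vec_le_zero[of w] by auto
    then show "(case p of (w, a) \<Rightarrow> (a + w, w)) \<in> (SIGMA a:?K - {0}. {..a} - {0})"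
      using p by (auto simp: vec_le_add)
    show "(case case p of (w, a) \<Rightarrow> (a + w, w) of (a, w) \<Rightarrow> (w, a - w)) = p"
      by (simp add: p vec_add_diff)
    show "(case case p of (w, a) \<Rightarrow> (a + w, w) of (a, w) \<Rightarrow> f w (a - w) * G a) = (case p of (w, a) \<Rightarrow> f w a * G (a + w))"
      by (simp add: p vec_add_diff)
  next
    fix q assume "q \<in> (SIGMA a:?K - {0}. {..a} - {0})"
    then obtain a w where q: "q = (a, w)" "a \<in> ?K" "a \<noteq> 0" "w \<le> a" "w \<noteq> 0" by blast
    have e: "a - w + w = a" using q(4) by (simp add: vec_add_diff_cancel)
    show "(case case q of (a, w) \<Rightarrow> (w, a - w) of (w, a) \<Rightarrow> (a + w, w)) = q"
      by (simp add: q e)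
    have "a - w \<in> F" by (rule inF[of _ w]) (use e q in auto)
    moreover have "w \<in> ?K" by (rule coinvariantD[OF F(2) q(2,4)])
    ultimately show "(case q of (a, w) \<Rightarrow> (w, a - w)) \<in> ?P"
      using q e by simp
  qed
  also have "\<dots> = (\<Sum>a\<in>?K - {0}. \<Sum>w\<in>{..a} - {0}. f w (a - w) * G a)"
    using K finite_atMost_vec by (subst sum.Sigma) auto
  finally show ?thesis by (simp add: sum_distrib_right)
qed

lemma qf_diagonal:
  assumes "finite K"
  shows "qf K (\<lambda>i j. if i = j then of_real (d i) else 0) v = of_real (\<Sum>i\<in>K. d i * (cmod (v i))\<^sup>2)"
proof -
  have "qf K (\<lambda>i j. if i = j then of_real (d i) else 0) v = (\<Sum>i\<in>K. \<Sum>j\<in>K. if j = i then of_real (d i) * (cnj (v i) * v i) else 0)"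
    unfolding qf_def by (intro sum.cong refl) auto
  also have "\<dots> = (\<Sum>i\<in>K. of_real (d i) * (cnj (v i) * v i))"
    using assms by (intro sum.cong refl) simp
  finally show ?thesis by (simp add: cnj_mult_self)
qed

context
  fixes kc lc :: "nat ^ 'd \<Rightarrow> real"
  assumes k0: "kc 0 = 1" and kpos: "\<And>a. 0 < kc a" and l0: "lc 0 = 1" and lpos: "\<And>a. 0 < lc a"
    and C: "\<And>b. 0 \<le> ps_mult (\<lambda>a. ps_one a - master kc a) lc b"
begin

text \<open>The part of the Toeplitz matrix that does not involve the next coefficient is contractive: apply
  the given contraction to the shifts of the vector by all \<open>w \<noteq> 0\<close>, weight with \<open>\<theta>\<^sub>w\<close>, and sum.\<close>

lemma toeplitz_shift_bound:
  assumes F: "finite F" "coinvariant (insert b F)" "b \<notin> F" and max: "\<And>a. a \<in> F \<Longrightarrow> \<not> b \<le> a"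
    and con: "coeff_contraction kc lc F J c"
  shows "wnorm2 kc (insert b F - {0}) J (toeplitz (insert b F) J c x) \<le>
    wnorm2 lc (insert b F) J x"
proof -
  let ?K = "insert b F"
  have K: "finite ?K" using F by simp
  have \<theta>: "0 \<le> master kc a" for a using master_nonneg[of kc a] k0 kpos by blast
  define G where "G a = (\<Sum>m<J. (cmod (toeplitz ?K J c x a m))\<^sup>2)" for a
  have G0: "0 \<le> G a" for a by (simp add: G_def sum_nonneg)
  have Goff: "G a = 0" if "a \<notin> ?K" for a
  proof -
    have "toeplitz ?K J c x a m = 0" for m
      unfolding toeplitz_def using coinvariantD[OF F(2)] that by (intro sum.neutral ballI) auto
    then show ?thesis by (simp add: G_def)
  qed
  define X where "X a = (if a \<in> ?K then \<Sum>p<J. (cmod (x a p))\<^sup>2 else 0)" for a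
  have X0: "0 \<le> X a" for a by (simp add: X_def sum_nonneg)
  define xs where "xs w u p = (if u + w \<in> ?K then x (u + w) p else 0)" for w u p
  have shift: "toeplitz F J c (xs w) a m = toeplitz ?K J c x (a + w) m" if w: "w \<noteq> 0" for w a m
  proof -
    have "toeplitz F J c (xs w) a m = (\<Sum>u\<in>{u \<in> F. u + w \<in> ?K}. \<Sum>p<J. if a \<le> u then c (u - a) m p * x (u + w) p else 0)"
      unfolding toeplitz_def xs_def using F(1) by (intro sum.mono_neutral_cong_right) (auto intro!: sum.neutral split: if_splits)
    also have "\<dots> = (\<Sum>u\<in>{u \<in> ?K. w \<le> u}. \<Sum>p<J. if a + w \<le> u then c (u - (a + w)) m p * x u p else 0)"
    proof (rule sum.reindex_bij_witness[where i = "\<lambda>u. u - w" and j = "\<lambda>u. u + w"])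
      fix u assume u: "u \<in> {u \<in> ?K. w \<le> u}"
      have e: "u - w + w = u" using u by (simp add: vec_add_diff_cancel)
      show "u - w + w = u" by (rule e)
      have "u - w \<in> ?K" using coinvariantD[OF F(2), of u "u - w"] u vec_diff_le by blast
      moreover have "u - w \<noteq> b"
      proof
        assume "u - w = b"
        then have "u = b + w" "u \<noteq> b" using e w by auto
        then show False using max[of u] u vec_le_add(1)[of b w] by auto
      qed
      ultimately show "u - w \<in> {u \<in> F. u + w \<in> ?K}" using u e by auto
    next
      fix u assume u: "u \<in> {u \<in> F. u + w \<in> ?K}"
      show "u + w - w = u" by (rule vec_add_diff)
      show "u + w \<in> {u \<in> ?K. w \<le> u}" using u vec_le_add by auto
      have "a + w \<le> u + w \<longleftrightarrow> a \<le> u" by (simp add: le_vec_iff)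
      moreover have "u + w - (a + w) = u - a" by (simp add: vec_eq_iff)
      ultimately show "(\<Sum>p<J. if a + w \<le> u + w then c (u + w - (a + w)) m p * x (u + w) p else 0) =
          (\<Sum>p<J. if a \<le> u then c (u - a) m p * x (u + w) p else 0)" by (simp only:)
    qed
    also have "\<dots> = toeplitz ?K J c x (a + w) m"
      unfolding toeplitz_def
    proof (rule sum.mono_neutral_left[OF K])
      have "w \<le> u" if "a + w \<le> u" for u using that vec_le_add(2)[of w a] by (rule order_trans[rotated])
      then show "\<forall>u\<in>?K - {u \<in> ?K. w \<le> u}. (\<Sum>p<J. if a + w \<le> u then c (u - (a + w)) m p * x u p else 0) = 0"
        by (auto intro!: sum.neutral split: if_splits)
    qed auto
    finally show ?thesis .
  qed
  have step: "(\<Sum>a\<in>F. kc a * G (a + w)) \<le> (\<Sum>u\<in>F. lc u * X (u + w))" if w: "w \<noteq> 0" for w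
  proof -
    have "(\<Sum>p<J. (cmod (xs w u p))\<^sup>2) = X (u + w)" for u
      by (simp add: xs_def X_def)
    then show ?thesis
      using coeff_contractionD[OF con, of "xs w"] unfolding shift[OF w] G_def by simp
  qed
  have "(\<Sum>a\<in>?K - {0}. kc a * G a) \<le> (\<Sum>a\<in>?K - {0}. (\<Sum>w\<in>{..a} - {0}. master kc w * kc (a - w)) * G a)"
  proof (intro sum_mono mult_right_mono G0)
    fix a assume "a \<in> ?K - {0}"
    then have "a \<noteq> 0" by simp
    then have "kc a \<le> (\<Sum>w\<in>{..a}. master kc w * kc (a - w))"
      using master_times_k[of kc a] master_defect_nonneg[of kc a] k0 kpos by simp
    then show "kc a \<le> (\<Sum>w\<in>{..a} - {0}. master kc w * kc (a - w))"
      by (simp add: atMost_vec_split[of _ a])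
  qed
  also have "\<dots> = (\<Sum>w\<in>?K - {0}. \<Sum>a\<in>F. (master kc w * kc a) * G (a + w))"
    by (rule sum_shift_pairs[OF F max Goff, symmetric])
  also have "\<dots> \<le> (\<Sum>w\<in>?K - {0}. \<Sum>a\<in>F. (master kc w * lc a) * X (a + w))"
  proof (rule sum_mono)
    fix w assume "w \<in> ?K - {0}"
    then have "master kc w * (\<Sum>a\<in>F. kc a * G (a + w)) \<le> master kc w * (\<Sum>u\<in>F. lc u * X (u + w))"
      using step \<theta> by (intro mult_left_mono) auto
    then show "(\<Sum>a\<in>F. (master kc w * kc a) * G (a + w)) \<le> (\<Sum>a\<in>F. (master kc w * lc a) * X (a + w))"
      by (simp add: sum_distrib_left mult.assoc)
  qed
  also have "\<dots> = (\<Sum>a\<in>?K - {0}. (\<Sum>w\<in>{..a} - {0}. master kc w * lc (a - w)) * X a)"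
    by (rule sum_shift_pairs[OF F max]) (auto simp: X_def)
  also have "\<dots> \<le> (\<Sum>a\<in>?K - {0}. lc a * X a)"
  proof (intro sum_mono mult_right_mono X0)
    fix a
    show "(\<Sum>w\<in>{..a} - {0}. master kc w * lc (a - w)) \<le> lc a"
      using C[of a] by (simp add: ps_mult_one_minus atMost_vec_split[of _ a])
  qed
  also have "\<dots> \<le> (\<Sum>a\<in>?K. lc a * X a)"
    using K X0 lpos less_imp_le by (intro sum_mono2) (auto intro!: mult_nonneg_nonneg)
  also have "\<dots> = wnorm2 lc ?K J x"
    by (intro sum.cong) (auto simp: X_def)
  finally show ?thesis by (simp add: G_def)
qed

text \<open>The rows other than the row of index \<open>0\<close> do not involve the coefficient at \<open>b\<close>. They leave a positive form
  \<open>D\<close> by the preceding bound, and the row of index \<open>0\<close> is a contraction with respect to \<open>D\<close> on the vectors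
  that vanish at \<open>b\<close>; the new coefficient is the extension of this contraction.\<close>

lemma toeplitz_one_step_extension:
  assumes F: "finite F" "coinvariant F" "coinvariant (insert b F)" "b \<notin> F" and max: "\<And>a. a \<in> F \<Longrightarrow> \<not> b \<le> a"
    and con: "coeff_contraction kc lc F J c"
  shows "\<exists>c'. (\<forall>a m p. a \<noteq> b \<longrightarrow> c' a m p = c a m p) \<and> coeff_contraction kc lc (insert b F) J c'"
proof -
  let ?S = "insert b F"
  let ?K = "?S \<times> {..<J}" and ?I = "F \<times> {..<J}"
  have S: "finite ?S" and K: "finite ?K" and IK: "?I \<subseteq> ?K" and I: "finite ?I" using F(1) by auto
  have b0: "b \<noteq> 0" using coinvariant_zero[OF F(2)] F(4) by auto
  define Bm where "Bm c a m i = (if a \<le> fst i then c (fst i - a) m (snd i) else 0 :: complex)"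
    for c :: "nat ^ 'd \<Rightarrow> nat \<Rightarrow> nat \<Rightarrow> complex" and a m and i :: "(nat ^ 'd) \<times> nat"
  have toep: "toeplitz F' J c (\<lambda>b p. v (b, p)) a m = (\<Sum>i\<in>F' \<times> {..<J}. Bm c a m i * v i)" for F' c v a m
    unfolding toeplitz_def sum.cartesian_product' Bm_def by (intro sum.cong refl) auto
  define R where "R F' c i j = (\<Sum>a\<in>F'. of_real (kc a) * (\<Sum>m<J. cnj (Bm c a m i) * Bm c a m j))"
    for F' c and i j :: "(nat ^ 'd) \<times> nat"
  define L where "L i j = (if i = j then of_real (lc (fst i)) else 0 :: complex)" for i j :: "(nat ^ 'd) \<times> nat"
  have qR: "qf (F' \<times> {..<J}) (R A c) v = of_real (wnorm2 kc A J (toeplitz F' J c (\<lambda>b p. v (b, p))))" for F' A c v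
  proof -
    have q1: "qf I (\<lambda>i j. cnj (Bm c a m i) * Bm c a m j) v = of_real ((cmod (\<Sum>i\<in>I. Bm c a m i * v i))\<^sup>2)" for I :: "((nat ^ 'd) \<times> nat) set" and a m
    proof -
      have "(\<Sum>i\<in>I. cnj (Bm c a m i) * cnj (v i)) = cnj (\<Sum>i\<in>I. Bm c a m i * v i)" by simp
      then show ?thesis
        using qf_rank_one[of I "\<lambda>i. cnj (Bm c a m i)" "\<lambda>i. cnj (Bm c a m i)" v] by (simp add: cnj_mult_self del: cnj_sum)
    qed
    show ?thesis
      unfolding R_def[abs_def] qf_sum qf_scale q1 toep by simp
  qed
  have qL: "qf (F' \<times> {..<J}) L v = of_real (\<Sum>b\<in>F'. lc b * (\<Sum>p<J. (cmod (v (b, p)))\<^sup>2))" if "finite F'" for F' v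
    unfolding L_def[abs_def] using that by (subst qf_diagonal) (simp_all add: sum.cartesian_product' sum_distrib_left)
  have psd_iff: "psd_on (F' \<times> {..<J}) (\<lambda>i j. L i j - R A c i j) \<longleftrightarrow>
      (\<forall>x. wnorm2 kc A J (toeplitz F' J c x) \<le> wnorm2 lc F' J x)"
    if "finite F'" for F' A c
  proof -
    have "psd_on (F' \<times> {..<J}) (\<lambda>i j. L i j - R A c i j) \<longleftrightarrow>
      (\<forall>v. wnorm2 kc A J (toeplitz F' J c (\<lambda>b p. v (b, p))) \<le> (\<Sum>b\<in>F'. lc b * (\<Sum>p<J. (cmod (v (b, p)))\<^sup>2)))"
      unfolding psd_on_iff qf_diff qR qL[OF that] of_real_diff[symmetric] complex_of_real_nonneg_iff by simp
    also have "\<dots> \<longleftrightarrow> (\<forall>x. wnorm2 kc A J (toeplitz F' J c x) \<le> wnorm2 lc F' J x)"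
    proof (intro iffI allI)
      fix x assume "\<forall>v. wnorm2 kc A J (toeplitz F' J c (\<lambda>b p. v (b, p))) \<le> (\<Sum>b\<in>F'. lc b * (\<Sum>p<J. (cmod (v (b, p)))\<^sup>2))"
      from this[rule_format, of "\<lambda>i. x (fst i) (snd i)"]
      show "wnorm2 kc A J (toeplitz F' J c x) \<le> wnorm2 lc F' J x" by simp
    qed blast
    finally show ?thesis .
  qed
  define D where "D i j = L i j - R (?S - {0}) c i j" for i j
  have psdD: "psd_on ?K D"
    unfolding D_def[abs_def] psd_iff[OF S] using toeplitz_shift_bound[OF F(1,3,4) max con] by blast
  have split: "R A c i j = (\<Sum>m<J. cnj (c (fst i) m (snd i)) * c (fst j) m (snd j)) + R (A - {0}) c i j" if "0 \<in> A" "finite A" for A c i j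
    unfolding R_def using that by (subst sum.remove[of A 0]) (auto simp: Bm_def vec_zero_le vec_diff_zero k0)
  have "psd_on ?I (\<lambda>i j. D i j - (\<Sum>m<J. cnj (c (fst i) m (snd i)) * c (fst j) m (snd j)))"
  proof -
    have "psd_on ?I (\<lambda>i j. L i j - R F c i j)"
      using con unfolding psd_iff[OF F(1)] coeff_contraction_def .
    then show ?thesis
    proof (rule iffD1[OF psd_on_cong, rotated])
      fix i j assume ij: "i \<in> ?I" "j \<in> ?I"
      have "R (?S - {0}) c i j = R (F - {0}) c i j"
      proof -
        have "?S - {0} = insert b (F - {0})" using b0 by auto
        moreover have "Bm c b m i = 0" for m using max ij by (auto simp: Bm_def)
        ultimately show ?thesis using F(1,4) by (simp add: R_def)
      qed
      then show "L i j - R F c i j = D i j - (\<Sum>m<J. cnj (c (fst i) m (snd i)) * c (fst j) m (snd j))"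
        unfolding D_def using split[OF coinvariant_zero[OF F(2)] F(1), of c i j] by simp
    qed
  qed
  then obtain A' where A': "\<And>m i. i \<in> ?I \<Longrightarrow> A' m i = c (fst i) m (snd i)"
    and psd': "psd_on ?K (\<lambda>i j. D i j - (\<Sum>m<J. cnj (A' m i) * A' m j))"
    using contraction_extension[where K = ?K and I = ?I and D = D and J = J and A = "\<lambda>m i. c (fst i) m (snd i)"] K IK psdD by blast
  define c' where "c' a m p = (if a = b then A' m (b, p) else c a m p)" for a m p
  have "psd_on ?K (\<lambda>i j. L i j - R ?S c' i j)"
  proof (rule iffD1[OF psd_on_cong, OF _ psd'])
    fix i j assume ij: "i \<in> ?K" "j \<in> ?K"
    have A'c': "A' m i = c' (fst i) m (snd i)" if i: "i \<in> ?K" for m i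
    proof (cases "fst i = b")
      case True
      then have "i = (b, snd i)" by (metis prod.collapse)
      then show ?thesis using True by (simp add: c'_def)
    next
      case False
      then have "i \<in> ?I" using i by auto
      then show ?thesis using A' False by (simp add: c'_def)
    qed
    have "Bm c' a m i = Bm c a m i" if a: "a \<noteq> 0" and i: "i \<in> ?K" for a m i
    proof -
      have "fst i - a \<noteq> b" if le: "a \<le> fst i"
      proof
        assume "fst i - a = b"
        then have e: "fst i = b + a" using vec_add_diff_cancel(2)[OF le] by simp
        then have "fst i \<noteq> b" using a by simp
        then have "fst i \<in> F" using i by auto
        then show False using max[of "fst i"] vec_le_add(1)[of b a] e by simp
      qed
      then show ?thesis by (simp add: Bm_def c'_def)
    qed
    then have "R (?S - {0}) c' i j = R (?S - {0}) c i j"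
      unfolding R_def using ij by (intro sum.cong refl) simp
    then show "D i j - (\<Sum>m<J. cnj (A' m i) * A' m j) = L i j - R ?S c' i j"
      unfolding D_def A'c'[OF ij(1)] A'c'[OF ij(2)]
      using split[OF coinvariant_zero[OF F(3)] S, of c' i j] by simp
  qed
  then have "coeff_contraction kc lc ?S J c'"
    unfolding psd_iff[OF S] coeff_contraction_def .
  then show ?thesis by (intro exI[of _ c']) (auto simp: c'_def)
qed

text \<open>Elements are added in an order that refines the order of multi-indices, smallest degree first: the
  induction removes an element of maximal degree.\<close>

lemma toeplitz_finite_extension:
  assumes F: "finite F" "coinvariant F" and con: "coeff_contraction kc lc F J c"
    and F': "finite F'" "coinvariant F'" "F \<subseteq> F'"
  shows "\<exists>c'. (\<forall>a\<in>F. \<forall>m p. c' a m p = c a m p) \<and> coeff_contraction kc lc F' J c'"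
  using F' 
proof (induction "card (F' - F)" arbitrary: F')
  case 0
  then have "F' = F" by auto
  then show ?case using con by auto
next
  case (Suc n)
  then have ne: "mdeg ` (F' - F) \<noteq> {}" and fin: "finite (mdeg ` (F' - F))" by auto
  from Max_in[OF fin ne] obtain b where b: "b \<in> F' - F" "Max (mdeg ` (F' - F)) = mdeg b" by blast
  have bmax: "mdeg a \<le> mdeg b" if "a \<in> F' - F" for a
    using Max_ge[OF fin imageI[OF that]] b(2) by simp
  let ?G = "F' - {b}"
  have max: "\<not> b \<le> a" if "a \<in> ?G" for a
  proof
    assume le: "b \<le> a"
    then have lt: "mdeg b < mdeg a" using that by (intro mdeg_strict_mono) auto
    show False
    proof (cases "a \<in> F")
      case True
      then show False using coinvariantD[OF F(2) True le] b(1) by simp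
    next
      case False
      then show False using bmax[of a] that lt by simp
    qed
  qed
  have G: "finite ?G" "F \<subseteq> ?G" using Suc.prems b by auto
  have coG: "coinvariant ?G"
    unfolding coinvariant_def
  proof (intro conjI ballI allI impI)
    show "?G \<noteq> {}" using coinvariant_zero[OF F(2)] G(2) by auto
    fix a e assume a: "a \<in> ?G" and e: "e \<le> a"
    then have "e \<in> F'" using coinvariantD[OF Suc.prems(2)] by blast
    moreover have "e \<noteq> b" using max[OF a] e by auto
    ultimately show "e \<in> ?G" by simp
  qed
  have "F' - F = insert b (?G - F)" using b by auto
  then have "card (?G - F) = n" using Suc(2) G(1) by simp
  from Suc(1)[OF this[symmetric] G(1) coG G(2)] obtain c1 where
    c1: "\<forall>a\<in>F. \<forall>m p. c1 a m p = c a m p" "coeff_contraction kc lc ?G J c1" by blast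
  have ins: "insert b ?G = F'" using b by auto
  obtain c' where "\<forall>a m p. a \<noteq> b \<longrightarrow> c' a m p = c1 a m p" "coeff_contraction kc lc F' J c'"
    using toeplitz_one_step_extension[OF G(1) coG _ _ max c1(2)] Suc.prems(2) unfolding ins by auto
  then show ?case using c1(1) b(1) by (intro exI[of _ c']) auto
qed

lemma toeplitz_first_row_bound:
  assumes F: "finite F" "coinvariant F" and con: "coeff_contraction kc lc F J c" and m: "m < J"
  shows "(cmod (toeplitz F J c x 0 m))\<^sup>2 \<le> wnorm2 lc F J x"
proof -
  have 0: "0 \<in> F" by (rule coinvariant_zero[OF F(2)])
  have "(cmod (toeplitz F J c x 0 m))\<^sup>2 \<le> (\<Sum>m<J. (cmod (toeplitz F J c x 0 m))\<^sup>2)"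
    using member_le_sum[of m "{..<J}" "\<lambda>m. (cmod (toeplitz F J c x 0 m))\<^sup>2"] m by simp
  also have "\<dots> \<le> wnorm2 kc F J (toeplitz F J c x)"
    using member_le_sum[OF 0, of "\<lambda>a. kc a * (\<Sum>m<J. (cmod (toeplitz F J c x a m))\<^sup>2)"] F(1) k0 less_imp_le[OF kpos]
    by (simp add: sum_nonneg)
  also have "\<dots> \<le> wnorm2 lc F J x" by (rule coeff_contractionD[OF con])
  finally show ?thesis .
qed

text \<open>Evaluate the row of index \<open>0\<close> on the vector with entries \<open>t\<^sub>a\<close> rotated so as to cancel the phases of the
  coefficients.\<close>

lemma toeplitz_weighted_row_bound:
  assumes F: "finite F" "coinvariant F" and con: "coeff_contraction kc lc F J c" and mp: "m < J" "p < J"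
  shows "(\<Sum>a\<in>F. cmod (c a m p) * \<bar>t a\<bar>)\<^sup>2 \<le> (\<Sum>a\<in>F. lc a * (t a)\<^sup>2)"
proof -
  define x where "x b q = (if q = p then cnj (sgn (c b m p)) * of_real \<bar>t b\<bar> else 0)" for b q
  have phase: "u * cnj (sgn u) = of_real (cmod u)" for u :: complex
    by (cases "u = 0") (auto simp: sgn_eq complex_norm_square[symmetric] power2_eq_square)
  have "toeplitz F J c x 0 m = (\<Sum>b\<in>F. \<Sum>q<J. if q = p then of_real (cmod (c b m p) * \<bar>t b\<bar>) else 0)"
    unfolding toeplitz_def
    by (intro sum.cong refl) (auto simp: x_def vec_zero_le vec_diff_zero phase mult.assoc[symmetric])
  also have "\<dots> = of_real (\<Sum>b\<in>F. cmod (c b m p) * \<bar>t b\<bar>)" using mp by simp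
  finally have "(\<Sum>b\<in>F. cmod (c b m p) * \<bar>t b\<bar>)\<^sup>2 = (cmod (toeplitz F J c x 0 m))\<^sup>2"
    by (simp only: norm_of_real power2_abs)
  also have "\<dots> \<le> wnorm2 lc F J x"
    by (rule toeplitz_first_row_bound[OF F con mp(1)])
  also have "\<dots> \<le> (\<Sum>b\<in>F. lc b * (t b)\<^sup>2)"
  proof (intro sum_mono mult_left_mono)
    fix b
    have "(\<Sum>q<J. (cmod (x b q))\<^sup>2) = (\<Sum>q<J. if q = p then (cmod (sgn (c b m p)) * \<bar>t b\<bar>)\<^sup>2 else 0)"
      by (intro sum.cong refl) (auto simp: x_def norm_mult)
    also have "\<dots> \<le> (t b)\<^sup>2" using mp by (simp add: norm_sgn)
    finally show "(\<Sum>q<J. (cmod (x b q))\<^sup>2) \<le> (t b)\<^sup>2" .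
  qed (use lpos less_imp_le in blast)
  finally show ?thesis .
qed

lemma toeplitz_entry_bound:
  assumes F: "finite F" "coinvariant F" "a \<in> F" and con: "coeff_contraction kc lc F J c" and mp: "m < J" "p < J"
  shows "cmod (c a m p) \<le> sqrt (lc a)"
proof -
  define t :: "nat ^ 'd \<Rightarrow> real" where "t b = (if b = a then 1 else 0)" for b
  have "(\<Sum>b\<in>F. cmod (c b m p) * \<bar>t b\<bar>) = (\<Sum>b\<in>F. if b = a then cmod (c a m p) else 0)"
    "(\<Sum>b\<in>F. lc b * (t b)\<^sup>2) = (\<Sum>b\<in>F. if b = a then lc a else 0)"
    by (intro sum.cong refl; simp add: t_def)+
  then have "(cmod (c a m p))\<^sup>2 \<le> lc a"
    using toeplitz_weighted_row_bound[OF F(1,2) con mp, of t] F(1,3) by simp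
  then show ?thesis by (rule real_le_rsqrt)
qed

text \<open>The same compactness argument as for Pick interpolation, with the entries bounded by \<open>\<surd>\<ell>\<^sub>a\<close>.\<close>

theorem toeplitz_extension:
  assumes F: "finite F" "coinvariant F" and con: "coeff_contraction kc lc F J c"
  shows "\<exists>c'. (\<forall>a\<in>F. \<forall>m<J. \<forall>p<J. c' a m p = c a m p) \<and>
    (\<forall>n. coeff_contraction kc lc {..n} J c')"
proof -
  define cu :: "((nat ^ 'd) \<times> nat \<times> nat \<Rightarrow> complex) \<Rightarrow> nat ^ 'd \<Rightarrow> nat \<Rightarrow> nat \<Rightarrow> complex" where
    "cu f a m p = f (a, m, p)" for f a m p
  define P where "P n = {f. coeff_contraction kc lc {..n} J (cu f)} \<inter>
    {f. \<forall>a\<in>F. \<forall>m\<in>{..<J}. \<forall>p\<in>{..<J}. cu f a m p = c a m p}" for n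
  have clP: "closed (P n)" for n
  proof -
    have "{f. \<forall>a\<in>F. \<forall>m\<in>{..<J}. \<forall>p\<in>{..<J}. cu f a m p = c a m p} =
        (\<Inter>a\<in>F. \<Inter>m\<in>{..<J}. \<Inter>p\<in>{..<J}. {f. f (a, m, p) = c a m p})"
      by (auto simp: cu_def)
    moreover have "closed {f. f (a, m, p) = c a m p}" for a m p
      by (intro closed_Collect_eq continuous_intros) auto
    ultimately have 1: "closed {f. \<forall>a\<in>F. \<forall>m\<in>{..<J}. \<forall>p\<in>{..<J}. cu f a m p = c a m p}"
      by (simp add: closed_INT)
    have "continuous_on UNIV (\<lambda>f. toeplitz {..n} J (cu f) x a m)" for x a m
    proof -
      have "continuous_on UNIV (\<lambda>f. if a \<le> b then f (b - a, m, p) * x b p else 0)" for b p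
        by (cases "a \<le> b") (auto intro!: continuous_intros)
      then show ?thesis unfolding toeplitz_def cu_def by (intro continuous_intros)
    qed
    then have "closed {f. wnorm2 kc {..n} J (toeplitz {..n} J (cu f) x) \<le>
        wnorm2 lc {..n} J x}" for x
      by (intro closed_Collect_le continuous_intros)
    then have "closed {f. coeff_contraction kc lc {..n} J (cu f)}"
      unfolding coeff_contraction_def Collect_all_eq by (intro closed_INT) auto
    then show ?thesis unfolding P_def using 1 by (rule closed_Int)
  qed
  have "\<exists>f. (\<forall>i. cmod (f i) \<le> sqrt (lc (fst i))) \<and> (\<forall>n\<in>UNIV. f \<in> P n)"
  proof (rule bounded_selection[OF clP])
    fix A :: "(nat ^ 'd) set" assume "finite A"
    then have "finite (F \<union> A)" using F by simp
    then obtain b where b: "F \<union> A \<subseteq> {..b}" by (rule finite_subset_atMost_vec)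
    then have Fb: "F \<subseteq> {..b}" by simp
    note G = finite_atMost_vec[of b] coinvariant_atMost[of b]
    obtain c' where c': "\<forall>a\<in>F. \<forall>m p. c' a m p = c a m p" "coeff_contraction kc lc {..b} J c'"
      using toeplitz_finite_extension[OF F con G Fb] by blast
    define f where "f i = (case i of (a, m, p) \<Rightarrow> if a \<le> b \<and> m < J \<and> p < J then c' a m p else 0)" for i
    have f: "cu f a m p = c' a m p" if "a \<in> {..b}" "m < J" "p < J" for a m p
      using that by (simp add: cu_def f_def)
    have "coeff_contraction kc lc {..b} J (cu f)"
      using c'(2) coeff_contraction_cong[of "{..b}" J "cu f" c' kc lc, OF G(2) f] by blast
    then have "coeff_contraction kc lc {..n} J (cu f)" if "n \<in> A" for n
      by (rule coeff_contraction_subset[OF _ G(1) _ kpos]) (use b that in \<open>auto intro: order_trans\<close>)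
    moreover have "cmod (f (a, m, p)) \<le> sqrt (lc a)" for a m p
    proof (cases "a \<le> b \<and> m < J \<and> p < J")
      case True
      then have "cmod (c' a m p) \<le> sqrt (lc a)" by (intro toeplitz_entry_bound[OF G _ c'(2)]) auto
      then show ?thesis using True by (simp add: f_def)
    next
      case False
      then show ?thesis using lpos[of a] by (auto simp: f_def less_imp_le)
    qed
    moreover have "\<forall>a\<in>F. \<forall>m\<in>{..<J}. \<forall>p\<in>{..<J}. cu f a m p = c a m p"
      using f c'(1) Fb by auto
    ultimately show "\<exists>f. (\<forall>i. cmod (f i) \<le> sqrt (lc (fst i))) \<and> (\<forall>n\<in>A. f \<in> P n)"
      by (intro exI[of _ f]) (auto simp: P_def)
  qed
  then obtain f where "\<And>n. f \<in> P n" by blast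
  then show ?thesis unfolding P_def by (intro exI[of _ "cu f"]) auto
qed

end

text \<open>The boxes \<open>{..(n, \<dots>, n) - a}\<close> exhaust the multi-indices, so box-shaped partial sums converge.\<close>

lemma has_sum_box_limit:
  fixes f :: "nat ^ 'd \<Rightarrow> complex"
  assumes "(f has_sum S) UNIV"
  shows "(\<lambda>n. \<Sum>c\<in>{..(\<chi> j. n) - a}. f c) \<longlonglongrightarrow> S"
proof -
  have "filterlim (\<lambda>n. {..(\<chi> j. n) - a}) (finite_subsets_at_top UNIV) sequentially"
    unfolding filterlim_finite_subsets_at_top
  proof (intro allI impI, elim conjE)
    fix A :: "(nat ^ 'd) set" assume "finite A"
    then obtain b where b: "A \<subseteq> {..b}" by (rule finite_subset_atMost_vec)
    have "A \<subseteq> {..(\<chi> j. n) - a}" if n: "mdeg (a + b) \<le> n" for n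
    proof -
      have "b \<le> (\<chi> j. n) - a"
        unfolding le_vec_iff
      proof
        fix i
        have "(a + b) $ i \<le> mdeg (a + b)"
          unfolding mdeg_def by (rule member_le_sum) auto
        then show "b $ i \<le> ((\<chi> j. n) - a) $ i" using n by simp
      qed
      then show ?thesis using b by (auto intro: order_trans)
    qed
    then show "eventually (\<lambda>n. finite {..(\<chi> j. n) - a} \<and> A \<subseteq> {..(\<chi> j. n) - a} \<and> {..(\<chi> j. n) - a} \<subseteq> UNIV) sequentially"
      using finite_atMost_vec by (auto simp: eventually_sequentially)
  qed
  from filterlim_compose[OF assms[unfolded has_sum_def] this] show ?thesis .
qed

lemma toeplitz_box_shift:
  assumes "a \<le> n"
  shows "toeplitz {..n} J c X a m = (\<Sum>u\<in>{..n - a}. \<Sum>p<J. c u m p * X (a + u) p)"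
proof -
  have "toeplitz {..n} J c X a m = (\<Sum>b\<in>{b \<in> {..n}. a \<le> b}. \<Sum>p<J. c (b - a) m p * X b p)"
    unfolding toeplitz_def using finite_atMost_vec by (intro sum.mono_neutral_cong_right) auto
  also have "\<dots> = (\<Sum>u\<in>{..n - a}. \<Sum>p<J. c u m p * X (a + u) p)"
    by (rule sum.reindex_bij_witness[where j = "\<lambda>b. b - a" and i = "\<lambda>u. a + u"])
      (use assms in \<open>auto simp: vec_add_diff vec_add_diff_cancel vec_le_add le_vec_iff diff_le_mono le_diff_conv2 add.commute\<close>)
  finally show ?thesis .
qed

text \<open>The moments of the image under the adjoint of multiplication by \<open>\<Phi>\<close> are obtained from the moments of
  the combination itself by the Toeplitz matrix of the coefficients.\<close>

lemma has_sum_moment_product: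
  assumes "\<And>z p. z \<in> E \<Longrightarrow> p < J \<Longrightarrow> ((\<lambda>u. mpow z u * cnj (c u m p)) has_sum \<Phi> z p m) UNIV"
    and E: "\<And>i. i \<in> I \<Longrightarrow> e i \<in> E"
  shows "((\<lambda>u. \<Sum>p<J. c u m p * moment I e (\<lambda>i. v (i, p)) (a + u)) has_sum
    moment I e (\<lambda>i. \<Sum>p<J. cnj (\<Phi> (e i) p m) * v (i, p)) a) UNIV"
proof -
  have "((\<lambda>u. \<Sum>i\<in>I. \<Sum>p<J. (v (i, p) * cnj (mpow (e i) a)) * (cnj (mpow (e i) u * cnj (c u m p)))) has_sum
      (\<Sum>i\<in>I. \<Sum>p<J. (v (i, p) * cnj (mpow (e i) a)) * cnj (\<Phi> (e i) p m))) UNIV"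
  proof (intro has_sum_finite_sum)
    fix i p assume "i \<in> I" "p \<in> {..<J}"
    then have "((\<lambda>u. cnj (mpow (e i) u * cnj (c u m p))) has_sum cnj (\<Phi> (e i) p m)) UNIV"
      unfolding has_sum_cnj_iff using assms(1)[OF E] by simp
    then show "((\<lambda>u. (v (i, p) * cnj (mpow (e i) a)) * (cnj (mpow (e i) u * cnj (c u m p)))) has_sum
      (v (i, p) * cnj (mpow (e i) a)) * cnj (\<Phi> (e i) p m)) UNIV"
      by (rule has_sum_cmult_right)
  qed
  moreover have "(\<Sum>i\<in>I. \<Sum>p<J. (v (i, p) * cnj (mpow (e i) a)) * (cnj (mpow (e i) u * cnj (c u m p)))) =
      (\<Sum>p<J. c u m p * moment I e (\<lambda>i. v (i, p)) (a + u))" for u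
    unfolding moment_def sum_distrib_left mpow_add by (subst sum.swap) (simp add: mult_ac)
  moreover have "(\<Sum>i\<in>I. \<Sum>p<J. (v (i, p) * cnj (mpow (e i) a)) * cnj (\<Phi> (e i) p m)) =
      moment I e (\<lambda>i. \<Sum>p<J. cnj (\<Phi> (e i) p m) * v (i, p)) a"
    unfolding moment_def sum_distrib_right by (intro sum.cong refl) (simp add: mult_ac)
  ultimately show ?thesis by simp
qed

context
  fixes kc lc :: "nat ^ 'd \<Rightarrow> real" and k l :: "complex ^ 'd \<Rightarrow> complex ^ 'd \<Rightarrow> complex" and X
  assumes k0: "kc 0 = 1" and kpos: "\<And>a. 0 < kc a" and lpos: "\<And>a. 0 < lc a"
    and k: "kernel X k" and l: "kernel X l"
    and kser: "\<And>z w. z \<in> X \<Longrightarrow> w \<in> X \<Longrightarrow> (ps_term kc (z * vcnj w) has_sum k z w) UNIV"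
    and lser: "\<And>z w. z \<in> X \<Longrightarrow> w \<in> X \<Longrightarrow> (ps_term lc (z * vcnj w) has_sum l z w) UNIV"
begin

lemma has_sum_qf_sum:
  assumes ser: "\<And>z w. z \<in> X \<Longrightarrow> w \<in> X \<Longrightarrow> (ps_term fc (z * vcnj w) has_sum f z w) UNIV" and e: "\<And>i. i \<in> I \<Longrightarrow> e i \<in> X"
  shows "((\<lambda>a. complex_of_real (fc a * (\<Sum>p<J. (cmod (moment I e (v p) a))\<^sup>2))) has_sum
    (\<Sum>p<J. qf I (\<lambda>i j. f (e i) (e j)) (v p))) UNIV"
proof -
  have "((\<lambda>a. \<Sum>p<J. complex_of_real (fc a * (cmod (moment I e (v p) a))\<^sup>2)) has_sum
    (\<Sum>p<J. qf I (\<lambda>i j. f (e i) (e j)) (v p))) UNIV"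
    by (intro has_sum_finite_sum diag_qf_has_sum ser e)
  then show ?thesis by (simp add: sum_distrib_left)
qed

text \<open>The row bound gives absolute convergence of the series on \<open>X\<close>, by comparison with the series of \<open>\<ell>\<close>. Its sum
  is contractive because the moments of the image of a combination of kernel functions are obtained from
  the moments of that combination by the infinite Toeplitz matrix, the limit of those on boxes.\<close>

theorem contractive_multiplier_of_coefficients:
  assumes con: "\<And>n. coeff_contraction kc lc {..n} J c"
    and row: "\<And>n m p t. m < J \<Longrightarrow> p < J \<Longrightarrow>
      (\<Sum>a\<in>{..n}. cmod (c a m p) * \<bar>t a\<bar>)\<^sup>2 \<le> (\<Sum>a\<in>{..n}. lc a * (t a)\<^sup>2)"
  shows "\<exists>\<Phi>. (\<forall>z\<in>X. \<forall>p<J. \<forall>q<J. ((\<lambda>a. mpow z a * cnj (c a q p)) has_sum \<Phi> z p q) UNIV) \<and>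
    contractive_multiplier X k l J \<Phi>"
proof -
  define \<Phi> where "\<Phi> z p q = infsum (\<lambda>a. mpow z a * cnj (c a q p)) UNIV" for z p q
  have ser: "((\<lambda>a. mpow z a * cnj (c a m p)) has_sum \<Phi> z p m) UNIV" if z: "z \<in> X" and mp: "m < J" "p < J" for z m p
  proof -
    define S where "S = Re (l z z)"
    have hs: "((\<lambda>a. lc a * (cmod (mpow z a))\<^sup>2) has_sum S) UNIV"
      using has_sum_Re[OF lser[OF z z]] by (simp add: S_def ps_term_diag)
    have "(\<lambda>a. norm (mpow z a * cnj (c a m p))) summable_on UNIV"
    proof (rule nonneg_bdd_above_summable_on)
      show "bdd_above (sum (\<lambda>a. norm (mpow z a * cnj (c a m p))) ` {A. A \<subseteq> UNIV \<and> finite A})"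
      proof (rule bdd_aboveI, elim imageE, safe)
        fix A :: "(nat ^ 'd) set" assume "finite A"
        then obtain n where n: "A \<subseteq> {..n}" by (rule finite_subset_atMost_vec)
        have "(\<Sum>a\<in>A. norm (mpow z a * cnj (c a m p))) \<le> (\<Sum>a\<in>{..n}. norm (mpow z a * cnj (c a m p)))"
          using n finite_atMost_vec by (intro sum_mono2) auto
        also have "\<dots> = (\<Sum>a\<in>{..n}. cmod (c a m p) * \<bar>cmod (mpow z a)\<bar>)"
          by (simp add: norm_mult mult.commute)
        also have "\<dots> \<le> sqrt S"
        proof (rule real_le_rsqrt, rule order_trans[OF row[OF mp]])
          show "(\<Sum>a\<in>{..n}. lc a * (cmod (mpow z a))\<^sup>2) \<le> S"
            using lpos less_imp_le by (intro finite_sum_le_has_sum[OF hs] finite_atMost_vec) (auto intro!: mult_nonneg_nonneg)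
        qed
        finally show "(\<Sum>a\<in>A. norm (mpow z a * cnj (c a m p))) \<le> sqrt S" .
      qed
    qed simp
    then show ?thesis unfolding \<Phi>_def by (intro has_sum_infsum) (rule abs_summable_summable)
  qed
  have "contractive_multiplier X k l J \<Phi>"
    unfolding contractive_multiplier_iff[OF k l]
  proof (intro allI impI, elim conjE)
    fix E assume E: "finite E" "E \<subseteq> X"
    show "psd_on (E \<times> {..<J}) (pick_block k l J \<Phi>)"
      unfolding psd_on_iff
    proof
      fix v :: "(complex ^ 'd) \<times> nat \<Rightarrow> complex"
      define w where "w m x = (\<Sum>p<J. cnj (\<Phi> x p m) * v (x, p))" for m x
      define Xm where "Xm b p = moment E (\<lambda>x. x) (\<lambda>x. v (x, p)) b" for b p
      define Y where "Y a m = moment E (\<lambda>x. x) (w m) a" for a m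
      define SL where "SL = (\<Sum>p<J. qf E l (\<lambda>x. v (x, p)))"
      define SK where "SK = (\<Sum>m<J. qf E k (w m))"
      have L: "((\<lambda>b. complex_of_real (lc b * (\<Sum>p<J. (cmod (Xm b p))\<^sup>2))) has_sum SL) UNIV"
        unfolding Xm_def SL_def using E by (intro has_sum_qf_sum lser) auto
      have K: "((\<lambda>a. complex_of_real (kc a * (\<Sum>m<J. (cmod (Y a m))\<^sup>2))) has_sum SK) UNIV"
        unfolding Y_def SK_def using E by (intro has_sum_qf_sum kser) auto
      have LR: "((\<lambda>b. lc b * (\<Sum>p<J. (cmod (Xm b p))\<^sup>2)) has_sum Re SL) UNIV"
        using has_sum_Re[OF L] by (simp only: Re_complex_of_real)
      have KR: "((\<lambda>a. kc a * (\<Sum>m<J. (cmod (Y a m))\<^sup>2)) has_sum Re SK) UNIV"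
        using has_sum_Re[OF K] by (simp only: Re_complex_of_real)
      have imz: "Im S = 0" if "((\<lambda>a. complex_of_real (g a)) has_sum S) UNIV" for g and S :: complex and UNIV :: "(nat ^ 'd) set"
        using has_sum_Im[OF that] has_sum_unique[OF _ has_sum_0_simp] by (simp only: Im_complex_of_real) blast
      have lim: "(\<lambda>n. toeplitz {..(\<chi> j. n)} J c Xm a m) \<longlonglongrightarrow> Y a m" if m: "m < J" for a m
      proof -
        have "((\<lambda>u. \<Sum>p<J. c u m p * Xm (a + u) p) has_sum Y a m) UNIV"
          unfolding Xm_def Y_def w_def by (rule has_sum_moment_product[where E = X]) (use ser m E in auto)
        then have "(\<lambda>n. \<Sum>u\<in>{..(\<chi> j. n) - a}. \<Sum>p<J. c u m p * Xm (a + u) p) \<longlonglongrightarrow> Y a m"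
          by (rule has_sum_box_limit)
        moreover have "eventually (\<lambda>n. (\<Sum>u\<in>{..(\<chi> j. n) - a}. \<Sum>p<J. c u m p * Xm (a + u) p) =
            toeplitz {..(\<chi> j. n)} J c Xm a m) sequentially"
        proof (rule eventually_sequentiallyI)
          fix n assume "mdeg a \<le> n"
          moreover have "a $ i \<le> mdeg a" for i unfolding mdeg_def by (rule member_le_sum) auto
          ultimately have "a \<le> (\<chi> j. n)" unfolding le_vec_iff by (auto intro: order_trans)
          then show "(\<Sum>u\<in>{..(\<chi> j. n) - a}. \<Sum>p<J. c u m p * Xm (a + u) p) = toeplitz {..(\<chi> j. n)} J c Xm a m"
            by (rule toeplitz_box_shift[symmetric])
        qed
        ultimately show ?thesis by (rule Lim_transform_eventually)
      qed
      have "Re SK \<le> Re SL"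
      proof (rule has_sum_le_finite_sums[OF KR])
        fix A :: "(nat ^ 'd) set" assume A: "finite A"
        then obtain b where b: "A \<subseteq> {..b}" by (rule finite_subset_atMost_vec)
        have "(\<lambda>n. wnorm2 kc A J (toeplitz {..(\<chi> j. n)} J c Xm)) \<longlonglongrightarrow>
            (wnorm2 kc A J Y)"
          by (intro tendsto_intros lim) simp
        moreover have "eventually (\<lambda>n. (wnorm2 kc A J (toeplitz {..(\<chi> j. n)} J c Xm)) \<le> Re SL) sequentially"
        proof (rule eventually_sequentiallyI)
          fix n assume n: "mdeg b \<le> n"
          have "b $ i \<le> mdeg b" for i unfolding mdeg_def by (rule member_le_sum) auto
          with n have "b \<le> (\<chi> j. n)" unfolding le_vec_iff by (auto intro: order_trans)
          with b have "A \<subseteq> {..(\<chi> j. n)}" by (auto intro: order_trans)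
          then have "wnorm2 kc A J (toeplitz {..(\<chi> j. n)} J c Xm) \<le>
              (\<Sum>a\<in>{..(\<chi> j. n)}. kc a * (\<Sum>m<J. (cmod (toeplitz {..(\<chi> j. n)} J c Xm a m))\<^sup>2))"
            using less_imp_le[OF kpos] by (intro sum_mono2 finite_atMost_vec mult_nonneg_nonneg sum_nonneg) auto
          also have "\<dots> \<le> (\<Sum>b\<in>{..(\<chi> j. n)}. lc b * (\<Sum>p<J. (cmod (Xm b p))\<^sup>2))"
            by (rule coeff_contractionD[OF con])
          also have "\<dots> \<le> Re SL"
            using less_imp_le[OF lpos] by (intro finite_sum_le_has_sum[OF LR] finite_atMost_vec mult_nonneg_nonneg sum_nonneg) auto
          finally show "wnorm2 kc A J (toeplitz {..(\<chi> j. n)} J c Xm) \<le> Re SL" .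
        qed
        ultimately show "wnorm2 kc A J Y \<le> Re SL"
          by (rule tendsto_upperbound) simp
      qed
      moreover have "qf (E \<times> {..<J}) (pick_block k l J \<Phi>) v = SL - SK"
        unfolding qf_pick_block[OF E(1)] SL_def SK_def w_def ..
      ultimately show "0 \<le> qf (E \<times> {..<J}) (pick_block k l J \<Phi>) v"
        using imz[OF L] imz[OF K] by (simp add: less_eq_complex_def)
    qed
  qed
  then show ?thesis using ser by (intro exI[of _ \<Phi>]) auto
qed

text \<open>Conversely, the contractivity of the multiplier is tested on combinations of kernel functions at the
  points of a shrinking grid whose moments up to \<open>b\<close> are prescribed and whose other moments vanish
  in the limit.\<close>

theorem coefficients_of_contractive_multiplier:
  assumes r: "0 < r" "ball 0 r \<subseteq> X" and \<Phi>: "contractive_multiplier X k l J \<Phi>"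
    and ser: "\<And>z p q. z \<in> X \<Longrightarrow> p < J \<Longrightarrow> q < J \<Longrightarrow> ((\<lambda>a. mpow z a * cnj (c a q p)) has_sum \<Phi> z p q) UNIV"
    and F: "finite F" "coinvariant F"
  shows "coeff_contraction kc lc F J c"
  unfolding coeff_contraction_def
proof
  fix x0 :: "nat ^ 'd \<Rightarrow> nat \<Rightarrow> complex"
  define x where "x e p = (if e \<in> F then x0 e p else 0)" for e p
  obtain b where b: "F \<subseteq> {..b}" using F(1) by (rule finite_subset_atMost_vec)
  have fin: "finite {..b}" by (rule finite_atMost_vec)
  obtain q where q: "0 < q" "q \<le> 1" "\<And>z :: complex ^ 'd. (\<And>j. cmod (z $ j) \<le> q) \<Longrightarrow> z \<in> ball 0 r"
    using ball_contains_const[OF r(1)] by blast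
  define zq :: "complex ^ 'd" where "zq = (\<chi> j. of_real q)"
  have zq: "zq \<in> X" "cmod (mpow zq a) = q ^ mdeg a" for a
    using q r(2) by (auto simp: zq_def intro!: cmod_mpow_const)
  have "(\<lambda>a. \<bar>lc a\<bar> * (q\<^sup>2) ^ mdeg a) summable_on UNIV"
    using lser[OF zq(1) zq(1)] by (intro ps_summable_radius) (auto simp: zq_def summable_on_def)
  then have lsum: "(\<lambda>a. lc a * (q\<^sup>2) ^ mdeg a) summable_on UNIV" using lpos by (simp add: less_imp_le)
  have csum: "(\<lambda>a. cmod (c a m p) * q ^ mdeg a) summable_on UNIV" if "m < J" "p < J" for m p
  proof -
    have "(\<lambda>a. mpow zq a * cnj (c a m p)) summable_on UNIV" using ser[OF zq(1)] that by (auto simp: summable_on_def)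
    then have "(\<lambda>a. norm (mpow zq a * cnj (c a m p))) summable_on UNIV"
      by (simp only: summable_on_iff_abs_summable_on_complex)
    then show ?thesis by (simp add: norm_mult zq(2) mult.commute)
  qed
  define Cp where "Cp p = (\<Sum>a\<in>{..b}. cmod (x a p)) / q ^ (mdeg b + 1)" for p
  have Cp: "0 \<le> Cp p" for p using q by (simp add: Cp_def sum_nonneg)
  define mom where "mom \<rho> p e = moment {..b} (grid b \<rho>) (grid_weight b \<rho> (\<lambda>a. x a p)) e" for \<rho> p e
  have mom_in: "mom \<rho> p e = x e p" if "0 < \<rho>" "e \<le> b" for \<rho> p e
    unfolding mom_def using that by (rule moment_grid_box)
  have mom_out: "cmod (mom \<rho> p e) \<le> \<rho> * (Cp p * q ^ mdeg e)" if "0 < \<rho>" "\<rho> \<le> q" "\<not> e \<le> b" for \<rho> p e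
    using moment_grid_outside[OF that(1,2) q(2) that(3), of "\<lambda>a. x a p"] by (simp add: mom_def Cp_def mult.assoc)
  define T where "T a m = toeplitz F J c x0 a m" for a m
  define Y where "Y \<rho> a m = moment {..b} (grid b \<rho>) (\<lambda>i. \<Sum>p<J. cnj (\<Phi> (grid b \<rho> i) p m) * grid_weight b \<rho> (\<lambda>a. x a p) i) a" for \<rho> a m
  define BK where "BK a m u = (\<Sum>p<J. Cp p * q ^ mdeg a * (cmod (c u m p) * q ^ mdeg u))" for a u :: "nat ^ 'd" and m
  have gX: "grid b \<rho> i \<in> X" if "0 < \<rho>" "\<rho> \<le> q" for \<rho> i
    using that q(3)[of "grid b \<rho> i"] r(2) by (auto simp: grid_coordinate)
  have Tx: "T a m = (\<Sum>u\<in>{..b - a}. \<Sum>p<J. c u m p * x (a + u) p)" if "a \<in> F" for a m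
  proof -
    have "T a m = toeplitz {..b} J c x a m"
      unfolding T_def toeplitz_def using b fin
      by (intro sum.mono_neutral_cong_left) (auto simp: x_def intro!: sum.neutral)
    also have "\<dots> = (\<Sum>u\<in>{..b - a}. \<Sum>p<J. c u m p * x (a + u) p)"
      using that b by (intro toeplitz_box_shift) auto
    finally show ?thesis .
  qed
  have Y_approx: "cmod (Y \<rho> a m - T a m) \<le> \<rho> * infsum (BK a m) UNIV" if \<rho>: "0 < \<rho>" "\<rho> \<le> q" and a: "a \<in> F" and m: "m < J" for \<rho> a m
  proof -
    have hs: "((\<lambda>u. \<Sum>p<J. c u m p * mom \<rho> p (a + u)) has_sum Y \<rho> a m) UNIV"
      unfolding mom_def Y_def
      by (rule has_sum_moment_product[where E = X and v = "\<lambda>(i, p). grid_weight b \<rho> (\<lambda>a. x a p) i", simplified])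
        (use ser m gX[OF \<rho>] in auto)
    have "(\<Sum>u\<in>{..b - a}. \<Sum>p<J. c u m p * mom \<rho> p (a + u)) = T a m"
      unfolding Tx[OF a]
    proof (intro sum.cong refl)
      fix u p assume "u \<in> {..b - a}"
      moreover have "a \<le> b" using a b by auto
      ultimately have "a + u \<le> b" by (auto simp: le_vec_iff le_diff_conv2 add.commute)
      then show "c u m p * mom \<rho> p (a + u) = c u m p * x (a + u) p" using \<rho> by (simp add: mom_in)
    qed
    moreover have "norm (Y \<rho> a m - (\<Sum>u\<in>{..b - a}. \<Sum>p<J. c u m p * mom \<rho> p (a + u))) \<le> \<rho> * infsum (BK a m) UNIV"
    proof (rule has_sum_finite_approx[OF hs finite_atMost_vec])
      show "BK a m summable_on UNIV"
        unfolding BK_def[abs_def] summable_on_def using m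
        by (intro exI) (rule has_sum_finite_sum, rule has_sum_infsum, intro summable_on_cmult_right csum, auto)
      show "0 \<le> BK a m u" for u using Cp q by (simp add: BK_def sum_nonneg)
      fix u assume "u \<notin> {..b - a}"
      then obtain i where "\<not> u $ i \<le> b $ i - a $ i" by (auto simp: le_vec_iff)
      then have "\<not> (a + u) $ i \<le> b $ i" by simp
      then have "\<not> a + u \<le> b" by (auto simp: le_vec_iff)
      then have "cmod (mom \<rho> p (a + u)) \<le> \<rho> * (Cp p * q ^ mdeg (a + u))" for p by (rule mom_out[OF \<rho>])
      then have "norm (\<Sum>p<J. c u m p * mom \<rho> p (a + u)) \<le> (\<Sum>p<J. cmod (c u m p) * (\<rho> * (Cp p * q ^ mdeg (a + u))))"
        by (intro sum_norm_le) (simp add: norm_mult mult_left_mono)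
      also have "\<dots> = \<rho> * BK a m u" by (simp add: BK_def sum_distrib_left mdeg_add power_add mult_ac)
      finally show "norm (\<Sum>p<J. c u m p * mom \<rho> p (a + u)) \<le> \<rho> * BK a m u" .
    qed (use \<rho> in simp)
    ultimately show ?thesis by simp
  qed
  define I where "I = infsum (\<lambda>a. lc a * (q\<^sup>2) ^ mdeg a) UNIV"
  define BI where "BI = (\<Sum>p<J. (Cp p)\<^sup>2) * I"
  have ineq: "wnorm2 kc F J (Y \<rho>) \<le>
      wnorm2 lc F J x0 + \<rho> * BI"
    if \<rho>: "0 < \<rho>" "\<rho> \<le> q" for \<rho>
  proof -
    let ?g = "grid b \<rho>"
    define v where "v i = grid_weight b \<rho> (\<lambda>a. x a (snd i)) (fst i)" for i :: "(nat ^ 'd) \<times> nat"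
    define w where "w m i = (\<Sum>p<J. cnj (\<Phi> (?g i) p m) * v (i, p))" for m i
    define K where "K i j = k (?g i) (?g j)" for i j
    define L where "L i j = l (?g i) (?g j)" for i j
    have "psd_on ((?g ` {..b}) \<times> {..<J}) (pick_block k l J \<Phi>)"
      using \<Phi>[unfolded contractive_multiplier_iff[OF k l]] fin gX[OF \<rho>] by blast
    then have "psd_on ({..b} \<times> {..<J}) (\<lambda>i j. pick_block k l J \<Phi> (map_prod ?g id i) (map_prod ?g id j))"
      by (rule psd_on_reindex) (use fin in auto)
    then have "psd_on ({..b} \<times> {..<J}) (pick_block K L J (\<lambda>i. \<Phi> (?g i)))"
      by (rule iffD1[OF psd_on_cong, rotated]) (auto simp: pick_block_def K_def L_def)
    then have "0 \<le> Re (qf ({..b} \<times> {..<J}) (pick_block K L J (\<lambda>i. \<Phi> (?g i))) v)"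
      using psd_onD by (auto simp: less_eq_complex_def)
    then have le: "Re (\<Sum>m<J. qf {..b} K (w m)) \<le> Re (\<Sum>p<J. qf {..b} L (\<lambda>i. v (i, p)))"
      unfolding qf_pick_block[OF fin] w_def by simp
    have hsK: "((\<lambda>a. complex_of_real (kc a * (\<Sum>m<J. (cmod (Y \<rho> a m))\<^sup>2))) has_sum (\<Sum>m<J. qf {..b} K (w m))) UNIV"
      unfolding Y_def K_def using has_sum_qf_sum[where e = ?g and I = "{..b}" and J = J and v = w, OF kser gX[OF \<rho>]] by (simp add: w_def[abs_def] v_def)
    have "((\<lambda>a. kc a * (\<Sum>m<J. (cmod (Y \<rho> a m))\<^sup>2)) has_sum Re (\<Sum>m<J. qf {..b} K (w m))) UNIV"
      using has_sum_Re[OF hsK] by (simp only: Re_complex_of_real)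
    then have "wnorm2 kc F J (Y \<rho>) \<le> Re (\<Sum>m<J. qf {..b} K (w m))"
      by (rule finite_sum_le_has_sum[OF _ F(1)]) (use less_imp_le[OF kpos] in \<open>auto intro!: mult_nonneg_nonneg sum_nonneg\<close>)
    also note le
    also have "Re (\<Sum>p<J. qf {..b} L (\<lambda>i. v (i, p))) \<le> wnorm2 lc F J x0 + \<rho> * BI"
    proof -
      let ?S = "\<Sum>p<J. qf {..b} L (\<lambda>i. v (i, p))"
      have "cmod (qf {..b} L (\<lambda>i. v (i, p)) - of_real (\<Sum>a\<in>{..b}. lc a * (cmod (x a p))\<^sup>2)) \<le> \<rho> * ((Cp p)\<^sup>2 * I)" for p
        using grid_form_approx[OF \<rho> q(2) _ lser[OF gX[OF \<rho>] gX[OF \<rho>]], of "\<lambda>a. x a p"] lsum lpos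
        by (simp add: L_def[abs_def] v_def Cp_def I_def less_imp_le)
      then have "cmod (\<Sum>p<J. qf {..b} L (\<lambda>i. v (i, p)) - of_real (\<Sum>a\<in>{..b}. lc a * (cmod (x a p))\<^sup>2)) \<le>
          (\<Sum>p<J. \<rho> * ((Cp p)\<^sup>2 * I))" by (intro sum_norm_le)
      also have "\<dots> = \<rho> * BI" by (simp add: BI_def sum_distrib_left sum_distrib_right)
      also have "(\<Sum>p<J. qf {..b} L (\<lambda>i. v (i, p)) - of_real (\<Sum>a\<in>{..b}. lc a * (cmod (x a p))\<^sup>2)) =
          ?S - of_real (wnorm2 lc {..b} J x)"
        unfolding sum_subtractf of_real_sum[symmetric] by (subst sum.swap) (simp add: sum_distrib_left)
      also have "wnorm2 lc {..b} J x = wnorm2 lc F J x0"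
        using b fin by (intro sum.mono_neutral_cong_right) (auto simp: x_def)
      finally show ?thesis using abs_Re_le_cmod[of "?S - of_real (wnorm2 lc F J x0)"] by simp
    qed
    finally show ?thesis .
  qed
  have "((\<lambda>\<rho>. Y \<rho> a m) \<longlongrightarrow> T a m) (at_right 0)" if a: "a \<in> F" and m: "m < J" for a m
  proof (rule LIM_zero_cancel, rule Lim_null_comparison)
    show "eventually (\<lambda>\<rho>. norm (Y \<rho> a m - T a m) \<le> \<rho> * infsum (BK a m) UNIV) (at_right 0)"
      using Y_approx[OF _ _ a m] q(1) by (auto simp: eventually_at_right_field intro!: exI[of _ q])
    have "((\<lambda>\<rho>. \<rho> * infsum (BK a m) UNIV) \<longlongrightarrow> 0 * infsum (BK a m) UNIV) (at_right 0)" by (intro tendsto_intros)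
    then show "((\<lambda>\<rho>. \<rho> * infsum (BK a m) UNIV) \<longlongrightarrow> 0) (at_right 0)" by simp
  qed
  then have "((\<lambda>\<rho>. wnorm2 kc F J (Y \<rho>)) \<longlongrightarrow> (wnorm2 kc F J T)) (at_right 0)"
    by (intro tendsto_intros) auto
  moreover have "((\<lambda>\<rho>. (wnorm2 lc F J x0) + \<rho> * BI) \<longlongrightarrow>
      (wnorm2 lc F J x0) + 0 * BI) (at_right 0)"
    by (intro tendsto_intros)
  moreover have "eventually (\<lambda>\<rho>. (wnorm2 kc F J (Y \<rho>)) \<le>
      wnorm2 lc F J x0 + \<rho> * BI) (at_right 0)"
    using ineq q(1) by (auto simp: eventually_at_right_field intro!: exI[of _ q])
  ultimately have "wnorm2 kc F J T \<le>
      wnorm2 lc F J x0 + 0 * BI"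
    by (intro tendsto_le[of "at_right (0::real)"]) auto
  then show "wnorm2 kc F J (toeplitz F J c x0) \<le> wnorm2 lc F J x0"
    by (simp add: T_def)
qed

end

text \<open>The coefficients \<open>c\<^sub>u = \<surd>y\<^sub>u E\<^sub>u\<^sub>,\<^sub>0\<close>, with a row \<open>\<iota> u\<close> of their own for every \<open>u\<close>, turn
  contractivity of the Toeplitz matrix into the linear constraints on \<open>y\<close>.\<close>

lemma lp_condition_of_toeplitz_extension:
  fixes kc lc :: "nat ^ 'd \<Rightarrow> real"
  assumes kpos: "\<And>a. 0 < kc a" and lpos: "\<And>a. 0 < lc a"
    and ext: "\<And>J F c. 1 \<le> J \<Longrightarrow> finite F \<Longrightarrow> coinvariant F \<Longrightarrow> coeff_contraction kc lc F J c \<Longrightarrow>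
      \<exists>c'. (\<forall>a\<in>F. \<forall>p<J. \<forall>q<J. c' a p q = c a p q) \<and> (\<forall>n. coeff_contraction kc lc {..n} J c')"
  shows "lp_condition kc lc"
  unfolding lp_condition_def
proof (intro allI impI, elim conjE)
  fix b and y :: "nat ^ 'd \<Rightarrow> real"
  assume b: "b \<noteq> 0" and y: "\<forall>a. 0 \<le> y a"
    and con: "\<forall>a. a \<le> b \<and> a \<noteq> b \<longrightarrow> (\<Sum>u\<in>{..a}. kc (a - u) * y u) \<le> lc a"
  let ?U = "{..b} - {b}"
  have fin: "finite {..b}" "finite ?U" using finite_atMost_vec[of b] by auto
  have 0: "0 \<in> ?U" using b vec_zero_le by auto
  have co: "coinvariant ?U" unfolding coinvariant_def using 0 by (auto dest: order_trans order_antisym)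
  define J where "J = card ?U"
  have J: "1 \<le> J" unfolding J_def Suc_le_eq One_nat_def card_gt_0_iff using 0 fin(2) by blast
  obtain \<iota> where \<iota>: "bij_betw \<iota> ?U {..<J}"
    using ex_bij_betw_finite_nat[OF fin(2)] by (auto simp: J_def atLeast0LessThan)
  define c where "c a p q = (if q = 0 \<and> a \<in> ?U \<and> p = \<iota> a then complex_of_real (sqrt (y a)) else 0)" for a p and q :: nat
  have rows: "(\<Sum>m<J. f m) = (\<Sum>w\<in>?U. f (\<iota> w))" for f :: "nat \<Rightarrow> real"
    by (rule sum.reindex_bij_betw[OF \<iota>, symmetric])
  have inj: "\<iota> u = \<iota> w \<longleftrightarrow> u = w" if "u \<in> ?U" "w \<in> ?U" for u w
    using that bij_betw_imp_inj_on[OF \<iota>] by (auto dest: inj_onD)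
  have diffU: "e - a \<in> ?U" if "e \<in> ?U" for e a using coinvariantD[OF co that vec_diff_le] .
  have "coeff_contraction kc lc ?U J c"
    unfolding coeff_contraction_def
  proof
    fix x :: "nat ^ 'd \<Rightarrow> nat \<Rightarrow> complex"
    have T: "toeplitz ?U J c x a (\<iota> w) = (if a + w \<in> ?U then of_real (sqrt (y w)) * x (a + w) 0 else 0)" if w: "w \<in> ?U" for a w
    proof -
      have "toeplitz ?U J c x a (\<iota> w) = (\<Sum>e\<in>?U. \<Sum>p<J. if p = 0 then (if e = a + w then of_real (sqrt (y w)) * x e 0 else 0) else 0)"
        unfolding toeplitz_def
      proof (intro sum.cong refl)
        fix e p assume e: "e \<in> ?U"
        have "e - a = w \<longleftrightarrow> e = a + w" if "a \<le> e" using vec_add_diff_cancel(1)[OF that] vec_add_diff(1)[of a w] by auto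
        moreover have "a \<le> e" if "e = a + w" using that vec_le_add by simp
        ultimately show "(if a \<le> e then c (e - a) (\<iota> w) p * x e p else 0) =
            (if p = 0 then (if e = a + w then of_real (sqrt (y w)) * x e 0 else 0) else 0)"
          using diffU[OF e, of a] inj[OF w diffU[OF e, of a]] by (auto simp: c_def)
      qed
      also have "\<dots> = (\<Sum>e\<in>?U. if e = a + w then of_real (sqrt (y w)) * x e 0 else 0)"
        using J by (intro sum.cong refl) (simp add: sum.delta)
      finally show ?thesis using fin(2) by (simp add: sum.delta)
    qed
    have "wnorm2 kc ?U J (toeplitz ?U J c x) =
        (\<Sum>a\<in>?U. \<Sum>w\<in>?U. if a + w \<in> ?U then kc a * y w * (cmod (x (a + w) 0))\<^sup>2 else 0)"
      unfolding rows sum_distrib_left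
      using y by (intro sum.cong refl) (simp add: T norm_mult power_mult_distrib)
    also have "\<dots> = (\<Sum>(a, w)\<in>{(a, w). a \<in> ?U \<and> w \<in> ?U \<and> a + w \<in> ?U}. kc a * y w * (cmod (x (a + w) 0))\<^sup>2)"
      unfolding sum.cartesian_product
    proof (rule sum.mono_neutral_cong_right)
      show "finite (?U \<times> ?U)" using fin by blast
    qed (auto split: if_splits)
    also have "\<dots> = (\<Sum>(e, w)\<in>(SIGMA e:?U. {..e}). kc (e - w) * y w * (cmod (x e 0))\<^sup>2)"
    proof (rule sum.reindex_bij_witness[where j = "\<lambda>(a, w). (a + w, w)" and i = "\<lambda>(e, w). (e - w, w)"])
      fix i assume "i \<in> (SIGMA e:?U. {..e})"
      then obtain e w where i: "i = (e, w)" "e \<in> ?U" "w \<le> e" by blast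
      have "e - w + w = e" using i(3) by (rule vec_add_diff_cancel(2))
      then show "(case case i of (e, w) \<Rightarrow> (e - w, w) of (a, w) \<Rightarrow> (a + w, w)) = i"
        "(case i of (e, w) \<Rightarrow> (e - w, w)) \<in> {(a, w). a \<in> ?U \<and> w \<in> ?U \<and> a + w \<in> ?U}"
        using i diffU[OF i(2)] coinvariantD[OF co i(2,3)] by auto
    qed (auto simp: vec_add_diff vec_le_add)
    also have "\<dots> = (\<Sum>e\<in>?U. (\<Sum>w\<in>{..e}. kc (e - w) * y w) * (cmod (x e 0))\<^sup>2)"
      unfolding sum_distrib_right using fin finite_atMost_vec by (intro sum.Sigma[symmetric]) auto
    also have "\<dots> \<le> wnorm2 lc ?U J x"
    proof (intro sum_mono mult_mono)
      fix e assume "e \<in> ?U"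
      then show "(\<Sum>w\<in>{..e}. kc (e - w) * y w) \<le> lc e" using con by auto
      show "(cmod (x e 0))\<^sup>2 \<le> (\<Sum>p<J. (cmod (x e p))\<^sup>2)"
        using J by (intro member_le_sum) auto
    qed (use less_imp_le[OF lpos] in auto)
    finally show "wnorm2 kc ?U J (toeplitz ?U J c x) \<le> wnorm2 lc ?U J x" .
  qed
  from ext[OF J fin(2) co this] obtain c' where
    c': "\<And>a p q. a \<in> ?U \<Longrightarrow> p < J \<Longrightarrow> q < J \<Longrightarrow> c' a p q = c a p q" and con': "coeff_contraction kc lc {..b} J c'"
    by blast
  \<comment> \<open>on this vector every row except that of index \<open>0\<close> reads off one of the prescribed coefficients\<close>
  define x where "x e p = (if p = 0 then (if e = b then 1 else 0) else 0 :: complex)" for e and p :: nat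
  have T: "toeplitz {..b} J c' x a m = c' (b - a) m 0" if "a \<le> b" for a m
  proof -
    have "toeplitz {..b} J c' x a m = (\<Sum>e\<in>{..b}. \<Sum>p<J. if p = 0 then (if e = b then c' (b - a) m 0 else 0) else 0)"
      unfolding toeplitz_def using that by (intro sum.cong refl) (auto simp: x_def)
    also have "\<dots> = (\<Sum>e\<in>{..b}. if e = b then c' (b - a) m 0 else 0)"
      using J by (intro sum.cong refl) (simp add: sum.delta)
    finally show ?thesis using fin(1) by (simp add: sum.delta)
  qed
  have refl': "b - (b - a) = a" if "a \<le> b" for a using that by (auto simp: vec_eq_iff le_vec_iff)
  have ne: "b - a \<noteq> b" if "a \<le> b" "a \<noteq> 0" for a using that refl'[OF that(1)] vec_diff_zero(2)[of b] by auto
  have "(\<Sum>u\<in>?U. kc (b - u) * y u) = (\<Sum>a\<in>{..b} - {0}. kc a * y (b - a))"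
    by (rule sum.reindex_bij_witness[where i = "\<lambda>a. b - a" and j = "\<lambda>u. b - u"])
      (use refl' ne in \<open>auto simp: vec_diff_le vec_diff_eq_zero\<close>)
  also have "\<dots> = (\<Sum>a\<in>{..b} - {0}. kc a * (\<Sum>m<J. (cmod (toeplitz {..b} J c' x a m))\<^sup>2))"
  proof (intro sum.cong refl arg_cong2[where f = "(*)"])
    fix a assume a: "a \<in> {..b} - {0}"
    then have "b - a \<noteq> b" using ne by blast
    then have u: "b - a \<in> ?U" using vec_diff_le[of b a] by auto
    have "(\<Sum>m<J. (cmod (toeplitz {..b} J c' x a m))\<^sup>2) = (\<Sum>m<J. (cmod (c (b - a) m 0))\<^sup>2)"
      using a c'[OF u] J by (simp add: T)
    also have "\<dots> = (\<Sum>w\<in>?U. if w = b - a then y w else 0)"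
      unfolding rows using u inj[OF _ u] y by (intro sum.cong refl) (auto simp: c_def)
    finally show "y (b - a) = (\<Sum>m<J. (cmod (toeplitz {..b} J c' x a m))\<^sup>2)"
      using u fin(2) by (simp add: sum.delta)
  qed
  also have "\<dots> \<le> (\<Sum>a\<in>{..b}. kc a * (\<Sum>m<J. (cmod (toeplitz {..b} J c' x a m))\<^sup>2))"
    using fin(1) less_imp_le[OF kpos] by (intro sum_mono2 mult_nonneg_nonneg sum_nonneg) auto
  also have "\<dots> \<le> (\<Sum>e\<in>{..b}. lc e * (\<Sum>p<J. (cmod (x e p))\<^sup>2))" by (rule coeff_contractionD[OF con'])
  also have "\<dots> = (\<Sum>e\<in>{..b}. if e = b then lc b else 0)"
  proof (intro sum.cong refl)
    fix e
    have "(\<Sum>p<J. (cmod (x e p))\<^sup>2) = (\<Sum>p<J. if p = 0 then (if e = b then 1 else 0) else 0)"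
      by (intro sum.cong refl) (auto simp: x_def)
    then show "lc e * (\<Sum>p<J. (cmod (x e p))\<^sup>2) = (if e = b then lc b else 0)" using J by (simp add: sum.delta)
  qed
  finally show "(\<Sum>u\<in>?U. kc (b - u) * y u) \<le> lc b" using fin(1) by simp
qed

section \<open>The equivalences\<close>

context
  fixes \<Omega> :: "(complex ^ 'd) set" and k l :: "complex ^ 'd \<Rightarrow> complex ^ 'd \<Rightarrow> complex" and kc lc :: "nat ^ 'd \<Rightarrow> real"
  assumes dom: "is_domain \<Omega>" and z0: "0 \<in> \<Omega>"
    and Dk: "normalized_diagonal_holomorphic_kernel \<Omega> k kc"
    and Dl: "normalized_diagonal_holomorphic_kernel \<Omega> l lc"
begin

lemma normalized_pair_facts:
  shows "kc 0 = 1" "\<And>a. 0 < kc a" "lc 0 = 1" "\<And>a. 0 < lc a" "kernel \<Omega> k" "kernel \<Omega> l"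
    and "open \<Omega>" "\<Omega> \<subseteq> conv_domain kc" "\<Omega> \<subseteq> conv_domain lc"
    and "\<And>z w. z \<in> \<Omega> \<Longrightarrow> w \<in> \<Omega> \<Longrightarrow> (ps_term kc (z * vcnj w) has_sum k z w) UNIV"
    and "\<And>z w. z \<in> \<Omega> \<Longrightarrow> w \<in> \<Omega> \<Longrightarrow> (ps_term lc (z * vcnj w) has_sum l z w) UNIV"
proof -
  have K: "diagonal_holomorphic_kernel \<Omega> k kc" and L: "diagonal_holomorphic_kernel \<Omega> l lc"
    and 0: "kc 0 = 1" "lc 0 = 1"
    using Dk Dl unfolding normalized_diagonal_holomorphic_kernel_def by blast+
  show "kc 0 = 1" "lc 0 = 1" by (rule 0)+
  show "\<And>a. 0 < kc a" "kernel \<Omega> k" using K unfolding diagonal_holomorphic_kernel_def by blast+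
  show "\<And>a. 0 < lc a" "kernel \<Omega> l" using L unfolding diagonal_holomorphic_kernel_def by blast+
  show "open \<Omega>" using dom by (simp add: is_domain_def)
  show "\<Omega> \<subseteq> conv_domain kc" "\<And>z w. z \<in> \<Omega> \<Longrightarrow> w \<in> \<Omega> \<Longrightarrow> (ps_term kc (z * vcnj w) has_sum k z w) UNIV"
    by (rule diagonal_holomorphic_kernel_expansion[OF K dom z0])+
  show "\<Omega> \<subseteq> conv_domain lc" "\<And>z w. z \<in> \<Omega> \<Longrightarrow> w \<in> \<Omega> \<Longrightarrow> (ps_term lc (z * vcnj w) has_sum l z w) UNIV"
    by (rule diagonal_holomorphic_kernel_expansion[OF L dom z0])+
qed

lemma diagonal_nonzero:
  assumes "z \<in> \<Omega>"
  shows "k z z \<noteq> 0" "l z z \<noteq> 0"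
proof -
  have "f z z \<noteq> 0" if f: "(ps_term fc (z * vcnj z) has_sum f z z) UNIV" "fc 0 = 1" "\<And>a. 0 < fc a" for fc and f :: "complex ^ 'd \<Rightarrow> complex ^ 'd \<Rightarrow> complex"
  proof -
    have "((\<lambda>a. fc a * (cmod (mpow z a))\<^sup>2) has_sum Re (f z z)) UNIV"
      using has_sum_Re[OF f(1)] by (simp add: ps_term_diag)
    then have "(\<Sum>a\<in>{0}. fc a * (cmod (mpow z a))\<^sup>2) \<le> Re (f z z)"
      using less_imp_le[OF f(3)] by (intro finite_sum_le_has_sum) auto
    then show ?thesis using f(2) by auto
  qed
  then show "k z z \<noteq> 0" "l z z \<noteq> 0"
    using normalized_pair_facts(1-4,10,11) assms by blast+
qed

lemma ball_in_domain:
  obtains r where "0 < r" "ball 0 r \<subseteq> \<Omega>"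
  using normalized_pair_facts(7) z0 open_contains_ball by blast

text \<open>The coefficients only depend on the germs at the origin, so interpolation on any neighbourhood suffices.\<close>

lemma complete_pick_pair_on_neighbourhood_imp_nonneg:
  assumes B: "B \<subseteq> \<Omega>" and r: "0 < r" "ball 0 r \<subseteq> B" and P: "complete_pick_pair B k l"
  shows "master_factor_nonneg kc lc"
proof -
  have sub: "z \<in> \<Omega>" if "z \<in> ball 0 r" for z using that r B by blast
  note N = normalized_pair_facts
  have "lp_condition kc lc"
  proof (rule complete_pick_pair_imp_lp_condition[OF P kernel_subset[OF N(5) B] kernel_subset[OF N(6) B] r])
    show "kc 0 = 1" "\<And>a. 0 < kc a" "\<And>a. 0 < lc a" by (rule N)+
    show "(ps_term kc (z * vcnj w) has_sum k z w) UNIV" "(ps_term lc (z * vcnj w) has_sum l z w) UNIV"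
      if "z \<in> ball 0 r" "w \<in> ball 0 r" for z w
      using N(10,11)[OF sub[OF that(1)] sub[OF that(2)]] by blast+
    show "k z z \<noteq> 0" "l z z \<noteq> 0" if "z \<in> B" for z using diagonal_nonzero that B by blast+
  qed
  then show "master_factor_nonneg kc lc" using lp_condition_imp_nonneg[of kc lc, OF N(1,2,4)] by blast
qed

lemma shimorin_certificate_iff: "(\<exists>p. shimorin_certificate \<Omega> k l p) \<longleftrightarrow> master_factor_nonneg kc lc"
  and complete_pick_pair_iff: "complete_pick_pair \<Omega> k l \<longleftrightarrow> master_factor_nonneg kc lc"
proof -
  note N = normalized_pair_facts
  obtain r where r: "0 < r" "ball 0 r \<subseteq> \<Omega>" by (rule ball_in_domain)
  have 1: "complete_pick_pair \<Omega> k l" if "shimorin_certificate \<Omega> k l p" for p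
    using shimorin_imp_complete_pick_pair[OF N(5,6) that] diagonal_nonzero by blast
  have 2: "master_factor_nonneg kc lc" if "complete_pick_pair \<Omega> k l"
    by (rule complete_pick_pair_on_neighbourhood_imp_nonneg[OF order_refl r that])
  have 3: "\<exists>p. shimorin_certificate \<Omega> k l p" if "master_factor_nonneg kc lc"
    by (rule master_certificate_consequences(5)[OF N(1-4) _ N(7,9,10,11)]) (use that in blast)+
  show "(\<exists>p. shimorin_certificate \<Omega> k l p) \<longleftrightarrow> master_factor_nonneg kc lc" "complete_pick_pair \<Omega> k l \<longleftrightarrow> master_factor_nonneg kc lc"
    using 1 2 3 by blast+
qed

text \<open>Here \<open>g = (1 - \<theta>) \<ell>\<close>, so the coefficients in question are those of a positive kernel.\<close>

lemma factorization_nonneg: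
  assumes D: "master_kernel_defined kc \<Omega>" and g: "kernel \<Omega> g" "\<And>z w. z \<in> \<Omega> \<Longrightarrow> w \<in> \<Omega> \<Longrightarrow> l z w = g z w * master_kernel kc z w"
  shows "master_factor_nonneg kc lc"
proof
  fix b
  note N = normalized_pair_facts
  obtain r where r: "0 < r" "ball 0 r \<subseteq> \<Omega>" by (rule ball_in_domain)
  show "0 \<le> ps_mult (\<lambda>a. ps_one a - master kc a) lc b"
  proof (rule kernel_coefficient_nonneg[OF g(1) r])
    fix z w :: "complex ^ 'd" assume "z \<in> ball 0 r" "w \<in> ball 0 r"
    then have zw: "z \<in> \<Omega>" "w \<in> \<Omega>" using r by blast+
    have t: "ps_term (master kc) (z * vcnj w) summable_on UNIV" and ne: "ps_eval (master kc) (z * vcnj w) \<noteq> 1"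
      using D zw unfolding master_kernel_defined_def ps_term_def[abs_def] by blast+
    note one = ps_one_minus_has_sum[OF t]
    have "ps_term lc (z * vcnj w) summable_on UNIV" "ps_eval lc (z * vcnj w) = l z w"
      using N(11)[OF zw] by (auto simp: summable_on_def ps_eval_eq infsumI)
    moreover have "ps_term (\<lambda>a. ps_one a - master kc a) (z * vcnj w) summable_on UNIV"
      "ps_eval (\<lambda>a. ps_one a - master kc a) (z * vcnj w) = 1 - ps_eval (master kc) (z * vcnj w)"
      using one by (auto simp: summable_on_def ps_eval_eq infsumI)
    ultimately have "(ps_term (ps_mult (\<lambda>a. ps_one a - master kc a) lc) (z * vcnj w) has_sum
        (1 - ps_eval (master kc) (z * vcnj w)) * l z w) UNIV"
      using ps_mult_has_sum[of "\<lambda>a. ps_one a - master kc a" "z * vcnj w" lc] by simp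
    moreover have "(1 - ps_eval (master kc) (z * vcnj w)) * l z w = g z w"
      using g(2)[OF zw] ne by (simp add: master_kernel_def)
    ultimately show "(ps_term (ps_mult (\<lambda>a. ps_one a - master kc a) lc) (z * vcnj w) has_sum g z w) UNIV" by simp
  qed
qed

text \<open>A strong certificate may have zeros; near the origin \<open>\<ell> = s g\<close> excludes them.\<close>

lemma nonvanishing_neighbourhood:
  obtains r where "0 < r" "ball 0 r \<subseteq> \<Omega>" "\<And>z w. z \<in> ball 0 r \<Longrightarrow> w \<in> ball 0 r \<Longrightarrow> l z w \<noteq> 0"
proof -
  note N = normalized_pair_facts
  have l0: "0 \<le> lc a" for a using N(4)[of a] by simp
  obtain y where y: "\<And>j. cmod (0 $ j) < cmod (y $ j)" "ps_term lc (y * vcnj y) summable_on UNIV"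
    by (rule conv_domain_polydisc[of lc 0]) (use l0 z0 N(9) in auto)
  have "cmod ((0 :: complex ^ 'd) $ j) < cmod ((y * vcnj y) $ j)" for j
    using y(1)[of j] by (simp add: vcnj_def)
  from ps_eval_continuous[OF y(2) this]
  have c: "continuous (at 0) (ps_eval lc)" .
  have "l 0 0 = ps_eval lc (0 * vcnj 0)" using N(11)[OF z0 z0] by (simp add: ps_eval_eq infsumI)
  then have "ps_eval lc 0 \<noteq> 0" using diagonal_nonzero(2)[OF z0] by simp
  then obtain e where e: "0 < e" "\<And>x. dist x 0 < e \<Longrightarrow> ps_eval lc x \<noteq> 0"
    using continuous_at_avoid[OF c] by (metis dist_commute)
  obtain r1 where r1: "0 < r1" "ball 0 r1 \<subseteq> \<Omega>" by (rule ball_in_domain)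
  define r where "r = min r1 (min 1 (e / (real CARD('d) + 1)))"
  have r: "0 < r" "r \<le> r1" "r \<le> 1" using r1 e by (auto simp: r_def)
  have re: "real CARD('d) * r < e"
  proof -
    have "r \<le> e / (real CARD('d) + 1)" by (simp add: r_def)
    then have "(real CARD('d) + 1) * r \<le> e" by (simp add: pos_le_divide_eq mult.commute)
    then show ?thesis using r(1) by (simp add: algebra_simps)
  qed
  show ?thesis
  proof (rule that[of r])
    show "ball 0 r \<subseteq> \<Omega>" using r1 r by auto
    fix z w :: "complex ^ 'd" assume zw: "z \<in> ball 0 r" "w \<in> ball 0 r"
    have "cmod ((z * vcnj w) $ j) \<le> r" for j
    proof -
      have "cmod (z $ j) \<le> r" "cmod (w $ j) \<le> 1"
        using Finite_Cartesian_Product.norm_nth_le[of z j] Finite_Cartesian_Product.norm_nth_le[of w j] zw r by auto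
      then show ?thesis using mult_mono[of "cmod (z $ j)" r "cmod (w $ j)" 1] r by (simp add: vcnj_def norm_mult)
    qed
    then have "norm (z * vcnj w) \<le> real CARD('d) * r" by (rule norm_vec_le)
    then have "ps_eval lc (z * vcnj w) \<noteq> 0" using e(2) re by simp
    moreover have "z \<in> \<Omega>" "w \<in> \<Omega>" using zw r r1 by auto
    then have "l z w = ps_eval lc (z * vcnj w)" using N(11) unfolding ps_eval_eq by (intro infsumI[symmetric])
    ultimately show "l z w \<noteq> 0" by simp
  qed (rule r)
qed

text \<open>On a ball without zeros of \<open>\<ell>\<close> the complete Pick kernel yields a Shimorin certificate, hence Pick
  interpolation on that ball.\<close>

lemma strong_shimorin_certificate_imp_nonneg:
  assumes "strong_shimorin_certificate \<Omega> k l t"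
  shows "master_factor_nonneg kc lc"
proof -
  note N = normalized_pair_facts
  obtain r where r: "0 < r" "ball 0 r \<subseteq> \<Omega>" and nz: "\<And>z w. z \<in> ball 0 r \<Longrightarrow> w \<in> ball 0 r \<Longrightarrow> l z w \<noteq> 0"
    using nonvanishing_neighbourhood by blast
  let ?B = "ball (0 :: complex ^ 'd) r"
  obtain h g where t: "complete_pick_pair \<Omega> t t" "kernel \<Omega> t" and h: "kernel \<Omega> h" and g: "kernel \<Omega> g"
    and keq: "\<And>z w. z \<in> \<Omega> \<Longrightarrow> w \<in> \<Omega> \<Longrightarrow> k z w = (1 - h z w) * t z w"
    and leq: "\<And>z w. z \<in> \<Omega> \<Longrightarrow> w \<in> \<Omega> \<Longrightarrow> l z w = t z w * g z w"
    using assms unfolding strong_shimorin_certificate_def complete_pick_kernel_def by blast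
  have tnz: "t x y \<noteq> 0" if "x \<in> ?B" "y \<in> ?B" for x y
  proof -
    have "x \<in> \<Omega>" "y \<in> \<Omega>" using that r(2) by blast+
    then show ?thesis using nz[OF that] leq[of x y] by auto
  qed
  have nzB: "k z z \<noteq> 0" "l z z \<noteq> 0" if "z \<in> ?B" for z
    using diagonal_nonzero that r(2) by blast+
  have "shimorin_certificate ?B k l (\<lambda>z x y. kernel_at t z x y / t x y)"
  proof (rule factorization_imp_shimorin_certificate)
    note N(5)
    show "kernel ?B t" "kernel ?B h" "kernel ?B g" "kernel ?B k"
      by (rule kernel_subset[OF _ r(2)], fact)+
    show "kernel ?B (\<lambda>x y. kernel_at t z x y / t x y)" if "z \<in> ?B" for z
      by (rule complete_pick_kernel_imp_kernel_at_quotient[OF t r(2) tnz that])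
    show "t x y \<noteq> 0" "k x y = (1 - h x y) * t x y" "l x y = t x y * g x y" if "x \<in> ?B" "y \<in> ?B" for x y
    proof -
      have "x \<in> \<Omega>" "y \<in> \<Omega>" using that r(2) by blast+
      then show "t x y \<noteq> 0" "k x y = (1 - h x y) * t x y" "l x y = t x y * g x y"
        using tnz[OF that] keq leq by blast+
    qed
  qed (rule nzB; assumption)+
  then have "complete_pick_pair ?B k l"
    by (rule shimorin_imp_complete_pick_pair[OF kernel_subset[OF N(5) r(2)] kernel_subset[OF N(6) r(2)]]) (rule nzB; assumption)+
  then show "master_factor_nonneg kc lc" by (rule complete_pick_pair_on_neighbourhood_imp_nonneg[OF r(2,1) order_refl])
qed

text \<open>The positivity condition enters through the extension of coefficients. The way back, from a contractive
  multiplier to contractions of the matrices of its coefficients, is the testing on grids above.\<close>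

lemma complete_caratheodory_pair_iff: "complete_caratheodory_pair \<Omega> k kc l lc \<longleftrightarrow> master_factor_nonneg kc lc"
proof
  note N = normalized_pair_facts
  obtain r where r: "0 < r" "ball 0 r \<subseteq> \<Omega>" by (rule ball_in_domain)
  have necessary: "coeff_contraction kc lc F J c" if "contractive_multiplier \<Omega> k l J \<Phi>"
      "\<And>z p q. z \<in> \<Omega> \<Longrightarrow> p < J \<Longrightarrow> q < J \<Longrightarrow> ((\<lambda>a. mpow z a * cnj (c a q p)) has_sum \<Phi> z p q) UNIV"
      "finite F" "coinvariant F" for J \<Phi> c F
    by (rule coefficients_of_contractive_multiplier[of kc lc \<Omega> k l, OF N(1,2,4,5,6) _ _ r that(1)]; fact N(10) N(11) that)
  show "master_factor_nonneg kc lc" if P: "complete_caratheodory_pair \<Omega> k kc l lc"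
  proof -
    have "lp_condition kc lc"
    proof (rule lp_condition_of_toeplitz_extension[OF N(2,4)])
      fix J F c assume J: "1 \<le> J" and F: "finite F" "coinvariant F" and con: "coeff_contraction kc lc F J c"
      have conj: "1 \<le> J \<and> finite F \<and> coinvariant F" using J F by blast
      have ctr: "contraction_on (F \<times> {..<J})
           (\<lambda>(a, p) (b, q). if a \<le> b then c (b - a) p q * of_real (sqrt (kc a / lc b)) else 0)"
        using con unfolding contraction_on_iff_coeff_contraction[of kc lc, OF N(2,4)] .
      from P[unfolded complete_caratheodory_pair_def, THEN spec, of J, THEN spec, of F, THEN spec, of c, THEN mp, OF conj,
          THEN iffD1, OF ctr]
      obtain c' \<Phi> where c': "\<forall>a\<in>F. \<forall>p<J. \<forall>q<J. c' a p q = c a p q"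
        and ser: "\<forall>z\<in>\<Omega>. \<forall>p<J. \<forall>q<J. ((\<lambda>a. mpow z a * cnj (c' a q p)) has_sum \<Phi> z p q) UNIV"
        and \<Phi>: "contractive_multiplier \<Omega> k l J \<Phi>" by blast
      have "coeff_contraction kc lc {..n} J c'" for n
        by (rule necessary[OF \<Phi> _ finite_atMost_vec coinvariant_atMost]) (use ser in blast)
      then show "\<exists>c'. (\<forall>a\<in>F. \<forall>p<J. \<forall>q<J. c' a p q = c a p q) \<and> (\<forall>n. coeff_contraction kc lc {..n} J c')"
        using c' by blast
    qed
    then show ?thesis using lp_condition_imp_nonneg[of kc lc, OF N(1,2,4)] by blast
  qed
  show "complete_caratheodory_pair \<Omega> k kc l lc" if C: "master_factor_nonneg kc lc"
    unfolding complete_caratheodory_pair_def contraction_on_iff_coeff_contraction[of kc lc, OF N(2,4)]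
  proof (intro allI impI iffI, elim conjE)
    fix J F and c :: "nat ^ 'd \<Rightarrow> nat \<Rightarrow> nat \<Rightarrow> complex"
    assume F: "finite F" "coinvariant F" and con: "coeff_contraction kc lc F J c"
    have C': "0 \<le> ps_mult (\<lambda>a. ps_one a - master kc a) lc b" for b using C by blast
    from toeplitz_extension[OF N(1-4) C' F con]
    obtain c' where c': "\<forall>a\<in>F. \<forall>m<J. \<forall>p<J. c' a m p = c a m p"
      and con': "\<And>n. coeff_contraction kc lc {..n} J c'" by blast
    have row: "(\<Sum>a\<in>{..n}. cmod (c' a m p) * \<bar>t a\<bar>)\<^sup>2 \<le> (\<Sum>a\<in>{..n}. lc a * (t a)\<^sup>2)" if "m < J" "p < J" for n m p t
      by (rule toeplitz_weighted_row_bound[OF N(1-4) C' finite_atMost_vec coinvariant_atMost con' that])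
    have "\<exists>\<Phi>. (\<forall>z\<in>\<Omega>. \<forall>p<J. \<forall>q<J. ((\<lambda>a. mpow z a * cnj (c' a q p)) has_sum \<Phi> z p q) UNIV) \<and>
        contractive_multiplier \<Omega> k l J \<Phi>"
      by (rule contractive_multiplier_of_coefficients[of kc lc \<Omega> k l, OF N(1,2,4,5,6)]; fact N(10) N(11) con' row)
    then obtain \<Phi> where "\<forall>z\<in>\<Omega>. \<forall>p<J. \<forall>q<J. ((\<lambda>a. mpow z a * cnj (c' a q p)) has_sum \<Phi> z p q) UNIV"
      "contractive_multiplier \<Omega> k l J \<Phi>"
      by blast
    then show "\<exists>c' \<Phi>. (\<forall>a\<in>F. \<forall>p<J. \<forall>q<J. c' a p q = c a p q) \<and>
            (\<forall>z\<in>\<Omega>. \<forall>p<J. \<forall>q<J. ((\<lambda>a. mpow z a * cnj (c' a q p)) has_sum \<Phi> z p q) UNIV) \<and>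
            contractive_multiplier \<Omega> k l J \<Phi>" using c' by blast
  next
    fix J F and c :: "nat ^ 'd \<Rightarrow> nat \<Rightarrow> nat \<Rightarrow> complex"
    assume F: "1 \<le> J \<and> finite F \<and> coinvariant F"
      and "\<exists>c' \<Phi>. (\<forall>a\<in>F. \<forall>p<J. \<forall>q<J. c' a p q = c a p q) \<and>
            (\<forall>z\<in>\<Omega>. \<forall>p<J. \<forall>q<J. ((\<lambda>a. mpow z a * cnj (c' a q p)) has_sum \<Phi> z p q) UNIV) \<and>
            contractive_multiplier \<Omega> k l J \<Phi>"
    then obtain c' \<Phi> where c': "\<And>a p q. a \<in> F \<Longrightarrow> p < J \<Longrightarrow> q < J \<Longrightarrow> c' a p q = c a p q" and
      ser: "\<And>z p q. z \<in> \<Omega> \<Longrightarrow> p < J \<Longrightarrow> q < J \<Longrightarrow> ((\<lambda>a. mpow z a * cnj (c' a q p)) has_sum \<Phi> z p q) UNIV" and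
      \<Phi>: "contractive_multiplier \<Omega> k l J \<Phi>" by blast
    have con: "coeff_contraction kc lc F J c'" by (rule necessary[OF \<Phi> ser]) (use F in blast)+
    then show "coeff_contraction kc lc F J c"
      using coeff_contraction_cong[of F J c' c, OF _ c'] F by blast
  qed
qed

theorem assertions_iff_nonneg:
  "complete_pick_pair \<Omega> k l \<longleftrightarrow> master_factor_nonneg kc lc"
  "complete_caratheodory_pair \<Omega> k kc l lc \<longleftrightarrow> master_factor_nonneg kc lc"
  "(master_kernel_defined kc \<Omega> \<and> strong_shimorin_certificate \<Omega> k l (master_kernel kc)) \<longleftrightarrow> master_factor_nonneg kc lc"
    (is "?iii \<longleftrightarrow> ?C")
  "(master_kernel_defined kc \<Omega> \<and>
    (\<exists>g. kernel \<Omega> g \<and> (\<forall>z\<in>\<Omega>. \<forall>w\<in>\<Omega>. l z w = g z w * master_kernel kc z w))) \<longleftrightarrow> master_factor_nonneg kc lc"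
    (is "?iv \<longleftrightarrow> _")
  "(\<exists>t tc. diagonal_holomorphic_kernel \<Omega> t tc \<and> strong_shimorin_certificate \<Omega> k l t) \<longleftrightarrow> master_factor_nonneg kc lc"
    (is "?v \<longleftrightarrow> _")
  "(\<exists>t. strong_shimorin_certificate \<Omega> k l t) \<longleftrightarrow> master_factor_nonneg kc lc" (is "?vi \<longleftrightarrow> _")
  "(\<exists>p. shimorin_certificate \<Omega> k l p) \<longleftrightarrow> master_factor_nonneg kc lc"
proof -
  note N = normalized_pair_facts
  have M: ?iii ?iv ?v if C: ?C
  proof -
    have C': "0 \<le> ps_mult (\<lambda>a. ps_one a - master kc a) lc b" for b using C by blast
    note c = master_certificate_consequences[OF N(1-4) C' N(7,9,10,11)]
    show ?iii ?iv ?v using c(1-4) by blast+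
  qed
  show "complete_pick_pair \<Omega> k l \<longleftrightarrow> ?C" "complete_caratheodory_pair \<Omega> k kc l lc \<longleftrightarrow> ?C"
    "(\<exists>p. shimorin_certificate \<Omega> k l p) \<longleftrightarrow> ?C"
    by (rule complete_pick_pair_iff complete_caratheodory_pair_iff shimorin_certificate_iff)+
  show "?iii \<longleftrightarrow> ?C" "?v \<longleftrightarrow> ?C" "?vi \<longleftrightarrow> ?C"
    using M strong_shimorin_certificate_imp_nonneg by blast+
  show "?iv \<longleftrightarrow> ?C" using M(2) factorization_nonneg by blast
qed

end

theorem theorem6p4:
  fixes \<Omega> :: "(complex ^ 'd) set"
    and k l :: "complex ^ 'd \<Rightarrow> complex ^ 'd \<Rightarrow> complex"
    and kc lc :: "nat ^ 'd \<Rightarrow> real"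
  assumes "is_domain \<Omega>" and "0 \<in> \<Omega>"
    and "normalized_diagonal_holomorphic_kernel \<Omega> k kc"
    and "normalized_diagonal_holomorphic_kernel \<Omega> l lc"
  shows
    "let \<theta> = master kc;
         s = master_kernel kc;
         sc = ps_reciprocal (\<lambda>a. ps_one a - \<theta> a);
         \<Omega>1 = {z \<in> conv_domain \<theta>. Re (ps_eval \<theta> (z * vcnj z)) < 1};
         assertions =
           {\<lambda>\<Omega> k l. complete_pick_pair \<Omega> k l,
            \<lambda>\<Omega> k l. complete_caratheodory_pair \<Omega> k kc l lc,
            \<lambda>\<Omega> k l. master_kernel_defined kc \<Omega> \<and> strong_shimorin_certificate \<Omega> k l s,
            \<lambda>\<Omega> k l. master_kernel_defined kc \<Omega> \<and>
              (\<exists>g. kernel \<Omega> g \<and> (\<forall>z\<in>\<Omega>. \<forall>w\<in>\<Omega>. l z w = g z w * s z w)),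
            \<lambda>\<Omega> k l. \<exists>t tc. diagonal_holomorphic_kernel \<Omega> t tc \<and> strong_shimorin_certificate \<Omega> k l t,
            \<lambda>\<Omega> k l. \<exists>t. strong_shimorin_certificate \<Omega> k l t,
            \<lambda>\<Omega> k l. \<exists>p. shimorin_certificate \<Omega> k l p}
     in (complete_pick_pair \<Omega> k l \<longrightarrow>
           \<Omega> \<subseteq> conv_domain lc \<and> conv_domain lc \<subseteq> conv_domain sc \<and> conv_domain sc = \<Omega>1 \<and>
           \<Omega>1 \<subseteq> conv_domain kc \<and> conv_domain kc \<subseteq> conv_domain \<theta>) \<and>
        (\<forall>A\<in>assertions. \<forall>B\<in>assertions.
           (A \<Omega> k l \<longleftrightarrow> B \<Omega> k l) \<and>
           (\<forall>\<Omega>'. is_domain \<Omega>' \<and> 0 \<in> \<Omega>' \<and> \<Omega>' \<subseteq> conv_domain lc \<longrightarrow>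
              (A \<Omega> k l \<longleftrightarrow>
                 (\<exists>k' l'. normalized_diagonal_holomorphic_kernel \<Omega>' k' kc \<and>
                          normalized_diagonal_holomorphic_kernel \<Omega>' l' lc \<and>
                          B \<Omega>' k' l'))))"
proof -
  define assertions where "assertions =
    {\<lambda>\<Omega> k l. complete_pick_pair \<Omega> k l,
      \<lambda>\<Omega> k l. complete_caratheodory_pair \<Omega> k kc l lc,
      \<lambda>\<Omega> k l. master_kernel_defined kc \<Omega> \<and> strong_shimorin_certificate \<Omega> k l (master_kernel kc),
      \<lambda>\<Omega> k l. master_kernel_defined kc \<Omega> \<and>
        (\<exists>g. kernel \<Omega> g \<and> (\<forall>z\<in>\<Omega>. \<forall>w\<in>\<Omega>. l z w = g z w * master_kernel kc z w)),
      \<lambda>\<Omega> k l. \<exists>t tc. diagonal_holomorphic_kernel \<Omega> t tc \<and> strong_shimorin_certificate \<Omega> k l t,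
      \<lambda>\<Omega> k l. \<exists>t. strong_shimorin_certificate \<Omega> k l t,
      \<lambda>\<Omega> k l. \<exists>p. shimorin_certificate \<Omega> k l p}"
  let ?C = "master_factor_nonneg kc lc"
  have k0: "kc 0 = 1" and l0: "lc 0 = 1" and kpos: "\<And>a. 0 < kc a" and lpos: "\<And>a. 0 < lc a"
    using normalized_pair_facts[OF assms] by blast+
  have iff: "A \<Omega>' k' l' \<longleftrightarrow> ?C"
    if "A \<in> assertions" "is_domain \<Omega>'" "0 \<in> \<Omega>'"
      "normalized_diagonal_holomorphic_kernel \<Omega>' k' kc" "normalized_diagonal_holomorphic_kernel \<Omega>' l' lc"
    for A \<Omega>' k' l'
    using that(1) unfolding assertions_def
    by (elim insertE emptyE; simp only: assertions_iff_nonneg[OF that(2-5)])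
  have domains: "conv_domain lc \<subseteq> conv_domain (reciprocal (master kc))"
    "conv_domain (reciprocal (master kc)) \<subseteq> conv_domain kc" "conv_domain kc \<subseteq> conv_domain (master kc)" if C: ?C
  proof -
    have "0 \<le> ps_mult (\<lambda>a. ps_one a - master kc a) lc b" for b using C by blast
    note d = master_conv_domains[of kc lc, OF k0 kpos l0 lpos this]
    show "conv_domain lc \<subseteq> conv_domain (reciprocal (master kc))"
      "conv_domain (reciprocal (master kc)) \<subseteq> conv_domain kc" "conv_domain kc \<subseteq> conv_domain (master kc)"
      by (rule d)+
  qed
  have reciprocal: "ps_reciprocal (\<lambda>a. ps_one a - master kc a) = reciprocal (master kc)"
    "conv_domain (reciprocal (master kc)) =
      {z \<in> conv_domain (master kc). Re (ps_eval (master kc) (z * vcnj z)) < 1}"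
    by (rule ps_reciprocal_eq conv_domain_reciprocal; simp add: master_nonneg[of kc, OF k0 kpos])+
  \<comment> \<open>on every other domain the kernels are defined by the same power series\<close>
  have series_kernels: "\<exists>k' l'. normalized_diagonal_holomorphic_kernel \<Omega>' k' kc \<and>
      normalized_diagonal_holomorphic_kernel \<Omega>' l' lc"
    if C: ?C and \<Omega>': "is_domain \<Omega>'" "\<Omega>' \<subseteq> conv_domain lc" for \<Omega>' :: "(complex ^ 'd) set"
  proof (intro exI conjI)
    have o: "open \<Omega>'" using \<Omega>'(1) by (simp add: is_domain_def)
    have sub: "\<Omega>' \<subseteq> conv_domain kc" using domains(1,2)[OF C] \<Omega>'(2) by blast
    show "normalized_diagonal_holomorphic_kernel \<Omega>' (\<lambda>z w. ps_eval kc (z * vcnj w)) kc"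
      unfolding normalized_diagonal_holomorphic_kernel_def
      using diagonal_holomorphic_kernelI[OF kpos o sub refl] k0 by blast
    show "normalized_diagonal_holomorphic_kernel \<Omega>' (\<lambda>z w. ps_eval lc (z * vcnj w)) lc"
      unfolding normalized_diagonal_holomorphic_kernel_def
      using diagonal_holomorphic_kernelI[OF lpos o \<Omega>'(2) refl] l0 by blast
  qed
  have chain: "\<Omega> \<subseteq> conv_domain lc \<and> conv_domain lc \<subseteq> conv_domain (reciprocal (master kc)) \<and>
      conv_domain (reciprocal (master kc)) =
        {z \<in> conv_domain (master kc). Re (ps_eval (master kc) (z * vcnj z)) < 1} \<and>
      {z \<in> conv_domain (master kc). Re (ps_eval (master kc) (z * vcnj z)) < 1} \<subseteq> conv_domain kc \<and>
      conv_domain kc \<subseteq> conv_domain (master kc)"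
    if P: "complete_pick_pair \<Omega> k l"
  proof -
    have C: ?C using P complete_pick_pair_iff[OF assms] by blast
    show ?thesis
      using domains[OF C] normalized_pair_facts(9)[OF assms] unfolding reciprocal(2) by blast
  qed
  have equivalences: "(A \<Omega> k l \<longleftrightarrow> B \<Omega> k l) \<and>
      (\<forall>\<Omega>'. is_domain \<Omega>' \<and> 0 \<in> \<Omega>' \<and> \<Omega>' \<subseteq> conv_domain lc \<longrightarrow>
         (A \<Omega> k l \<longleftrightarrow> (\<exists>k' l'. normalized_diagonal_holomorphic_kernel \<Omega>' k' kc \<and>
            normalized_diagonal_holomorphic_kernel \<Omega>' l' lc \<and> B \<Omega>' k' l')))"
    if "A \<in> assertions" "B \<in> assertions" for A B
  proof (intro conjI allI impI)
    show "A \<Omega> k l \<longleftrightarrow> B \<Omega> k l" by (simp only: iff[OF that(1) assms] iff[OF that(2) assms])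
    fix \<Omega>' :: "(complex ^ 'd) set"
    assume \<Omega>': "is_domain \<Omega>' \<and> 0 \<in> \<Omega>' \<and> \<Omega>' \<subseteq> conv_domain lc"
    have B: "B \<Omega>' k' l' \<longleftrightarrow> ?C" if "normalized_diagonal_holomorphic_kernel \<Omega>' k' kc"
        "normalized_diagonal_holomorphic_kernel \<Omega>' l' lc" for k' l'
      using iff[OF \<open>B \<in> assertions\<close> _ _ that] \<Omega>' by blast
    show "A \<Omega> k l \<longleftrightarrow> (\<exists>k' l'. normalized_diagonal_holomorphic_kernel \<Omega>' k' kc \<and>
        normalized_diagonal_holomorphic_kernel \<Omega>' l' lc \<and> B \<Omega>' k' l')"
      unfolding iff[OF that(1) assms]
    proof
      assume C: ?C
      obtain k' l' where kl: "normalized_diagonal_holomorphic_kernel \<Omega>' k' kc"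
        "normalized_diagonal_holomorphic_kernel \<Omega>' l' lc"
        using series_kernels[OF C] \<Omega>' by blast
      with B[OF kl] C show "\<exists>k' l'. normalized_diagonal_holomorphic_kernel \<Omega>' k' kc \<and>
          normalized_diagonal_holomorphic_kernel \<Omega>' l' lc \<and> B \<Omega>' k' l'"
        by (intro exI[of _ k'] exI[of _ l']) simp
    next
      assume "\<exists>k' l'. normalized_diagonal_holomorphic_kernel \<Omega>' k' kc \<and>
          normalized_diagonal_holomorphic_kernel \<Omega>' l' lc \<and> B \<Omega>' k' l'"
      then show ?C using B by (elim exE conjE) simp
    qed
  qed
  show ?thesis
    unfolding Let_def reciprocal(1) assertions_def[symmetric]
    by (rule conjI, rule impI, erule chain, intro ballI, rule equivalences)
qed

end
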